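(* In the setting described in the context, suppose: (i) for all $i$, the functions $\mu_i$ and $h_i$ are twice continuously differentiable; (ii) $F_0$ has an absolutely continuous density $f_0$ with a.e. derivative $\dot f_0$, $\sup_{x\in\mathbb{R}}|x|f_0(x)<\infty$, $0<\int(\dot f_0/f_0)^2\,dF_0<\infty$ and $0<\int\left(1+\frac{x\dot f_0(x)}{f_0(x)}\right)^2dF_0(x)<\infty$; (iii) $E\,\psi_0(\eta_1)\varphi_0(\eta_1)=0$; (iv) $\hat\theta_n$ is an estimator of $\theta$ satisfying $$n^{1/2}(\hat\theta_n-\theta)=-\mathcal{I}(\theta)^{-1}n^{-1/2}\sum_{i=1}^nW_i(\theta)\begin{pmatrix}\psi_0(\eta_i)\\ \varphi_0(\eta_i)\end{pmatrix}+o_p(1);$$ (v) for an open neighborhood $U_\theta$ of $\theta$, $$E_\theta\sup_{s\in U_\theta}\frac{\|\dot\mu_1(s)\|^2}{h_1(\theta)}<\infty,\qquad E_\theta\sup_{s\in U_\theta}\frac{\|\dot h_1(s)\|^2}{h_1(s)h_1(\theta)}<\infty,$$ $$E_\theta\sup_{s\in U_\theta}\frac{\|\ddot h_1(s)\|}{h_1(s)}<\infty,\qquad E_\theta\sup_{s\in U_\theta}\frac{\|\dot h_1(s)\|^2}{h_1^2(s)}<\infty.$$ Then, for every $0<b<\infty$, $$K_n(x,\theta+n^{-1/2}t)=K_n(x,\theta)+\frac12\,n^{-1}\sum_{i=1}^nW_{22,i}(\theta)\left[\frac{\dot\mu_i(\theta)'}{\sqrt{h_i(\theta)}}f_0(x)+xf_0(x)\frac12\frac{\dot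 h_i(\theta)'}{h_i(\theta)}\right]t+u_p(1),$$ where $u_p(1)$ is a sequence of stochastic processes tending to $0$ uniformly in $x\in\mathbb{R}$ and $\|t\|\le b$, in probability.
   Context: Model. Let $q,r$ be known positive integers, $\Theta_1\subset\mathbb{R}^q$, $\Theta_2\subset\mathbb{R}^r$, $\Theta=\Theta_1\times\Theta_2$. $\{y_i:i\in\mathbb{Z}\}$ is a strictly stationary and ergodic real time series such that for some sequences of past measurable functions $\mu_i$ from $\Theta_1$ to $\mathbb{R}$ and $h_i$ from $\Theta$ to $(0,\infty)$, and for some true parameter $\theta=(\theta_1',\theta_2')'$, $\theta_1\in\Theta_1$, $\theta_2\in\Theta_2$, the variables $$\eta_i:=\frac{y_i-\mu_i(\theta_1)}{\sqrt{h_i(\theta)}},\quad i\in\mathbb{Z},$$ are i.i.d. standardized random variables with common distribution function $F$. Past measurable means that for every $s=(s_1,s_2)\in\Theta$, $s_1\in\Theta_1$, the functions $\mu_i(s_1)$ and $h_i(s)$ are $\mathcal{F}_{i-1}$-measurable, where $\mathcal{F}_i$ is the $\sigma$-field generated by $\{\eta_i,\eta_{i-1},\ldots,y_0,y_{-1},\ldots\}$. The initial vector $Y_0$ (either $(y_0,\ldots,y_{1-p})'$ for some positive integer $p$, or $(y_0,y_{-1},\ldots)'$) is chosen to be independent of $\eta_i$, $i\ge1$. The observations are $y_1,\ldots,y_n$. $F_0$ is a known distribution function (the null hypothesis of interest is $H_0:F=F_0$). $E_\theta$ is expectation under the true parameter $\theta$. Notation. For $s=(s_1,s_2)\in\Theta$: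 $\eta_i(s):=(y_i-\mu_i(s_1))/\sqrt{h_i(s)}$, so $\eta_i=\eta_i(\theta)$. Dots on $\mu_i$ and $h_i$ denote differentials: $\dot\mu_i(s_1)=\partial\mu_i(s_1)/\partial s_1$ is $q\times1$, and $\dot\mu_i(s)=(\dot\mu_i(s_1)',0')'$ is its extension to a $(q+r)\times1$ vector; $\dot h_i(s)=(\dot h_{1i}(s)',\dot h_{2i}(s)')'$ with $\dot h_{ki}(s)=\partial h_i(s)/\partial s_k$, $k=1,2$; $\ddot h_i$ is the matrix of second derivatives of $h_i$. Norms are Euclidean, $'$ denotes transpose, and $t\in\mathbb{R}^{q+r}$. $\psi_0:=\dot f_0/f_0$, $\varphi_0(x):=(1+x\psi_0(x))/2$, $b_1:=E\psi_0^2(\eta_1)$, $b_2:=E\varphi_0^2(\eta_1)$, $\mathcal{B}:=\mathrm{diag}(b_1,b_2)$, $$W_i(s):=\begin{pmatrix}\dot\mu_i(s_1)/h_i^{1/2}(s)&\dot h_{1i}(s)/h_i(s)\\0&\dot h_{2i}(s)/h_i(s)\end{pmatrix}=\begin{pmatrix}W_{11,i}(s)&W_{12,i}(s)\\0&W_{22,i}(s)\end{pmatrix},\qquad \mathcal{I}(\theta):=E_\theta W_1(\theta)\mathcal{B}W_1(\theta)'.$$ It is assumed throughout that, under $H_0$, $\mathcal{I}(\theta)$ is positive definite. The $r\times1$ vector of weighted residual empirical processes is $$K_n(x,s):=\frac1{2\sqrt n}\sum_{i=1}^nW_{22,i}(s)\,[I(\eta_i(s)\le x)-F_0(x)],\qquad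 x\in\mathbb{R},\ s\in\Theta.$$
   Formalization: Stationarity and ergodicity are assumed jointly for (y_i, μ_i, h_i), not only for y_i (conditions at index 1 alone do not control other i: e.g. h_i(s)=exp(i! s_2), θ=0, makes the claim fail), and the null hypothesis F=F_0 is assumed explicitly. *)

theory Defs
  imports "HOL-Probability.Probability"
begin

section \<open>Calculus\<close>

definition absolutely_cont_on :: "real set \<Rightarrow> (real \<Rightarrow> real) \<Rightarrow> bool" where
  "absolutely_cont_on S f \<longleftrightarrow>
     (\<forall>\<epsilon>>0. \<exists>\<delta>>0. \<forall>I :: (real \<times> real) set.
        finite I \<and> (\<forall>(u, v)\<in>I. u \<le> v \<and> {u..v} \<subseteq> S) \<and>
        pairwise (\<lambda>p q. disjnt {fst p<..<snd p} {fst q<..<snd q}) I \<and>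
        (\<Sum>(u, v)\<in>I. v - u) < \<delta> \<longrightarrow> (\<Sum>(u, v)\<in>I. \<bar>f v - f u\<bar>) < \<epsilon>)"

definition grad :: "('e::euclidean_space \<Rightarrow> real) \<Rightarrow> 'e \<Rightarrow> 'e" where
  "grad f x = (THE D. GDERIV f x :> D)"

definition hessian :: "('e::euclidean_space \<Rightarrow> real) \<Rightarrow> 'e \<Rightarrow> 'e \<Rightarrow> 'e \<Rightarrow> real" where
  "hessian f x a b = frechet_derivative (\<lambda>u. grad f u \<bullet> b) (at x) a"

text \<open>The Euclidean (Frobenius) norm of the matrix of second partial derivatives.\<close>

definition hessian_norm :: "('e::euclidean_space \<Rightarrow> real) \<Rightarrow> 'e \<Rightarrow> real" where
  "hessian_norm f x = sqrt (\<Sum>a\<in>Basis. \<Sum>b\<in>Basis. (hessian f x a b)\<^sup>2)"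

text \<open>Twice continuous differentiability; meant for open \<open>S\<close>.\<close>

definition C2_on :: "'e::euclidean_space set \<Rightarrow> ('e \<Rightarrow> real) \<Rightarrow> bool" where
  "C2_on S f \<longleftrightarrow>
     (\<forall>x\<in>S. f differentiable (at x)) \<and> (\<forall>x\<in>S. grad f differentiable (at x)) \<and>
     (\<forall>a\<in>Basis. \<forall>b\<in>Basis. continuous_on S (\<lambda>x. hessian f x a b))"

definition positive_definite :: "real^'n^'n \<Rightarrow> bool" where
  "positive_definite A \<longleftrightarrow> transpose A = A \<and> (\<forall>v. v \<noteq> 0 \<longrightarrow> 0 < v \<bullet> (A *v v))"


section \<open>Stochastic processes\<close>

definition strictly_stationary :: "'a measure \<Rightarrow> 'b measure \<Rightarrow> (int \<Rightarrow> 'a \<Rightarrow> 'b) \<Rightarrow> bool" where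
  "strictly_stationary M N X \<longleftrightarrow>
     (\<forall>i. X i \<in> measurable M N) \<and>
     (\<forall>k. distr M (Pi\<^sub>M UNIV (\<lambda>_. N)) (\<lambda>\<omega> i. X (i + k) \<omega>) =
          distr M (Pi\<^sub>M UNIV (\<lambda>_. N)) (\<lambda>\<omega> i. X i \<omega>))"

text \<open>Shift-invariant events have probability 0 or 1; meant for stationary processes.\<close>

definition ergodic_process :: "'a measure \<Rightarrow> 'b measure \<Rightarrow> (int \<Rightarrow> 'a \<Rightarrow> 'b) \<Rightarrow> bool" where
  "ergodic_process M N X \<longleftrightarrow>
     (\<forall>A\<in>sets (Pi\<^sub>M UNIV (\<lambda>_. N)).
        {x \<in> space (Pi\<^sub>M UNIV (\<lambda>_. N)). (\<lambda>i. x (i + 1)) \<in> A} = A \<longrightarrow>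
        measure M {\<omega> \<in> space M. (\<lambda>i. X i \<omega>) \<in> A} \<in> {0, 1})"

text \<open>\<open>o\<^sub>p(1)\<close>, and its version \<open>u\<^sub>p(1)\<close> uniform over an index set \<open>Z\<close>. Outer measure is used
  because a supremum over an uncountable \<open>Z\<close> need not be measurable; on events it is the
  ordinary probability. The event \<open>\<exists>z\<in>Z. \<epsilon> < norm (R n z \<omega>)\<close> says that the supremum over \<open>Z\<close>
  exceeds \<open>\<epsilon>\<close>.\<close>

definition small_in_prob ::
  "'a measure \<Rightarrow> (nat \<Rightarrow> 'a \<Rightarrow> 'v::real_normed_vector) \<Rightarrow> bool" where
  "small_in_prob M R \<longleftrightarrow>
     (\<forall>\<epsilon>>0. (\<lambda>n. outer_measure_of M {\<omega> \<in> space M. \<epsilon> < norm (R n \<omega>)}) \<longlonglongrightarrow> 0)"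

definition unif_small_in_prob ::
  "'a measure \<Rightarrow> 'z set \<Rightarrow> (nat \<Rightarrow> 'z \<Rightarrow> 'a \<Rightarrow> 'v::real_normed_vector) \<Rightarrow> bool" where
  "unif_small_in_prob M Z R \<longleftrightarrow>
     (\<forall>\<epsilon>>0. (\<lambda>n. outer_measure_of M {\<omega> \<in> space M. \<exists>z\<in>Z. \<epsilon> < norm (R n z \<omega>)}) \<longlonglongrightarrow> 0)"


section \<open>The model\<close>

text \<open>A parameter is a pair \<open>s = (s\<^sub>1, s\<^sub>2)\<close> in \<open>\<real>\<^sup>q \<times> \<real>\<^sup>r\<close>, with \<open>q\<close>, \<open>r\<close> the
  cardinalities of the index types. The product norm and inner product are the Euclidean ones of
  \<open>\<real>\<^bsup>q+r\<^esup>\<close>; \<open>stack\<close> identifies the two spaces where matrices act.\<close>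

type_synonym ('q, 'r) param = "(real^'q) \<times> (real^'r)"

type_synonym ('a, 'q) mean_fn = "int \<Rightarrow> real^'q \<Rightarrow> 'a \<Rightarrow> real"
type_synonym ('a, 'q, 'r) var_fn = "int \<Rightarrow> ('q, 'r) param \<Rightarrow> 'a \<Rightarrow> real"

definition stack :: "('q::finite, 'r::finite) param \<Rightarrow> real^('q + 'r)" where
  "stack v = (\<chi> k. case k of Inl a \<Rightarrow> fst v $ a | Inr c \<Rightarrow> snd v $ c)"

definition resid :: "(int \<Rightarrow> 'a \<Rightarrow> real) \<Rightarrow> ('a, 'q::finite) mean_fn \<Rightarrow> ('a, 'q, 'r::finite) var_fn \<Rightarrow>
    int \<Rightarrow> ('q, 'r) param \<Rightarrow> 'a \<Rightarrow> real" where
  "resid y \<mu> h i s \<omega> = (y i \<omega> - \<mu> i (fst s) \<omega>) / sqrt (h i s \<omega>)"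

text \<open>The index set of the initial vector \<open>Y\<^sub>0\<close>, which is \<open>(y\<^sub>0, \<dots>, y\<^bsub>1-p\<^esub>)\<close> for some \<open>p \<ge> 1\<close> or
  \<open>(y\<^sub>0, y\<^bsub>-1\<^esub>, \<dots>)\<close>.\<close>

definition initial_index_set :: "int set \<Rightarrow> bool" where
  "initial_index_set L \<longleftrightarrow> (\<exists>p::nat. p \<ge> 1 \<and> L = {1 - int p..0}) \<or> L = {..0}"

text \<open>\<open>\<F>\<^sub>i\<close> for \<open>i \<ge> 0\<close>: generated by \<open>\<eta>\<^sub>i, \<dots>, \<eta>\<^sub>1\<close> and the entries \<open>y\<^sub>j\<close>, \<open>j \<in> L\<close>, of \<open>Y\<^sub>0\<close>,
  so that \<open>\<eta>\<^bsub>i+1\<^esub>\<close> is independent of \<open>\<F>\<^sub>i\<close> when \<open>Y\<^sub>0\<close> is independent of \<open>(\<eta>\<^sub>k)\<^bsub>k\<ge>1\<^esub>\<close>.\<close>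

definition past_field ::
  "'a measure \<Rightarrow> (int \<Rightarrow> 'a \<Rightarrow> real) \<Rightarrow> (int \<Rightarrow> 'a \<Rightarrow> real) \<Rightarrow> int set \<Rightarrow> int \<Rightarrow> 'a measure" where
  "past_field M y \<eta> L i = sigma (space M)
     ({\<eta> k -` B \<inter> space M | k B. 1 \<le> k \<and> k \<le> i \<and> B \<in> sets borel} \<union>
      {y j -` B \<inter> space M | j B. j \<in> L \<and> B \<in> sets borel})"

text \<open>Generated by the initial vector and the observations \<open>y\<^sub>1, \<dots>, y\<^sub>n\<close>.\<close>

definition data_field ::
  "'a measure \<Rightarrow> (int \<Rightarrow> 'a \<Rightarrow> real) \<Rightarrow> int set \<Rightarrow> nat \<Rightarrow> 'a measure" where
  "data_field M y L n = sigma (space M)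
     {y j -` B \<inter> space M | j B. j \<in> L \<union> {1..int n} \<and> B \<in> sets borel}"

text \<open>\<open>(y\<^sub>i, \<mu>\<^sub>i, h\<^sub>i)\<close> as one random element. Stationarity and ergodicity are imposed on this
  process (hence on \<open>y\<close>), so that moment conditions at the index 1 are conditions at every
  \<open>i\<close>; past measurability alone would let \<open>\<mu>\<^sub>i\<close> and \<open>h\<^sub>i\<close> vary arbitrarily with \<open>i\<close>. The functions \<open>\<mu>\<^sub>i\<close> and \<open>h\<^sub>i\<close> carry the product
  (cylinder) \<open>\<sigma>\<close>-algebras over the parameter sets.\<close>

definition model_space ::
  "(real^'q) set \<Rightarrow> (real^'r) set \<Rightarrow>
   (real \<times> (real^'q \<Rightarrow> real) \<times> (('q::finite, 'r::finite) param \<Rightarrow> real)) measure" where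
  "model_space \<Theta>1 \<Theta>2 =
     borel \<Otimes>\<^sub>M (Pi\<^sub>M \<Theta>1 (\<lambda>_. borel) \<Otimes>\<^sub>M Pi\<^sub>M (\<Theta>1 \<times> \<Theta>2) (\<lambda>_. borel))"

definition model_process ::
  "(real^'q) set \<Rightarrow> (real^'r) set \<Rightarrow> (int \<Rightarrow> 'a \<Rightarrow> real) \<Rightarrow>
   ('a, 'q::finite) mean_fn \<Rightarrow> ('a, 'q, 'r::finite) var_fn \<Rightarrow>
   int \<Rightarrow> 'a \<Rightarrow> real \<times> (real^'q \<Rightarrow> real) \<times> (('q, 'r) param \<Rightarrow> real)" where
  "model_process \<Theta>1 \<Theta>2 y \<mu> h i \<omega> =
     (y i \<omega>, restrict (\<lambda>s\<^sub>1. \<mu> i s\<^sub>1 \<omega>) \<Theta>1, restrict (\<lambda>s. h i s \<omega>) (\<Theta>1 \<times> \<Theta>2))"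


section \<open>Scores, information matrix, residual process\<close>

definition mu_dot :: "('a, 'q::finite) mean_fn \<Rightarrow> int \<Rightarrow> real^'q \<Rightarrow> 'a \<Rightarrow> real^'q" where
  "mu_dot \<mu> i s\<^sub>1 \<omega> = grad (\<lambda>u. \<mu> i u \<omega>) s\<^sub>1"

definition mu_dot_ext ::
  "('a, 'q::finite) mean_fn \<Rightarrow> int \<Rightarrow> ('q, 'r::finite) param \<Rightarrow> 'a \<Rightarrow> ('q, 'r) param" where
  "mu_dot_ext \<mu> i s \<omega> = (mu_dot \<mu> i (fst s) \<omega>, 0)"

definition h_dot ::
  "('a, 'q::finite, 'r::finite) var_fn \<Rightarrow> int \<Rightarrow> ('q, 'r) param \<Rightarrow> 'a \<Rightarrow> ('q, 'r) param" where
  "h_dot h i s \<omega> = grad (\<lambda>u. h i u \<omega>) s"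

definition psi0 :: "(real \<Rightarrow> real) \<Rightarrow> (real \<Rightarrow> real) \<Rightarrow> real \<Rightarrow> real" where
  "psi0 f\<^sub>0 f\<^sub>0' x = f\<^sub>0' x / f\<^sub>0 x"

definition phi0 :: "(real \<Rightarrow> real) \<Rightarrow> (real \<Rightarrow> real) \<Rightarrow> real \<Rightarrow> real" where
  "phi0 f\<^sub>0 f\<^sub>0' x = (1 + x * psi0 f\<^sub>0 f\<^sub>0' x) / 2"

definition W22 ::
  "('a, 'q::finite, 'r::finite) var_fn \<Rightarrow> int \<Rightarrow> ('q, 'r) param \<Rightarrow> 'a \<Rightarrow> real^'r" where
  "W22 h i s \<omega> = (1 / h i s \<omega>) *\<^sub>R snd (h_dot h i s \<omega>)"

definition W ::
  "('a, 'q::finite) mean_fn \<Rightarrow> ('a, 'q, 'r::finite) var_fn \<Rightarrow>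
   int \<Rightarrow> ('q, 'r) param \<Rightarrow> 'a \<Rightarrow> real^2^('q + 'r)" where
  "W \<mu> h i s \<omega> = (\<chi> k. case k of
      Inl a \<Rightarrow> vector [mu_dot \<mu> i (fst s) \<omega> $ a / sqrt (h i s \<omega>),
                       fst (h_dot h i s \<omega>) $ a / h i s \<omega>]
    | Inr c \<Rightarrow> vector [0, W22 h i s \<omega> $ c])"

definition B_matrix :: "'a measure \<Rightarrow> (real \<Rightarrow> real) \<Rightarrow> (real \<Rightarrow> real) \<Rightarrow> ('a \<Rightarrow> real) \<Rightarrow> real^2^2" where
  "B_matrix M f\<^sub>0 f\<^sub>0' \<eta>1 =
     vector [vector [LINT \<omega>|M. (psi0 f\<^sub>0 f\<^sub>0' (\<eta>1 \<omega>))\<^sup>2, 0],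
             vector [0, LINT \<omega>|M. (phi0 f\<^sub>0 f\<^sub>0' (\<eta>1 \<omega>))\<^sup>2]]"

definition info_matrix ::
  "'a measure \<Rightarrow> (int \<Rightarrow> 'a \<Rightarrow> real) \<Rightarrow> ('a, 'q::finite) mean_fn \<Rightarrow> ('a, 'q, 'r::finite) var_fn \<Rightarrow>
   (real \<Rightarrow> real) \<Rightarrow> (real \<Rightarrow> real) \<Rightarrow> ('q, 'r) param \<Rightarrow> real^('q + 'r)^('q + 'r)" where
  "info_matrix M y \<mu> h f\<^sub>0 f\<^sub>0' \<theta> =
     (LINT \<omega>|M. W \<mu> h 1 \<theta> \<omega> ** B_matrix M f\<^sub>0 f\<^sub>0' (resid y \<mu> h 1 \<theta>) ** transpose (W \<mu> h 1 \<theta> \<omega>))"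

definition K_process ::
  "(int \<Rightarrow> 'a \<Rightarrow> real) \<Rightarrow> ('a, 'q::finite) mean_fn \<Rightarrow> ('a, 'q, 'r::finite) var_fn \<Rightarrow>
   (real \<Rightarrow> real) \<Rightarrow> nat \<Rightarrow> real \<Rightarrow> ('q, 'r) param \<Rightarrow> 'a \<Rightarrow> real^'r" where
  "K_process y \<mu> h F\<^sub>0 n x s \<omega> =
     (1 / (2 * sqrt (real n))) *\<^sub>R
     (\<Sum>i\<in>{1..int n}. (of_bool (resid y \<mu> h i s \<omega> \<le> x) - F\<^sub>0 x) *\<^sub>R W22 h i s \<omega>)"

end

theory Submission
  imports Defs "HOL-Probability.Probability"
begin

text \<open>
  Put \<open>s = \<theta> + n\<^sup>-\<^sup>1\<^sup>/\<^sup>2 t\<close>. Since \<open>y\<^sub>i = \<mu>\<^sub>i(\<theta>) + \<eta>\<^sub>i \<surd>h\<^sub>i(\<theta>)\<close>, the event \<open>\<eta>\<^sub>i(s) \<le> x\<close> is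
  \<open>\<eta>\<^sub>i \<le> loc\<^sub>i(s) + x scl\<^sub>i(s)\<close> with \<open>loc\<^sub>i(s) = (\<mu>\<^sub>i(s) - \<mu>\<^sub>i(\<theta>)) / \<surd>h\<^sub>i(\<theta>)\<close> and
  \<open>scl\<^sub>i(s) = \<surd>(h\<^sub>i(s) / h\<^sub>i(\<theta>))\<close>. Both are known at time \<open>i - 1\<close>, and \<open>\<eta>\<^sub>i\<close> is independent of that past.
  So \<open>K\<^sub>n(x, s)\<close> is a weighted empirical process of innovations with predictable weights and
  predictably perturbed thresholds, and the correction term is the linear part of the drift that the
  perturbation causes. Four facts carry the proof.

  \<^item> Smoothness of the distribution function. By Cauchy-Schwarz, the finiteness of the two Fisher informations
  is what makes \<open>f\<close> and \<open>x f(x)\<close> into \<open>1/2\<close>-Hoelder functions of \<open>F(x)\<close>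
  (\<open>hoelder_density_exists\<close>). Hence \<open>F(x + u + v x) = F(x) + (u + v x) f(x) + O((|u| + |v|)\<^sup>3\<^sup>/\<^sup>2)\<close>,
  uniformly over the whole line (\<open>F_taylor\<close>).

  \<^item> Uniformity in \<open>x\<close>. The centred sums are martingales, so Freedman's inequality applies, and one chains
  along the dyadic quantiles of \<open>F\<close>. A summand with weight \<open>w\<close> and perturbation of size \<open>\<rho>\<close> takes
  part in level \<open>k\<close> of the chain only as long as \<open>w\<^sup>2 + \<rho>\<^sup>3\<^sup>/\<^sup>2 \<le> 2\<^sup>-\<^sup>k\<close>: up to that level its jumps are below
  the scale \<open>2\<^sup>-\<^sup>k\<^sup>/\<^sup>2\<close> of the level, and the perturbed cells still have conditional probability
  \<open>O(2\<^sup>-\<^sup>k)\<close>. Leaving the chain costs \<open>O(w (w\<^sup>2 + \<rho>\<^sup>3\<^sup>/\<^sup>2))\<close>, and the sum of these cubic terms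
  tends to 0 because the entries of the arrays do and their square sums stay bounded (\<open>chaining\<close>,
  \<open>perturbed_expansion\<close>).

  \<^item> Uniformity in \<open>t\<close>. Near a point \<open>t\<^sub>0\<close> of a finite net the thresholds are bracketed by two
  predictable thresholds that do not depend on \<open>t\<close>; their distance is made of the mesh \<open>\<delta>\<close> times the
  gradients of \<open>loc\<^sub>i\<close> and \<open>scl\<^sub>i\<close>, and of the linearisation remainder on a ball of radius \<open>\<kappa>\<close>
  (\<open>local_expansion\<close>). The weights at \<open>s\<close> and at \<open>\<theta>\<close> differ by \<open>O(1/\<surd>n)\<close> times an integrable Lipschitz
  constant (\<open>weight_change_small\<close>).

  \<^item> Moments. The assumed moment bounds dominate the gradients, the remainders and the Lipschitz constant at time 1.
  By dominated convergence the remainder tends to 0 in \<open>L\<^sup>2\<close> as \<open>\<kappa> \<rightarrow> 0\<close>, and stationarity carries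
  this to every time (\<open>null_array_identical\<close>, \<open>frem_moment_tendsto_0\<close>, \<open>fwt_lip_moment\<close>).

  Gradients and suprema over a neighbourhood of \<open>\<theta>\<close> enter the thresholds of the bracketing, so they must be
  predictable. They are therefore written as limits of difference quotients and as suprema over
  a countable dense set, which are measurable functions of countably many values of \<open>\<mu>\<^sub>i\<close> and \<open>h\<^sub>i\<close>.
\<close>

section \<open>Absolutely continuous functions and Hoelder bounds\<close>

lemma absolutely_cont_onE:
  assumes "absolutely_cont_on S f" "0 < e"
  obtains \<delta> where "\<delta> > 0" and "\<And>I :: (real \<times> real) set.
        finite I \<Longrightarrow> (\<forall>(u, v)\<in>I. u \<le> v \<and> {u..v} \<subseteq> S) \<Longrightarrow>
        pairwise (\<lambda>p q. disjnt {fst p<..<snd p} {fst q<..<snd q}) I \<Longrightarrow>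
        (\<Sum>(u, v)\<in>I. v - u) < \<delta> \<Longrightarrow> (\<Sum>(u, v)\<in>I. \<bar>f v - f u\<bar>) < e"
proof -
  from mp[OF spec[OF assms(1)[unfolded absolutely_cont_on_def], of e] assms(2)]
  show ?thesis by (elim exE conjE, intro that) (assumption, simp only: simp_thms)
qed

text \<open>Tags outside the exceptional null set \<open>N\<close> contribute a small error by differentiability there. Tags in
  \<open>N\<close> lie in intervals inside an open set of measure below \<open>\<delta>\<close>, and absolute continuity makes
  the total increment of \<open>f\<close> over those intervals small.\<close>

lemma absolutely_cont_FTC:
  fixes f g :: "real \<Rightarrow> real"
  assumes ab: "a \<le> b"
    and ac: "absolutely_cont_on {a..b} f"
    and N: "N \<in> null_sets lborel"
    and deriv: "\<And>x. x \<in> {a..b} - N \<Longrightarrow> (f has_real_derivative g x) (at x)"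
  shows "(g has_integral (f b - f a)) {a..b}"
proof -
  define g0 where "g0 x = (if x \<in> N then 0 else g x)" for x
  have negN: "negligible N"
    using N by (simp add: negligible_iff_null_sets null_sets_completionI)
  have "(g0 has_integral (f b - f a)) {a..b}"
    unfolding has_integral_real
  proof (intro allI impI)
    fix e :: real assume e: "0 < e"
    define e1 where "e1 = e / (2 * (b - a + 1))"
    have e1: "e1 > 0" using e ab by (simp add: e1_def)
    obtain \<delta> where \<delta>: "\<delta> > 0" and acd: "\<And>I :: (real \<times> real) set.
        finite I \<Longrightarrow> (\<forall>(u, v)\<in>I. u \<le> v \<and> {u..v} \<subseteq> {a..b}) \<Longrightarrow>
        pairwise (\<lambda>p q. disjnt {fst p<..<snd p} {fst q<..<snd q}) I \<Longrightarrow>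
        (\<Sum>(u, v)\<in>I. v - u) < \<delta> \<Longrightarrow> (\<Sum>(u, v)\<in>I. \<bar>f v - f u\<bar>) < e / 2"
      using absolutely_cont_onE[OF ac, of "e/2"] e by auto
    have Nb: "N \<in> sets borel" using N by auto
    obtain O' where O: "open O'" "N \<subseteq> O'" "emeasure lborel (O' - N) < ennreal \<delta>"
      using outer_regular_lborel[OF Nb \<delta>] by metis
    have Om: "emeasure lborel O' < ennreal \<delta>"
    proof -
      have "emeasure lborel O' = emeasure lborel (O' - N)"
        using N O(1) by (metis borel_open emeasure_Diff_null_set sets_lborel)
      with O(3) show ?thesis by simp
    qed
    have "\<forall>x. \<exists>d>0. (x \<in> N \<longrightarrow> ball x d \<subseteq> O') \<and>
        (x \<in> {a..b} - N \<longrightarrow> (\<forall>y. \<bar>y - x\<bar> < d \<longrightarrow> \<bar>f y - f x - (y - x) * g x\<bar> \<le> e1 * \<bar>y - x\<bar>))"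
    proof
      fix x
      show "\<exists>d>0. (x \<in> N \<longrightarrow> ball x d \<subseteq> O') \<and>
        (x \<in> {a..b} - N \<longrightarrow> (\<forall>y. \<bar>y - x\<bar> < d \<longrightarrow> \<bar>f y - f x - (y - x) * g x\<bar> \<le> e1 * \<bar>y - x\<bar>))"
      proof (cases "x \<in> N")
        case True
        then show ?thesis using O by (metis Diff_iff open_contains_ball subsetD)
      next
        case False
        show ?thesis
        proof (cases "x \<in> {a..b}")
          case True
          with False have "(f has_real_derivative g x) (at x)" using deriv by auto
          then have "(f has_derivative (\<lambda>h. h * g x)) (at x)"
            by (simp add: has_field_derivative_def mult.commute[of _ "g x"])
          then obtain d where "d > 0" "\<And>y. norm (y - x) < d \<Longrightarrow> norm (f y - f x - (y - x) * g x) \<le> e1 * norm (y - x)"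
            unfolding has_derivative_at_alt using e1 by blast
          with False show ?thesis by (auto intro!: exI[of _ d])
        next
          case False': False
          with False show ?thesis by (auto intro!: exI[of _ 1])
        qed
      qed
    qed
    then obtain d where d: "\<And>x. d x > 0" "\<And>x. x \<in> N \<Longrightarrow> ball x (d x) \<subseteq> O'"
      "\<And>x y. x \<in> {a..b} - N \<Longrightarrow> \<bar>y - x\<bar> < d x \<Longrightarrow> \<bar>f y - f x - (y - x) * g x\<bar> \<le> e1 * \<bar>y - x\<bar>"
      by metis
    show "\<exists>\<gamma>. gauge \<gamma> \<and> (\<forall>\<D>. \<D> tagged_division_of {a..b} \<and> \<gamma> fine \<D> \<longrightarrow>
        norm ((\<Sum>(x, k)\<in>\<D>. measure lborel k *\<^sub>R g0 x) - (f b - f a)) < e)"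
    proof (rule exI, safe)
      show "gauge (\<lambda>x. ball x (d x))" using d(1) gauge_ball_dependent by blast
    next
      fix p assume p: "p tagged_division_of {a..b}" and fine: "(\<lambda>x. ball x (d x)) fine p"
      note pD = tagged_division_ofD[OF p]
      have fin: "finite p" using p by auto
      have K: "\<exists>u v. K = {u..v} \<and> u \<le> v \<and> x \<in> K \<and> a \<le> u \<and> v \<le> b \<and> Inf K = u \<and> Sup K = v
          \<and> measure lborel K = v - u \<and> K \<subseteq> ball x (d x)" if xK: "(x, K) \<in> p" for x K
      proof -
        obtain u v where uv: "K = cbox u v" using pD(4)[OF xK] by blast
        have xin: "x \<in> K" using pD(2)[OF xK] .
        then have le: "u \<le> v" using uv by auto
        have "K \<subseteq> {a..b}" using pD(3)[OF xK] .
        then have "a \<le> u" "v \<le> b" using uv le by auto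
        moreover have "K \<subseteq> ball x (d x)" using fine xK by (auto simp: fine_def)
        ultimately show ?thesis using uv le xin by (intro exI[of _ u] exI[of _ v]) auto
      qed
      define A where "A = {xk \<in> p. fst xk \<in> N}"
      have pA: "A \<subseteq> p" by (auto simp: A_def)
      have finA: "finite A" using fin pA finite_subset by blast
      have ba: "b - a = (\<Sum>(x,K)\<in>p. Sup K - Inf K)" "f b - f a = (\<Sum>(x,K)\<in>p. f(Sup K) - f(Inf K))"
        using additive_tagged_division_1[where f= "\<lambda>x. x"] additive_tagged_division_1[where f= f] ab p by auto
      have nonN: "\<bar>\<Sum>(x,K)\<in>p-A. measure lborel K * g0 x - (f (Sup K) - f (Inf K))\<bar> \<le> e1 * (b - a)"
      proof -
        have "\<bar>\<Sum>(x,K)\<in>p-A. measure lborel K * g0 x - (f (Sup K) - f (Inf K))\<bar>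
          \<le> (\<Sum>(x,K)\<in>p-A. e1 * (Sup K - Inf K))"
          unfolding real_norm_def[symmetric]
        proof (rule sum_norm_le, safe)
          fix x K assume xK: "(x, K) \<in> p" "(x, K) \<notin> A"
          then have xN: "x \<notin> N" by (simp add: A_def)
          obtain u v where uv: "K = {u..v}" "u \<le> v" "x \<in> K" "a \<le> u" "v \<le> b" "Inf K = u" "Sup K = v"
            "measure lborel K = v - u" "K \<subseteq> ball x (d x)" using K[OF xK(1)] by blast
          have x: "x \<in> {a..b} - N" using uv xN by auto
          have du: "\<bar>u - x\<bar> < d x" "\<bar>v - x\<bar> < d x"
            using uv(1,2,9) by (auto simp: subset_iff dist_real_def abs_minus_commute)
          have "\<bar>f u - f x - (u - x) * g x\<bar> \<le> e1 * (x - u)" "\<bar>f v - f x - (v - x) * g x\<bar> \<le> e1 * (v - x)"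
            using d(3)[OF x du(1)] d(3)[OF x du(2)] uv(1,3) by auto
          then have "\<bar>(v - u) * g x - (f v - f u)\<bar> \<le> e1 * (v - u)"
            by (simp add: algebra_simps abs_le_iff)
          then show "norm (measure lborel K * g0 x - (f (Sup K) - f (Inf K))) \<le> e1 * (Sup K - Inf K)"
            using uv xN by (simp add: g0_def)
        qed
        also have "\<dots> \<le> (\<Sum>(x,K)\<in>p. e1 * (Sup K - Inf K))"
          using fin e1 K by (intro sum_mono2) (fastforce simp: split_def)+
        also have "\<dots> = e1 * (b - a)"
          unfolding ba(1) by (simp add: sum_distrib_left split_def)
        finally show ?thesis .
      qed
      have inN: "(\<Sum>(x,K)\<in>A. \<bar>f (Sup K) - f (Inf K)\<bar>) < e / 2"
      proof -
        (* Degenerate intervals carry no increment of f; without them the endpoint map is injective. *)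
        define A' where "A' = {xk \<in> A. measure lborel (snd xk) \<noteq> 0}"
        have A'A: "A' \<subseteq> A" by (auto simp: A'_def)
        then have A'p: "A' \<subseteq> p" using pA by blast
        define J where "J = (\<lambda>(x,K). (Inf K, Sup K)) ` A'"
        have KK: "K = {Inf K..Sup K} \<and> Inf K < Sup K \<and> measure lborel K = Sup K - Inf K" if "(x,K) \<in> A'" for x K
        proof -
          have "(x,K) \<in> p" "measure lborel K \<noteq> 0" using that A'p by (auto simp: A'_def)
          then show ?thesis using K[of x K] by force
        qed
        have intdis: "{Inf K<..<Sup K} \<inter> {Inf K'<..<Sup K'} = {}" if "(x,K) \<in> A'" "(x',K') \<in> A'" "(x,K) \<noteq> (x',K')" for x K x' K'
        proof -
          have "interior K \<inter> interior K' = {}" using pD(5)[of x K x' K'] that A'p by auto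
          then show ?thesis using KK[OF that(1)] KK[OF that(2)] by (metis interior_atLeastAtMost_real)
        qed
        have inj: "inj_on (\<lambda>(x,K). (Inf K, Sup K)) A'"
        proof (rule inj_onI, clarify)
          fix x K x' K' assume h: "(x,K) \<in> A'" "(x',K') \<in> A'" "Inf K = Inf K'" "Sup K = Sup K'"
          have "(x,K) = (x',K')"
          proof (rule ccontr)
            assume "(x,K) \<noteq> (x',K')"
            from intdis[OF h(1,2) this] h(3,4) KK[OF h(1)] show False by auto
          qed
          then show "x = x' \<and> K = K'" by auto
        qed
        have finA': "finite A'" using finA A'A finite_subset by blast
        have tp: "A' tagged_partial_division_of {a..b}"
          using tagged_partial_division_subset[OF _ A'p] p by (auto simp: tagged_division_of_def)
        have "(\<Sum>(x,K)\<in>A'. measure lborel K) = sum (measure lborel) (snd ` A')"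
          by (rule sum.over_tagged_division_lemma[OF tagged_partial_division_of_Union_self[OF tp]])
             (simp add: content_eq_0_interior)
        also have "\<dots> = sum (measure lebesgue) (snd ` A')"
        proof (rule sum.cong[OF refl])
          fix K assume "K \<in> snd ` A'"
          then obtain x where "K = {Inf K..Sup K}" using KK by force
          then have "K \<in> sets lborel" by (metis atLeastAtMost_borel sets_lborel)
          then show "measure lborel K = measure lebesgue K" by (simp add: measure_completion)
        qed
        also have "\<dots> = measure lebesgue (\<Union>(snd ` A'))"
          using content_division[OF partial_division_of_tagged_division[OF tp]] .
        also have "\<dots> = measure lborel (\<Union>(snd ` A'))"
        proof -
          have "closed (\<Union>(snd ` A'))"
            using finA' KK by (intro closed_Union) (auto, metis closed_real_atLeastAtMost)
          then show ?thesis by simp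
        qed
        finally have sumc: "(\<Sum>(x,K)\<in>A'. measure lborel K) = measure lborel (\<Union>(snd ` A'))" .
        have sub: "\<Union>(snd ` A') \<subseteq> O'"
          using K d(2) A'p by (fastforce simp: A'_def A_def)
        have "emeasure lborel (\<Union>(snd ` A')) < ennreal \<delta>"
          using emeasure_mono[OF sub, of lborel] O(1) Om by (simp add: order.strict_trans1)
        then have lt: "measure lborel (\<Union>(snd ` A')) < \<delta>"
          using \<delta> by (metis emeasure_eq_ennreal_measure ennreal_less_iff measure_nonneg order_less_imp_not_less top.not_eq_extremum top_greatest leD)
        have "(\<Sum>(u, v)\<in>J. \<bar>f v - f u\<bar>) < e / 2"
        proof (rule acd)
          show "finite J" using finA' by (simp add: J_def)
          show "\<forall>(u, v)\<in>J. u \<le> v \<and> {u..v} \<subseteq> {a..b}"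
            using K A'p by (fastforce simp: J_def)
          show "pairwise (\<lambda>p q. disjnt {fst p<..<snd p} {fst q<..<snd q}) J"
            unfolding pairwise_def J_def disjnt_def using intdis by fastforce
          have "(\<Sum>(u, v)\<in>J. v - u) = (\<Sum>(x,K)\<in>A'. measure lborel K)"
            unfolding J_def using KK by (subst sum.reindex[OF inj]) (auto intro!: sum.cong)
          then show "(\<Sum>(u, v)\<in>J. v - u) < \<delta>" using sumc lt by simp
        qed
        also have "(\<Sum>(u, v)\<in>J. \<bar>f v - f u\<bar>) = (\<Sum>(x,K)\<in>A'. \<bar>f (Sup K) - f (Inf K)\<bar>)"
          unfolding J_def by (subst sum.reindex[OF inj]) (auto intro!: sum.cong)
        also have "\<dots> = (\<Sum>(x,K)\<in>A. \<bar>f (Sup K) - f (Inf K)\<bar>)"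
        proof (rule sum.mono_neutral_left[OF finA A'A], safe)
          fix x K assume "(x,K) \<in> A" "(x,K) \<notin> A'"
          then have "(x,K) \<in> p" "measure lborel K = 0" using pA by (auto simp: A'_def)
          then show "\<bar>f (Sup K) - f (Inf K)\<bar> = 0" using K[of x K] by force
        qed
        finally show ?thesis .
      qed
      have "(\<Sum>(x, k)\<in>p. measure lborel k * g0 x) - (f b - f a)
          = (\<Sum>(x,K)\<in>p. measure lborel K * g0 x - (f (Sup K) - f (Inf K)))"
        unfolding ba(2) by (simp add: sum_subtractf split_def)
      also have "\<dots> = (\<Sum>(x,K)\<in>p-A. measure lborel K * g0 x - (f (Sup K) - f (Inf K)))
          + (\<Sum>(x,K)\<in>A. measure lborel K * g0 x - (f (Sup K) - f (Inf K)))"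
        by (rule sum.subset_diff[OF pA fin])
      also have "(\<Sum>(x,K)\<in>A. measure lborel K * g0 x - (f (Sup K) - f (Inf K))) = - (\<Sum>(x,K)\<in>A. f (Sup K) - f (Inf K))"
        unfolding sum_negf[symmetric] by (rule sum.cong) (auto simp: A_def g0_def)
      finally have eq: "(\<Sum>(x, k)\<in>p. measure lborel k * g0 x) - (f b - f a)
        = (\<Sum>(x,K)\<in>p-A. measure lborel K * g0 x - (f (Sup K) - f (Inf K))) - (\<Sum>(x,K)\<in>A. f (Sup K) - f (Inf K))"
        by simp
      have "\<bar>\<Sum>(x,K)\<in>A. f (Sup K) - f (Inf K)\<bar> \<le> (\<Sum>(x,K)\<in>A. \<bar>f (Sup K) - f (Inf K)\<bar>)"
        using sum_abs[of "\<lambda>(x,K). f (Sup K) - f (Inf K)" A] by (simp add: split_def)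
      moreover have "e1 * (b - a) \<le> e / 2"
        using ab e by (simp add: e1_def field_simps)
      ultimately show "norm ((\<Sum>(x, k)\<in>p. measure lborel k *\<^sub>R g0 x) - (f b - f a)) < e"
        using nonN inN unfolding real_scaleR_def eq real_norm_def by linarith
    qed
  qed
  then show ?thesis
    by (rule has_integral_spike[OF negN, rotated]) (simp add: g0_def)
qed

lemma absolutely_cont_on_times_ident:
  assumes ac: "absolutely_cont_on {a..b} f" and cont: "continuous_on {a..b} f"
  shows "absolutely_cont_on {a..b} (\<lambda>x. x * f x)"
proof -
  have "bounded (f ` {a..b})"
    using cont compact_continuous_image compact_imp_bounded by blast
  then obtain B0 where "\<forall>z\<in>f ` {a..b}. norm z \<le> B0"
    unfolding bounded_iff by blast
  then have B0: "\<And>x. x \<in> {a..b} \<Longrightarrow> \<bar>f x\<bar> \<le> B0" by simp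
  define B where "B = 1 + \<bar>B0\<bar> + \<bar>a\<bar> + \<bar>b\<bar>"
  have B: "B > 0" by (simp add: B_def)
  have B2: "\<bar>f x\<bar> \<le> B \<and> \<bar>x\<bar> \<le> B" if "x \<in> {a..b}" for x
  proof -
    have "\<bar>f x\<bar> \<le> B0" "a \<le> x" "x \<le> b" using B0[OF that] that by auto
    then show "\<bar>f x\<bar> \<le> B \<and> \<bar>x\<bar> \<le> B" unfolding B_def by linarith
  qed
  show ?thesis
    unfolding absolutely_cont_on_def
  proof (intro allI impI)
    fix e :: real assume e: "e > 0"
    obtain \<delta> where \<delta>: "\<delta> > 0" and acd: "\<And>I :: (real \<times> real) set.
        finite I \<Longrightarrow> (\<forall>(u, v)\<in>I. u \<le> v \<and> {u..v} \<subseteq> {a..b}) \<Longrightarrow>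
        pairwise (\<lambda>p q. disjnt {fst p<..<snd p} {fst q<..<snd q}) I \<Longrightarrow>
        (\<Sum>(u, v)\<in>I. v - u) < \<delta> \<Longrightarrow> (\<Sum>(u, v)\<in>I. \<bar>f v - f u\<bar>) < e / (2*B)"
      using absolutely_cont_onE[OF ac, of "e/(2*B)"] e B by auto
    show "\<exists>\<delta>>0. \<forall>I. finite I \<and> (\<forall>(u, v)\<in>I. u \<le> v \<and> {u..v} \<subseteq> {a..b}) \<and>
             pairwise (\<lambda>p q. disjnt {fst p<..<snd p} {fst q<..<snd q}) I \<and>
             (\<Sum>(u, v)\<in>I. v - u) < \<delta> \<longrightarrow> (\<Sum>(u, v)\<in>I. \<bar>v * f v - u * f u\<bar>) < e"
    proof (intro exI conjI allI impI; (elim conjE)?)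
      show "min \<delta> (e / (2*B)) > 0" using \<delta> e B by simp
    next
      fix I :: "(real \<times> real) set"
      assume I: "finite I" "\<forall>(u, v)\<in>I. u \<le> v \<and> {u..v} \<subseteq> {a..b}"
        "pairwise (\<lambda>p q. disjnt {fst p<..<snd p} {fst q<..<snd q}) I"
        "(\<Sum>(u, v)\<in>I. v - u) < min \<delta> (e / (2*B))"
      have 1: "(\<Sum>(u, v)\<in>I. \<bar>f v - f u\<bar>) < e / (2*B)" using acd[OF I(1-3)] I(4) by simp
      have "(\<Sum>(u, v)\<in>I. \<bar>v * f v - u * f u\<bar>) \<le> (\<Sum>(u, v)\<in>I. B * \<bar>f v - f u\<bar> + B * (v - u))"
      proof (rule sum_mono, clarify)
        fix u v assume "(u,v) \<in> I"
        then have uv: "u \<le> v" "u \<in> {a..b}" "v \<in> {a..b}" using I(2) by auto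
        have "v * f v - u * f u = v * (f v - f u) + (v - u) * f u" by (simp add: algebra_simps)
        also have "\<bar>\<dots>\<bar> \<le> \<bar>v\<bar> * \<bar>f v - f u\<bar> + (v - u) * \<bar>f u\<bar>"
          using uv(1) by (metis abs_mult abs_of_nonneg abs_triangle_ineq diff_ge_0_iff_ge)
        also have "\<dots> \<le> B * \<bar>f v - f u\<bar> + (v - u) * B"
          using B2[OF uv(2)] B2[OF uv(3)] uv(1) by (intro add_mono mult_right_mono mult_left_mono) auto
        finally show "\<bar>v * f v - u * f u\<bar> \<le> B * \<bar>f v - f u\<bar> + B * (v - u)" by (simp add: mult.commute)
      qed
      also have "\<dots> = B * (\<Sum>(u, v)\<in>I. \<bar>f v - f u\<bar>) + B * (\<Sum>(u, v)\<in>I. v - u)"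
        by (simp add: split_def sum.distrib sum_distrib_left)
      also have "\<dots> < B * (e / (2*B)) + B * (e/(2*B))"
        using 1 I(4) B by (intro add_strict_mono mult_strict_left_mono) auto
      also have "\<dots> = e" using B by simp
      finally show "(\<Sum>(u, v)\<in>I. \<bar>v * f v - u * f u\<bar>) < e" .
    qed
  qed
qed

lemma absolutely_cont_on_imp_continuous:
  assumes ac: "absolutely_cont_on {a..b} f"
  shows "continuous_on {a..b} f"
  unfolding continuous_on_iff
proof (intro ballI allI impI)
  fix x and e :: real assume x: "x \<in> {a..b}" and e: "e > 0"
  obtain \<delta> where \<delta>: "\<delta> > 0" and acd: "\<And>I :: (real \<times> real) set.
        finite I \<Longrightarrow> (\<forall>(u, v)\<in>I. u \<le> v \<and> {u..v} \<subseteq> {a..b}) \<Longrightarrow>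
        pairwise (\<lambda>p q. disjnt {fst p<..<snd p} {fst q<..<snd q}) I \<Longrightarrow>
        (\<Sum>(u, v)\<in>I. v - u) < \<delta> \<Longrightarrow> (\<Sum>(u, v)\<in>I. \<bar>f v - f u\<bar>) < e"
    using absolutely_cont_onE[OF ac e] by blast
  show "\<exists>d>0. \<forall>y\<in>{a..b}. dist y x < d \<longrightarrow> dist (f y) (f x) < e"
  proof (intro exI conjI ballI impI)
    fix y assume y: "y \<in> {a..b}" "dist y x < \<delta>"
    show "dist (f y) (f x) < e"
      using acd[of "{(x, y)}"] acd[of "{(y, x)}"] x y
      by (cases "x \<le> y") (auto simp: dist_real_def abs_minus_commute)
  qed (fact \<delta>)
qed

lemma power2_le_imp_le_ennreal: "a\<^sup>2 \<le> b\<^sup>2 \<Longrightarrow> a \<le> (b::ennreal)"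
proof (rule ccontr)
  assume le: "a\<^sup>2 \<le> b\<^sup>2" and "\<not> a \<le> b"
  then have ba: "b < a" by simp
  show False
  proof (cases "a = top")
    case True
    then have "b\<^sup>2 = top" using le by (simp add: top_unique)
    then show False using ba True by (simp add: power2_eq_square ennreal_mult_eq_top_iff)
  next
    case False
    have "b * b \<le> b * a" using ba by (intro mult_left_mono) auto
    also have "\<dots> < a * a" using ba False
      by (intro ennreal_mult_strict_right_mono) (auto simp: less_top[symmetric] intro: le_less_trans)
    finally show False using le by (simp add: power2_eq_square)
  qed
qed

text \<open>The increment of \<open>k\<close> over \<open>[x, y]\<close> is the integral of \<open>\<psi>\<close> against the distribution
  with density \<open>f\<close>; Cauchy-Schwarz bounds it by the \<open>L\<^sup>2\<close> norm of \<open>\<psi>\<close> times the square root of the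
  probability of \<open>[x, y]\<close>. For \<open>k = f\<close> and \<open>k x = x f(x)\<close> the squared norms are the Fisher
  informations for location and scale.\<close>

lemma hoelder_of_weighted_derivative:
  fixes k f \<psi> :: "real \<Rightarrow> real"
  defines "P \<equiv> density lborel f"
  assumes P: "prob_space P"
    and f: "\<And>x. 0 \<le> f x" "f \<in> borel_measurable borel" and \<psi>: "\<psi> \<in> borel_measurable borel"
    and ac: "\<And>a b. absolutely_cont_on {a..b} k"
    and deriv: "AE x in lborel. (k has_real_derivative \<psi> x * f x) (at x)"
    and int: "integrable P (\<lambda>x. (\<psi> x)\<^sup>2)"
  shows "\<bar>k x - k y\<bar> \<le> sqrt (LINT x|P. (\<psi> x)\<^sup>2) * sqrt \<bar>cdf P x - cdf P y\<bar>"
proof -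
  interpret P: prob_space P by fact
  have setsP: "sets P = sets borel" by (simp add: P_def)
  have meas[measurable]: "\<psi> \<in> borel_measurable borel" "f \<in> borel_measurable borel" by fact+
  have measP: "g \<in> borel_measurable P \<longleftrightarrow> g \<in> borel_measurable borel" for g :: "real \<Rightarrow> 'c::topological_space"
    by (simp add: P_def)
  obtain N where N: "N \<in> null_sets lborel" "\<And>x. x \<notin> N \<Longrightarrow> (k has_real_derivative \<psi> x * f x) (at x)"
  proof -
    obtain N where "{x \<in> space lborel. \<not> (k has_real_derivative \<psi> x * f x) (at x)} \<subseteq> N"
      "emeasure lborel N = 0" "N \<in> sets lborel"
      using deriv by (rule AE_E)
    then show ?thesis by (intro that[of N]) (auto simp: null_sets_def)
  qed
  have main: "\<bar>k y - k x\<bar> \<le> sqrt (LINT x|P. (\<psi> x)\<^sup>2) * sqrt (cdf P y - cdf P x)" if xy: "x \<le> y" for x y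
  proof -
    have hi: "((\<lambda>x. \<psi> x * f x) has_integral (k y - k x)) {x..y}"
      by (rule absolutely_cont_FTC[OF xy ac N(1)]) (use N(2) in auto)
    have mP: "measure P {x..y} = cdf P y - cdf P x"
    proof -
      have "emeasure P {x} = 0" by (simp add: P_def emeasure_density nn_integral_indicator_singleton)
      then have "measure P {x} = 0" by (simp add: measure_def)
      moreover have "measure P {x..y} = measure P {x} + measure P {x<..y}"
      proof -
        have "{x..y} = {x} \<union> {x<..y}" using xy by auto
        then show ?thesis using P.finite_measure_Union[of "{x}" "{x<..y}"] by (simp add: setsP)
      qed
      moreover have "measure P {..y} = measure P {..x} + measure P {x<..y}"
      proof -
        have "{..y} = {..x} \<union> {x<..y}" "{..x} \<inter> {x<..y} = {}" using xy by auto
        then show ?thesis using P.finite_measure_Union[of "{..x}" "{x<..y}"] by (simp add: setsP)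
      qed
      ultimately show ?thesis by (simp add: cdf_def)
    qed
    have "(\<integral>\<^sup>+z. ennreal \<bar>\<psi> z\<bar> * indicator {x..y} z \<partial>P)\<^sup>2
        \<le> (\<integral>\<^sup>+z. (ennreal \<bar>\<psi> z\<bar>)\<^sup>2 \<partial>P) * (\<integral>\<^sup>+z. (indicator {x..y} z)\<^sup>2 \<partial>P)"
      by (rule Cauchy_Schwarz_nn_integral) (simp_all add: measP setsP)
    also have "(\<integral>\<^sup>+z. (indicator {x..y} z :: ennreal)\<^sup>2 \<partial>P) = emeasure P {x..y}"
    proof -
      have "(\<lambda>z. (indicator {x..y} z :: ennreal)\<^sup>2) = indicator {x..y}" by (auto simp: indicator_def)
      then show ?thesis by (simp add: setsP)
    qed
    also have "\<dots> = ennreal (cdf P y - cdf P x)" using mP by (simp add: P.emeasure_eq_measure)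
    also have "(\<integral>\<^sup>+z. (ennreal \<bar>\<psi> z\<bar>)\<^sup>2 \<partial>P) = ennreal (LINT x|P. (\<psi> x)\<^sup>2)"
      using int by (subst nn_integral_eq_integral[symmetric]) (auto simp: ennreal_power)
    also have "ennreal (LINT x|P. (\<psi> x)\<^sup>2) * ennreal (cdf P y - cdf P x)
       = (ennreal (sqrt (LINT x|P. (\<psi> x)\<^sup>2) * sqrt (cdf P y - cdf P x)))\<^sup>2"
      using mP measure_nonneg[of P "{x..y}"]
      by (simp add: ennreal_power ennreal_mult' power_mult_distrib)
    finally have "(\<integral>\<^sup>+z. ennreal \<bar>\<psi> z\<bar> * indicator {x..y} z \<partial>P)
      \<le> ennreal (sqrt (LINT x|P. (\<psi> x)\<^sup>2) * sqrt (cdf P y - cdf P x))"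
      by (rule power2_le_imp_le_ennreal)
    also have "(\<integral>\<^sup>+z. ennreal \<bar>\<psi> z\<bar> * indicator {x..y} z \<partial>P) = (\<integral>\<^sup>+z. ennreal (norm (indicator {x..y} z *\<^sub>R (\<psi> z * f z))) \<partial>lborel)"
      unfolding P_def using f
      by (subst nn_integral_density)
         (auto intro!: nn_integral_cong simp: indicator_def ennreal_mult' abs_mult mult.commute)
    finally have bnd: "(\<integral>\<^sup>+z. ennreal (norm (indicator {x..y} z *\<^sub>R (\<psi> z * f z))) \<partial>lborel)
      \<le> ennreal (sqrt (LINT x|P. (\<psi> x)\<^sup>2) * sqrt (cdf P y - cdf P x))" .
    have si: "set_integrable lborel {x..y} (\<lambda>z. \<psi> z * f z)"
      unfolding set_integrable_def
      by (rule integrableI_bounded) (use bnd in \<open>auto intro: le_less_trans\<close>)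
    have "k y - k x = (LINT z:{x..y}|lborel. \<psi> z * f z)"
      using set_borel_integral_eq_integral(2)[OF si] integral_unique[OF hi] by simp
    then have "ennreal \<bar>k y - k x\<bar> \<le> ennreal (\<integral>z. norm (indicator {x..y} z *\<^sub>R (\<psi> z * f z)) \<partial>lborel)"
      unfolding set_lebesgue_integral_def
      by (metis ennreal_leI integral_norm_bound real_norm_def)
    also have "\<dots> = (\<integral>\<^sup>+z. ennreal (norm (indicator {x..y} z *\<^sub>R (\<psi> z * f z))) \<partial>lborel)"
      using si by (intro nn_integral_eq_integral[symmetric]) (auto simp: set_integrable_def)
    also note bnd
    finally show ?thesis
      using mP measure_nonneg[of P "{x..y}"] by (simp add: ennreal_le_iff)
  qed
  show ?thesis
  proof (cases "x \<le> y")
    case True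
    have "cdf P x \<le> cdf P y" unfolding cdf_def using True
      by (intro P.finite_measure_mono) (auto simp: setsP)
    then have "\<bar>cdf P x - cdf P y\<bar> = cdf P y - cdf P x" by linarith
    then show ?thesis using main[OF True] abs_minus_commute[of "k x" "k y"] by metis
  next
    case False
    then have yx: "y \<le> x" by simp
    have "cdf P y \<le> cdf P x" unfolding cdf_def using yx
      by (intro P.finite_measure_mono) (auto simp: setsP)
    then have "\<bar>cdf P x - cdf P y\<bar> = cdf P x - cdf P y" by linarith
    then show ?thesis using main[OF yx] by metis
  qed
qed

section \<open>Distribution functions with a Hoelder continuous density\<close>

locale hoelder_density =
  fixes f :: "real \<Rightarrow> real" and C :: real
  assumes f_nonneg: "\<And>x. 0 \<le> f x"
    and f_meas[measurable]: "f \<in> borel_measurable borel"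
    and f_prob: "prob_space (density lborel f)"
    and C_ge_1: "1 \<le> C"
    and hoelder_f: "\<And>x y. \<bar>f x - f y\<bar> \<le> C * sqrt \<bar>cdf (density lborel f) x - cdf (density lborel f) y\<bar>"
    and hoelder_xf: "\<And>x y. \<bar>x * f x - y * f y\<bar> \<le> C * sqrt \<bar>cdf (density lborel f) x - cdf (density lborel f) y\<bar>"
begin

definition P :: "real measure" where "P = density lborel f"
definition F :: "real \<Rightarrow> real" where "F = cdf P"

sublocale P: real_distribution P
proof -
  interpret prob_space P using f_prob by (simp add: P_def)
  show "real_distribution P" by unfold_locales (simp_all add: P_def)
qed

lemma F_mono: "x \<le> y \<Longrightarrow> F x \<le> F y"
  unfolding F_def by (rule P.cdf_nondecreasing)

lemma F_nonneg: "0 \<le> F x" unfolding F_def by (rule P.cdf_nonneg)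
lemma F_le_1: "F x \<le> 1" unfolding F_def by (rule P.cdf_bounded_prob)

lemma F_measurable[measurable]: "F \<in> borel_measurable borel"
  by (rule borel_measurable_mono) (auto simp: mono_def F_mono)

lemma hoelder: "\<bar>f x - f y\<bar> \<le> C * sqrt \<bar>F x - F y\<bar>" "\<bar>x * f x - y * f y\<bar> \<le> C * sqrt \<bar>F x - F y\<bar>"
  using hoelder_f hoelder_xf by (simp_all add: F_def P_def)

lemma isCont_F: "isCont F x"
proof -
  have "emeasure P {x} = 0" by (simp add: P_def emeasure_density nn_integral_indicator_singleton)
  then show ?thesis unfolding F_def by (simp add: P.isCont_cdf measure_def)
qed

lemma isCont_f: "isCont f x"
proof -
  have "((\<lambda>y. C * sqrt \<bar>F y - F x\<bar>) \<longlongrightarrow> C * sqrt \<bar>F x - F x\<bar>) (at x)"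
    using isCont_F[of x] unfolding isCont_def by (intro tendsto_intros)
  then have "((\<lambda>y. C * sqrt \<bar>F y - F x\<bar>) \<longlongrightarrow> 0) (at x)" by simp
  then have "((\<lambda>y. f y - f x) \<longlongrightarrow> 0) (at x)"
    by (rule Lim_null_comparison[rotated]) (use hoelder(1) in auto)
  then show ?thesis unfolding isCont_def using LIM_zero_cancel by blast
qed

lemma F_diff: "a \<le> b \<Longrightarrow> F b - F a = integral {a..b} f"
proof -
  assume ab: "a \<le> b"
  have si: "set_integrable lborel {a..b} f"
    by (rule borel_integrable_compact[unfolded set_integrable_def[symmetric]])
       (auto intro!: continuous_at_imp_continuous_on isCont_f)
  have "{..b} = {..a} \<union> {a<..b}" "{..a} \<inter> {a<..b} = {}" using ab by auto
  then have "F b - F a = measure P {a<..b}"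
    using P.finite_measure_Union[of "{..a}" "{a<..b}"] by (simp add: F_def cdf_def)
  also have "\<dots> = (LINT x|lborel. f x * indicator {a<..b} x)"
  proof -
    have "measure P {a<..b} = (LINT x|P. indicat_real {a<..b} x)" by simp
    also have "\<dots> = (LINT x|lborel. f x *\<^sub>R indicat_real {a<..b} x)"
      unfolding P_def by (rule integral_density) (auto simp: f_nonneg)
    finally show ?thesis by simp
  qed
  also have "\<dots> = (LINT x:{a..b}|lborel. f x)"
    unfolding set_lebesgue_integral_def
    by (rule integral_cong_AE) (use AE_lborel_singleton[of a] in \<open>auto simp: indicator_def\<close>)
  also have "\<dots> = integral {a..b} f"
    by (rule set_borel_integral_eq_integral(2)[OF si])
  finally show ?thesis .
qed

lemma F_deriv: "(F has_real_derivative f x) (at x)"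
proof -
  have "((\<lambda>u. integral {x - 1..u} f) has_real_derivative f x) (at x within {x-1..x+1})"
    by (rule integral_has_real_derivative)
       (auto intro!: continuous_at_imp_continuous_on isCont_f)
  then have "((\<lambda>u. integral {x - 1..u} f) has_real_derivative f x) (at x)"
    by (simp add: at_within_Icc_at)
  then have "((\<lambda>u. F (x - 1) + integral {x - 1..u} f) has_real_derivative f x) (at x)"
    by (auto intro!: derivative_eq_intros)
  then show ?thesis
  proof (rule has_field_derivative_transform_within_open)
    show "open {x-1<..}" "x \<in> {x-1<..}" by auto
    show "F (x - 1) + integral {x - 1..u} f = F u" if "u \<in> {x-1<..}" for u
      using F_diff[of "x-1" u] that by auto
  qed
qed

lemma F_mvt:
  assumes "a \<le> b"
  shows "\<exists>z\<in>{a..b}. F b - F a = (b - a) * f z"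
proof (cases "a = b")
  case False
  then have "a < b" using assms by simp
  then obtain z where "a < z" "z < b" "F b - F a = (b - a) * f z"
    using MVT2[of a b F f] F_deriv by metis
  then show ?thesis by auto
qed auto

lemma F_mvt':
  shows "\<exists>z\<in>closed_segment a b. F b - F a = (b - a) * f z"
proof (cases "a \<le> b")
  case True
  then show ?thesis using F_mvt[OF True] by (simp add: closed_segment_eq_real_ivl)
next
  case False
  then have "b \<le> a" by simp
  from F_mvt[OF this] obtain z where z: "z \<in> {b..a}" "F a - F b = (a - b) * f z" ..
  then have "F b - F a = (b - a) * f z" by (simp add: algebra_simps)
  then show ?thesis using z(1) False by (intro bexI[of _ z]) (auto simp: closed_segment_eq_real_ivl)
qed

text \<open>The Hoelder bound extends to the endpoints \<open>F = 0\<close> and \<open>F = 1\<close>, where \<open>k\<close> must vanish. Otherwise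
  \<open>\<bar>k\<bar>\<close> would stay above some \<open>e > 0\<close> near infinity, hence \<open>f y \<ge> e / y\<close> there, and \<open>F\<close> would
  grow like \<open>e ln y\<close>. It is applied to the density and to \<open>x * f x\<close>.\<close>

lemma tail_bound_aux:
  assumes k: "\<And>x y. \<bar>k x - k y\<bar> \<le> C * sqrt \<bar>F x - F y\<bar>"
    and kf: "\<And>x. \<bar>x\<bar> \<ge> 1 \<Longrightarrow> \<bar>k x\<bar> \<le> \<bar>x\<bar> * f x"
  shows "\<bar>k x\<bar> \<le> C * sqrt (1 - F x)" "\<bar>k x\<bar> \<le> C * sqrt (F x)"
proof -
  have C0: "0 \<le> C" using C_ge_1 by simp
  show "\<bar>k x\<bar> \<le> C * sqrt (1 - F x)"
  proof (rule ccontr)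
    assume "\<not> ?thesis"
    then obtain e where e: "e > 0" "\<bar>k x\<bar> = C * sqrt (1 - F x) + e"
      by (metis add.commute diff_add_cancel diff_gt_0_iff_gt not_le)
    define a where "a = max x 1"
    have low: "f y \<ge> e / y" if "y \<ge> a" for y
    proof -
      have y: "y \<ge> x" "y \<ge> 1" using that by (auto simp: a_def)
      have "\<bar>k x - k y\<bar> \<le> C * sqrt \<bar>F x - F y\<bar>" by (rule k)
      also have "\<dots> \<le> C * sqrt (1 - F x)"
        using F_mono[OF y(1)] F_le_1[of y] C0 by (intro mult_left_mono real_sqrt_le_mono) auto
      finally have "\<bar>k y\<bar> \<ge> e" using e(2) by linarith
      then have "e \<le> y * f y" using kf[of y] y by auto
      then show ?thesis using y(2) by (simp add: field_simps)
    qed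
    (* On [a, b] the function e ln y grows by 2, which F cannot follow. *)
    define b where "b = a * exp (2 / e)"
    have a1: "a \<ge> 1" by (simp add: a_def)
    then have ab: "a < b" using e(1) by (simp add: b_def)
    have "((\<lambda>y. F y - e * ln y) has_real_derivative (f y - e / y)) (at y)" if "a \<le> y" for y
    proof (rule DERIV_diff[OF F_deriv])
      show "((\<lambda>y. e * ln y) has_real_derivative e / y) (at y)"
        using that a1 by (auto intro!: derivative_eq_intros)
    qed
    then obtain z where "a < z" "(F b - e * ln b) - (F a - e * ln a) = (b - a) * (f z - e / z)"
      using MVT2[OF ab, of "\<lambda>y. F y - e * ln y" "\<lambda>y. f y - e / y"] by metis
    then have "(F b - e * ln b) - (F a - e * ln a) \<ge> 0"
      using low[of z] ab by (auto intro!: mult_nonneg_nonneg)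
    moreover have "ln b = ln a + 2 / e" using a1 by (simp add: b_def ln_mult)
    moreover have "e * (ln a + 2 / e) = e * ln a + 2" using e(1) by (simp add: field_simps)
    ultimately have "F b - F a \<ge> 2" by simp
    then show False using F_le_1[of b] F_nonneg[of a] by simp
  qed
  show "\<bar>k x\<bar> \<le> C * sqrt (F x)"
  proof (rule ccontr)
    assume "\<not> ?thesis"
    then obtain e where e: "e > 0" "\<bar>k x\<bar> = C * sqrt (F x) + e"
      by (metis add.commute diff_add_cancel diff_gt_0_iff_gt not_le)
    define a where "a = max (-x) 1"
    have low: "f (-y) \<ge> e / y" if "y \<ge> a" for y
    proof -
      have y: "-y \<le> x" "y \<ge> 1" using that by (auto simp: a_def)
      have "\<bar>k x - k (-y)\<bar> \<le> C * sqrt \<bar>F x - F (-y)\<bar>" by (rule k)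
      also have "\<dots> \<le> C * sqrt (F x)"
        using F_mono[OF y(1)] F_nonneg[of "-y"] C0 by (intro mult_left_mono real_sqrt_le_mono) auto
      finally have "\<bar>k (-y)\<bar> \<ge> e" using e(2) by linarith
      then have "e \<le> y * f (-y)" using kf[of "-y"] y by auto
      then show ?thesis using y(2) by (simp add: field_simps)
    qed
    define b where "b = a * exp (2 / e)"
    have a1: "a \<ge> 1" by (simp add: a_def)
    then have ab: "a < b" using e(1) by (simp add: b_def)
    have "((\<lambda>y. F (-y) + e * ln y) has_real_derivative (- f (-y) + e / y)) (at y)" if "a \<le> y" for y
    proof -
      have "((\<lambda>y. F (-y)) has_real_derivative f (-y) * (-1)) (at y)"
        by (rule DERIV_chain2[OF F_deriv]) (auto intro!: derivative_eq_intros)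
      moreover have "((\<lambda>y. e * ln y) has_real_derivative e / y) (at y)"
        using that a1 by (auto intro!: derivative_eq_intros)
      ultimately have "((\<lambda>y. F (-y) + e * ln y) has_real_derivative f (-y) * (-1) + e / y) (at y)"
        by (rule DERIV_add)
      then show ?thesis by simp
    qed
    then have "\<exists>z>a. z < b \<and> (F (-b) + e * ln b) - (F (-a) + e * ln a) = (b - a) * (- f (-z) + e / z)"
      by (intro MVT2[OF ab]) auto
    then obtain z where "a < z" "(F (-b) + e * ln b) - (F (-a) + e * ln a) = (b - a) * (- f (-z) + e / z)"
      by blast
    then have "(F (-b) + e * ln b) - (F (-a) + e * ln a) \<le> 0"
      using low[of z] ab by (auto intro!: mult_nonneg_nonpos)
    moreover have "ln b = ln a + 2 / e" using a1 by (simp add: b_def ln_mult)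
    moreover have "e * (ln a + 2 / e) = e * ln a + 2" using e(1) by (simp add: field_simps)
    ultimately have "F (-a) - F (-b) \<ge> 2" by simp
    then show False using F_le_1[of "-a"] F_nonneg[of "-b"] by simp
  qed
qed

lemma f_tail: "f x \<le> C * sqrt (1 - F x)" "f x \<le> C * sqrt (F x)"
proof -
  have *: "\<bar>f x\<bar> \<le> \<bar>x\<bar> * f x" if "1 \<le> \<bar>x\<bar>" for x
    using mult_right_mono[OF that f_nonneg[of x]] f_nonneg[of x] by simp
  show "f x \<le> C * sqrt (1 - F x)" "f x \<le> C * sqrt (F x)"
    using tail_bound_aux[OF hoelder(1) *, of x] by auto
qed

lemma xf_tail: "\<bar>x * f x\<bar> \<le> C * sqrt (1 - F x)" "\<bar>x * f x\<bar> \<le> C * sqrt (F x)"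
proof -
  have *: "\<bar>x * f x\<bar> \<le> \<bar>x\<bar> * f x" for x
    using f_nonneg[of x] by (simp add: abs_mult)
  show "\<bar>x * f x\<bar> \<le> C * sqrt (1 - F x)" "\<bar>x * f x\<bar> \<le> C * sqrt (F x)"
    using tail_bound_aux[OF hoelder(2) *, of x] by auto
qed

lemma f_le: "f x \<le> C" and xf_le: "\<bar>x\<bar> * f x \<le> C"
proof -
  have "C * sqrt (F x) \<le> C * 1"
    using F_le_1[of x] C_ge_1 by (intro mult_left_mono) auto
  then show "f x \<le> C" "\<bar>x\<bar> * f x \<le> C"
    using f_tail(2)[of x] xf_tail(2)[of x] f_nonneg[of x] by (auto simp: abs_mult)
qed

lemma F_onto:
  assumes "0 < u" "u < 1"
  shows "\<exists>x. F x = u"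
proof -
  have bot: "(F \<longlongrightarrow> 0) at_bot" unfolding F_def by (rule P.cdf_lim_at_bot)
  have top: "(F \<longlongrightarrow> 1) at_top" unfolding F_def by (rule P.cdf_lim_at_top_prob)
  obtain a where a: "F a < u"
    using order_tendstoD(2)[OF bot assms(1)] by (metis eventually_at_bot_linorder order_refl)
  obtain b where b: "F b > u"
    using order_tendstoD(1)[OF top assms(2)] by (metis eventually_at_top_linorder order_refl)
  have "a \<le> b" using a b F_mono[of b a] by linarith
  then show ?thesis using IVT'[of F a u b] a b isCont_F
    by (metis continuous_at_imp_continuous_on less_imp_le)
qed

text \<open>Every \<open>z\<close> between \<open>x\<close> and the perturbed threshold satisfies \<open>\<bar>x\<bar> \<le> 2 \<bar>z\<bar> + 1\<close>, so that the
  length of the segment is \<open>O(\<rho> (1 + \<bar>z\<bar>))\<close>; this is compensated by \<open>f z\<close> because \<open>f\<close> and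
  \<open>\<bar>z\<bar> f z\<close> are bounded.\<close>

lemma segment_dist:
  fixes x :: real
  assumes rho: "\<bar>u\<bar> + \<bar>v\<bar> \<le> \<rho>" "\<rho> \<le> 1/2" and z: "z \<in> closed_segment x (x + u + v * x)"
  shows "\<bar>u + v * x\<bar> * f z \<le> 3 * C * \<rho>" "\<bar>z - x\<bar> \<le> \<bar>u + v * x\<bar>"
proof -
  show zx: "\<bar>z - x\<bar> \<le> \<bar>u + v * x\<bar>"
    using z by (auto simp: closed_segment_eq_real_ivl split: if_splits)
  have r0: "\<rho> \<ge> 0" using rho by linarith
  have uvx: "\<bar>u + v * x\<bar> \<le> \<bar>u\<bar> + \<bar>v\<bar> * \<bar>x\<bar>" by (metis abs_mult abs_triangle_ineq)
  have v: "\<bar>v\<bar> * \<bar>x\<bar> \<le> (1/2) * \<bar>x\<bar>" using rho by (intro mult_right_mono) auto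
  have "\<bar>x\<bar> \<le> 2 * \<bar>z\<bar> + 1"
    using zx uvx v rho by linarith
  then have "\<bar>v\<bar> * \<bar>x\<bar> \<le> \<bar>v\<bar> * (2 * \<bar>z\<bar> + 1)" by (intro mult_left_mono) auto
  also have "\<dots> = \<bar>v\<bar> + 2 * (\<bar>v\<bar> * \<bar>z\<bar>)" by (simp add: algebra_simps)
  also have "\<bar>v\<bar> * \<bar>z\<bar> \<le> \<rho> * \<bar>z\<bar>" using rho by (intro mult_right_mono) auto
  finally have "\<bar>u + v * x\<bar> \<le> \<rho> + 2 * (\<rho> * \<bar>z\<bar>)" using uvx rho by linarith
  then have "\<bar>u + v * x\<bar> * f z \<le> (\<rho> + 2 * (\<rho> * \<bar>z\<bar>)) * f z"
    using f_nonneg by (intro mult_right_mono) auto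
  also have "\<dots> = \<rho> * f z + 2 * \<rho> * (\<bar>z\<bar> * f z)" by (simp add: algebra_simps)
  also have "\<dots> \<le> \<rho> * C + 2 * \<rho> * C"
    using f_le xf_le r0 by (intro add_mono mult_left_mono) auto
  finally show "\<bar>u + v * x\<bar> * f z \<le> 3 * C * \<rho>" by simp
qed

text \<open>Two applications of the mean value theorem: \<open>F\<close> changes by \<open>O(\<rho>)\<close> along the segment, so
  the density changes by \<open>O(\<surd>\<rho>)\<close>, and so does \<open>x f\<close>; multiplied with \<open>u + v x\<close> this gives \<open>O(\<rho>\<^sup>3\<^sup>/\<^sup>2)\<close>.\<close>

lemma F_taylor_aux:
  assumes rho: "\<bar>u\<bar> + \<bar>v\<bar> \<le> \<rho>" "\<rho> \<le> 1/2"
  shows "\<bar>F (x + u + v * x) - F x - (u + v * x) * f x\<bar> \<le> 5 * C\<^sup>2 * (\<rho> * sqrt \<rho>)"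
    and "\<bar>F (x + u + v * x) - F x\<bar> \<le> 3 * C * \<rho>"
proof -
  have r0: "\<rho> \<ge> 0" using rho by linarith
  have C0: "C \<ge> 0" using C_ge_1 by simp
  obtain z where z: "z \<in> closed_segment x (x + u + v * x)" and "F (x + u + v * x) - F x = ((x + u + v * x) - x) * f z"
    using F_mvt' by blast
  then have Fz: "F (x + u + v * x) - F x = (u + v * x) * f z" by simp
  note sz = segment_dist[OF rho z]
  show "\<bar>F (x + u + v * x) - F x\<bar> \<le> 3 * C * \<rho>"
    using sz(1) f_nonneg[of z] by (simp add: Fz abs_mult)
  obtain z' where z': "z' \<in> closed_segment x z" and Fz': "F z - F x = (z - x) * f z'"
    using F_mvt' by blast
  have "z' \<in> closed_segment x (x + u + v * x)"
    using z z' by (auto simp: closed_segment_eq_real_ivl split: if_splits)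
  note sz' = segment_dist[OF rho this]
  have "\<bar>F z - F x\<bar> \<le> \<bar>u + v * x\<bar> * f z'"
    using sz(2) f_nonneg[of z'] by (simp add: Fz' abs_mult mult_right_mono)
  then have Fb: "\<bar>F z - F x\<bar> \<le> 3 * C * \<rho>" using sz' by simp
  have "sqrt \<bar>F z - F x\<bar> \<le> sqrt (3 * C * \<rho>)" using Fb by simp
  also have "\<dots> \<le> sqrt ((2*C)\<^sup>2 * \<rho>)"
  proof (intro real_sqrt_le_mono mult_right_mono r0)
    have "3 * C \<le> 4 * (C * C)" using C_ge_1 mult_left_mono[of 1 C "4*C"] by simp
    then show "3 * C \<le> (2*C)\<^sup>2" by (simp add: power2_eq_square)
  qed
  also have "\<dots> = 2 * C * sqrt \<rho>" using C0 by (simp add: real_sqrt_mult real_sqrt_abs)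
  finally have sq: "C * sqrt \<bar>F z - F x\<bar> \<le> C * (2 * C * sqrt \<rho>)" using C0 by (intro mult_left_mono)
  have CCs: "C * (2 * C * sqrt \<rho>) = 2 * C\<^sup>2 * sqrt \<rho>" by (simp add: power2_eq_square)
  have h0: "\<bar>f z - f x\<bar> \<le> 2 * C\<^sup>2 * sqrt \<rho>"
    using hoelder(1)[of z x] sq unfolding CCs by linarith
  have h1: "\<bar>z * f z - x * f x\<bar> \<le> 2 * C\<^sup>2 * sqrt \<rho>"
    using hoelder(2)[of z x] sq unfolding CCs by linarith
  have zf: "\<bar>(z - x) * f z\<bar> \<le> 3 * C * \<rho>"
  proof -
    have "\<bar>(z - x) * f z\<bar> \<le> \<bar>u + v * x\<bar> * f z"
      using sz(2) f_nonneg[of z] by (simp add: abs_mult mult_right_mono)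
    then show ?thesis using sz(1) by linarith
  qed
  have rs: "\<rho> \<le> sqrt \<rho>"
    using r0 rho(2) by (intro real_le_rsqrt) (simp add: power2_eq_square mult_left_le)
  have CC: "C \<le> C\<^sup>2" using C_ge_1 by (simp add: power2_eq_square)
  have "3 * C * \<rho> \<le> 3 * C\<^sup>2 * sqrt \<rho>"
    using CC rs r0 C0 by (intro mult_mono) auto
  then have zf': "\<bar>(z - x) * f z\<bar> \<le> 3 * C\<^sup>2 * sqrt \<rho>" using zf by simp
  have xb: "\<bar>x * (f z - f x)\<bar> \<le> 5 * C\<^sup>2 * sqrt \<rho>"
  proof -
    have "x * (f z - f x) = (z * f z - x * f x) - (z - x) * f z" by (simp add: algebra_simps)
    then show ?thesis using h1 zf' by linarith
  qed
  have s0: "0 \<le> C\<^sup>2 * sqrt \<rho>" using r0 by simp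
  have "F (x + u + v * x) - F x - (u + v * x) * f x = u * (f z - f x) + v * (x * (f z - f x))"
    unfolding Fz by (simp add: algebra_simps)
  also have "\<bar>\<dots>\<bar> \<le> \<bar>u\<bar> * \<bar>f z - f x\<bar> + \<bar>v\<bar> * \<bar>x * (f z - f x)\<bar>"
    by (metis abs_mult abs_triangle_ineq)
  also have "\<dots> \<le> \<bar>u\<bar> * (5 * C\<^sup>2 * sqrt \<rho>) + \<bar>v\<bar> * (5 * C\<^sup>2 * sqrt \<rho>)"
    using h0 xb s0 by (intro add_mono mult_left_mono) auto
  also have "\<dots> = (\<bar>u\<bar> + \<bar>v\<bar>) * (5 * C\<^sup>2 * sqrt \<rho>)" by (simp add: algebra_simps)
  also have "\<dots> \<le> \<rho> * (5 * C\<^sup>2 * sqrt \<rho>)"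
    using rho s0 by (intro mult_right_mono) auto
  finally show "\<bar>F (x + u + v * x) - F x - (u + v * x) * f x\<bar> \<le> 5 * C\<^sup>2 * (\<rho> * sqrt \<rho>)"
    by (simp add: mult_ac)
qed

text \<open>The term \<open>d * \<bar>x\<bar>\<close> is a change of the slope \<open>v\<close> by \<open>\<plusminus>d\<close>, the sign being that of \<open>x\<close>.\<close>

lemma F_taylor:
  assumes rho: "\<bar>u\<bar> + \<bar>v\<bar> + \<bar>d\<bar> \<le> \<rho>" "\<rho> \<le> 1/2"
  shows "\<bar>F (x + u + v * x + d * \<bar>x\<bar>) - F x - (u + v * x + d * \<bar>x\<bar>) * f x\<bar> \<le> 5 * C\<^sup>2 * (\<rho> * sqrt \<rho>)"
    and "\<bar>F (x + u + v * x + d * \<bar>x\<bar>) - F x\<bar> \<le> 3 * C * \<rho>"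
proof -
  define v' where "v' = v + d * sgn x"
  have "\<bar>d * sgn x\<bar> \<le> \<bar>d\<bar>" by (simp add: sgn_if)
  then have r: "\<bar>u\<bar> + \<bar>v'\<bar> \<le> \<rho>" using rho unfolding v'_def by linarith
  have eq: "x + u + v * x + d * \<bar>x\<bar> = x + u + v' * x" "u + v * x + d * \<bar>x\<bar> = u + v' * x"
    by (auto simp: v'_def algebra_simps abs_sgn)
  show "\<bar>F (x + u + v * x + d * \<bar>x\<bar>) - F x - (u + v * x + d * \<bar>x\<bar>) * f x\<bar> \<le> 5 * C\<^sup>2 * (\<rho> * sqrt \<rho>)"
    "\<bar>F (x + u + v * x + d * \<bar>x\<bar>) - F x\<bar> \<le> 3 * C * \<rho>"
    unfolding eq using F_taylor_aux[OF r rho(2)] by auto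
qed

end

section \<open>Innovations and Freedman's inequality\<close>

lemma exp_le_quadratic:
  fixes x :: real
  assumes "\<bar>x\<bar> \<le> 1"
  shows "exp x \<le> 1 + x + x\<^sup>2"
proof (cases "0 \<le> x")
  case True
  then show ?thesis using exp_bound[of x] assms by auto
next
  case False
  define h where "h t = 1 + t + t\<^sup>2 - exp t" for t :: real
  have d: "(h has_real_derivative (1 + 2 * t - exp t)) (at t)" for t
    unfolding h_def by (auto intro!: derivative_eq_intros simp: power2_eq_square)
  have "1 + 2 * t - exp t \<le> 0" if "-1 \<le> t" "t \<le> 0" for t :: real
  proof -
    have "0 < 1 - t" using that by simp
    have "(1 + 2 * t) * (1 - t) \<le> 1" using that mult_nonneg_nonpos2[of "1 - 2*t" t] by (simp add: algebra_simps)
    moreover have "1 - t \<le> exp (- t)" using exp_ge_add_one_self[of "-t"] by simp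
    ultimately show ?thesis using that exp_ge_add_one_self[of t] 
    proof (cases "1 + 2 * t \<le> 0")
      case False
      then have "(1 + 2 * t) \<le> exp t"
        using that exp_ge_add_one_self[of t] by linarith
      then show ?thesis by simp
    qed (use exp_gt_zero[of t] in linarith)
  qed
  then have "h x \<ge> h 0"
    using False assms d by (intro DERIV_nonpos_imp_nonincreasing[of x 0 h]) fastforce+
  then show ?thesis by (simp add: h_def)
qed

lemma (in prob_space) exp_centered_le:
  assumes [measurable]: "\<zeta> \<in> borel_measurable M"
    and bound: "\<And>x. x \<in> space M \<Longrightarrow> \<bar>\<zeta> x\<bar> \<le> 1"
    and mean: "(LINT x|M. \<zeta> x) = 0" and var: "(LINT x|M. (\<zeta> x)\<^sup>2) \<le> V"
  shows "(\<integral>\<^sup>+x. ennreal (exp (\<zeta> x - V)) \<partial>M) \<le> 1"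
proof -
  have i1: "integrable M \<zeta>"
    by (rule integrable_const_bound[where B=1]) (use bound in auto)
  have i2: "integrable M (\<lambda>x. (\<zeta> x)\<^sup>2)"
    by (rule integrable_const_bound[where B=1]) (use bound in \<open>auto simp: abs_square_le_1\<close>)
  have "(\<integral>\<^sup>+x. ennreal (exp (\<zeta> x - V)) \<partial>M) \<le> (\<integral>\<^sup>+x. ennreal (exp (-V) * (1 + \<zeta> x + (\<zeta> x)\<^sup>2)) \<partial>M)"
  proof (intro nn_integral_mono ennreal_leI)
    fix x assume "x \<in> space M"
    then have "exp (\<zeta> x) \<le> 1 + \<zeta> x + (\<zeta> x)\<^sup>2" by (intro exp_le_quadratic bound)
    then show "exp (\<zeta> x - V) \<le> exp (-V) * (1 + \<zeta> x + (\<zeta> x)\<^sup>2)"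
      by (simp add: exp_diff exp_minus field_simps)
  qed
  also have "\<dots> = ennreal (LINT x|M. exp (-V) * (1 + \<zeta> x + (\<zeta> x)\<^sup>2))"
  proof (intro nn_integral_eq_integral)
    show "integrable M (\<lambda>x. exp (-V) * (1 + \<zeta> x + (\<zeta> x)\<^sup>2))" using i1 i2 by auto
    show "AE x in M. 0 \<le> exp (-V) * (1 + \<zeta> x + (\<zeta> x)\<^sup>2)"
    proof (rule AE_I2)
      fix x assume "x \<in> space M"
      then have "\<bar>\<zeta> x\<bar> \<le> 1" by (rule bound)
      then have "0 \<le> 1 + \<zeta> x" by linarith
      then show "0 \<le> exp (-V) * (1 + \<zeta> x + (\<zeta> x)\<^sup>2)" by simp
    qed
  qed
  also have "(LINT x|M. exp (-V) * (1 + \<zeta> x + (\<zeta> x)\<^sup>2)) = exp (-V) * (1 + (LINT x|M. (\<zeta> x)\<^sup>2))"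
    using i1 i2 mean by (simp add: prob_space)
  also have "\<dots> \<le> exp (-V) * (1 + V)" using var by (intro mult_left_mono) auto
  also have "\<dots> \<le> exp (-V) * exp V"
    by (intro mult_left_mono) (simp_all add: exp_ge_add_one_self)
  also have "\<dots> = 1" by (simp add: exp_minus)
  finally show ?thesis by (simp add: ennreal_leI)
qed

text \<open>\<open>G i\<close> is the past of the innovation \<open>\<eta> i\<close>: independence of \<open>\<eta> i\<close> from \<open>G i\<close> and its distribution are
  stated together, as a product formula for probabilities.\<close>

locale innovations = hoelder_density f C + M: prob_space M
  for f :: "real \<Rightarrow> real" and C :: real and M :: "'a measure" +
  fixes G :: "nat \<Rightarrow> 'a measure" and \<eta> :: "nat \<Rightarrow> 'a \<Rightarrow> real"
  assumes space_G: "\<And>i. space (G i) = space M"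
    and sets_G: "\<And>i. sets (G i) \<subseteq> sets M"
    and G_Suc: "\<And>i. sets (G i) \<subseteq> sets (G (Suc i))"
    and eta_adapted: "\<And>i. \<eta> i \<in> borel_measurable (G (Suc i))"
    and eta_innovation: "\<And>i A B. A \<in> sets (G i) \<Longrightarrow> B \<in> sets borel \<Longrightarrow>
      measure M (A \<inter> \<eta> i -` B) = measure M A * measure (density lborel f) B"
begin

lemma measurable_G_M: "g \<in> measurable (G i) N \<Longrightarrow> g \<in> measurable M N"
  by (rule measurable_from_subalg[of M "G i"]) (use space_G sets_G in \<open>auto simp: subalgebra_def\<close>)

lemma G_mono: "i \<le> j \<Longrightarrow> sets (G i) \<subseteq> sets (G j)"
  by (induction j rule: dec_induct) (use G_Suc in auto)

lemma measurable_G_mono: "i \<le> j \<Longrightarrow> g \<in> measurable (G i) N \<Longrightarrow> g \<in> measurable (G j) N"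
  using space_G G_mono by (intro measurable_from_subalg[of "G j" "G i"]) (auto simp: subalgebra_def)

lemma eta_measurable[measurable]: "\<eta> i \<in> borel_measurable M"
  using eta_adapted by (rule measurable_G_M)

text \<open>The pair of the past and the present innovation is distributed as a product measure, so an expectation
  may be computed by integrating out \<open>\<eta> i\<close> first with the past held fixed.\<close>

lemma nn_integral_innovation:
  fixes H :: "'a \<times> real \<Rightarrow> ennreal"
  assumes H: "H \<in> borel_measurable (G i \<Otimes>\<^sub>M borel)"
  shows "(\<integral>\<^sup>+\<omega>. H (\<omega>, \<eta> i \<omega>) \<partial>M) = (\<integral>\<^sup>+\<omega>. \<integral>\<^sup>+x. H (\<omega>, x) \<partial>P \<partial>M)"
proof -
  define R where "R = restr_to_subalg M (G i)"
  have sub: "subalgebra M (G i)" using space_G sets_G by (auto simp: subalgebra_def)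
  have setsR: "sets R = sets (G i)" using sub by (simp add: R_def sets_restr_to_subalg)
  have Rp: "prob_space R"
    unfolding R_def by (rule prob_space_restr_to_subalg[OF sub M.prob_space_axioms])
  have Rsf: "sigma_finite_measure R" by (rule prob_space_imp_sigma_finite[OF Rp])
  have m[measurable]: "(\<lambda>\<omega>. (\<omega>, \<eta> i \<omega>)) \<in> measurable M (R \<Otimes>\<^sub>M P)"
  proof (rule measurable_Pair)
    show "(\<lambda>\<omega>. \<omega>) \<in> measurable M R"
    proof (rule measurableI)
      fix A assume "A \<in> sets R"
      then have "A \<in> sets M" using setsR sets_G by auto
      then show "(\<lambda>\<omega>. \<omega>) -` A \<inter> space M \<in> sets M" by (simp add: sets.Int_space_eq2)
    qed (simp add: R_def space_restr_to_subalg)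
    show "\<eta> i \<in> measurable M P" using eta_measurable by simp
  qed
  have "R \<Otimes>\<^sub>M P = distr M (R \<Otimes>\<^sub>M P) (\<lambda>\<omega>. (\<omega>, \<eta> i \<omega>))"
  proof (rule pair_measure_eqI)
    fix A B assume A: "A \<in> sets R" and B: "B \<in> sets P"
    have AM: "A \<in> sets M" using A setsR sets_G by auto
    have "emeasure (distr M (R \<Otimes>\<^sub>M P) (\<lambda>\<omega>. (\<omega>, \<eta> i \<omega>))) (A \<times> B) = emeasure M ((\<lambda>\<omega>. (\<omega>, \<eta> i \<omega>)) -` (A \<times> B) \<inter> space M)"
      using A B by (intro emeasure_distr m) auto
    also have "(\<lambda>\<omega>. (\<omega>, \<eta> i \<omega>)) -` (A \<times> B) \<inter> space M = A \<inter> \<eta> i -` B"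
      using AM sets.sets_into_space by auto
    also have "emeasure M (A \<inter> \<eta> i -` B) = ennreal (measure M A * measure P B)"
      using eta_innovation[of A i B] A B setsR by (simp add: M.emeasure_eq_measure P_def)
    also have "\<dots> = emeasure R A * emeasure P B"
      using A AM sub setsR by (simp add: ennreal_mult M.emeasure_eq_measure P.emeasure_eq_measure R_def emeasure_restr_to_subalg)
    finally show "emeasure R A * emeasure P B = emeasure (distr M (R \<Otimes>\<^sub>M P) (\<lambda>\<omega>. (\<omega>, \<eta> i \<omega>))) (A \<times> B)" ..
  qed (simp_all add: Rsf P.sigma_finite_measure_axioms)
  note eq = this
  have HR: "H \<in> borel_measurable (R \<Otimes>\<^sub>M P)"
    using H by (simp add: measurable_cong_sets[OF sets_pair_measure_cong[OF setsR P.events_eq_borel] refl])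
  have "(\<integral>\<^sup>+\<omega>. H (\<omega>, \<eta> i \<omega>) \<partial>M) = (\<integral>\<^sup>+z. H z \<partial>distr M (R \<Otimes>\<^sub>M P) (\<lambda>\<omega>. (\<omega>, \<eta> i \<omega>)))"
    using HR m by (subst nn_integral_distr) auto
  also have "\<dots> = (\<integral>\<^sup>+z. H z \<partial>(R \<Otimes>\<^sub>M P))" by (simp add: eq[symmetric])
  also have "\<dots> = (\<integral>\<^sup>+\<omega>. \<integral>\<^sup>+x. H (\<omega>, x) \<partial>P \<partial>R)"
    using P.nn_integral_fst[OF HR] by simp
  also have "\<dots> = (\<integral>\<^sup>+\<omega>. \<integral>\<^sup>+x. H (\<omega>, x) \<partial>P \<partial>M)"
    unfolding R_def
  proof (rule nn_integral_subalgebra2[OF sub])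
    have "(\<lambda>\<omega>. \<integral>\<^sup>+x. H (\<omega>, x) \<partial>P) \<in> borel_measurable R"
      using P.borel_measurable_nn_integral_fst[OF HR] .
    then show "(\<lambda>\<omega>. \<integral>\<^sup>+x. H (\<omega>, x) \<partial>P) \<in> borel_measurable (G i)"
      using measurable_cong_sets[OF setsR refl] by blast
  qed
  finally show ?thesis .
qed

text \<open>The last factor \<open>exp (g m \<omega> (\<eta> m \<omega>))\<close> has conditional expectation at most 1 given the past, which
  allows removing the factors one after the other.\<close>

lemma exp_supermartingale:
  fixes g :: "nat \<Rightarrow> 'a \<Rightarrow> real \<Rightarrow> real"
  assumes g: "\<And>i. i < n \<Longrightarrow> (\<lambda>(\<omega>, x). g i \<omega> x) \<in> borel_measurable (G i \<Otimes>\<^sub>M borel)"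
    and le: "\<And>i \<omega>. i < n \<Longrightarrow> \<omega> \<in> space M \<Longrightarrow> (\<integral>\<^sup>+x. ennreal (exp (g i \<omega> x)) \<partial>P) \<le> 1"
  shows "(\<integral>\<^sup>+\<omega>. ennreal (exp (\<Sum>i<n. g i \<omega> (\<eta> i \<omega>))) \<partial>M) \<le> 1"
    and "(\<lambda>\<omega>. \<Sum>i<n. g i \<omega> (\<eta> i \<omega>)) \<in> borel_measurable (G n)"
proof -
  have meas: "(\<lambda>\<omega>. \<Sum>i<m. g i \<omega> (\<eta> i \<omega>)) \<in> borel_measurable (G m)" if "m \<le> n" for m
  proof (rule borel_measurable_sum)
    fix i assume i: "i \<in> {..<m}"
    have "(\<lambda>\<omega>. (\<omega>, \<eta> i \<omega>)) \<in> measurable (G m) (G i \<Otimes>\<^sub>M borel)"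
    proof (rule measurable_Pair)
      show "(\<lambda>\<omega>. \<omega>) \<in> measurable (G m) (G i)"
        using i by (intro measurable_G_mono[of i m]) auto
      show "\<eta> i \<in> borel_measurable (G m)"
        using i by (intro measurable_G_mono[OF _ eta_adapted]) auto
    qed
    from measurable_compose[OF this g[of i]] i that
    show "(\<lambda>\<omega>. g i \<omega> (\<eta> i \<omega>)) \<in> borel_measurable (G m)" by simp
  qed
  then show "(\<lambda>\<omega>. \<Sum>i<n. g i \<omega> (\<eta> i \<omega>)) \<in> borel_measurable (G n)" by simp
  have "(\<integral>\<^sup>+\<omega>. ennreal (exp (\<Sum>i<m. g i \<omega> (\<eta> i \<omega>))) \<partial>M) \<le> 1" if "m \<le> n" for m
    using that
  proof (induction m)
    case 0
    then show ?case by (simp add: M.emeasure_space_1)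
  next
    case (Suc m)
    define Y where "Y \<omega> = ennreal (exp (\<Sum>i<m. g i \<omega> (\<eta> i \<omega>)))" for \<omega>
    have [measurable]: "Y \<in> borel_measurable (G m)"
    proof -
      have [measurable]: "(\<lambda>\<omega>. \<Sum>i<m. g i \<omega> (\<eta> i \<omega>)) \<in> borel_measurable (G m)"
        using meas[of m] Suc.prems by simp
      show ?thesis unfolding Y_def by measurable
    qed
    have [measurable]: "(\<lambda>(\<omega>, x). g m \<omega> x) \<in> borel_measurable (G m \<Otimes>\<^sub>M borel)"
      using g[of m] Suc.prems by simp
    have "(\<integral>\<^sup>+\<omega>. ennreal (exp (\<Sum>i<Suc m. g i \<omega> (\<eta> i \<omega>))) \<partial>M)
      = (\<integral>\<^sup>+\<omega>. (\<lambda>(\<omega>, x). Y \<omega> * ennreal (exp (g m \<omega> x))) (\<omega>, \<eta> m \<omega>) \<partial>M)"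
      by (simp add: Y_def exp_add ennreal_mult)
    also have "\<dots> = (\<integral>\<^sup>+\<omega>. \<integral>\<^sup>+x. (\<lambda>(\<omega>, x). Y \<omega> * ennreal (exp (g m \<omega> x))) (\<omega>, x) \<partial>P \<partial>M)"
      by (rule nn_integral_innovation) measurable
    also have "\<dots> \<le> (\<integral>\<^sup>+\<omega>. Y \<omega> \<partial>M)"
    proof (rule nn_integral_mono)
      fix \<omega> assume \<omega>: "\<omega> \<in> space M"
      have "(\<lambda>x. (\<omega>, x)) \<in> measurable borel (G m \<Otimes>\<^sub>M borel)"
        using \<omega> space_G[of m] by (intro measurable_Pair1') auto
      from measurable_compose[OF this, of "\<lambda>(\<omega>, x). g m \<omega> x" borel]
      have [measurable]: "g m \<omega> \<in> borel_measurable borel" by simp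
      have "(\<integral>\<^sup>+x. (\<lambda>(\<omega>, x). Y \<omega> * ennreal (exp (g m \<omega> x))) (\<omega>, x) \<partial>P) = Y \<omega> * (\<integral>\<^sup>+x. ennreal (exp (g m \<omega> x)) \<partial>P)"
        by (simp add: nn_integral_cmult)
      also have "\<dots> \<le> Y \<omega> * 1" using le[of m \<omega>] \<omega> Suc.prems by (intro mult_left_mono) auto
      finally show "(\<integral>\<^sup>+x. (\<lambda>(\<omega>, x). Y \<omega> * ennreal (exp (g m \<omega> x))) (\<omega>, x) \<partial>P) \<le> Y \<omega>" by simp
    qed
    also have "\<dots> \<le> 1" using Suc by (simp add: Y_def)
    finally show ?case .
  qed
  then show "(\<integral>\<^sup>+\<omega>. ennreal (exp (\<Sum>i<n. g i \<omega> (\<eta> i \<omega>))) \<partial>M) \<le> 1" by simp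
qed

text \<open>Subtracting the conditional variances from the exponents makes the exponential a supermartingale, by
  \<open>exp x \<le> 1 + x + x\<^sup>2\<close>; Markov's inequality then bounds the event on which the sum exceeds \<open>e\<close>
  while the variances stay below \<open>c\<close>. The variances are random, hence the joint event.\<close>

lemma freedman_one_sided:
  fixes g :: "nat \<Rightarrow> 'a \<Rightarrow> real \<Rightarrow> real"
  assumes g: "\<And>i. i < n \<Longrightarrow> (\<lambda>(\<omega>, x). g i \<omega> x) \<in> borel_measurable (G i \<Otimes>\<^sub>M borel)"
    and V: "\<And>i. i < n \<Longrightarrow> V i \<in> borel_measurable (G i)"
    and bound: "\<And>i \<omega> x. i < n \<Longrightarrow> \<omega> \<in> space M \<Longrightarrow> \<bar>g i \<omega> x\<bar> \<le> 1"
    and mean: "\<And>i \<omega>. i < n \<Longrightarrow> \<omega> \<in> space M \<Longrightarrow> (LINT x|P. g i \<omega> x) = 0"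
    and var: "\<And>i \<omega>. i < n \<Longrightarrow> \<omega> \<in> space M \<Longrightarrow> (LINT x|P. (g i \<omega> x)\<^sup>2) \<le> V i \<omega>"
  shows "emeasure M {\<omega> \<in> space M. (\<Sum>i<n. g i \<omega> (\<eta> i \<omega>)) > e \<and> (\<Sum>i<n. V i \<omega>) \<le> c} \<le> ennreal (exp (c - e))"
proof -
  define g' where "g' i \<omega> x = g i \<omega> x - V i \<omega>" for i \<omega> x
  have g'm: "(\<lambda>(\<omega>, x). g' i \<omega> x) \<in> borel_measurable (G i \<Otimes>\<^sub>M borel)" if "i < n" for i
  proof -
    note [measurable] = g[OF that] V[OF that]
    show ?thesis unfolding g'_def by measurable
  qed
  have g'le: "(\<integral>\<^sup>+x. ennreal (exp (g' i \<omega> x)) \<partial>P) \<le> 1" if "i < n" "\<omega> \<in> space M" for i \<omega>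
    unfolding g'_def
  proof (rule P.exp_centered_le)
    have "(\<lambda>x. (\<omega>, x)) \<in> measurable borel (G i \<Otimes>\<^sub>M borel)"
      using that(2) space_G[of i] by (intro measurable_Pair1') auto
    from measurable_compose[OF this g[OF that(1)]]
    show "g i \<omega> \<in> borel_measurable P" by simp
  qed (use that bound mean var in auto)
  define S where "S \<omega> = (\<Sum>i<n. g i \<omega> (\<eta> i \<omega>)) - (\<Sum>i<n. V i \<omega>)" for \<omega>
  have S: "S \<omega> = (\<Sum>i<n. g' i \<omega> (\<eta> i \<omega>))" for \<omega> by (simp add: S_def g'_def sum_subtractf)
  have [measurable]: "S \<in> borel_measurable M"
    unfolding S[abs_def] by (rule measurable_G_M[OF exp_supermartingale(2)[of n g', OF g'm g'le]])
  have "emeasure M {\<omega> \<in> space M. (\<Sum>i<n. g i \<omega> (\<eta> i \<omega>)) > e \<and> (\<Sum>i<n. V i \<omega>) \<le> c}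
    \<le> emeasure M {\<omega> \<in> space M. ennreal (exp (e - c)) \<le> ennreal (exp (S \<omega>))}"
    by (rule emeasure_mono, force simp: S_def, measurable)
  also have "\<dots> \<le> ennreal (exp (c - e)) * (\<integral>\<^sup>+\<omega>. ennreal (exp (S \<omega>)) \<partial>M)"
  proof -
    have "{\<omega> \<in> space M. ennreal (exp (e - c)) \<le> ennreal (exp (S \<omega>))}
      = {\<omega> \<in> space M. 1 \<le> ennreal (exp (c - e)) * ennreal (exp (S \<omega>))}"
      by (auto simp: ennreal_mult[symmetric] exp_diff field_simps)
    moreover have "emeasure M {\<omega> \<in> space M. 1 \<le> ennreal (exp (c - e)) * ennreal (exp (S \<omega>))}
      \<le> ennreal (exp (c - e)) * (\<integral>\<^sup>+\<omega>. ennreal (exp (S \<omega>)) * indicator (space M) \<omega> \<partial>M)"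
      by (rule nn_integral_Markov_inequality) measurable
    moreover have "(\<integral>\<^sup>+\<omega>. ennreal (exp (S \<omega>)) * indicator (space M) \<omega> \<partial>M) = (\<integral>\<^sup>+\<omega>. ennreal (exp (S \<omega>)) \<partial>M)"
      by (rule nn_integral_cong) (simp add: indicator_def)
    ultimately show ?thesis by simp
  qed
  also have "\<dots> \<le> ennreal (exp (c - e)) * 1"
    using exp_supermartingale(1)[of n g', OF g'm g'le] by (intro mult_left_mono) (auto simp: S)
  finally show ?thesis by simp
qed

lemma freedman:
  fixes g :: "nat \<Rightarrow> 'a \<Rightarrow> real \<Rightarrow> real"
  assumes g: "\<And>i. i < n \<Longrightarrow> (\<lambda>(\<omega>, x). g i \<omega> x) \<in> borel_measurable (G i \<Otimes>\<^sub>M borel)"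
    and V: "\<And>i. i < n \<Longrightarrow> V i \<in> borel_measurable (G i)"
    and bound: "\<And>i \<omega> x. i < n \<Longrightarrow> \<omega> \<in> space M \<Longrightarrow> \<bar>g i \<omega> x\<bar> \<le> 1"
    and mean: "\<And>i \<omega>. i < n \<Longrightarrow> \<omega> \<in> space M \<Longrightarrow> (LINT x|P. g i \<omega> x) = 0"
    and var: "\<And>i \<omega>. i < n \<Longrightarrow> \<omega> \<in> space M \<Longrightarrow> (LINT x|P. (g i \<omega> x)\<^sup>2) \<le> V i \<omega>"
  shows "emeasure M {\<omega> \<in> space M. \<bar>\<Sum>i<n. g i \<omega> (\<eta> i \<omega>)\<bar> > e \<and> (\<Sum>i<n. V i \<omega>) \<le> c} \<le> ennreal (2 * exp (c - e))"
    and "(\<lambda>\<omega>. \<Sum>i<n. g i \<omega> (\<eta> i \<omega>)) \<in> borel_measurable M"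
proof -
  define A where "A = (\<lambda>g::nat \<Rightarrow> 'a \<Rightarrow> real \<Rightarrow> real. {\<omega> \<in> space M. (\<Sum>i<n. g i \<omega> (\<eta> i \<omega>)) > e \<and> (\<Sum>i<n. V i \<omega>) \<le> c})"
  have g0: "(\<lambda>(\<omega>, x). 0::real) \<in> borel_measurable (G i \<Otimes>\<^sub>M borel)" for i by simp
  have meas: "(\<lambda>\<omega>. \<Sum>i<n. g i \<omega> (\<eta> i \<omega>)) \<in> borel_measurable M"
  proof (rule borel_measurable_sum)
    fix i assume i: "i \<in> {..<n}"
    have "(\<lambda>\<omega>. (\<omega>, \<eta> i \<omega>)) \<in> measurable M (G i \<Otimes>\<^sub>M borel)"
      by (intro measurable_Pair measurable_G_M[of _ i] eta_measurable) auto
    from measurable_compose[OF this g[of i]] i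
    show "(\<lambda>\<omega>. g i \<omega> (\<eta> i \<omega>)) \<in> borel_measurable M" by simp
  qed
  then show "(\<lambda>\<omega>. \<Sum>i<n. g i \<omega> (\<eta> i \<omega>)) \<in> borel_measurable M" .
  note [measurable] = this
  have [measurable]: "(\<lambda>\<omega>. \<Sum>i<n. V i \<omega>) \<in> borel_measurable M"
    using V by (intro borel_measurable_sum) (auto intro: measurable_G_M)
  have m: "(\<lambda>(\<omega>, x). - g i \<omega> x) \<in> borel_measurable (G i \<Otimes>\<^sub>M borel)" if "i < n" for i
    using borel_measurable_uminus[OF g[OF that]] by (simp add: split_def)
  have 1: "emeasure M (A g) \<le> ennreal (exp (c - e))"
    unfolding A_def by (rule freedman_one_sided[OF assms])
  have 2: "emeasure M (A (\<lambda>i \<omega> x. - g i \<omega> x)) \<le> ennreal (exp (c - e))"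
    unfolding A_def using bound mean var by (intro freedman_one_sided m V) auto
  have "emeasure M {\<omega> \<in> space M. \<bar>\<Sum>i<n. g i \<omega> (\<eta> i \<omega>)\<bar> > e \<and> (\<Sum>i<n. V i \<omega>) \<le> c}
     \<le> emeasure M (A g \<union> A (\<lambda>i \<omega> x. - g i \<omega> x))"
    by (rule emeasure_mono) (auto simp: A_def sum_negf abs_if split: if_splits)
  also have "\<dots> \<le> emeasure M (A g) + emeasure M (A (\<lambda>i \<omega> x. - g i \<omega> x))"
    by (rule emeasure_subadditive) (auto simp: A_def sum_negf)
  also have "\<dots> \<le> ennreal (exp (c - e)) + ennreal (exp (c - e))" by (intro add_mono 1 2)
  also have "\<dots> = ennreal (2 * exp (c - e))" by (simp flip: ennreal_plus)
  finally show "emeasure M {\<omega> \<in> space M. \<bar>\<Sum>i<n. g i \<omega> (\<eta> i \<omega>)\<bar> > e \<and> (\<Sum>i<n. V i \<omega>) \<le> c} \<le> ennreal (2 * exp (c - e))" .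
qed

end

section \<open>Dyadic quantiles and perturbed cells\<close>

context hoelder_density
begin

text \<open>A quantile function of \<open>F\<close>; only its values on the open unit interval matter.\<close>

definition q :: "real \<Rightarrow> real" where "q s = (SOME x. F x = s)"

lemma F_q: "0 < s \<Longrightarrow> s < 1 \<Longrightarrow> F (q s) = s"
  unfolding q_def using F_onto by (rule someI_ex)

lemma q_mono: assumes "0 < s" "s \<le> t" "t < 1" shows "q s \<le> q t"
proof (rule ccontr)
  assume "\<not> q s \<le> q t"
  then have "F (q t) \<le> F (q s)" by (intro F_mono) simp
  then have "s = t" using assms F_q[of s] F_q[of t] by simp
  with \<open>\<not> q s \<le> q t\<close> show False by simp
qed

text \<open>The number of the dyadic cell at level \<open>k\<close> whose closure contains \<open>F x\<close>, found by bisection. Comparing quantiles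
  with \<open>x\<close> instead of \<open>F x\<close> with dyadic numbers keeps \<open>x\<close> itself between the quantiles of
  the cell, also where \<open>F\<close> is flat.\<close>

primrec path :: "real \<Rightarrow> nat \<Rightarrow> nat" where
  "path x 0 = 0"
| "path x (Suc k) = (if q (real (2 * path x k + 1) / 2 ^ Suc k) \<le> x then 2 * path x k + 1 else 2 * path x k)"

definition knot :: "real \<Rightarrow> nat \<Rightarrow> real" where "knot x k = real (path x k) / 2 ^ k"

lemma path_less: "path x k < 2 ^ k"
  by (induction k) auto

lemma knot_ge_0: "0 \<le> knot x k" by (simp add: knot_def)

lemma knot_next_le_1: "knot x k + (1/2)^k \<le> 1"
proof -
  have "real (path x k) + 1 \<le> 2 ^ k"
    using path_less[of x k] by (metis Suc_eq_plus1 Suc_leI of_nat_1 of_nat_add of_nat_le_iff of_nat_numeral of_nat_power)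
  then show ?thesis by (simp add: knot_def power_one_over field_simps)
qed

lemma knot_less_1: "knot x k < 1"
  using knot_next_le_1[of x k] zero_less_power[of "1/2::real" k] by linarith

lemma knot_Suc: "knot x (Suc k) = knot x k \<or> knot x (Suc k) = knot x k + (1/2) ^ Suc k"
  by (auto simp: knot_def field_simps power_one_over)

lemma knot_bracket:
  "(knot x k = 0 \<or> q (knot x k) \<le> x) \<and> (knot x k + (1/2)^k = 1 \<or> x \<le> q (knot x k + (1/2)^k))"
proof (induction k)
  case 0
  then show ?case by (simp add: knot_def)
next
  case (Suc k)
  let ?m = "real (2 * path x k + 1) / 2 ^ Suc k"
  have m: "?m = knot x k + (1/2) ^ Suc k" by (simp add: knot_def field_simps power_one_over)
  show ?case
  proof (cases "q ?m \<le> x")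
    case True
    then have "knot x (Suc k) = ?m" by (simp add: knot_def)
    moreover have "?m + (1/2) ^ Suc k = knot x k + (1/2)^k" using m by simp
    ultimately show ?thesis using True Suc by auto
  next
    case False
    then have "knot x (Suc k) = knot x k" by (simp add: knot_def field_simps)
    then show ?thesis using False Suc m by auto
  qed
qed

text \<open>The deviation allowed in one link of the chain at level \<open>k\<close>. The factor \<open>2 k\<close> makes the failure
  probability \<open>exp (- 2 k)\<close>, which beats the number \<open>2\<^sup>k\<close> of cells.\<close>

definition eps :: "nat \<Rightarrow> real" where "eps k = 2 * real k * sqrt ((1/2) ^ k)"
definition tail :: "nat \<Rightarrow> real" where "tail k0 = (\<Sum>k. eps (k + k0))"

lemma eps_nonneg: "0 \<le> eps k" by (simp add: eps_def)

lemma summable_eps: "summable eps"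
proof -
  define r where "r = sqrt (1/2 :: real)"
  have r: "norm r < 1" by (simp add: r_def real_sqrt_divide)
  have "summable (\<lambda>k. of_nat (Suc k) * r ^ k)"
    using geometric_deriv_sums[OF r] by (rule sums_summable)
  then have "summable (\<lambda>k. 2 * (of_nat (Suc k) * r ^ k))" by (rule summable_mult)
  then show ?thesis
  proof (rule summable_comparison_test'[where N=0])
    fix k :: nat
    have "sqrt ((1/2) ^ k) = r ^ k" by (simp add: r_def real_sqrt_power)
    then show "norm (eps k) \<le> 2 * (of_nat (Suc k) * r ^ k)"
      by (simp add: eps_def r_def mult_right_mono)
  qed
qed

lemma tail_tendsto_0: "tail \<longlonglongrightarrow> 0"
proof (rule LIMSEQ_I)
  fix r :: real assume "0 < r"
  from suminf_exist_split[OF this summable_eps]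
  show "\<exists>no. \<forall>n\<ge>no. norm (tail n - 0) < r" by (simp add: tail_def)
qed

lemma sum_eps_le_tail: "(\<Sum>k=k0..<K. eps k) \<le> tail k0" "(\<Sum>k=k0..<K. eps (Suc k)) \<le> tail k0"
proof -
  have s: "summable (\<lambda>k. eps (k + k0))" using summable_eps by (rule summable_ignore_initial_segment)
  have *: "(\<Sum>k=k0..<k0+m. eps k) \<le> tail k0" for m
  proof -
    have "(\<Sum>k=k0..<k0+m. eps k) = (\<Sum>k<m. eps (k + k0))"
      using sum.shift_bounds_nat_ivl[of eps 0 k0 m] by (simp add: lessThan_atLeast0 add.commute)
    also have "\<dots> \<le> tail k0" unfolding tail_def
      by (rule sum_le_suminf[OF s]) (auto simp: eps_nonneg)
    finally show ?thesis .
  qed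
  show "(\<Sum>k=k0..<K. eps k) \<le> tail k0"
  proof (cases "k0 \<le> K")
    case True
    then show ?thesis using *[of "K - k0"] by simp
  next
    case False
    then show ?thesis using *[of 0] by simp
  qed
  have "(\<Sum>k=k0..<K. eps (Suc k)) = (\<Sum>k=Suc k0..<Suc K. eps k)"
    by (simp add: sum.shift_bounds_Suc_ivl del: sum.op_ivl_Suc)
  also have "\<dots> \<le> (\<Sum>k=k0..<Suc K. eps k)"
    by (rule sum_mono2) (auto simp: eps_nonneg)
  also have "\<dots> \<le> tail k0"
  proof (cases "k0 \<le> Suc K")
    case True
    then show ?thesis using *[of "Suc K - k0"] by simp
  next
    case False
    then show ?thesis using *[of 0] by simp
  qed
  finally show "(\<Sum>k=k0..<K. eps (Suc k)) \<le> tail k0" .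
qed

end

text \<open>The parameters \<open>u\<close> and \<open>v\<close> come from the changes of location and scale; \<open>d\<close> is needed for
  bracketing, where an upper bound of a change of scale must enlarge positive and negative \<open>x\<close> alike.\<close>

definition thr :: "real \<Rightarrow> real \<Rightarrow> real \<Rightarrow> real \<Rightarrow> real" where
  "thr u v d x = x + u + v * x + d * \<bar>x\<bar>"

lemma thr_mono:
  assumes "\<bar>u\<bar> + \<bar>v\<bar> + \<bar>d\<bar> \<le> 1/2" "x \<le> y"
  shows "thr u v d x \<le> thr u v d y"
proof -
  have aux: "0 \<le> t" if "\<bar>A\<bar> \<le> a" "\<bar>B\<bar> \<le> b" "a + b \<le> 1 * c" "t = c - A - B" for A B a b c t :: real
    using that by linarith
  have 1: "\<bar>v * (x - y)\<bar> \<le> \<bar>v\<bar> * (y - x)" using assms(2) by (simp add: abs_mult)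
  have 2: "\<bar>d * (\<bar>x\<bar> - \<bar>y\<bar>)\<bar> \<le> \<bar>d\<bar> * (y - x)"
    unfolding abs_mult using assms(2) by (intro mult_left_mono) auto
  have 3: "\<bar>v\<bar> * (y - x) + \<bar>d\<bar> * (y - x) \<le> 1 * (y - x)"
    unfolding distrib_right[symmetric] using assms by (intro mult_right_mono) auto
  have 4: "thr u v d y - thr u v d x = (y - x) - v * (x - y) - d * (\<bar>x\<bar> - \<bar>y\<bar>)"
    unfolding thr_def by (simp add: algebra_simps)
  from aux[OF 1 2 3 4] show ?thesis by simp
qed

context hoelder_density
begin

text \<open>The perturbed indicator and its conditional mean at the threshold \<open>q s\<close>, continued by the
  limits 0 and 1 to the endpoints of the unit interval, where no quantile exists.\<close>

definition kN :: "real \<Rightarrow> real \<Rightarrow> real \<Rightarrow> real \<Rightarrow> real \<Rightarrow> real" where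
  "kN u v d s e = (if s \<le> 0 then 0 else if 1 \<le> s then 1 else of_bool (e \<le> thr u v d (q s)))"
definition kF :: "real \<Rightarrow> real \<Rightarrow> real \<Rightarrow> real \<Rightarrow> real" where
  "kF u v d s = (if s \<le> 0 then 0 else if 1 \<le> s then 1 else F (thr u v d (q s)))"

lemma kN_01: "0 \<le> kN u v d s e" "kN u v d s e \<le> 1" by (auto simp: kN_def)
lemma kF_01: "0 \<le> kF u v d s" "kF u v d s \<le> 1" by (auto simp: kF_def F_nonneg F_le_1)

lemma kN_cases: "kN u v d s e = 0 \<or> kN u v d s e = 1" by (auto simp: kN_def)

lemma kN_mono: "\<bar>u\<bar> + \<bar>v\<bar> + \<bar>d\<bar> \<le> 1/2 \<Longrightarrow> s \<le> t \<Longrightarrow> kN u v d s e \<le> kN u v d t e"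
  using thr_mono[of u v d "q s" "q t"] q_mono[of s t] by (auto simp: kN_def)

lemma kF_mono: "\<bar>u\<bar> + \<bar>v\<bar> + \<bar>d\<bar> \<le> 1/2 \<Longrightarrow> s \<le> t \<Longrightarrow> kF u v d s \<le> kF u v d t"
  using F_mono[OF thr_mono[of u v d "q s" "q t"]] q_mono[of s t] by (auto simp: kF_def F_nonneg F_le_1)

lemma integral_kN: "(LINT e|P. kN u v d s e) = kF u v d s"
proof -
  have "(LINT e|P. kN u v d s e) = kF u v d s" if "0 < s" "s < 1"
  proof -
    have "kN u v d s = indicat_real {..thr u v d (q s)}" using that by (auto simp: kN_def fun_eq_iff)
    then show ?thesis using that by (simp add: kF_def F_def cdf_def)
  qed
  then show ?thesis by (cases "s \<le> 0"; cases "1 \<le> s") (auto simp: kN_def kF_def P.prob_space[simplified])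
qed

lemma kN_measurable[measurable]: "kN u v d s \<in> borel_measurable borel"
  unfolding kN_def by measurable

text \<open>Given the past, the increment of the indicator over a cell is a Bernoulli variable.\<close>

lemma cell_moments:
  assumes small: "\<bar>u\<bar> + \<bar>v\<bar> + \<bar>d\<bar> \<le> 1/2" and st: "s \<le> t"
  defines "\<zeta> \<equiv> \<lambda>e. (kN u v d t e - kN u v d s e) - (kF u v d t - kF u v d s)"
  shows "(LINT e|P. \<zeta> e) = 0" "(LINT e|P. (\<zeta> e)\<^sup>2) \<le> kF u v d t - kF u v d s" "\<bar>\<zeta> e\<bar> \<le> 1"
proof -
  define p where "p = kF u v d t - kF u v d s"
  have p: "0 \<le> p" "p \<le> 1" using kF_mono[OF small st] kF_01[of u v d] by (auto simp: p_def) (smt (verit))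
  define I where "I e = kN u v d t e - kN u v d s e" for e
  have I: "I e = 0 \<or> I e = 1" for e
    using kN_mono[OF small st, of e] kN_cases[of u v d s e] kN_cases[of u v d t e] by (auto simp: I_def)
  have kint: "integrable P (kN u v d s)" for s
    by (rule P.integrable_const_bound[where B=1]) (auto simp: kN_01)
  have Iint: "integrable P I" unfolding I_def using kint by auto
  have EI: "(LINT e|P. I e) = p" unfolding I_def p_def using kint by (simp add: integral_kN)
  show "(LINT e|P. \<zeta> e) = 0"
    using Iint EI by (simp add: \<zeta>_def I_def[symmetric] p_def[symmetric] P.prob_space[simplified])
  have sq: "(\<zeta> e)\<^sup>2 = (1 - 2 * p) * I e + p\<^sup>2" for e
    using I[of e] by (auto simp: \<zeta>_def I_def[symmetric] p_def[symmetric] power2_eq_square algebra_simps)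
  have "(LINT e|P. (\<zeta> e)\<^sup>2) = (1 - 2 * p) * p + p\<^sup>2"
    unfolding sq using Iint EI by (simp add: P.prob_space[simplified])
  also have "\<dots> = p - p\<^sup>2" by (simp add: power2_eq_square algebra_simps)
  also have "\<dots> \<le> p" by simp
  finally show "(LINT e|P. (\<zeta> e)\<^sup>2) \<le> kF u v d t - kF u v d s" by (simp add: p_def)
  show "\<bar>\<zeta> e\<bar> \<le> 1" using I[of e] p by (auto simp: \<zeta>_def I_def[symmetric] p_def[symmetric])
qed

text \<open>First order term of \<open>kF\<close> along the quantile scale.\<close>

definition kg :: "real \<Rightarrow> real \<Rightarrow> real \<Rightarrow> real \<Rightarrow> real" where
  "kg u v d s = (if s \<le> 0 \<or> 1 \<le> s then 0 else (u + v * q s + d * \<bar>q s\<bar>) * f (q s))"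

lemma kF_expand:
  assumes "\<bar>u\<bar> + \<bar>v\<bar> + \<bar>d\<bar> \<le> \<rho>" "\<rho> \<le> 1/2" "0 \<le> s" "s \<le> 1"
  shows "\<bar>kF u v d s - s - kg u v d s\<bar> \<le> 5 * C\<^sup>2 * (\<rho> * sqrt \<rho>)"
proof -
  have "0 \<le> \<rho>" using assms by linarith
  then have 0: "0 \<le> 5 * C\<^sup>2 * (\<rho> * sqrt \<rho>)" by simp
  consider "s = 0" | "s = 1" | "0 < s" "s < 1" using assms by fastforce
  then show ?thesis
  proof cases
    case 3
    then show ?thesis using F_taylor(1)[OF assms(1,2), of "q s"] by (simp add: kF_def kg_def thr_def F_q)
  qed (use 0 in \<open>auto simp: kF_def kg_def\<close>)
qed

text \<open>In the quantile scale, the Hoelder bounds and the tail bounds say that \<open>f (q s)\<close> and \<open>q s * f (q s)\<close>, set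
  to 0 at the endpoints, are \<open>1/2\<close>-Hoelder on the closed unit interval.\<close>

lemma kg_hoelder:
  assumes r: "\<bar>u\<bar> + \<bar>v\<bar> + \<bar>d\<bar> \<le> \<rho>" and st: "0 \<le> s" "s \<le> t" "t \<le> 1"
  shows "\<bar>kg u v d t - kg u v d s\<bar> \<le> \<rho> * (C * sqrt (t - s))"
proof -
  define c0 where "c0 r = (if r \<le> 0 \<or> 1 \<le> r then 0 else f (q r))" for r
  define c1 where "c1 r = (if r \<le> 0 \<or> 1 \<le> r then 0 else q r * f (q r))" for r
  have H: "\<bar>c0 t - c0 s\<bar> \<le> C * sqrt (t - s) \<and> \<bar>c1 t - c1 s\<bar> \<le> C * sqrt (t - s)"
  proof (cases "0 < s")
    case s: True
    show ?thesis
    proof (cases "t < 1")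
      case True
      then show ?thesis using hoelder[of "q t" "q s"] s st F_q[of s] F_q[of t]
        by (auto simp: c0_def c1_def)
    next
      case False
      then show ?thesis using f_tail(1)[of "q s"] xf_tail(1)[of "q s"] f_nonneg[of "q s"] s st F_q[of s] C_ge_1
        by (auto simp: c0_def c1_def)
    qed
  next
    case s: False
    then have s0: "s = 0" using st by simp
    show ?thesis
    proof (cases "0 < t \<and> t < 1")
      case True
      then show ?thesis using f_tail(2)[of "q t"] xf_tail(2)[of "q t"] f_nonneg[of "q t"] s0 F_q[of t]
        by (auto simp: c0_def c1_def)
    next
      case False
      then show ?thesis using s0 C_ge_1 st by (auto simp: c0_def c1_def)
    qed
  qed
  have c1a: "\<bar>\<bar>c1 t\<bar> - \<bar>c1 s\<bar>\<bar> \<le> C * sqrt (t - s)" using H by linarith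
  have kg: "kg u v d r = u * c0 r + v * c1 r + d * \<bar>c1 r\<bar>" for r
    using f_nonneg[of "q r"] by (auto simp: kg_def c0_def c1_def algebra_simps abs_mult)
  have "kg u v d t - kg u v d s = u * (c0 t - c0 s) + v * (c1 t - c1 s) + d * (\<bar>c1 t\<bar> - \<bar>c1 s\<bar>)"
    unfolding kg by (simp add: algebra_simps)
  also have "\<bar>\<dots>\<bar> \<le> \<bar>u\<bar> * \<bar>c0 t - c0 s\<bar> + \<bar>v\<bar> * \<bar>c1 t - c1 s\<bar> + \<bar>d\<bar> * \<bar>\<bar>c1 t\<bar> - \<bar>c1 s\<bar>\<bar>"
    unfolding abs_mult[symmetric] by linarith
  also have "\<dots> \<le> \<bar>u\<bar> * (C * sqrt (t - s)) + \<bar>v\<bar> * (C * sqrt (t - s)) + \<bar>d\<bar> * (C * sqrt (t - s))"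
    using H c1a by (intro add_mono mult_left_mono) auto
  also have "\<dots> = (\<bar>u\<bar> + \<bar>v\<bar> + \<bar>d\<bar>) * (C * sqrt (t - s))" by (simp add: algebra_simps)
  also have "\<dots> \<le> \<rho> * (C * sqrt (t - s))" using r C_ge_1 st by (intro mult_right_mono) auto
  finally show ?thesis .
qed

text \<open>The perturbed probability of a cell of length \<open>l = 2\<^sup>-\<^sup>k\<close> differs from \<open>l\<close> by the increment of the linear
  part, which is \<open>O(\<rho> \<surd>l)\<close>, and by twice the Taylor error \<open>O(\<rho>\<^sup>3\<^sup>/\<^sup>2)\<close>. With \<open>\<rho>\<^sup>3\<^sup>/\<^sup>2 \<le> l\<close> both
  are \<open>O(l)\<close>.\<close>

lemma cell_prob:
  assumes r: "\<bar>u\<bar> + \<bar>v\<bar> + \<bar>d\<bar> \<le> \<rho>" "\<rho> \<le> 1/2" "\<rho> * sqrt \<rho> \<le> (1/2)^k"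
    and s: "0 \<le> s" "s + (1/2)^k \<le> 1"
  shows "kF u v d (s + (1/2)^k) - kF u v d s \<le> 12 * C\<^sup>2 * (1/2)^k"
proof -
  define t where "t = s + (1/2::real)^k"
  have C0: "0 \<le> C" "C \<le> C\<^sup>2" using C_ge_1 by (auto simp: power2_eq_square)
  have d0: "(0::real) < (1/2)^k" by simp
  have st: "s \<le> t" "0 \<le> t" "t \<le> 1" "s \<le> 1" using s d0 unfolding t_def by linarith+
  have r0: "0 \<le> \<rho>" using r by linarith
  have "\<rho> \<le> sqrt ((1/2)^k)"
  proof (rule real_le_rsqrt)
    have "\<rho> \<le> sqrt \<rho>" using r0 r(2) by (intro real_le_rsqrt) (simp add: power2_eq_square mult_left_le)
    then have "\<rho>\<^sup>2 \<le> \<rho> * sqrt \<rho>" unfolding power2_eq_square using r0 by (intro mult_left_mono) auto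
    then show "\<rho>\<^sup>2 \<le> (1/2)^k" using r(3) by simp
  qed
  then have "\<rho> * (C * sqrt (t - s)) \<le> sqrt ((1/2)^k) * (C * sqrt ((1/2)^k))"
    using C0 by (simp add: t_def mult_right_mono)
  also have "\<dots> = C * (1/2)^k" by (simp add: mult_ac)
  also have "\<dots> \<le> C\<^sup>2 * (1/2)^k" using C0 by (intro mult_right_mono) auto
  finally have 1: "\<rho> * (C * sqrt (t - s)) \<le> C\<^sup>2 * (1/2)^k" .
  have 2: "5 * C\<^sup>2 * (\<rho> * sqrt \<rho>) \<le> 5 * C\<^sup>2 * (1/2)^k" using r(3) by (intro mult_left_mono) auto
  have 3: "1 * (1/2)^k \<le> C\<^sup>2 * (1/2)^k" using C_ge_1 C0 by (intro mult_right_mono) auto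
  have "kF u v d t - kF u v d s \<le> (t - s) + (kg u v d t - kg u v d s) + 2 * (5 * C\<^sup>2 * (\<rho> * sqrt \<rho>))"
    using kF_expand[OF r(1,2) s(1) st(4)] kF_expand[OF r(1,2) st(2,3)] by linarith
  also have "\<dots> \<le> (1/2)^k + C\<^sup>2 * (1/2)^k + 10 * (C\<^sup>2 * (1/2)^k)"
    using kg_hoelder[OF r(1) s(1) st(1) st(3)] 1 2 by (simp add: t_def)
  also have "\<dots> \<le> 12 * C\<^sup>2 * (1/2)^k" using 3 by simp
  finally show ?thesis by (simp add: t_def)
qed

end

section \<open>Chaining\<close>

locale perturbation = innovations f C M G \<eta>
  for f :: "real \<Rightarrow> real" and C :: real and M :: "'a measure" and G :: "nat \<Rightarrow> 'a measure" and \<eta> :: "nat \<Rightarrow> 'a \<Rightarrow> real" +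
  fixes n :: nat and w u v d \<rho> :: "nat \<Rightarrow> 'a \<Rightarrow> real"
  assumes w_meas[measurable]: "\<And>i. i < n \<Longrightarrow> w i \<in> borel_measurable (G i)"
    and u_meas: "\<And>i. i < n \<Longrightarrow> u i \<in> borel_measurable (G i)"
    and v_meas: "\<And>i. i < n \<Longrightarrow> v i \<in> borel_measurable (G i)"
    and d_meas: "\<And>i. i < n \<Longrightarrow> d i \<in> borel_measurable (G i)"
    and \<rho>_meas: "\<And>i. i < n \<Longrightarrow> \<rho> i \<in> borel_measurable (G i)"
    and w_nonneg: "\<And>i \<omega>. i < n \<Longrightarrow> \<omega> \<in> space M \<Longrightarrow> 0 \<le> w i \<omega>"
    and uvd_le: "\<And>i \<omega>. i < n \<Longrightarrow> \<omega> \<in> space M \<Longrightarrow> \<bar>u i \<omega>\<bar> + \<bar>v i \<omega>\<bar> + \<bar>d i \<omega>\<bar> \<le> \<rho> i \<omega>"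
begin

text \<open>\<open>z i\<close> measures how coarse the summand \<open>i\<close> is, and \<open>act k i\<close> says that it still takes part in the chain at
  level \<open>k\<close>. \<open>kD\<close> is its centred indicator at a quantile, \<open>fullD\<close> the one at a point \<open>x\<close> of the line.\<close>

definition z :: "nat \<Rightarrow> 'a \<Rightarrow> real" where "z i \<omega> = (w i \<omega>)\<^sup>2 + \<rho> i \<omega> * sqrt (\<rho> i \<omega>)"
definition act :: "nat \<Rightarrow> nat \<Rightarrow> 'a \<Rightarrow> bool" where "act k i \<omega> \<longleftrightarrow> \<rho> i \<omega> \<le> 1/2 \<and> z i \<omega> \<le> (1/2)^k"
definition kD :: "real \<Rightarrow> nat \<Rightarrow> 'a \<Rightarrow> real" where
  "kD s i \<omega> = kN (u i \<omega>) (v i \<omega>) (d i \<omega>) s (\<eta> i \<omega>) - kF (u i \<omega>) (v i \<omega>) (d i \<omega>) s"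
definition fullD :: "real \<Rightarrow> nat \<Rightarrow> 'a \<Rightarrow> real" where
  "fullD x i \<omega> = of_bool (\<eta> i \<omega> \<le> thr (u i \<omega>) (v i \<omega>) (d i \<omega>) x) - F (thr (u i \<omega>) (v i \<omega>) (d i \<omega>) x)"
definition c1 :: real where "c1 = 12 * C\<^sup>2"

lemma c1_pos: "0 < c1" using C_ge_1 by (simp add: c1_def)

lemma \<rho>_nonneg: "i < n \<Longrightarrow> \<omega> \<in> space M \<Longrightarrow> 0 \<le> \<rho> i \<omega>"
  using uvd_le[of i \<omega>] by linarith

lemma act_measurable: "i < n \<Longrightarrow> Measurable.pred (G i) (act k i)"
  using w_meas[of i] \<rho>_meas[of i] unfolding act_def z_def by measurable

abbreviation iT where "iT i \<omega> \<equiv> thr (u i \<omega>) (v i \<omega>) (d i \<omega>)"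
abbreviation iN where "iN i \<omega> \<equiv> kN (u i \<omega>) (v i \<omega>) (d i \<omega>)"
abbreviation iF where "iF i \<omega> \<equiv> kF (u i \<omega>) (v i \<omega>) (d i \<omega>)"

lemma act_antimono: "act (Suc k) i \<omega> \<Longrightarrow> act k i \<omega>"
proof -
  have "(1/2::real) ^ Suc k \<le> (1/2)^k" by simp
  then show "act (Suc k) i \<omega> \<Longrightarrow> act k i \<omega>" unfolding act_def by linarith
qed

text \<open>One link of the chain. For an active summand, \<open>w\<close> divided by \<open>l = \<surd>(2\<^sup>-\<^sup>k)\<close> is at most 1 and the
  conditional variance of its increment over a cell is \<open>O(w\<^sup>2 l\<^sup>2)\<close>. Freedman's inequality for the sum
  divided by \<open>l\<close>, with \<open>e = 2 k\<close>, gives the bound.\<close>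

lemma cell_tail:
  assumes \<phi>m: "\<And>i. i < n \<Longrightarrow> Measurable.pred (G i) (\<phi> i)"
    and \<phi>: "\<And>i \<omega>. i < n \<Longrightarrow> \<omega> \<in> space M \<Longrightarrow> \<phi> i \<omega> \<Longrightarrow> act k i \<omega>"
    and s: "0 \<le> s" "s + (1/2)^k \<le> 1"
  defines "S \<equiv> \<lambda>\<omega>. \<Sum>i<n. w i \<omega> * of_bool (\<phi> i \<omega>) * (kD (s + (1/2)^k) i \<omega> - kD s i \<omega>)"
  shows "emeasure M {\<omega> \<in> space M. \<bar>S \<omega>\<bar> > eps k \<and> (\<Sum>i<n. (w i \<omega>)\<^sup>2) \<le> B} \<le> ennreal (2 * exp (c1 * B - 2 * real k))"
    and "S \<in> borel_measurable M"
proof -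
  define t where "t = s + (1/2)^k"
  define l where "l = sqrt ((1/2)^k :: real)"
  have l: "l > 0" "l\<^sup>2 = (1/2)^k" by (auto simp: l_def)
  have st: "s \<le> t" by (simp add: t_def)
  define \<zeta> where "\<zeta> i \<omega> e = (iN i \<omega> t e - iN i \<omega> s e)
     - (iF i \<omega> t - iF i \<omega> s)" for i \<omega> e
  define a where "a i \<omega> = w i \<omega> * of_bool (\<phi> i \<omega>) / l" for i \<omega>
  define g where "g i \<omega> e = a i \<omega> * \<zeta> i \<omega> e" for i \<omega> e
  define V where "V i \<omega> = c1 * (w i \<omega>)\<^sup>2" for i \<omega>
  have gm: "(\<lambda>(\<omega>, e). g i \<omega> e) \<in> borel_measurable (G i \<Otimes>\<^sub>M borel)" if "i < n" for i
  proof -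
    note [measurable] = w_meas[OF that] u_meas[OF that] v_meas[OF that] d_meas[OF that] \<phi>m[OF that]
    show ?thesis unfolding g_def a_def \<zeta>_def kN_def kF_def thr_def by measurable
  qed
  have Vm: "V i \<in> borel_measurable (G i)" if "i < n" for i
    unfolding V_def using w_meas[OF that] by measurable
  have sm: "\<bar>u i \<omega>\<bar> + \<bar>v i \<omega>\<bar> + \<bar>d i \<omega>\<bar> \<le> 1/2" if "i < n" "\<omega> \<in> space M" "\<phi> i \<omega>" for i \<omega>
    using uvd_le[OF that(1,2)] \<phi>[OF that] by (simp add: act_def)
  have wl: "\<bar>a i \<omega>\<bar> \<le> 1" "(w i \<omega>)\<^sup>2 \<le> (1/2)^k" "\<rho> i \<omega> * sqrt (\<rho> i \<omega>) \<le> (1/2)^k" "\<rho> i \<omega> \<le> 1/2"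
    if "i < n" "\<omega> \<in> space M" "\<phi> i \<omega>" for i \<omega>
  proof -
    have "z i \<omega> \<le> (1/2)^k" "\<rho> i \<omega> \<le> 1/2" using \<phi>[OF that] by (auto simp: act_def)
    moreover have "0 \<le> \<rho> i \<omega> * sqrt (\<rho> i \<omega>)" using \<rho>_nonneg[OF that(1,2)] by simp
    ultimately show w2: "(w i \<omega>)\<^sup>2 \<le> (1/2)^k" and "\<rho> i \<omega> * sqrt (\<rho> i \<omega>) \<le> (1/2)^k" "\<rho> i \<omega> \<le> 1/2"
      unfolding z_def using zero_le_power2[of "w i \<omega>"] by linarith+
    have "w i \<omega> \<le> l" unfolding l_def using w2 by (rule real_le_rsqrt)
    then show "\<bar>a i \<omega>\<bar> \<le> 1" using w_nonneg[OF that(1,2)] l that by (simp add: a_def)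
  qed
  have bnd: "\<bar>g i \<omega> e\<bar> \<le> 1" if "i < n" "\<omega> \<in> space M" for i \<omega> e
  proof (cases "\<phi> i \<omega>")
    case True
    have "\<bar>\<zeta> i \<omega> e\<bar> \<le> 1" unfolding \<zeta>_def by (rule cell_moments(3)[OF sm[OF that True] st])
    then show ?thesis unfolding g_def abs_mult using wl(1)[OF that True] by (simp add: mult_le_one)
  qed (simp add: g_def a_def)
  have mn: "(LINT e|P. g i \<omega> e) = 0" if "i < n" "\<omega> \<in> space M" for i \<omega>
  proof (cases "\<phi> i \<omega>")
    case True
    have "(LINT e|P. \<zeta> i \<omega> e) = 0" unfolding \<zeta>_def by (rule cell_moments(1)[OF sm[OF that True] st])
    then show ?thesis by (simp add: g_def)
  qed (simp add: g_def a_def)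
  have vr: "(LINT e|P. (g i \<omega> e)\<^sup>2) \<le> V i \<omega>" if "i < n" "\<omega> \<in> space M" for i \<omega>
  proof (cases "\<phi> i \<omega>")
    case True
    have "(LINT e|P. (\<zeta> i \<omega> e)\<^sup>2) \<le> iF i \<omega> t - iF i \<omega> s"
      unfolding \<zeta>_def by (rule cell_moments(2)[OF sm[OF that True] st])
    also have "\<dots> \<le> c1 * l\<^sup>2"
      unfolding t_def c1_def l by (rule cell_prob[OF uvd_le[OF that] wl(4)[OF that True] wl(3)[OF that True] s])
    finally have "(a i \<omega>)\<^sup>2 * (LINT e|P. (\<zeta> i \<omega> e)\<^sup>2) \<le> (a i \<omega>)\<^sup>2 * (c1 * l\<^sup>2)" by (intro mult_left_mono) auto
    also have "\<dots> = V i \<omega>" using l True by (simp add: a_def V_def power_divide)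
    finally show ?thesis by (simp add: g_def power_mult_distrib)
  qed (use c1_pos in \<open>simp add: g_def a_def V_def\<close>)
  have \<zeta>D: "\<zeta> i \<omega> (\<eta> i \<omega>) = kD (s + (1/2)^k) i \<omega> - kD s i \<omega>" for i \<omega>
    by (simp add: \<zeta>_def kD_def t_def)
  have gS: "(\<Sum>i<n. g i \<omega> (\<eta> i \<omega>)) = S \<omega> / l" for \<omega>
    unfolding S_def sum_divide_distrib
    by (intro sum.cong refl) (simp add: g_def a_def \<zeta>D)
  have VS: "(\<Sum>i<n. V i \<omega>) = c1 * (\<Sum>i<n. (w i \<omega>)\<^sup>2)" for \<omega>
    by (simp add: V_def sum_distrib_left)
  have "emeasure M {\<omega> \<in> space M. \<bar>\<Sum>i<n. g i \<omega> (\<eta> i \<omega>)\<bar> > 2 * real k \<and> (\<Sum>i<n. V i \<omega>) \<le> c1 * B} \<le> ennreal (2 * exp (c1 * B - 2 * real k))"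
    by (rule freedman(1)[OF gm Vm bnd mn vr])
  also have "{\<omega> \<in> space M. \<bar>\<Sum>i<n. g i \<omega> (\<eta> i \<omega>)\<bar> > 2 * real k \<and> (\<Sum>i<n. V i \<omega>) \<le> c1 * B}
    = {\<omega> \<in> space M. \<bar>S \<omega>\<bar> > eps k \<and> (\<Sum>i<n. (w i \<omega>)\<^sup>2) \<le> B}"
    unfolding gS VS eps_def l_def[symmetric] using l c1_pos by (auto simp: field_simps abs_divide)
  finally show "emeasure M {\<omega> \<in> space M. \<bar>S \<omega>\<bar> > eps k \<and> (\<Sum>i<n. (w i \<omega>)\<^sup>2) \<le> B} \<le> ennreal (2 * exp (c1 * B - 2 * real k))" .
  have "(\<lambda>\<omega>. (\<Sum>i<n. g i \<omega> (\<eta> i \<omega>)) * l) \<in> borel_measurable M"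
    using freedman(2)[OF gm Vm bnd mn vr] by measurable
  then show "S \<in> borel_measurable M" using l by (simp add: gS)
qed

text \<open>The chain needs the increments over a cell summed over the summands active at level \<open>k\<close>, and over
  those that are active at level \<open>k\<close> for the last time; the flag selects the latter.\<close>

definition fam :: "bool \<Rightarrow> nat \<Rightarrow> nat \<Rightarrow> 'a \<Rightarrow> bool" where
  "fam b k i \<omega> \<longleftrightarrow> act k i \<omega> \<and> (b \<longrightarrow> \<not> act (Suc k) i \<omega>)"

definition cell_sum :: "bool \<Rightarrow> nat \<Rightarrow> real \<Rightarrow> 'a \<Rightarrow> real" where
  "cell_sum b k s \<omega> = (\<Sum>i<n. w i \<omega> * of_bool (fam b k i \<omega>) * (kD (s + (1/2)^k) i \<omega> - kD s i \<omega>))"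

definition bad :: "nat \<Rightarrow> real \<Rightarrow> 'a set" where
  "bad k0 B = (\<Union>k. \<Union>j\<in>{..<2^(k+k0)}. \<Union>b\<in>{True, False}.
     {\<omega> \<in> space M. \<bar>cell_sum b (k + k0) (real j / 2^(k+k0)) \<omega>\<bar> > eps (k + k0) \<and> (\<Sum>i<n. (w i \<omega>)\<^sup>2) \<le> B})"

lemma cell_sum_tail:
  assumes "j < 2^k"
  shows "emeasure M {\<omega> \<in> space M. \<bar>cell_sum b k (real j / 2^k) \<omega>\<bar> > eps k \<and> (\<Sum>i<n. (w i \<omega>)\<^sup>2) \<le> B} \<le> ennreal (2 * exp (c1 * B - 2 * real k))"
    and "{\<omega> \<in> space M. \<bar>cell_sum b k (real j / 2^k) \<omega>\<bar> > eps k \<and> (\<Sum>i<n. (w i \<omega>)\<^sup>2) \<le> B} \<in> sets M"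
proof -
  have "real j + 1 \<le> 2^k"
    using assms by (metis Suc_eq_plus1 Suc_leI of_nat_1 of_nat_add of_nat_le_iff of_nat_numeral of_nat_power)
  then have s: "0 \<le> real j / 2^k" "real j / 2^k + (1/2)^k \<le> 1"
    by (auto simp: power_one_over field_simps)
  have pm: "Measurable.pred (G i) (fam b k i)" if "i < n" for i
    using act_measurable[OF that] unfolding fam_def by measurable
  have pa: "fam b k i \<omega> \<Longrightarrow> act k i \<omega>" for i \<omega> by (simp add: fam_def)
  note ct = cell_tail[where \<phi>="fam b k" and k=k, OF pm pa s, folded cell_sum_def]
  show "emeasure M {\<omega> \<in> space M. \<bar>cell_sum b k (real j / 2^k) \<omega>\<bar> > eps k \<and> (\<Sum>i<n. (w i \<omega>)\<^sup>2) \<le> B} \<le> ennreal (2 * exp (c1 * B - 2 * real k))"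
    by (rule ct(1))
  have [measurable]: "cell_sum b k (real j / 2^k) \<in> borel_measurable M" using ct(2) by simp
  have [measurable]: "(\<lambda>\<omega>. \<Sum>i<n. (w i \<omega>)\<^sup>2) \<in> borel_measurable M"
    by (intro borel_measurable_sum borel_measurable_power measurable_G_M[OF w_meas]) auto
  show "{\<omega> \<in> space M. \<bar>cell_sum b k (real j / 2^k) \<omega>\<bar> > eps k \<and> (\<Sum>i<n. (w i \<omega>)\<^sup>2) \<le> B} \<in> sets M"
    by measurable
qed

lemma bad_measurable: "bad k0 B \<in> sets M"
  unfolding bad_def using cell_sum_tail(2) by (intro sets.countable_UN'' sets.finite_UN) auto

text \<open>At level \<open>k\<close> there are \<open>2\<^sup>k\<close> cells, each failing with probability \<open>O(exp (- 2 k)) \<le> O(4\<^sup>-\<^sup>k)\<close>.\<close>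

lemma bad_small: "emeasure M (bad k0 B) \<le> ennreal (8 * exp (c1 * B) * (1/2)^k0)"
proof -
  define E where "E k j b = {\<omega> \<in> space M. \<bar>cell_sum b k (real j / 2^k) \<omega>\<bar> > eps k \<and> (\<Sum>i<n. (w i \<omega>)\<^sup>2) \<le> B}" for k j b
  define A where "A k = (\<Union>j\<in>{..<2^(k+k0)}. \<Union>b\<in>{True, False}. E (k+k0) j b)" for k
  have Em: "j < 2^k \<Longrightarrow> E k j b \<in> sets M" for k j b unfolding E_def by (rule cell_sum_tail(2))
  have Am: "A k \<in> sets M" for k unfolding A_def using Em by (intro sets.finite_UN) auto
  have Ab: "emeasure M (A k) \<le> ennreal (4 * exp (c1 * B) * (1/2)^(k+k0))" for k
  proof -
    let ?k = "k + k0"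
    have "emeasure M (A k) \<le> (\<Sum>j\<in>{..<2^?k}. emeasure M (\<Union>b\<in>{True, False}. E ?k j b))"
      unfolding A_def using Em by (intro emeasure_subadditive_finite) auto
    also have "\<dots> \<le> (\<Sum>j\<in>{..<2^?k::nat}. ennreal (4 * exp (c1 * B - 2 * real ?k)))"
    proof (rule sum_mono)
      fix j :: nat assume j: "j \<in> {..<2^?k}"
      let ?e = "2 * exp (c1 * B - 2 * real ?k)"
      have "emeasure M (\<Union>b\<in>{True, False}. E ?k j b) = emeasure M (E ?k j True \<union> E ?k j False)" by simp
      also have "\<dots> \<le> emeasure M (E ?k j True) + emeasure M (E ?k j False)"
        using j by (intro emeasure_subadditive Em) auto
      also have "\<dots> \<le> ennreal ?e + ennreal ?e"
        unfolding E_def using j by (intro add_mono cell_sum_tail(1)) auto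
      also have "\<dots> = ennreal (?e + ?e)" by (rule ennreal_plus[symmetric]) auto
      also have "?e + ?e = 4 * exp (c1 * B - 2 * real ?k)" by simp
      finally show "emeasure M (\<Union>b\<in>{True, False}. E ?k j b) \<le> ennreal (4 * exp (c1 * B - 2 * real ?k))" .
    qed
    also have "\<dots> = ennreal (2^?k * (4 * exp (c1 * B - 2 * real ?k)))"
      by (simp add: ennreal_mult ennreal_of_nat_eq_real_of_nat[symmetric] of_nat_power flip: ennreal_power)
    also have "\<dots> \<le> ennreal (4 * exp (c1 * B) * (1/2)^?k)"
    proof (rule ennreal_leI)
      have "(4::real) \<le> exp 2" using exp_lower_Taylor_quadratic[of 2] by simp
      then have "(4::real)^?k \<le> exp 2 ^ ?k" by (intro power_mono) auto
      also have "\<dots> = exp (2 * real ?k)" by (simp add: exp_of_nat_mult[symmetric] mult.commute)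
      finally have le: "(4::real)^?k \<le> exp (2 * real ?k)" .
      have aux: "a * inverse E \<le> 1 / a" if "0 < a" "0 < E" "a * a \<le> E" for a E :: real
        using that by (simp add: field_simps)
      have "2^?k * inverse (exp (2 * real ?k)) \<le> 1 / 2^?k"
        using le by (intro aux) (auto simp flip: power_mult_distrib)
      then have "2^?k * exp (- (2 * real ?k)) \<le> (1/2)^?k"
        by (simp only: exp_minus power_one_over)
      then have "4 * exp (c1 * B) * (2^?k * exp (- (2 * real ?k))) \<le> 4 * exp (c1 * B) * (1/2)^?k"
        by (intro mult_left_mono) auto
      moreover have "exp (c1 * B - 2 * real ?k) = exp (c1 * B) * exp (- (2 * real ?k))"
        by (simp flip: exp_add)
      ultimately show "2^?k * (4 * exp (c1 * B - 2 * real ?k)) \<le> 4 * exp (c1 * B) * (1/2)^?k"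
        by (simp add: mult_ac)
    qed
    finally show ?thesis .
  qed
  have "bad k0 B = (\<Union>k. A k)" by (simp add: bad_def A_def E_def)
  then have "emeasure M (bad k0 B) \<le> (\<Sum>k. emeasure M (A k))"
    using emeasure_subadditive_countably[of A M] Am by auto
  also have "\<dots> \<le> (\<Sum>k. ennreal (4 * exp (c1 * B) * (1/2)^(k+k0)))"
    by (intro suminf_le Ab) auto
  also have "\<dots> = ennreal (\<Sum>k. 4 * exp (c1 * B) * (1/2)^(k+k0))"
    by (intro suminf_ennreal2) (auto simp: power_add intro!: summable_mult summable_mult2 summable_geometric)
  also have "(\<Sum>k. 4 * exp (c1 * B) * (1/2)^(k+k0)) = 8 * exp (c1 * B) * (1/2)^k0"
  proof -
    have "(\<lambda>k. (1/2::real)^k) sums 2" using geometric_sums[of "1/2::real"] by simp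
    then have "(\<lambda>k. (4 * exp (c1 * B) * (1/2)^k0) * (1/2)^k) sums ((4 * exp (c1 * B) * (1/2)^k0) * 2)"
      by (rule sums_mult)
    then show ?thesis by (simp add: sums_iff power_add mult_ac)
  qed
  finally show ?thesis .
qed

lemma chain_bracket:
  assumes "i < n" "\<omega> \<in> space M" "\<rho> i \<omega> \<le> 1/2"
  shows "iN i \<omega> (knot x k) e \<le> of_bool (e \<le> iT i \<omega> x)"
    "of_bool (e \<le> iT i \<omega> x) \<le> iN i \<omega> (knot x k + (1/2)^k) e"
    "iF i \<omega> (knot x k) \<le> F (iT i \<omega> x)"
    "F (iT i \<omega> x) \<le> iF i \<omega> (knot x k + (1/2)^k)"
proof -
  have sm: "\<bar>u i \<omega>\<bar> + \<bar>v i \<omega>\<bar> + \<bar>d i \<omega>\<bar> \<le> 1/2" using uvd_le[OF assms(1,2)] assms(3) by simp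
  let ?T = "iT i \<omega>"
  have k: "0 \<le> knot x k" "knot x k < 1" "knot x k + (1/2)^k \<le> 1" "0 < knot x k + (1/2)^k"
    using knot_ge_0[of x k] knot_less_1[of x k] knot_next_le_1[of x k] by (auto intro: add_nonneg_pos)
  have lo: "?T (q (knot x k)) \<le> ?T x" if "0 < knot x k"
    using knot_bracket[of x k] that by (intro thr_mono[OF sm]) auto
  have hi: "?T x \<le> ?T (q (knot x k + (1/2)^k))" if "knot x k + (1/2)^k < 1"
    using knot_bracket[of x k] that by (intro thr_mono[OF sm]) auto
  show "iN i \<omega> (knot x k) e \<le> of_bool (e \<le> ?T x)"
    "iF i \<omega> (knot x k) \<le> F (?T x)"
    using lo k F_mono[OF lo] F_nonneg by (auto simp: kN_def kF_def)
  show "of_bool (e \<le> ?T x) \<le> iN i \<omega> (knot x k + (1/2)^k) e"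
    "F (?T x) \<le> iF i \<omega> (knot x k + (1/2)^k)"
    using hi k F_mono[OF hi] F_le_1 by (auto simp: kN_def kF_def)
qed

text \<open>Monotonicity replaces a centred indicator inside a bracket by the centred increment over the bracket, at
  the price of the probability of the bracket.\<close>

lemma bracket_deviation:
  fixes h1 F1 hs ht Fs Ft :: real
  assumes "hs \<le> h1" "h1 \<le> ht" "Fs \<le> F1" "F1 \<le> Ft"
  shows "\<bar>h1 - F1 - (hs - Fs)\<bar> \<le> ht - Ft - (hs - Fs) + 2 * (Ft - Fs)"
  using assms unfolding abs_le_iff by simp

text \<open>Off the bad event the chain can be followed from every \<open>x\<close> down to its knot at level \<open>k0\<close>, for
  all \<open>x\<close> at once: the links at level \<open>k\<close> cost \<open>eps k\<close>. A summand whose last active level is \<open>k\<close>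
  is compared with \<open>x\<close> through the bracket of that level; the conditional probability of the bracket
  is \<open>O(2\<^sup>-\<^sup>k)\<close>, that is \<open>O(z i)\<close>, since \<open>z i > 2\<^sup>-\<^sup>k\<^sup>-\<^sup>1\<close> by inactivity at the next level.\<close>

lemma chaining:
  assumes \<omega>: "\<omega> \<in> space M" "\<omega> \<notin> bad k0 B" "(\<Sum>i<n. (w i \<omega>)\<^sup>2) \<le> B"
    and act0: "\<And>i. i < n \<Longrightarrow> act k0 i \<omega>"
  shows "\<bar>\<Sum>i<n. w i \<omega> * (fullD x i \<omega> - kD (knot x k0) i \<omega>)\<bar> \<le> 2 * tail k0 + 4 * c1 * (\<Sum>i<n. w i \<omega> * z i \<omega>)"
proof -
  define ch where "ch k i = (of_bool (act k i \<omega>) :: real)" for k i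
  define X where "X i = fullD x i \<omega>" for i
  define D where "D k i = kD (knot x k) i \<omega>" for k i
  define W where "W i = w i \<omega>" for i
  have W0: "i < n \<Longrightarrow> 0 \<le> W i" for i using w_nonneg \<omega>(1) by (simp add: W_def)
  have cs: "\<bar>cell_sum b k (real j / 2^k) \<omega>\<bar> \<le> eps k" if "k \<ge> k0" "j < 2^k" for b k j
  proof (rule ccontr)
    assume "\<not> ?thesis"
    then have "\<omega> \<in> bad k0 B"
      unfolding bad_def using \<omega>(1,3) that by (intro UN_I[of "k - k0"] UN_I[of j] UN_I[of b]) auto
    with \<omega>(2) show False by simp
  qed
  (* Every summand with positive weight is inactive from some level on, so the chain is finite. *)
  obtain K where K: "ch K i * W i = 0" if "i < n" for i
  proof -
    have "\<exists>K. \<forall>i<n. W i > 0 \<longrightarrow> (1/2::real)^K < z i \<omega>"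
    proof -
      have "\<forall>i\<in>{..<n}. \<forall>\<^sub>F K in sequentially. W i > 0 \<longrightarrow> (1/2::real)^K < z i \<omega>"
      proof
        fix i assume i: "i \<in> {..<n}"
        have "0 \<le> \<rho> i \<omega> * sqrt (\<rho> i \<omega>)" using \<rho>_nonneg[of i \<omega>] i \<omega> by simp
        then have "W i > 0 \<Longrightarrow> z i \<omega> > 0" by (simp add: z_def W_def add_pos_nonneg)
        moreover have "(\<lambda>K. (1/2::real)^K) \<longlonglongrightarrow> 0" by (rule LIMSEQ_power_zero) simp
        ultimately show "\<forall>\<^sub>F K in sequentially. W i > 0 \<longrightarrow> (1/2::real)^K < z i \<omega>"
          by (cases "W i > 0") (auto dest: order_tendstoD(2))
      qed
      then have "\<forall>\<^sub>F K in sequentially. \<forall>i\<in>{..<n}. W i > 0 \<longrightarrow> (1/2::real)^K < z i \<omega>"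
        by (rule eventually_ball_finite[rotated]) simp
      then obtain K where "\<forall>i\<in>{..<n}. W i > 0 \<longrightarrow> (1/2::real)^K < z i \<omega>"
        using eventually_happens[of _ sequentially] by fastforce
      then show ?thesis by auto
    qed
    then obtain K where "\<forall>i<n. W i > 0 \<longrightarrow> (1/2::real)^K < z i \<omega>" ..
    then have "ch K i * W i = 0" if "i < n" for i
      using that W0[OF that] by (auto simp: ch_def act_def le_less)
    then show ?thesis by (rule that)
  qed
  have chmono: "ch (Suc k) i \<le> ch k i" for k i using act_antimono[of k i \<omega>] by (auto simp: ch_def)
  have fb: "ch k i - ch (Suc k) i = of_bool (fam True k i \<omega>)" for k i
    using act_antimono[of k i \<omega>] by (auto simp: ch_def fam_def)
  have ff: "ch k i = of_bool (fam False k i \<omega>)" for k i by (simp add: ch_def fam_def)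
  (* Telescoping: a step to the next knot while active, the remaining distance to x on leaving. *)
  have tele: "ch k0 i * (X i - D k0 i) = (\<Sum>k=k0..<k0+m. ch (Suc k) i * (D (Suc k) i - D k i) + (ch k i - ch (Suc k) i) * (X i - D k i))
     + ch (k0+m) i * (X i - D (k0+m) i)" for m i
    by (induction m) (auto simp: algebra_simps)
  have ch0: "ch k0 i = 1" if "i < n" for i using act0[OF that] by (simp add: ch_def)
  define m where "m = K - k0"
  have Km: "ch (k0+m) i * W i = 0" if "i < n" for i
  proof (cases "k0 \<le> K")
    case True
    then have "k0 + m = K" unfolding m_def by (rule le_add_diff_inverse)
    then show ?thesis using K[OF that] by (simp only:)
  next
    case False
    then have "K \<le> k0" by simp
    then have "ch k0 i \<le> ch K i" by (rule lift_Suc_antimono_le[of "\<lambda>k. ch k i", OF chmono])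
    then have "1 \<le> ch K i" using ch0[OF that] by (simp only:)
    then have "W i = 0" using K[OF that] by auto
    then show ?thesis by simp
  qed
  have aux: "a * (b + c * e) = a * b + (c * a) * e" for a b c e :: real by (simp add: algebra_simps)
  have "(\<Sum>i<n. W i * (X i - D k0 i)) = (\<Sum>i<n. \<Sum>k=k0..<k0+m. W i * (ch (Suc k) i * (D (Suc k) i - D k i)) + W i * ((ch k i - ch (Suc k) i) * (X i - D k i)))"
  proof (rule sum.cong[OF refl])
    fix i assume i: "i \<in> {..<n}"
    have "W i * (X i - D k0 i) = W i * (ch k0 i * (X i - D k0 i))" using ch0[of i] i by simp
    also have "\<dots> = W i * (\<Sum>k=k0..<k0+m. ch (Suc k) i * (D (Suc k) i - D k i) + (ch k i - ch (Suc k) i) * (X i - D k i))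
       + (ch (k0+m) i * W i) * (X i - D (k0+m) i)"
      by (subst tele[of i m]) (rule aux)
    also have "\<dots> = (\<Sum>k=k0..<k0+m. W i * (ch (Suc k) i * (D (Suc k) i - D k i)) + W i * ((ch k i - ch (Suc k) i) * (X i - D k i)))"
      using Km[of i] i by (simp add: sum_distrib_left distrib_left)
    finally show "W i * (X i - D k0 i) = \<dots>" .
  qed
  also have "\<dots> = (\<Sum>k=k0..<k0+m. (\<Sum>i<n. W i * (ch (Suc k) i * (D (Suc k) i - D k i))) + (\<Sum>i<n. W i * ((ch k i - ch (Suc k) i) * (X i - D k i))))"
    by (subst sum.swap) (simp add: sum.distrib)
  finally have split: "(\<Sum>i<n. W i * (X i - D k0 i)) = \<dots>" .
  have link: "\<bar>\<Sum>i<n. W i * (ch (Suc k) i * (D (Suc k) i - D k i))\<bar> \<le> eps (Suc k)" if "k \<ge> k0" for k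
  proof (cases "knot x (Suc k) = knot x k")
    case True
    then show ?thesis by (simp add: D_def eps_nonneg)
  next
    case False
    then have eq: "knot x (Suc k) = knot x k + (1/2) ^ Suc k" using knot_Suc[of x k] by simp
    have kn: "knot x k = real (2 * path x k) / 2 ^ Suc k" by (simp add: knot_def)
    have "(\<Sum>i<n. W i * (ch (Suc k) i * (D (Suc k) i - D k i))) = cell_sum False (Suc k) (knot x k) \<omega>"
      unfolding cell_sum_def ff D_def eq W_def by (simp add: mult.assoc)
    also have "\<bar>\<dots>\<bar> \<le> eps (Suc k)"
      unfolding kn using that path_less[of x k] by (intro cs) auto
    finally show ?thesis .
  qed
  define R where "R k = (\<Sum>i<n. W i * ((ch k i - ch (Suc k) i) * z i \<omega>))" for k
  have rem: "\<bar>\<Sum>i<n. W i * ((ch k i - ch (Suc k) i) * (X i - D k i))\<bar> \<le> eps k + 4 * c1 * R k" if "k \<ge> k0" for k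
  proof -
    let ?s = "knot x k" and ?t = "knot x k + (1/2)^k"
    define p where "p i = iF i \<omega> ?t - iF i \<omega> ?s" for i
    have pt: "\<bar>W i * ((ch k i - ch (Suc k) i) * (X i - D k i))\<bar>
       \<le> W i * of_bool (fam True k i \<omega>) * (kD ?t i \<omega> - kD ?s i \<omega>) + 4 * c1 * (W i * ((ch k i - ch (Suc k) i) * z i \<omega>))"
      if i: "i < n" for i
    proof (cases "fam True k i \<omega>")
      case True
      then have a: "act k i \<omega>" "\<not> act (Suc k) i \<omega>" by (auto simp: fam_def)
      then have \<rho>: "\<rho> i \<omega> \<le> 1/2" and zk: "z i \<omega> \<le> (1/2)^k" "(1/2)^Suc k < z i \<omega>" by (auto simp: act_def)
      note br = chain_bracket(1,2)[OF i \<omega>(1) \<rho>, where x=x and k=k and e="\<eta> i \<omega>"]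
        chain_bracket(3,4)[OF i \<omega>(1) \<rho>, where x=x and k=k]
      have 1: "\<bar>X i - D k i\<bar> \<le> (kD ?t i \<omega> - kD ?s i \<omega>) + 2 * p i"
        unfolding X_def D_def fullD_def kD_def p_def
        by (rule bracket_deviation[OF br])
      have "\<rho> i \<omega> * sqrt (\<rho> i \<omega>) \<le> (1/2)^k" using zk(1) zero_le_power2[of "w i \<omega>"] unfolding z_def by linarith
      then have "p i \<le> c1 * (1/2)^k"
        unfolding p_def c1_def using cell_prob[OF uvd_le[OF i \<omega>(1)] \<rho>] knot_ge_0 knot_next_le_1 by blast
      also have "\<dots> \<le> c1 * (2 * z i \<omega>)" using zk(2) c1_pos by (intro mult_left_mono) auto
      finally have 2: "\<bar>X i - D k i\<bar> \<le> (kD ?t i \<omega> - kD ?s i \<omega>) + 4 * c1 * z i \<omega>" using 1 by linarith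
      have "\<bar>W i * ((ch k i - ch (Suc k) i) * (X i - D k i))\<bar> = W i * \<bar>X i - D k i\<bar>"
        using True W0[OF i] by (simp add: fb abs_mult)
      also have "\<dots> \<le> W i * ((kD ?t i \<omega> - kD ?s i \<omega>) + 4 * c1 * z i \<omega>)"
        using 2 W0[OF i] by (rule mult_left_mono)
      also have "\<dots> = W i * of_bool (fam True k i \<omega>) * (kD ?t i \<omega> - kD ?s i \<omega>) + 4 * c1 * (W i * ((ch k i - ch (Suc k) i) * z i \<omega>))"
        using True by (simp add: fb algebra_simps)
      finally show ?thesis .
    qed (simp add: fb)
    have "\<bar>\<Sum>i<n. W i * ((ch k i - ch (Suc k) i) * (X i - D k i))\<bar>
      \<le> (\<Sum>i<n. W i * of_bool (fam True k i \<omega>) * (kD ?t i \<omega> - kD ?s i \<omega>) + 4 * c1 * (W i * ((ch k i - ch (Suc k) i) * z i \<omega>)))"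
      by (rule order_trans[OF sum_abs]) (intro sum_mono pt, simp)
    also have "\<dots> = cell_sum True k ?s \<omega> + 4 * c1 * R k"
      by (simp add: sum.distrib cell_sum_def W_def R_def sum_distrib_left)
    also have "\<dots> \<le> eps k + 4 * c1 * R k"
      using cs[OF that path_less, of True x] unfolding knot_def by linarith
    finally show ?thesis .
  qed
  (* Every summand leaves the chain at most once. *)
  have Rsum: "(\<Sum>k=k0..<k0+m. R k) \<le> (\<Sum>i<n. W i * z i \<omega>)"
  proof -
    have "(\<Sum>k=k0..<k0+m. R k) = (\<Sum>i<n. (W i * z i \<omega>) * (\<Sum>k=k0..<k0+m. ch k i - ch (Suc k) i))"
      unfolding R_def by (subst sum.swap) (simp add: sum_distrib_left mult_ac)
    also have "\<dots> \<le> (\<Sum>i<n. (W i * z i \<omega>) * 1)"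
    proof (intro sum_mono mult_left_mono)
      fix i assume i: "i \<in> {..<n}"
      have "(\<Sum>k=k0..<k0+m. ch k i - ch (Suc k) i) = ch k0 i - ch (k0+m) i"
        by (induction m) auto
      then show "(\<Sum>k=k0..<k0+m. ch k i - ch (Suc k) i) \<le> 1" by (simp add: ch_def)
      show "0 \<le> W i * z i \<omega>" using W0[of i] \<rho>_nonneg[of i \<omega>] i \<omega>(1) by (simp add: z_def)
    qed
    finally show ?thesis by simp
  qed
  have "\<bar>\<Sum>i<n. W i * (X i - D k0 i)\<bar> \<le> (\<Sum>k=k0..<k0+m. eps (Suc k) + (eps k + 4 * c1 * R k))"
    unfolding split
  proof (rule order_trans[OF sum_abs], rule sum_mono)
    fix k assume "k \<in> {k0..<k0+m}"
    then have "k \<ge> k0" by simp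
    from link[OF this] rem[OF this]
    show "\<bar>(\<Sum>i<n. W i * (ch (Suc k) i * (D (Suc k) i - D k i))) + (\<Sum>i<n. W i * ((ch k i - ch (Suc k) i) * (X i - D k i)))\<bar>
      \<le> eps (Suc k) + (eps k + 4 * c1 * R k)" by linarith
  qed
  also have "\<dots> = (\<Sum>k=k0..<k0+m. eps (Suc k)) + (\<Sum>k=k0..<k0+m. eps k) + 4 * c1 * (\<Sum>k=k0..<k0+m. R k)"
    by (simp add: sum.distrib sum_distrib_left)
  also have "\<dots> \<le> tail k0 + tail k0 + 4 * c1 * (\<Sum>i<n. W i * z i \<omega>)"
    using Rsum c1_pos by (intro add_mono sum_eps_le_tail mult_left_mono) auto
  finally show ?thesis by (simp add: W_def X_def D_def)
qed

end

section \<open>Convergence in outer probability\<close>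

text \<open>\<open>whp\<close>: the statement eventually holds up to outer probability \<open>\<zeta>\<close>. \<open>aas\<close>: its outer
  probability of failing tends to 0, in the form in which finitely many such statements can be combined.\<close>

definition whp :: "'a measure \<Rightarrow> real \<Rightarrow> (nat \<Rightarrow> 'a \<Rightarrow> bool) \<Rightarrow> bool" where
  "whp M \<zeta> Q \<longleftrightarrow> (\<forall>\<^sub>F n in sequentially. outer_measure_of M {\<omega> \<in> space M. \<not> Q n \<omega>} \<le> ennreal \<zeta>)"

definition aas :: "'a measure \<Rightarrow> (nat \<Rightarrow> 'a \<Rightarrow> bool) \<Rightarrow> bool" where
  "aas M Q \<longleftrightarrow> (\<forall>\<zeta>>0. whp M \<zeta> Q)"

definition tight :: "'a measure \<Rightarrow> (nat \<Rightarrow> 'a \<Rightarrow> real) \<Rightarrow> bool" where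
  "tight M X \<longleftrightarrow> (\<forall>\<zeta>>0. \<exists>B>0. whp M \<zeta> (\<lambda>n \<omega>. X n \<omega> \<le> B))"

lemma whp_mono:
  assumes "whp M \<zeta> Q" "\<zeta> \<le> \<zeta>'" "\<forall>\<^sub>F n in sequentially. \<forall>\<omega>\<in>space M. Q n \<omega> \<longrightarrow> Q' n \<omega>"
  shows "whp M \<zeta>' Q'"
  using assms(1,3) unfolding whp_def
proof eventually_elim
  case (elim n)
  then have "outer_measure_of M {\<omega> \<in> space M. \<not> Q' n \<omega>} \<le> outer_measure_of M {\<omega> \<in> space M. \<not> Q n \<omega>}"
    by (intro outer_measure_of_mono) auto
  also have "\<dots> \<le> ennreal \<zeta>'" using elim assms(2) by (meson ennreal_leI order_trans)
  finally show ?case .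
qed

lemma whp_impI: "whp M \<zeta> Q \<Longrightarrow> (\<And>n \<omega>. \<omega> \<in> space M \<Longrightarrow> Q n \<omega> \<Longrightarrow> Q' n \<omega>) \<Longrightarrow> whp M \<zeta> Q'"
  by (erule whp_mono) auto

lemma outer_measure_of_Un:
  assumes "A \<subseteq> space M" "B \<subseteq> space M"
  shows "outer_measure_of M (A \<union> B) \<le> outer_measure_of M A + outer_measure_of M B"
proof -
  obtain A' where A': "A' \<in> sets M" "A \<subseteq> A'" "outer_measure_of M A = emeasure M A'"
    using outer_measure_of_attain[OF assms(1)] by blast
  obtain B' where B': "B' \<in> sets M" "B \<subseteq> B'" "outer_measure_of M B = emeasure M B'"
    using outer_measure_of_attain[OF assms(2)] by blast
  have "outer_measure_of M (A \<union> B) \<le> outer_measure_of M (A' \<union> B')"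
    using A' B' by (intro outer_measure_of_mono) auto
  also have "\<dots> = emeasure M (A' \<union> B')" using A' B' by simp
  also have "\<dots> \<le> emeasure M A' + emeasure M B'" using A' B' by (intro emeasure_subadditive)
  finally show ?thesis using A' B' by simp
qed

lemma whp_conj:
  assumes "whp M a Q" "whp M b R" "0 \<le> a" "0 \<le> b"
  shows "whp M (a + b) (\<lambda>n \<omega>. Q n \<omega> \<and> R n \<omega>)"
  using assms(1,2) unfolding whp_def
proof eventually_elim
  case (elim n)
  have "{\<omega> \<in> space M. \<not> (Q n \<omega> \<and> R n \<omega>)} = {\<omega> \<in> space M. \<not> Q n \<omega>} \<union> {\<omega> \<in> space M. \<not> R n \<omega>}" by auto
  then have "outer_measure_of M {\<omega> \<in> space M. \<not> (Q n \<omega> \<and> R n \<omega>)}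
    \<le> outer_measure_of M {\<omega> \<in> space M. \<not> Q n \<omega>} + outer_measure_of M {\<omega> \<in> space M. \<not> R n \<omega>}"
    using outer_measure_of_Un[of "{\<omega> \<in> space M. \<not> Q n \<omega>}" M "{\<omega> \<in> space M. \<not> R n \<omega>}"] by auto
  also have "\<dots> \<le> ennreal a + ennreal b" using elim by (intro add_mono)
  finally show ?case using assms(3,4) by simp
qed

lemma whp_set:
  assumes "\<forall>\<^sub>F n in sequentially. \<exists>A\<in>sets M. emeasure M A \<le> ennreal \<zeta> \<and> (\<forall>\<omega>\<in>space M - A. Q n \<omega>)"
  shows "whp M \<zeta> Q"
  unfolding whp_def using assms
proof eventually_elim
  case (elim n)
  then obtain A where A: "A \<in> sets M" "emeasure M A \<le> ennreal \<zeta>" "\<forall>\<omega>\<in>space M - A. Q n \<omega>" by auto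
  then have "outer_measure_of M {\<omega> \<in> space M. \<not> Q n \<omega>} \<le> outer_measure_of M A"
    by (intro outer_measure_of_mono) auto
  also have "\<dots> \<le> ennreal \<zeta>" using A by simp
  finally show ?case .
qed

lemma aasD: "aas M Q \<Longrightarrow> 0 < \<zeta> \<Longrightarrow> whp M \<zeta> Q" by (simp add: aas_def)

lemma aas_mono: "aas M Q \<Longrightarrow> \<forall>\<^sub>F n in sequentially. \<forall>\<omega>\<in>space M. Q n \<omega> \<longrightarrow> Q' n \<omega> \<Longrightarrow> aas M Q'"
  unfolding aas_def using whp_mono by blast

lemma aas_impI: "aas M Q \<Longrightarrow> (\<And>n \<omega>. \<omega> \<in> space M \<Longrightarrow> Q n \<omega> \<Longrightarrow> Q' n \<omega>) \<Longrightarrow> aas M Q'"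
  by (erule aas_mono) auto

lemma aas_conj: "aas M Q \<Longrightarrow> aas M R \<Longrightarrow> aas M (\<lambda>n \<omega>. Q n \<omega> \<and> R n \<omega>)"
  unfolding aas_def
proof (intro allI impI)
  fix \<zeta> :: real assume "\<forall>\<zeta>>0. whp M \<zeta> Q" "\<forall>\<zeta>>0. whp M \<zeta> R" "0 < \<zeta>"
  then show "whp M \<zeta> (\<lambda>n \<omega>. Q n \<omega> \<and> R n \<omega>)"
    using whp_conj[of M "\<zeta>/2" Q "\<zeta>/2" R] by simp
qed

lemma aas_True: "aas M (\<lambda>n \<omega>. True)"
  unfolding aas_def whp_def using outer_measure_of_eq[of "{}" M] by simp

lemma aas_finite_ball:
  assumes "finite T" "\<And>t. t \<in> T \<Longrightarrow> aas M (\<lambda>n \<omega>. Q t n \<omega>)"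
  shows "aas M (\<lambda>n \<omega>. \<forall>t\<in>T. Q t n \<omega>)"
  using assms by (induction T rule: finite_induct) (auto simp: aas_True aas_conj)

text \<open>The Lindeberg type condition for weights and perturbations: uniformly negligible entries and square
  sums that are bounded in probability.\<close>

definition null_array :: "'a measure \<Rightarrow> (nat \<Rightarrow> nat \<Rightarrow> 'a \<Rightarrow> real) \<Rightarrow> bool" where
  "null_array M w \<longleftrightarrow> (\<forall>a>0. aas M (\<lambda>n \<omega>. \<forall>i<n. \<bar>w n i \<omega>\<bar> \<le> a)) \<and> tight M (\<lambda>n \<omega>. \<Sum>i<n. (w n i \<omega>)\<^sup>2)"

abbreviation sq_sum :: "(nat \<Rightarrow> nat \<Rightarrow> 'a \<Rightarrow> real) \<Rightarrow> nat \<Rightarrow> 'a \<Rightarrow> real" where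
  "sq_sum w n \<omega> \<equiv> \<Sum>i<n. (w n i \<omega>)\<^sup>2"

lemma null_array_small: "null_array M w \<Longrightarrow> 0 < a \<Longrightarrow> aas M (\<lambda>n \<omega>. \<forall>i<n. \<bar>w n i \<omega>\<bar> \<le> a)"
  by (simp add: null_array_def)

lemma null_array_tight:
  assumes "null_array M w" "0 < \<zeta>"
  obtains B where "B > 0" "whp M \<zeta> (\<lambda>n \<omega>. sq_sum w n \<omega> \<le> B)"
  using assms unfolding null_array_def tight_def by blast

lemma null_array_mono:
  assumes "null_array M w" and le: "\<And>n i \<omega>. i < n \<Longrightarrow> \<omega> \<in> space M \<Longrightarrow> \<bar>w' n i \<omega>\<bar> \<le> c * \<bar>w n i \<omega>\<bar>" and c: "c \<ge> 0"
  shows "null_array M w'"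
  unfolding null_array_def
proof (intro conjI allI impI)
  fix a :: real assume a: "a > 0"
  have "aas M (\<lambda>n \<omega>. \<forall>i<n. \<bar>w n i \<omega>\<bar> \<le> a / (c + 1))"
    using assms(1) a c by (simp add: null_array_def)
  then show "aas M (\<lambda>n \<omega>. \<forall>i<n. \<bar>w' n i \<omega>\<bar> \<le> a)"
  proof (rule aas_impI, intro allI impI)
    fix n \<omega> i assume h: "\<omega> \<in> space M" "\<forall>i<n. \<bar>w n i \<omega>\<bar> \<le> a / (c + 1)" "i < n"
    have "\<bar>w' n i \<omega>\<bar> \<le> c * \<bar>w n i \<omega>\<bar>" using le h by simp
    also have "\<dots> \<le> c * (a / (c+1))" using h c by (intro mult_left_mono) auto
    also have "\<dots> \<le> a" using a c by (simp add: field_simps)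
    finally show "\<bar>w' n i \<omega>\<bar> \<le> a" .
  qed
next
  show "tight M (\<lambda>n \<omega>. \<Sum>i<n. (w' n i \<omega>)\<^sup>2)"
    unfolding tight_def
  proof (intro allI impI)
    fix \<zeta> :: real assume "\<zeta> > 0"
    then obtain B where B: "B > 0" "whp M \<zeta> (\<lambda>n \<omega>. sq_sum w n \<omega> \<le> B)"
      using assms(1) by (auto simp: null_array_def tight_def)
    have "whp M \<zeta> (\<lambda>n \<omega>. (\<Sum>i<n. (w' n i \<omega>)\<^sup>2) \<le> (c\<^sup>2 + 1) * B)"
      using B(2)
    proof (rule whp_impI)
      fix n \<omega> assume h: "\<omega> \<in> space M" "sq_sum w n \<omega> \<le> B"
      have "(\<Sum>i<n. (w' n i \<omega>)\<^sup>2) \<le> (\<Sum>i<n. c\<^sup>2 * (w n i \<omega>)\<^sup>2)"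
      proof (rule sum_mono)
        fix i assume "i \<in> {..<n}"
        then have "\<bar>w' n i \<omega>\<bar>\<^sup>2 \<le> (c * \<bar>w n i \<omega>\<bar>)\<^sup>2" using le h(1) by (intro power_mono) auto
        then show "(w' n i \<omega>)\<^sup>2 \<le> c\<^sup>2 * (w n i \<omega>)\<^sup>2" by (simp add: power_mult_distrib)
      qed
      also have "\<dots> = c\<^sup>2 * sq_sum w n \<omega>" by (simp add: sum_distrib_left)
      also have "\<dots> \<le> (c\<^sup>2 + 1) * B" using h(2) B(1) by (intro mult_mono) (auto intro: sum_nonneg)
      finally show "(\<Sum>i<n. (w' n i \<omega>)\<^sup>2) \<le> (c\<^sup>2 + 1) * B" .
    qed
    moreover have "(c\<^sup>2 + 1) * B > 0" using B(1) by (simp add: add_nonneg_pos)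
    ultimately show "\<exists>B>0. whp M \<zeta> (\<lambda>n \<omega>. (\<Sum>i<n. (w' n i \<omega>)\<^sup>2) \<le> B)" by blast
  qed
qed

lemma sum_prod_le_squares:
  fixes a b :: "nat \<Rightarrow> real"
  shows "(\<Sum>i<n. \<bar>a i\<bar> * \<bar>b i\<bar>) \<le> (\<Sum>i<n. (a i)\<^sup>2) + (\<Sum>i<n. (b i)\<^sup>2)"
  unfolding sum.distrib[symmetric]
proof (rule sum_mono)
  fix i
  have "0 \<le> (\<bar>a i\<bar> - \<bar>b i\<bar>)\<^sup>2" by simp
  then have "2 * (\<bar>a i\<bar> * \<bar>b i\<bar>) \<le> (a i)\<^sup>2 + (b i)\<^sup>2" by (simp add: power2_diff)
  moreover have "0 \<le> \<bar>a i\<bar> * \<bar>b i\<bar>" by simp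
  ultimately show "\<bar>a i\<bar> * \<bar>b i\<bar> \<le> (a i)\<^sup>2 + (b i)\<^sup>2" by linarith
qed

abbreviation cubic_sum :: "(nat \<Rightarrow> nat \<Rightarrow> 'a \<Rightarrow> real) \<Rightarrow> (nat \<Rightarrow> nat \<Rightarrow> 'a \<Rightarrow> real) \<Rightarrow> nat \<Rightarrow> 'a \<Rightarrow> real" where
  "cubic_sum w \<rho> n \<omega> \<equiv> \<Sum>i<n. w n i \<omega> * ((w n i \<omega>)\<^sup>2 + \<rho> n i \<omega> * sqrt (\<rho> n i \<omega>))"

text \<open>The maximal entries tend to 0 and can be factored out of sums of quadratic terms, which are bounded. This
  disposes of the Taylor errors and of the cost of leaving the chain.\<close>

lemma null_array_cubic:
  assumes w: "null_array M w" and r: "null_array M \<rho>" and e: "0 < e"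
    and w0: "\<And>n i \<omega>. i < n \<Longrightarrow> \<omega> \<in> space M \<Longrightarrow> 0 \<le> w n i \<omega> \<and> 0 \<le> \<rho> n i \<omega>"
  shows "aas M (\<lambda>n \<omega>. cubic_sum w \<rho> n \<omega> \<le> e)"
  unfolding aas_def
proof (intro allI impI)
  fix \<zeta> :: real assume \<zeta>: "\<zeta> > 0"
  obtain B where B: "B > 0" "whp M (\<zeta>/4) (\<lambda>n \<omega>. sq_sum w n \<omega> \<le> B)"
    using null_array_tight[OF w, of "\<zeta>/4"] \<zeta> by auto
  obtain B' where B': "B' > 0" "whp M (\<zeta>/4) (\<lambda>n \<omega>. sq_sum \<rho> n \<omega> \<le> B')"
    using null_array_tight[OF r, of "\<zeta>/4"] \<zeta> by auto
  have "((\<lambda>a. a * B + sqrt a * (B + B')) \<longlongrightarrow> 0 * B + sqrt 0 * (B + B')) (at_right 0)"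
    by (intro tendsto_intros)
  then have "\<forall>\<^sub>F a in at_right 0. a * B + sqrt a * (B + B') < e"
    using e by (intro order_tendstoD(2)) auto
  then have "\<forall>\<^sub>F a in at_right 0. a * B + sqrt a * (B + B') < e \<and> a > 0"
    using eventually_at_right_less by (rule eventually_conj)
  then obtain a where a: "a * B + sqrt a * (B + B') < e" "a > 0"
    using eventually_happens[of _ "at_right (0::real)"] by auto
  have 1: "aas M (\<lambda>n \<omega>. (\<forall>i<n. \<bar>w n i \<omega>\<bar> \<le> a) \<and> (\<forall>i<n. \<bar>\<rho> n i \<omega>\<bar> \<le> a))"
    using w r a(2) by (intro aas_conj) (auto simp: null_array_def)
  have "whp M (\<zeta>/2 + \<zeta>/2) (\<lambda>n \<omega>. (sq_sum w n \<omega> \<le> B \<and> sq_sum \<rho> n \<omega> \<le> B') \<and> ((\<forall>i<n. \<bar>w n i \<omega>\<bar> \<le> a) \<and> (\<forall>i<n. \<bar>\<rho> n i \<omega>\<bar> \<le> a)))"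
    using whp_conj[OF B(2) B'(2)] \<zeta> by (intro whp_conj aasD[OF 1]) auto
  then have "whp M (\<zeta>/2 + \<zeta>/2) (\<lambda>n \<omega>. cubic_sum w \<rho> n \<omega> \<le> e)"
  proof (rule whp_impI)
    fix n \<omega> assume \<omega>: "\<omega> \<in> space M" and h: "(sq_sum w n \<omega> \<le> B \<and> sq_sum \<rho> n \<omega> \<le> B') \<and> ((\<forall>i<n. \<bar>w n i \<omega>\<bar> \<le> a) \<and> (\<forall>i<n. \<bar>\<rho> n i \<omega>\<bar> \<le> a))"
    have "cubic_sum w \<rho> n \<omega>
      \<le> (\<Sum>i<n. a * (w n i \<omega>)\<^sup>2 + sqrt a * (\<bar>w n i \<omega>\<bar> * \<bar>\<rho> n i \<omega>\<bar>))"
    proof (rule sum_mono)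
      fix i assume i: "i \<in> {..<n}"
      then have p: "0 \<le> w n i \<omega>" "0 \<le> \<rho> n i \<omega>" "w n i \<omega> \<le> a" "\<rho> n i \<omega> \<le> a" using w0 \<omega> h by auto
      have "w n i \<omega> * (w n i \<omega>)\<^sup>2 \<le> a * (w n i \<omega>)\<^sup>2" using p by (intro mult_right_mono) auto
      moreover have "(w n i \<omega> * \<rho> n i \<omega>) * sqrt (\<rho> n i \<omega>) \<le> (w n i \<omega> * \<rho> n i \<omega>) * sqrt a"
        using p by (intro mult_left_mono) auto
      ultimately show "w n i \<omega> * ((w n i \<omega>)\<^sup>2 + \<rho> n i \<omega> * sqrt (\<rho> n i \<omega>)) \<le> a * (w n i \<omega>)\<^sup>2 + sqrt a * (\<bar>w n i \<omega>\<bar> * \<bar>\<rho> n i \<omega>\<bar>)"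
        using p by (simp add: distrib_left mult_ac)
    qed
    also have "\<dots> = a * sq_sum w n \<omega> + sqrt a * (\<Sum>i<n. \<bar>w n i \<omega>\<bar> * \<bar>\<rho> n i \<omega>\<bar>)"
      by (simp add: sum.distrib sum_distrib_left)
    also have "\<dots> \<le> a * B + sqrt a * (B + B')"
      using h a(2) sum_prod_le_squares[of "\<lambda>i. w n i \<omega>" "\<lambda>i. \<rho> n i \<omega>" n]
      by (intro add_mono mult_left_mono) auto
    finally show "cubic_sum w \<rho> n \<omega> \<le> e" using a(1) by simp
  qed
  then show "whp M \<zeta> (\<lambda>n \<omega>. cubic_sum w \<rho> n \<omega> \<le> e)" by simp
qed

section \<open>Weighted empirical processes with perturbed thresholds\<close>

context hoelder_density
begin

definition dev :: "real \<Rightarrow> real \<Rightarrow> real \<Rightarrow> real \<Rightarrow> real \<Rightarrow> real" where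
  "dev u v d x e = of_bool (e \<le> thr u v d x) - F (thr u v d x)"
definition kdev :: "real \<Rightarrow> real \<Rightarrow> real \<Rightarrow> real \<Rightarrow> real \<Rightarrow> real" where
  "kdev u v d s e = kN u v d s e - kF u v d s"

text \<open>The perturbation moves the indicator at a fixed quantile only when the innovation falls between the two
  thresholds, which has conditional probability \<open>O(\<rho>)\<close>.\<close>

lemma kdev_diff_moments:
  fixes s e :: real
  assumes r: "\<bar>u\<bar> + \<bar>v\<bar> + \<bar>d\<bar> \<le> \<rho>" "\<rho> \<le> 1/2"
  defines "\<zeta> \<equiv> \<lambda>e. kdev u v d s e - kdev 0 0 0 s e"
  shows "(LINT e|P. \<zeta> e) = 0" "(LINT e|P. (\<zeta> e)\<^sup>2) \<le> 3 * C * \<rho>" "\<bar>\<zeta> e\<bar> \<le> 1"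
proof -
  have r0: "0 \<le> \<rho>" using r by linarith
  define p where "p = kF u v d s - kF 0 0 0 s"
  define I where "I e = kN u v d s e - kN 0 0 0 s e" for e
  have \<zeta>: "\<zeta> e = I e - p" for e by (simp add: \<zeta>_def kdev_def I_def p_def)
  have pC: "\<bar>p\<bar> \<le> 3 * C * \<rho>"
    unfolding p_def kF_def using F_taylor(2)[OF r, of "q s"] r0 C_ge_1 by (auto simp: thr_def)
  have kint: "integrable P (kN u v d s)" for u v d
    by (rule P.integrable_const_bound[where B=1]) (auto simp: kN_01)
  have Iint: "integrable P I" unfolding I_def using kint by auto
  have EI: "(LINT e|P. I e) = p" unfolding I_def p_def using kint by (simp add: integral_kN)
  show "(LINT e|P. \<zeta> e) = 0" unfolding \<zeta> using Iint EI by (simp add: P.prob_space[simplified])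
  have sg: "(p \<ge> 0 \<and> (\<forall>e. I e = 0 \<or> I e = 1)) \<or> (p \<le> 0 \<and> (\<forall>e. I e = 0 \<or> I e = -1))"
  proof (cases "thr 0 0 0 (q s) \<le> thr u v d (q s)")
    case True
    then have "p \<ge> 0 \<and> (\<forall>e. I e = 0 \<or> I e = 1)"
      using F_mono[OF True] by (auto simp: p_def I_def kN_def kF_def)
    then show ?thesis ..
  next
    case False
    then have "p \<le> 0 \<and> (\<forall>e. I e = 0 \<or> I e = -1)"
      using F_mono[of "thr u v d (q s)" "thr 0 0 0 (q s)"] by (auto simp: p_def I_def kN_def kF_def)
    then show ?thesis ..
  qed
  have p1: "\<bar>p\<bar> \<le> 1" using kF_01[of u v d s] kF_01[of 0 0 0 s] by (simp add: p_def)
  show "\<bar>\<zeta> e\<bar> \<le> 1" unfolding \<zeta> using sg p1 by (elim disjE conjE) (auto dest!: spec[of _ e])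
  have sq: "(LINT e|P. (\<zeta> e)\<^sup>2) \<le> \<bar>p\<bar>"
    using sg
  proof (elim disjE conjE)
    assume p0: "0 \<le> p" and I: "\<forall>e. I e = 0 \<or> I e = 1"
    have "(\<zeta> e)\<^sup>2 = (1 - 2 * p) * I e + p\<^sup>2" for e
      using I[rule_format, of e] by (auto simp: \<zeta> power2_eq_square algebra_simps)
    then have "(LINT e|P. (\<zeta> e)\<^sup>2) = (1 - 2 * p) * p + p\<^sup>2"
      using Iint EI by (simp add: P.prob_space[simplified])
    also have "\<dots> = p - p * p" by (simp add: power2_eq_square algebra_simps)
    finally show ?thesis using p0 zero_le_square[of p] by linarith
  next
    assume p0: "p \<le> 0" and I: "\<forall>e. I e = 0 \<or> I e = -1"
    have "(\<zeta> e)\<^sup>2 = (- 1 - 2 * p) * I e + p\<^sup>2" for e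
      using I[rule_format, of e] by (auto simp: \<zeta> power2_eq_square algebra_simps)
    then have "(LINT e|P. (\<zeta> e)\<^sup>2) = (- 1 - 2 * p) * p + p\<^sup>2"
      using Iint EI by (simp add: P.prob_space[simplified])
    also have "\<dots> = - p - p * p" by (simp add: power2_eq_square algebra_simps)
    finally show ?thesis using p0 zero_le_square[of p] by linarith
  qed
  then show "(LINT e|P. (\<zeta> e)\<^sup>2) \<le> 3 * C * \<rho>" using pC by simp
qed

lemma kdev_moments:
  shows "(LINT e|P. kdev u v d s e) = 0" "(LINT e|P. (kdev u v d s e)\<^sup>2) \<le> 1" "\<bar>kdev u v d s e\<bar> \<le> 1"
proof -
  have kint: "integrable P (kN u v d s)"
    by (rule P.integrable_const_bound[where B=1]) (auto simp: kN_01)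
  show "(LINT e|P. kdev u v d s e) = 0"
    unfolding kdev_def using kint by (simp add: integral_kN P.prob_space[simplified])
  show b: "\<bar>kdev u v d s e\<bar> \<le> 1" for e
    using kN_01[of u v d s e] kF_01[of u v d s] by (simp add: kdev_def)
  have m: "kdev u v d s \<in> borel_measurable borel" unfolding kdev_def by measurable
  have "integrable P (\<lambda>e. (kdev u v d s e)\<^sup>2)"
    by (rule P.integrable_const_bound[where B=1]) (use b m in \<open>auto simp: abs_square_le_1\<close>)
  then have "(LINT e|P. (kdev u v d s e)\<^sup>2) \<le> (LINT e|P. 1)"
    by (intro integral_mono) (use b in \<open>auto simp: abs_square_le_1\<close>)
  then show "(LINT e|P. (kdev u v d s e)\<^sup>2) \<le> 1" by (simp add: P.prob_space[simplified])
qed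

end

context perturbation
begin

lemma chaining_event:
  "\<exists>A\<in>sets M. emeasure M A \<le> ennreal (8 * exp (12 * C\<^sup>2 * B) * (1/2)^k0) \<and>
     (\<forall>\<omega>\<in>space M - A. (\<Sum>i<n. (w i \<omega>)\<^sup>2) \<le> B \<longrightarrow>
        (\<forall>i<n. \<rho> i \<omega> \<le> 1/2 \<and> (w i \<omega>)\<^sup>2 + \<rho> i \<omega> * sqrt (\<rho> i \<omega>) \<le> (1/2)^k0) \<longrightarrow>
        (\<forall>x. \<bar>\<Sum>i<n. w i \<omega> * (dev (u i \<omega>) (v i \<omega>) (d i \<omega>) x (\<eta> i \<omega>) - kdev (u i \<omega>) (v i \<omega>) (d i \<omega>) (knot x k0) (\<eta> i \<omega>))\<bar>
           \<le> 2 * tail k0 + 48 * C\<^sup>2 * (\<Sum>i<n. w i \<omega> * ((w i \<omega>)\<^sup>2 + \<rho> i \<omega> * sqrt (\<rho> i \<omega>)))))"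
proof (rule bexI[OF _ bad_measurable[of k0 B]], intro conjI ballI impI allI)
  show "emeasure M (bad k0 B) \<le> ennreal (8 * exp (12 * C\<^sup>2 * B) * (1/2)^k0)"
    using bad_small by (simp add: c1_def)
next
  fix \<omega> x
  assume h: "\<omega> \<in> space M - bad k0 B" "(\<Sum>i<n. (w i \<omega>)\<^sup>2) \<le> B"
    "\<forall>i<n. \<rho> i \<omega> \<le> 1/2 \<and> (w i \<omega>)\<^sup>2 + \<rho> i \<omega> * sqrt (\<rho> i \<omega>) \<le> (1/2)^k0"
  have "\<bar>\<Sum>i<n. w i \<omega> * (fullD x i \<omega> - kD (knot x k0) i \<omega>)\<bar> \<le> 2 * tail k0 + 4 * c1 * (\<Sum>i<n. w i \<omega> * z i \<omega>)"
    by (rule chaining[of _ _ B]) (use h in \<open>auto simp: act_def z_def\<close>)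
  then show "\<bar>\<Sum>i<n. w i \<omega> * (dev (u i \<omega>) (v i \<omega>) (d i \<omega>) x (\<eta> i \<omega>) - kdev (u i \<omega>) (v i \<omega>) (d i \<omega>) (knot x k0) (\<eta> i \<omega>))\<bar>
           \<le> 2 * tail k0 + 48 * C\<^sup>2 * (\<Sum>i<n. w i \<omega> * ((w i \<omega>)\<^sup>2 + \<rho> i \<omega> * sqrt (\<rho> i \<omega>)))"
    by (simp add: fullD_def kD_def dev_def kdev_def c1_def z_def mult.assoc)
qed

end

context innovations
begin

lemma dev_0 [simp]: "dev 0 0 0 x e = of_bool (e \<le> x) - F x"
  by (simp add: dev_def thr_def)

text \<open>For fixed \<open>x\<close> no chaining is needed: Freedman's inequality, applied to the sum scaled by a large \<open>l\<close>
  and truncated where a weight exceeds \<open>1 / l\<close>, gives the claim.\<close>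

lemma martingale_sum_small:
  fixes w \<pi> :: "nat \<Rightarrow> nat \<Rightarrow> 'a \<Rightarrow> real" and \<zeta> :: "nat \<Rightarrow> nat \<Rightarrow> 'a \<Rightarrow> real \<Rightarrow> real"
  assumes wm: "\<And>n i. i < n \<Longrightarrow> w n i \<in> borel_measurable (G i)"
    and pm: "\<And>n i. i < n \<Longrightarrow> \<pi> n i \<in> borel_measurable (G i)"
    and zm: "\<And>n i. i < n \<Longrightarrow> (\<lambda>(\<omega>, e). \<zeta> n i \<omega> e) \<in> borel_measurable (G i \<Otimes>\<^sub>M borel)"
    and bound: "\<And>n i \<omega> e. i < n \<Longrightarrow> \<omega> \<in> space M \<Longrightarrow> \<bar>\<zeta> n i \<omega> e\<bar> \<le> 1"
    and mean: "\<And>n i \<omega>. i < n \<Longrightarrow> \<omega> \<in> space M \<Longrightarrow> (LINT e|P. \<zeta> n i \<omega> e) = 0"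
    and var: "\<And>n i \<omega>. i < n \<Longrightarrow> \<omega> \<in> space M \<Longrightarrow> (LINT e|P. (\<zeta> n i \<omega> e)\<^sup>2) \<le> \<pi> n i \<omega>"
    and wsmall: "\<And>a. 0 < a \<Longrightarrow> aas M (\<lambda>n \<omega>. \<forall>i<n. \<bar>w n i \<omega>\<bar> \<le> a)"
    and vsmall: "\<And>a. 0 < a \<Longrightarrow> aas M (\<lambda>n \<omega>. (\<Sum>i<n. (w n i \<omega>)\<^sup>2 * \<pi> n i \<omega>) \<le> a)"
    and e: "0 < e"
  shows "aas M (\<lambda>n \<omega>. \<bar>\<Sum>i<n. w n i \<omega> * \<zeta> n i \<omega> (\<eta> i \<omega>)\<bar> \<le> e)"
  unfolding aas_def
proof (intro allI impI)
  fix \<kappa> :: real assume \<kappa>: "\<kappa> > 0"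
  define l where "l = (2 + \<bar>ln (\<kappa>/4)\<bar>) / e"
  have l: "2 * exp (1 - l * e) < \<kappa> / 2" "l > 0"
  proof -
    have "1 - l * e < ln (\<kappa>/4)" using e by (simp add: l_def)
    then have "exp (1 - l * e) < \<kappa> / 4" using \<kappa> by (metis exp_less_cancel_iff exp_ln divide_pos_pos zero_less_numeral)
    then show "2 * exp (1 - l * e) < \<kappa> / 2" by simp
    show "l > 0" using e by (simp add: l_def add_pos_nonneg)
  qed
  have 1: "whp M (\<kappa>/2) (\<lambda>n \<omega>. (\<forall>i<n. \<bar>w n i \<omega>\<bar> \<le> 1 / l) \<and> (\<Sum>i<n. (w n i \<omega>)\<^sup>2 * \<pi> n i \<omega>) \<le> 1 / l\<^sup>2)"
    using l(2) \<kappa> by (intro aasD aas_conj wsmall vsmall) auto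
  have 2: "whp M (\<kappa>/2) (\<lambda>n \<omega>. (\<forall>i<n. \<bar>w n i \<omega>\<bar> \<le> 1 / l) \<and> (\<Sum>i<n. (w n i \<omega>)\<^sup>2 * \<pi> n i \<omega>) \<le> 1 / l\<^sup>2
       \<longrightarrow> \<bar>\<Sum>i<n. w n i \<omega> * \<zeta> n i \<omega> (\<eta> i \<omega>)\<bar> \<le> e)"
  proof (rule whp_set, rule always_eventually, rule allI)
    fix n
    define a where "a i \<omega> = l * w n i \<omega> * of_bool (\<bar>w n i \<omega>\<bar> \<le> 1 / l)" for i \<omega>
    define g where "g i \<omega> x = a i \<omega> * \<zeta> n i \<omega> x" for i \<omega> x
    define V where "V i \<omega> = (a i \<omega>)\<^sup>2 * \<pi> n i \<omega>" for i \<omega>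
    have a1: "\<bar>a i \<omega>\<bar> \<le> 1" for i \<omega>
      using l(2) by (auto simp: a_def abs_mult field_simps)
    have am: "a i \<in> borel_measurable (G i)" if "i < n" for i
      using wm[OF that] unfolding a_def by measurable
    have gm: "(\<lambda>(\<omega>, x). g i \<omega> x) \<in> borel_measurable (G i \<Otimes>\<^sub>M borel)" if "i < n" for i
    proof -
      note [measurable] = am[OF that] zm[OF that]
      have "(\<lambda>z. a i (fst z) * (\<lambda>(\<omega>, x). \<zeta> n i \<omega> x) z) \<in> borel_measurable (G i \<Otimes>\<^sub>M borel)" by measurable
      then show ?thesis by (simp add: g_def split_def)
    qed
    have Vm: "V i \<in> borel_measurable (G i)" if "i < n" for i
      using am[OF that] pm[OF that] unfolding V_def by measurable
    have gb: "\<bar>g i \<omega> x\<bar> \<le> 1" if "i < n" "\<omega> \<in> space M" for i \<omega> x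
      unfolding g_def abs_mult using a1[of i \<omega>] bound[OF that] by (simp add: mult_le_one)
    have gmean: "(LINT x|P. g i \<omega> x) = 0" if "i < n" "\<omega> \<in> space M" for i \<omega>
      using mean[OF that] by (simp add: g_def)
    have gvar: "(LINT x|P. (g i \<omega> x)\<^sup>2) \<le> V i \<omega>" if "i < n" "\<omega> \<in> space M" for i \<omega>
      using var[OF that] by (simp add: g_def V_def power_mult_distrib mult_left_mono)
    let ?A = "{\<omega> \<in> space M. \<bar>\<Sum>i<n. g i \<omega> (\<eta> i \<omega>)\<bar> > l * e \<and> (\<Sum>i<n. V i \<omega>) \<le> 1}"
    have "emeasure M ?A \<le> ennreal (2 * exp (1 - l * e))"
      by (rule freedman(1)[OF gm Vm gb gmean gvar])
    also have "\<dots> \<le> ennreal (\<kappa>/2)" using l(1) by (intro ennreal_leI) simp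
    finally have A: "emeasure M ?A \<le> ennreal (\<kappa>/2)" .
    have [measurable]: "(\<lambda>\<omega>. \<Sum>i<n. g i \<omega> (\<eta> i \<omega>)) \<in> borel_measurable M"
      by (rule freedman(2)[OF gm Vm gb gmean gvar])
    have [measurable]: "(\<lambda>\<omega>. \<Sum>i<n. V i \<omega>) \<in> borel_measurable M"
      by (intro borel_measurable_sum measurable_G_M[OF Vm]) auto
    have Am: "?A \<in> sets M" by measurable
    show "\<exists>A\<in>sets M. emeasure M A \<le> ennreal (\<kappa> / 2) \<and>
      (\<forall>\<omega>\<in>space M - A. (\<forall>i<n. \<bar>w n i \<omega>\<bar> \<le> 1 / l) \<and> (\<Sum>i<n. (w n i \<omega>)\<^sup>2 * \<pi> n i \<omega>) \<le> 1 / l\<^sup>2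
       \<longrightarrow> \<bar>\<Sum>i<n. w n i \<omega> * \<zeta> n i \<omega> (\<eta> i \<omega>)\<bar> \<le> e)"
    proof (intro bexI[OF _ Am] conjI A ballI impI)
      fix \<omega> assume \<omega>: "\<omega> \<in> space M - ?A"
        and h: "(\<forall>i<n. \<bar>w n i \<omega>\<bar> \<le> 1 / l) \<and> (\<Sum>i<n. (w n i \<omega>)\<^sup>2 * \<pi> n i \<omega>) \<le> 1 / l\<^sup>2"
      have ai: "a i \<omega> = l * w n i \<omega>" if "i < n" for i using h that by (simp add: a_def)
      have "(\<Sum>i<n. V i \<omega>) = l\<^sup>2 * (\<Sum>i<n. (w n i \<omega>)\<^sup>2 * \<pi> n i \<omega>)"
        unfolding sum_distrib_left by (intro sum.cong refl) (simp add: V_def ai power_mult_distrib)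
      also have "\<dots> \<le> l\<^sup>2 * (1 / l\<^sup>2)" using h by (intro mult_left_mono) auto
      also have "\<dots> = 1" using l(2) by simp
      finally have "\<bar>\<Sum>i<n. g i \<omega> (\<eta> i \<omega>)\<bar> \<le> l * e" using \<omega> by auto
      moreover have "(\<Sum>i<n. g i \<omega> (\<eta> i \<omega>)) = l * (\<Sum>i<n. w n i \<omega> * \<zeta> n i \<omega> (\<eta> i \<omega>))"
        unfolding sum_distrib_left by (intro sum.cong refl) (simp add: g_def ai)
      ultimately show "\<bar>\<Sum>i<n. w n i \<omega> * \<zeta> n i \<omega> (\<eta> i \<omega>)\<bar> \<le> e"
        using l(2) by (simp add: abs_mult)
    qed
  qed
  have "whp M (\<kappa>/2 + \<kappa>/2) (\<lambda>n \<omega>. ((\<forall>i<n. \<bar>w n i \<omega>\<bar> \<le> 1 / l) \<and> (\<Sum>i<n. (w n i \<omega>)\<^sup>2 * \<pi> n i \<omega>) \<le> 1 / l\<^sup>2) \<and>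
     ((\<forall>i<n. \<bar>w n i \<omega>\<bar> \<le> 1 / l) \<and> (\<Sum>i<n. (w n i \<omega>)\<^sup>2 * \<pi> n i \<omega>) \<le> 1 / l\<^sup>2
       \<longrightarrow> \<bar>\<Sum>i<n. w n i \<omega> * \<zeta> n i \<omega> (\<eta> i \<omega>)\<bar> \<le> e))"
    using \<kappa> by (intro whp_conj 1 2) auto
  then show "whp M \<kappa> (\<lambda>n \<omega>. \<bar>\<Sum>i<n. w n i \<omega> * \<zeta> n i \<omega> (\<eta> i \<omega>)\<bar> \<le> e)"
    by (auto elim: whp_impI)
qed

abbreviation pdev where "pdev u v d n i \<omega> \<equiv> dev (u n i \<omega>) (v n i \<omega>) (d n i \<omega>)"
abbreviation pkdev where "pkdev u v d n i \<omega> \<equiv> kdev (u n i \<omega>) (v n i \<omega>) (d n i \<omega>)"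

text \<open>Chaining down to a fixed level \<open>k\<close>: the weighted process is approximated uniformly in \<open>x\<close> by its
  values at finitely many knots. For \<open>k\<close> large the bad event and the tail of the chain are small, and
  for \<open>n\<close> large all summands are active at level \<open>k\<close>.\<close>

lemma knot_approximation:
  fixes w u v d \<rho> :: "nat \<Rightarrow> nat \<Rightarrow> 'a \<Rightarrow> real"
  assumes pert: "\<And>n. perturbation f C M G \<eta> n (w n) (u n) (v n) (d n) (\<rho> n)"
    and w: "null_array M w" and r: "null_array M \<rho>" and e: "0 < e" and \<kappa>: "0 < \<kappa>"
  shows "\<exists>K. \<forall>k\<ge>K. whp M \<kappa> (\<lambda>n \<omega>. \<forall>x. \<bar>\<Sum>i<n. w n i \<omega> *
     (pdev u v d n i \<omega> x (\<eta> i \<omega>) - pkdev u v d n i \<omega> (knot x k) (\<eta> i \<omega>))\<bar> \<le> e)"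
proof -
  obtain B where B: "B > 0" "whp M (\<kappa>/4) (\<lambda>n \<omega>. sq_sum w n \<omega> \<le> B)"
    using null_array_tight[OF w, of "\<kappa>/4"] \<kappa> by auto
  have "(\<lambda>k. 8 * exp (12 * C\<^sup>2 * B) * (1/2)^k) \<longlonglongrightarrow> 8 * exp (12 * C\<^sup>2 * B) * 0"
    by (intro tendsto_intros LIMSEQ_power_zero) simp
  then have lim: "(\<lambda>k. 8 * exp (12 * C\<^sup>2 * B) * (1/2)^k) \<longlonglongrightarrow> 0" by simp
  have "\<forall>\<^sub>F k in sequentially. 8 * exp (12 * C\<^sup>2 * B) * (1/2)^k < \<kappa> / 4"
    using \<kappa> by (intro order_tendstoD(2)[OF lim]) simp
  moreover have "\<forall>\<^sub>F k in sequentially. tail k < e / 4"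
    using e by (intro order_tendstoD(2)[OF tail_tendsto_0]) auto
  ultimately have "\<forall>\<^sub>F k in sequentially. 8 * exp (12 * C\<^sup>2 * B) * (1/2)^k < \<kappa> / 4 \<and> tail k < e / 4"
    by (rule eventually_conj)
  then obtain K where K: "\<And>k. k \<ge> K \<Longrightarrow> 8 * exp (12 * C\<^sup>2 * B) * (1/2)^k < \<kappa> / 4 \<and> tail k < e / 4"
    by (auto simp: eventually_sequentially)
  have C0: "C > 0" using C_ge_1 by simp
  have nn: "0 \<le> w n i \<omega> \<and> 0 \<le> \<rho> n i \<omega>" if "i < n" "\<omega> \<in> space M" for n i \<omega>
    using perturbation.w_nonneg[OF pert that] perturbation.\<rho>_nonneg[OF pert that] by simp
  show ?thesis
  proof (intro exI allI impI)
    fix k assume k: "K \<le> k"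
    let ?Q = "\<lambda>n \<omega>. cubic_sum w \<rho> n \<omega> \<le> e / (96 * C\<^sup>2)"
    let ?S = "\<lambda>n \<omega>. \<forall>i<n. \<rho> n i \<omega> \<le> 1/2 \<and> (w n i \<omega>)\<^sup>2 + \<rho> n i \<omega> * sqrt (\<rho> n i \<omega>) \<le> (1/2)^k"
    let ?W = "\<lambda>n \<omega>. sq_sum w n \<omega> \<le> B"
    let ?Z = "\<lambda>n \<omega> x. \<bar>\<Sum>i<n. w n i \<omega> * (pdev u v d n i \<omega> x (\<eta> i \<omega>) - pkdev u v d n i \<omega> (knot x k) (\<eta> i \<omega>))\<bar>"
    let ?E = "\<lambda>n \<omega>. ?W n \<omega> \<longrightarrow> ?S n \<omega> \<longrightarrow> (\<forall>x. ?Z n \<omega> x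
       \<le> 2 * tail k + 48 * C\<^sup>2 * cubic_sum w \<rho> n \<omega>)"
    have Q: "aas M ?Q" using e C0 nn by (intro null_array_cubic[OF w r]) auto
    have S: "aas M ?S"
    proof -
      have "((\<lambda>a. a\<^sup>2 + a * sqrt a) \<longlongrightarrow> 0\<^sup>2 + 0 * sqrt 0) (at_right (0::real))"
        by (intro tendsto_intros)
      then have "\<forall>\<^sub>F a in at_right (0::real). a\<^sup>2 + a * sqrt a < (1/2)^k"
        by (intro order_tendstoD(2)) auto
      then have "\<forall>\<^sub>F a in at_right (0::real). a\<^sup>2 + a * sqrt a < (1/2)^k \<and> 0 < a"
        using eventually_at_right_less by (rule eventually_conj)
      then obtain a0 :: real where a0: "a0\<^sup>2 + a0 * sqrt a0 < (1/2)^k" "0 < a0"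
        using eventually_happens[of _ "at_right (0::real)"] by auto
      define a where "a = min a0 (1/2)"
      have a: "0 < a" "a \<le> 1/2" "a \<le> a0" using a0 by (auto simp: a_def)
      have "a\<^sup>2 + a * sqrt a \<le> a0\<^sup>2 + a0 * sqrt a0"
        using a by (intro add_mono power_mono mult_mono) auto
      then have a': "a\<^sup>2 + a * sqrt a \<le> (1/2)^k" using a0 by simp
      have "aas M (\<lambda>n \<omega>. (\<forall>i<n. \<bar>w n i \<omega>\<bar> \<le> a) \<and> (\<forall>i<n. \<bar>\<rho> n i \<omega>\<bar> \<le> a))"
        by (intro aas_conj null_array_small w r a)
      then show ?thesis
      proof (rule aas_impI, intro allI impI conjI)
        fix n \<omega> i assume h: "\<omega> \<in> space M" "(\<forall>i<n. \<bar>w n i \<omega>\<bar> \<le> a) \<and> (\<forall>i<n. \<bar>\<rho> n i \<omega>\<bar> \<le> a)" "i < n"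
        then have p: "0 \<le> w n i \<omega>" "0 \<le> \<rho> n i \<omega>" "w n i \<omega> \<le> a" "\<rho> n i \<omega> \<le> a" using nn[of i n \<omega>] by auto
        then show "\<rho> n i \<omega> \<le> 1/2" using a by simp
        have "(w n i \<omega>)\<^sup>2 + \<rho> n i \<omega> * sqrt (\<rho> n i \<omega>) \<le> a\<^sup>2 + a * sqrt a"
          using p a by (intro add_mono power_mono mult_mono) auto
        then show "(w n i \<omega>)\<^sup>2 + \<rho> n i \<omega> * sqrt (\<rho> n i \<omega>) \<le> (1/2)^k" using a' by simp
      qed
    qed
    have E: "whp M (\<kappa>/4) ?E"
    proof (rule whp_set, rule always_eventually, rule allI)
      fix n
      have le: "ennreal (8 * exp (12 * C\<^sup>2 * B) * (1/2)^k) \<le> ennreal (\<kappa> / 4)"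
        using K[OF k] by (intro ennreal_leI) simp
      from perturbation.chaining_event[OF pert[of n], of B k]
      show "\<exists>A\<in>sets M. emeasure M A \<le> ennreal (\<kappa> / 4) \<and> (\<forall>\<omega>\<in>space M - A. ?E n \<omega>)"
        using le by (meson order_trans)
    qed
    have "whp M ((\<kappa>/4 + \<kappa>/4) + \<kappa>/2) (\<lambda>n \<omega>. (?W n \<omega> \<and> ?E n \<omega>) \<and> (?Q n \<omega> \<and> ?S n \<omega>))"
      using \<kappa> by (intro whp_conj B(2) E aasD[OF aas_conj[OF Q S]]) auto
    then have "whp M \<kappa> (\<lambda>n \<omega>. (?W n \<omega> \<and> ?E n \<omega>) \<and> (?Q n \<omega> \<and> ?S n \<omega>))" by simp
    then show "whp M \<kappa> (\<lambda>n \<omega>. \<forall>x. ?Z n \<omega> x \<le> e)"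
    proof (rule whp_impI, intro allI)
      fix n \<omega> x assume h: "(?W n \<omega> \<and> ?E n \<omega>) \<and> (?Q n \<omega> \<and> ?S n \<omega>)"
      then have "?Z n \<omega> x \<le> 2 * tail k + 48 * C\<^sup>2 * cubic_sum w \<rho> n \<omega>"
        by blast
      also have "\<dots> \<le> 2 * (e/4) + 48 * C\<^sup>2 * (e / (96 * C\<^sup>2))"
        using h K[OF k] by (intro add_mono mult_left_mono) auto
      also have "\<dots> = e" using C0 by (simp add: field_simps)
      finally show "?Z n \<omega> x \<le> e" .
    qed
  qed
qed

text \<open>Both the perturbed and the unperturbed process are close to their values at finitely many
  knots, and at each knot the difference is a martingale sum with vanishing conditional variance.\<close>

theorem perturbed_process:
  fixes w u v d \<rho> :: "nat \<Rightarrow> nat \<Rightarrow> 'a \<Rightarrow> real"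
  assumes pert: "\<And>n. perturbation f C M G \<eta> n (w n) (u n) (v n) (d n) (\<rho> n)"
    and w: "null_array M w" and r: "null_array M \<rho>" and e: "0 < e"
  shows "aas M (\<lambda>n \<omega>. \<forall>x. \<bar>\<Sum>i<n. w n i \<omega> *
     (pdev u v d n i \<omega> x (\<eta> i \<omega>) - dev 0 0 0 x (\<eta> i \<omega>))\<bar> \<le> e)"
  unfolding aas_def
proof (intro allI impI)
  fix \<kappa> :: real assume \<kappa>: "0 < \<kappa>"
  interpret p: perturbation f C M G \<eta> n "w n" "u n" "v n" "d n" "\<rho> n" for n by (rule pert)
  have pert0: "perturbation f C M G \<eta> n (w n) (\<lambda>_ _. 0) (\<lambda>_ _. 0) (\<lambda>_ _. 0) (\<rho> n)" for n
    by unfold_locales (auto simp: p.w_meas p.\<rho>_meas p.w_nonneg p.\<rho>_nonneg)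
  obtain K1 where K1: "\<And>k. k \<ge> K1 \<Longrightarrow> whp M (\<kappa>/4) (\<lambda>n \<omega>. \<forall>x. \<bar>\<Sum>i<n. w n i \<omega> *
     (pdev u v d n i \<omega> x (\<eta> i \<omega>) - pkdev u v d n i \<omega> (knot x k) (\<eta> i \<omega>))\<bar> \<le> e/3)"
    using knot_approximation[OF pert w r, of "e/3" "\<kappa>/4"] e \<kappa> by auto
  obtain K2 where K2: "\<And>k. k \<ge> K2 \<Longrightarrow> whp M (\<kappa>/4) (\<lambda>n \<omega>. \<forall>x. \<bar>\<Sum>i<n. w n i \<omega> *
     (dev 0 0 0 x (\<eta> i \<omega>) - kdev 0 0 0 (knot x k) (\<eta> i \<omega>))\<bar> \<le> e/3)"
    using knot_approximation[OF pert0 w r, of "e/3" "\<kappa>/4"] e \<kappa> by (auto simp del: dev_0)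
  define k where "k = max K1 K2"
  have base: "aas M (\<lambda>n \<omega>. \<bar>\<Sum>i<n. w n i \<omega> * (pkdev u v d n i \<omega> s (\<eta> i \<omega>) - kdev 0 0 0 s (\<eta> i \<omega>))\<bar> \<le> e/3)" for s
  proof -
    let ?z = "\<lambda>n i \<omega> x. of_bool (\<rho> n i \<omega> \<le> 1/2) * (pkdev u v d n i \<omega> s x - kdev 0 0 0 s x)"
    have "aas M (\<lambda>n \<omega>. \<bar>\<Sum>i<n. w n i \<omega> * ?z n i \<omega> (\<eta> i \<omega>)\<bar> \<le> e/3)"
    proof (rule martingale_sum_small[where \<pi>="\<lambda>n i \<omega>. 3 * C * \<rho> n i \<omega>"])
      fix n i :: nat assume i: "i < n"
      note [measurable] = p.w_meas[OF i] p.u_meas[OF i] p.v_meas[OF i] p.d_meas[OF i] p.\<rho>_meas[OF i]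
      show "w n i \<in> borel_measurable (G i)" "(\<lambda>\<omega>. 3 * C * \<rho> n i \<omega>) \<in> borel_measurable (G i)" by measurable
      show "(\<lambda>(\<omega>, x). ?z n i \<omega> x) \<in> borel_measurable (G i \<Otimes>\<^sub>M borel)"
        unfolding kdev_def kN_def kF_def thr_def by measurable
      fix \<omega> assume \<omega>: "\<omega> \<in> space M"
      note m = kdev_diff_moments[OF p.uvd_le[OF i \<omega>]]
      show "\<bar>?z n i \<omega> x\<bar> \<le> 1" for x using m(3)[of s x] by auto
      show "(LINT x|P. ?z n i \<omega> x) = 0" using m(1)[of s] by auto
      have "0 \<le> 3 * C * \<rho> n i \<omega>" using C_ge_1 p.\<rho>_nonneg[OF i \<omega>] by simp
      then show "(LINT x|P. (?z n i \<omega> x)\<^sup>2) \<le> 3 * C * \<rho> n i \<omega>" using m(2)[of s] by auto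
    next
      fix a :: real assume a: "0 < a"
      show "aas M (\<lambda>n \<omega>. \<forall>i<n. \<bar>w n i \<omega>\<bar> \<le> a)" using w a by (rule null_array_small)
      show "aas M (\<lambda>n \<omega>. (\<Sum>i<n. (w n i \<omega>)\<^sup>2 * (3 * C * \<rho> n i \<omega>)) \<le> a)"
        unfolding aas_def
      proof (intro allI impI)
        fix \<kappa> :: real assume \<kappa>: "0 < \<kappa>"
        obtain B where B: "B > 0" "whp M (\<kappa>/2) (\<lambda>n \<omega>. sq_sum w n \<omega> \<le> B)"
          using null_array_tight[OF w, of "\<kappa>/2"] \<kappa> by auto
        have "whp M (\<kappa>/2 + \<kappa>/2) (\<lambda>n \<omega>. sq_sum w n \<omega> \<le> B \<and> (\<forall>i<n. \<bar>\<rho> n i \<omega>\<bar> \<le> a / (3 * C * B)))"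
          using \<kappa> a B C_ge_1 by (intro whp_conj B(2) aasD[OF null_array_small[OF r]]) auto
        then have "whp M \<kappa> (\<lambda>n \<omega>. sq_sum w n \<omega> \<le> B \<and> (\<forall>i<n. \<bar>\<rho> n i \<omega>\<bar> \<le> a / (3 * C * B)))" by simp
        then show "whp M \<kappa> (\<lambda>n \<omega>. (\<Sum>i<n. (w n i \<omega>)\<^sup>2 * (3 * C * \<rho> n i \<omega>)) \<le> a)"
        proof (rule whp_impI)
          fix n \<omega> assume h: "sq_sum w n \<omega> \<le> B \<and> (\<forall>i<n. \<bar>\<rho> n i \<omega>\<bar> \<le> a / (3 * C * B))"
          have "(\<Sum>i<n. (w n i \<omega>)\<^sup>2 * (3 * C * \<rho> n i \<omega>)) \<le> (\<Sum>i<n. (w n i \<omega>)\<^sup>2 * (3 * C * (a / (3 * C * B))))"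
            using h C_ge_1 by (intro sum_mono mult_left_mono) (auto simp: abs_le_iff)
          also have "\<dots> = sq_sum w n \<omega> * (a / B)"
            unfolding sum_distrib_right using C_ge_1 by (intro sum.cong refl) simp
          also have "\<dots> \<le> B * (a / B)" using h a B by (intro mult_right_mono) auto
          also have "\<dots> = a" using B by simp
          finally show "(\<Sum>i<n. (w n i \<omega>)\<^sup>2 * (3 * C * \<rho> n i \<omega>)) \<le> a" .
        qed
      qed
    qed (use e in simp)
    moreover have "aas M (\<lambda>n \<omega>. \<forall>i<n. \<bar>\<rho> n i \<omega>\<bar> \<le> 1/2)" by (rule null_array_small[OF r]) simp
    ultimately have "aas M (\<lambda>n \<omega>. \<bar>\<Sum>i<n. w n i \<omega> * ?z n i \<omega> (\<eta> i \<omega>)\<bar> \<le> e/3 \<and> (\<forall>i<n. \<bar>\<rho> n i \<omega>\<bar> \<le> 1/2))"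
      by (rule aas_conj)
    then show ?thesis
    proof (rule aas_impI)
      fix n \<omega> assume h: "\<bar>\<Sum>i<n. w n i \<omega> * ?z n i \<omega> (\<eta> i \<omega>)\<bar> \<le> e/3 \<and> (\<forall>i<n. \<bar>\<rho> n i \<omega>\<bar> \<le> 1/2)"
      have "(\<Sum>i<n. w n i \<omega> * ?z n i \<omega> (\<eta> i \<omega>)) = (\<Sum>i<n. w n i \<omega> * (pkdev u v d n i \<omega> s (\<eta> i \<omega>) - kdev 0 0 0 s (\<eta> i \<omega>)))"
        using h by (intro sum.cong refl) (auto simp: abs_le_iff)
      then show "\<bar>\<Sum>i<n. w n i \<omega> * (pkdev u v d n i \<omega> s (\<eta> i \<omega>) - kdev 0 0 0 s (\<eta> i \<omega>))\<bar> \<le> e/3"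
        using h by simp
    qed
  qed
  have "aas M (\<lambda>n \<omega>. \<forall>s\<in>(\<lambda>j. real j / 2^k) ` {..<2^k}. \<bar>\<Sum>i<n. w n i \<omega> * (pkdev u v d n i \<omega> s (\<eta> i \<omega>) - kdev 0 0 0 s (\<eta> i \<omega>))\<bar> \<le> e/3)"
    by (intro aas_finite_ball base) auto
  then have "whp M ((\<kappa>/4 + \<kappa>/4) + \<kappa>/2) (\<lambda>n \<omega>. ((\<forall>x. \<bar>\<Sum>i<n. w n i \<omega> *
     (pdev u v d n i \<omega> x (\<eta> i \<omega>) - pkdev u v d n i \<omega> (knot x k) (\<eta> i \<omega>))\<bar> \<le> e/3)
     \<and> (\<forall>x. \<bar>\<Sum>i<n. w n i \<omega> *
     (dev 0 0 0 x (\<eta> i \<omega>) - kdev 0 0 0 (knot x k) (\<eta> i \<omega>))\<bar> \<le> e/3))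
     \<and> (\<forall>s\<in>(\<lambda>j. real j / 2^k) ` {..<2^k}. \<bar>\<Sum>i<n. w n i \<omega> * (pkdev u v d n i \<omega> s (\<eta> i \<omega>) - kdev 0 0 0 s (\<eta> i \<omega>))\<bar> \<le> e/3))"
    using \<kappa> by (intro whp_conj K1 K2 aasD) (auto simp: k_def)
  then show "whp M \<kappa> (\<lambda>n \<omega>. \<forall>x. \<bar>\<Sum>i<n. w n i \<omega> *
     (pdev u v d n i \<omega> x (\<eta> i \<omega>) - dev 0 0 0 x (\<eta> i \<omega>))\<bar> \<le> e)"
    unfolding field_sum_of_halves[of "\<kappa>/2", simplified]
  proof (elim whp_mono, goal_cases)
    case 1 then show ?case by simp
  next
    case 2
    show ?case
    proof (intro always_eventually allI ballI impI, elim conjE)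
      fix n \<omega> x
      let ?A = "\<lambda>i. pdev u v d n i \<omega> x (\<eta> i \<omega>)"
      let ?B = "\<lambda>i. pkdev u v d n i \<omega> (knot x k) (\<eta> i \<omega>)"
      let ?Az = "\<lambda>i. dev 0 0 0 x (\<eta> i \<omega>)"
      let ?Bz = "\<lambda>i. kdev 0 0 0 (knot x k) (\<eta> i \<omega>)"
      assume h: "\<forall>x. \<bar>\<Sum>i<n. w n i \<omega> * (pdev u v d n i \<omega> x (\<eta> i \<omega>) - pkdev u v d n i \<omega> (knot x k) (\<eta> i \<omega>))\<bar> \<le> e/3"
        "\<forall>x. \<bar>\<Sum>i<n. w n i \<omega> * (dev 0 0 0 x (\<eta> i \<omega>) - kdev 0 0 0 (knot x k) (\<eta> i \<omega>))\<bar> \<le> e/3"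
        "\<forall>s\<in>(\<lambda>j. real j / 2^k) ` {..<2^k}. \<bar>\<Sum>i<n. w n i \<omega> * (pkdev u v d n i \<omega> s (\<eta> i \<omega>) - kdev 0 0 0 s (\<eta> i \<omega>))\<bar> \<le> e/3"
      have "knot x k \<in> (\<lambda>j. real j / 2^k) ` {..<2^k}" using path_less[of x k] by (auto simp: knot_def)
      with h(3) have 3: "\<bar>\<Sum>i<n. w n i \<omega> * (?B i - ?Bz i)\<bar> \<le> e/3" by blast
      have "(\<Sum>i<n. w n i \<omega> * (?A i - ?Az i)) = (\<Sum>i<n. w n i \<omega> * (?A i - ?B i)) + (\<Sum>i<n. w n i \<omega> * (?B i - ?Bz i)) - (\<Sum>i<n. w n i \<omega> * (?Az i - ?Bz i))"
        unfolding sum.distrib[symmetric] sum_subtractf[symmetric] by (intro sum.cong refl) (simp add: algebra_simps)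
      then show "\<bar>\<Sum>i<n. w n i \<omega> * (?A i - ?Az i)\<bar> \<le> e"
        using 3 h(1)[rule_format, of x] h(2)[rule_format, of x] by linarith
    qed
  qed
qed

text \<open>If the square sums of the weights tend to 0, the values at the knots are negligible by themselves.\<close>

theorem process_small:
  fixes w :: "nat \<Rightarrow> nat \<Rightarrow> 'a \<Rightarrow> real"
  assumes wm: "\<And>n i. i < n \<Longrightarrow> w n i \<in> borel_measurable (G i)"
    and w0: "\<And>n i \<omega>. i < n \<Longrightarrow> \<omega> \<in> space M \<Longrightarrow> 0 \<le> w n i \<omega>"
    and w: "null_array M w" and sq: "\<And>a. 0 < a \<Longrightarrow> aas M (\<lambda>n \<omega>. sq_sum w n \<omega> \<le> a)" and e: "0 < e"
  shows "aas M (\<lambda>n \<omega>. \<forall>x. \<bar>\<Sum>i<n. w n i \<omega> * dev 0 0 0 x (\<eta> i \<omega>)\<bar> \<le> e)"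
  unfolding aas_def
proof (intro allI impI)
  fix \<kappa> :: real assume \<kappa>: "0 < \<kappa>"
  have pert0: "perturbation f C M G \<eta> n (w n) (\<lambda>_ _. 0) (\<lambda>_ _. 0) (\<lambda>_ _. 0) (w n)" for n
    by unfold_locales (auto simp: wm w0)
  obtain k where k: "whp M (\<kappa>/2) (\<lambda>n \<omega>. \<forall>x. \<bar>\<Sum>i<n. w n i \<omega> *
     (dev 0 0 0 x (\<eta> i \<omega>) - kdev 0 0 0 (knot x k) (\<eta> i \<omega>))\<bar> \<le> e/2)"
    using knot_approximation[OF pert0 w w, of "e/2" "\<kappa>/2"] e \<kappa> by (auto simp del: dev_0)
  have base: "aas M (\<lambda>n \<omega>. \<bar>\<Sum>i<n. w n i \<omega> * kdev 0 0 0 s (\<eta> i \<omega>)\<bar> \<le> e/2)" for s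
  proof (rule martingale_sum_small[where \<pi>="\<lambda>n i \<omega>. 1"])
    show "(\<lambda>(\<omega>, x). kdev 0 0 0 s x) \<in> borel_measurable (G i \<Otimes>\<^sub>M borel)" for i
      unfolding kdev_def by measurable
  qed (use wm kdev_moments null_array_small[OF w] sq e in auto)
  have "aas M (\<lambda>n \<omega>. \<forall>s\<in>(\<lambda>j. real j / 2^k) ` {..<2^k}. \<bar>\<Sum>i<n. w n i \<omega> * kdev 0 0 0 s (\<eta> i \<omega>)\<bar> \<le> e/2)"
    by (intro aas_finite_ball base) auto
  then have "whp M (\<kappa>/2 + \<kappa>/2) (\<lambda>n \<omega>. (\<forall>x. \<bar>\<Sum>i<n. w n i \<omega> *
     (dev 0 0 0 x (\<eta> i \<omega>) - kdev 0 0 0 (knot x k) (\<eta> i \<omega>))\<bar> \<le> e/2)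
     \<and> (\<forall>s\<in>(\<lambda>j. real j / 2^k) ` {..<2^k}. \<bar>\<Sum>i<n. w n i \<omega> * kdev 0 0 0 s (\<eta> i \<omega>)\<bar> \<le> e/2))"
    using \<kappa> by (intro whp_conj k aasD) auto
  then have "whp M \<kappa> (\<lambda>n \<omega>. (\<forall>x. \<bar>\<Sum>i<n. w n i \<omega> *
     (dev 0 0 0 x (\<eta> i \<omega>) - kdev 0 0 0 (knot x k) (\<eta> i \<omega>))\<bar> \<le> e/2)
     \<and> (\<forall>s\<in>(\<lambda>j. real j / 2^k) ` {..<2^k}. \<bar>\<Sum>i<n. w n i \<omega> * kdev 0 0 0 s (\<eta> i \<omega>)\<bar> \<le> e/2))" by simp
  then show "whp M \<kappa> (\<lambda>n \<omega>. \<forall>x. \<bar>\<Sum>i<n. w n i \<omega> * dev 0 0 0 x (\<eta> i \<omega>)\<bar> \<le> e)"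
  proof (rule whp_impI, intro allI, elim conjE)
    fix n \<omega> x
    let ?Az = "\<lambda>i. dev 0 0 0 x (\<eta> i \<omega>)"
    let ?Bz = "\<lambda>i. kdev 0 0 0 (knot x k) (\<eta> i \<omega>)"
    assume h: "\<forall>x. \<bar>\<Sum>i<n. w n i \<omega> * (dev 0 0 0 x (\<eta> i \<omega>) - kdev 0 0 0 (knot x k) (\<eta> i \<omega>))\<bar> \<le> e/2"
      "\<forall>s\<in>(\<lambda>j. real j / 2^k) ` {..<2^k}. \<bar>\<Sum>i<n. w n i \<omega> * kdev 0 0 0 s (\<eta> i \<omega>)\<bar> \<le> e/2"
    have "knot x k \<in> (\<lambda>j. real j / 2^k) ` {..<2^k}" using path_less[of x k] by (auto simp: knot_def)
    with h(2) have 2: "\<bar>\<Sum>i<n. w n i \<omega> * ?Bz i\<bar> \<le> e/2" by blast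
    have "(\<Sum>i<n. w n i \<omega> * ?Az i) = (\<Sum>i<n. w n i \<omega> * (?Az i - ?Bz i)) + (\<Sum>i<n. w n i \<omega> * ?Bz i)"
      unfolding sum.distrib[symmetric] by (intro sum.cong refl) (simp add: algebra_simps)
    then show "\<bar>\<Sum>i<n. w n i \<omega> * ?Az i\<bar> \<le> e" using 2 h(1)[rule_format, of x] by linarith
  qed
qed

text \<open>The centring of the perturbed process is replaced by its Taylor polynomial, with cubic total error.\<close>

theorem perturbed_expansion:
  fixes w u v d \<rho> :: "nat \<Rightarrow> nat \<Rightarrow> 'a \<Rightarrow> real"
  assumes pert: "\<And>n. perturbation f C M G \<eta> n (w n) (u n) (v n) (d n) (\<rho> n)"
    and w: "null_array M w" and r: "null_array M \<rho>" and e: "0 < e"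
  shows "aas M (\<lambda>n \<omega>. \<forall>x. \<bar>(\<Sum>i<n. w n i \<omega> * (of_bool (\<eta> i \<omega> \<le> thr (u n i \<omega>) (v n i \<omega>) (d n i \<omega>) x) - F x))
      - (\<Sum>i<n. w n i \<omega> * (of_bool (\<eta> i \<omega> \<le> x) - F x))
      - (\<Sum>i<n. w n i \<omega> * ((u n i \<omega> + v n i \<omega> * x + d n i \<omega> * \<bar>x\<bar>) * f x))\<bar> \<le> e)"
proof -
  interpret p: perturbation f C M G \<eta> n "w n" "u n" "v n" "d n" "\<rho> n" for n by (rule pert)
  have C0: "C > 0" using C_ge_1 by simp
  have nn: "0 \<le> w n i \<omega> \<and> 0 \<le> \<rho> n i \<omega>" if "i < n" "\<omega> \<in> space M" for n i \<omega>
    using p.w_nonneg[OF that] p.\<rho>_nonneg[OF that] by simp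
  have "aas M (\<lambda>n \<omega>. (\<forall>x. \<bar>\<Sum>i<n. w n i \<omega> *
     (pdev u v d n i \<omega> x (\<eta> i \<omega>) - dev 0 0 0 x (\<eta> i \<omega>))\<bar> \<le> e/2) \<and>
     cubic_sum w \<rho> n \<omega> \<le> e / (10 * C\<^sup>2) \<and> (\<forall>i<n. \<bar>\<rho> n i \<omega>\<bar> \<le> 1/2))"
    using e C0 nn by (intro aas_conj perturbed_process[OF pert w r] null_array_cubic[OF w r] null_array_small[OF r]) auto
  then show ?thesis
  proof (rule aas_impI, intro allI, elim conjE)
    fix n \<omega> x assume \<omega>: "\<omega> \<in> space M"
      and h: "\<forall>x. \<bar>\<Sum>i<n. w n i \<omega> * (pdev u v d n i \<omega> x (\<eta> i \<omega>) - dev 0 0 0 x (\<eta> i \<omega>))\<bar> \<le> e/2"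
        "cubic_sum w \<rho> n \<omega> \<le> e / (10 * C\<^sup>2)" "\<forall>i<n. \<bar>\<rho> n i \<omega>\<bar> \<le> 1/2"
    let ?T = "\<lambda>i. thr (u n i \<omega>) (v n i \<omega>) (d n i \<omega>) x"
    let ?l = "\<lambda>i. (u n i \<omega> + v n i \<omega> * x + d n i \<omega> * \<bar>x\<bar>) * f x"
    have "\<bar>\<Sum>i<n. w n i \<omega> * (F (?T i) - F x - ?l i)\<bar> \<le> (\<Sum>i<n. 5 * C\<^sup>2 * (w n i \<omega> * ((w n i \<omega>)\<^sup>2 + \<rho> n i \<omega> * sqrt (\<rho> n i \<omega>))))"
    proof (rule order_trans[OF sum_abs], rule sum_mono)
      fix i assume "i \<in> {..<n}"
      then have i: "i < n" by simp
      have r: "\<rho> n i \<omega> \<le> 1/2" using h(3) i by (auto simp: abs_le_iff)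
      have "\<bar>F (?T i) - F x - ?l i\<bar> \<le> 5 * C\<^sup>2 * (\<rho> n i \<omega> * sqrt (\<rho> n i \<omega>))"
        unfolding thr_def by (rule F_taylor(1)[OF p.uvd_le[OF i \<omega>] r])
      also have "\<dots> \<le> 5 * C\<^sup>2 * ((w n i \<omega>)\<^sup>2 + \<rho> n i \<omega> * sqrt (\<rho> n i \<omega>))" by (intro mult_left_mono) auto
      finally have "w n i \<omega> * \<bar>F (?T i) - F x - ?l i\<bar> \<le> w n i \<omega> * (5 * C\<^sup>2 * ((w n i \<omega>)\<^sup>2 + \<rho> n i \<omega> * sqrt (\<rho> n i \<omega>)))"
        using nn[OF i \<omega>] by (intro mult_left_mono) auto
      then show "\<bar>w n i \<omega> * (F (?T i) - F x - ?l i)\<bar> \<le> 5 * C\<^sup>2 * (w n i \<omega> * ((w n i \<omega>)\<^sup>2 + \<rho> n i \<omega> * sqrt (\<rho> n i \<omega>)))"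
        using nn[OF i \<omega>] by (simp add: abs_mult mult.left_commute)
    qed
    also have "\<dots> \<le> 5 * C\<^sup>2 * (e / (10 * C\<^sup>2))"
      unfolding sum_distrib_left[symmetric] using h(2) by (intro mult_left_mono) auto
    also have "\<dots> = e / 2" using C0 by simp
    finally have 2: "\<bar>\<Sum>i<n. w n i \<omega> * (F (?T i) - F x - ?l i)\<bar> \<le> e / 2" .
    have "(\<Sum>i<n. w n i \<omega> * (of_bool (\<eta> i \<omega> \<le> ?T i) - F x)) - (\<Sum>i<n. w n i \<omega> * (of_bool (\<eta> i \<omega> \<le> x) - F x)) - (\<Sum>i<n. w n i \<omega> * ?l i)
      = (\<Sum>i<n. w n i \<omega> * (pdev u v d n i \<omega> x (\<eta> i \<omega>) - dev 0 0 0 x (\<eta> i \<omega>))) + (\<Sum>i<n. w n i \<omega> * (F (?T i) - F x - ?l i))"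
      unfolding sum.distrib[symmetric] sum_subtractf[symmetric] dev_0 by (intro sum.cong refl) (simp add: dev_def algebra_simps)
    then show "\<bar>(\<Sum>i<n. w n i \<omega> * (of_bool (\<eta> i \<omega> \<le> ?T i) - F x)) - (\<Sum>i<n. w n i \<omega> * (of_bool (\<eta> i \<omega> \<le> x) - F x)) - (\<Sum>i<n. w n i \<omega> * ?l i)\<bar> \<le> e"
      using 2 h(1)[rule_format, of x] by linarith
  qed
qed

end

section \<open>Smooth parametric families of thresholds\<close>

lemma null_array_plus:
  assumes w: "null_array M w" and w': "null_array M w'"
  shows "null_array M (\<lambda>n i \<omega>. w n i \<omega> + w' n i \<omega>)"
  unfolding null_array_def
proof (intro conjI allI impI)
  fix a :: real assume a: "a > 0"
  have "aas M (\<lambda>n \<omega>. (\<forall>i<n. \<bar>w n i \<omega>\<bar> \<le> a/2) \<and> (\<forall>i<n. \<bar>w' n i \<omega>\<bar> \<le> a/2))"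
    using a by (intro aas_conj null_array_small w w') auto
  then show "aas M (\<lambda>n \<omega>. \<forall>i<n. \<bar>w n i \<omega> + w' n i \<omega>\<bar> \<le> a)"
  proof (rule aas_impI, intro allI impI)
    fix n \<omega> i assume h: "(\<forall>i<n. \<bar>w n i \<omega>\<bar> \<le> a/2) \<and> (\<forall>i<n. \<bar>w' n i \<omega>\<bar> \<le> a/2)" "i < n"
    then have "\<bar>w n i \<omega>\<bar> \<le> a/2" "\<bar>w' n i \<omega>\<bar> \<le> a/2" by auto
    then show "\<bar>w n i \<omega> + w' n i \<omega>\<bar> \<le> a" by linarith
  qed
next
  show "tight M (\<lambda>n \<omega>. \<Sum>i<n. (w n i \<omega> + w' n i \<omega>)\<^sup>2)"
    unfolding tight_def
  proof (intro allI impI)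
    fix \<zeta> :: real assume \<zeta>: "\<zeta> > 0"
    obtain B where B: "B > 0" "whp M (\<zeta>/2) (\<lambda>n \<omega>. sq_sum w n \<omega> \<le> B)"
      using null_array_tight[OF w, of "\<zeta>/2"] \<zeta> by auto
    obtain B' where B': "B' > 0" "whp M (\<zeta>/2) (\<lambda>n \<omega>. (\<Sum>i<n. (w' n i \<omega>)\<^sup>2) \<le> B')"
      using null_array_tight[OF w', of "\<zeta>/2"] \<zeta> by auto
    have "whp M (\<zeta>/2 + \<zeta>/2) (\<lambda>n \<omega>. sq_sum w n \<omega> \<le> B \<and> (\<Sum>i<n. (w' n i \<omega>)\<^sup>2) \<le> B')"
      using \<zeta> by (intro whp_conj B(2) B'(2)) auto
    then have "whp M \<zeta> (\<lambda>n \<omega>. sq_sum w n \<omega> \<le> B \<and> (\<Sum>i<n. (w' n i \<omega>)\<^sup>2) \<le> B')" by simp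
    then have "whp M \<zeta> (\<lambda>n \<omega>. (\<Sum>i<n. (w n i \<omega> + w' n i \<omega>)\<^sup>2) \<le> 2 * B + 2 * B')"
    proof (rule whp_impI)
      fix n \<omega> assume h: "sq_sum w n \<omega> \<le> B \<and> (\<Sum>i<n. (w' n i \<omega>)\<^sup>2) \<le> B'"
      have "(\<Sum>i<n. (w n i \<omega> + w' n i \<omega>)\<^sup>2) \<le> (\<Sum>i<n. 2 * (w n i \<omega>)\<^sup>2 + 2 * (w' n i \<omega>)\<^sup>2)"
      proof (rule sum_mono)
        fix i
        have "0 \<le> (w n i \<omega> - w' n i \<omega>)\<^sup>2" by simp
        then show "(w n i \<omega> + w' n i \<omega>)\<^sup>2 \<le> 2 * (w n i \<omega>)\<^sup>2 + 2 * (w' n i \<omega>)\<^sup>2"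
          by (simp add: power2_diff power2_sum)
      qed
      also have "\<dots> = 2 * sq_sum w n \<omega> + 2 * (\<Sum>i<n. (w' n i \<omega>)\<^sup>2)"
        by (simp add: sum.distrib sum_distrib_left)
      finally show "(\<Sum>i<n. (w n i \<omega> + w' n i \<omega>)\<^sup>2) \<le> 2 * B + 2 * B'" using h by linarith
    qed
    then show "\<exists>B>0. whp M \<zeta> (\<lambda>n \<omega>. (\<Sum>i<n. (w n i \<omega> + w' n i \<omega>)\<^sup>2) \<le> B)"
      using B(1) B'(1) by (intro exI[of _ "2 * B + 2 * B'"]) auto
  qed
qed

lemma weighted_am_gm: "0 < \<tau> \<Longrightarrow> \<bar>a\<bar> * \<bar>b\<bar> \<le> \<tau> * a\<^sup>2 + b\<^sup>2 / (\<tau>::real)"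
proof -
  assume \<tau>: "0 < \<tau>"
  have "0 \<le> (\<bar>a\<bar> * sqrt \<tau> - \<bar>b\<bar> / sqrt \<tau>)\<^sup>2" by simp
  also have "\<dots> = \<tau> * a\<^sup>2 + b\<^sup>2 / \<tau> - 2 * (\<bar>a\<bar> * \<bar>b\<bar>)"
    using \<tau> by (simp add: power2_diff power_mult_distrib power_divide)
  finally have "2 * (\<bar>a\<bar> * \<bar>b\<bar>) \<le> \<tau> * a\<^sup>2 + b\<^sup>2 / \<tau>" by simp
  moreover have "0 \<le> \<bar>a\<bar> * \<bar>b\<bar>" by simp
  ultimately show ?thesis by linarith
qed

lemma sum_weighted_am_gm:
  fixes a b :: "nat \<Rightarrow> real"
  assumes "0 < \<tau>"
  shows "(\<Sum>i<n. \<bar>a i\<bar> * \<bar>b i\<bar>) \<le> \<tau> * (\<Sum>i<n. (a i)\<^sup>2) + (\<Sum>i<n. (b i)\<^sup>2) / \<tau>"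
  unfolding sum_distrib_left sum_divide_distrib sum.distrib[symmetric]
  by (intro sum_mono weighted_am_gm assms)

lemma mixed_product_small:
  assumes w: "\<And>a. 0 < a \<Longrightarrow> aas M (\<lambda>n \<omega>. sq_sum w n \<omega> \<le> a)" and r: "null_array M r" and e: "0 < e"
  shows "aas M (\<lambda>n \<omega>. (\<Sum>i<n. \<bar>w n i \<omega>\<bar> * \<bar>r n i \<omega>\<bar>) \<le> e)"
  unfolding aas_def
proof (intro allI impI)
  fix \<zeta> :: real assume \<zeta>: "\<zeta> > 0"
  obtain B where B: "B > 0" "whp M (\<zeta>/2) (\<lambda>n \<omega>. sq_sum r n \<omega> \<le> B)"
    using null_array_tight[OF r, of "\<zeta>/2"] \<zeta> by auto
  define \<tau> where "\<tau> = 2 * B / e"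
  have \<tau>: "0 < \<tau>" using B e by (simp add: \<tau>_def)
  have "whp M (\<zeta>/2 + \<zeta>/2) (\<lambda>n \<omega>. sq_sum w n \<omega> \<le> e / (2 * \<tau>) \<and> sq_sum r n \<omega> \<le> B)"
    using \<zeta> \<tau> e by (intro whp_conj B(2) aasD[OF w]) auto
  then have "whp M \<zeta> (\<lambda>n \<omega>. sq_sum w n \<omega> \<le> e / (2 * \<tau>) \<and> sq_sum r n \<omega> \<le> B)" by simp
  then show "whp M \<zeta> (\<lambda>n \<omega>. (\<Sum>i<n. \<bar>w n i \<omega>\<bar> * \<bar>r n i \<omega>\<bar>) \<le> e)"
  proof (rule whp_impI)
    fix n \<omega> assume h: "sq_sum w n \<omega> \<le> e / (2 * \<tau>) \<and> sq_sum r n \<omega> \<le> B"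
    have "(\<Sum>i<n. \<bar>w n i \<omega>\<bar> * \<bar>r n i \<omega>\<bar>) \<le> \<tau> * sq_sum w n \<omega> + sq_sum r n \<omega> / \<tau>"
      by (rule sum_weighted_am_gm[OF \<tau>])
    also have "\<dots> \<le> \<tau> * (e / (2 * \<tau>)) + B / \<tau>"
      using h \<tau> by (intro add_mono mult_left_mono divide_right_mono) auto
    also have "\<dots> = e" using \<tau> B e by (simp add: \<tau>_def)
    finally show "(\<Sum>i<n. \<bar>w n i \<omega>\<bar> * \<bar>r n i \<omega>\<bar>) \<le> e" .
  qed
qed

text \<open>The model with the probabilistic input isolated: \<open>\<alpha>\<close> and \<open>\<beta>\<close> are the gradients of location and scale at
  \<open>\<theta>\<close>, \<open>\<Delta> m\<close> is the linearisation error relative to the distance on the ball of radius \<open>\<kappa> m\<close>, and \<open>\<Gamma>\<close>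
  is a Lipschitz constant of the weight. \<open>\<Delta>\<close> must be small in square mean for a suitable \<open>m\<close>, while \<open>\<Gamma>\<close> only has
  to be integrable, whence the square root.\<close>

locale smooth_model = innovations f C M G \<eta>
  for f :: "real \<Rightarrow> real" and C :: real and M :: "'a measure" and G :: "nat \<Rightarrow> 'a measure" and \<eta> :: "nat \<Rightarrow> 'a \<Rightarrow> real" +
  fixes \<theta> :: "'e::euclidean_space" and \<kappa> :: "nat \<Rightarrow> real"
    and loc scl wt :: "nat \<Rightarrow> 'e \<Rightarrow> 'a \<Rightarrow> real"
    and \<alpha> \<beta> :: "nat \<Rightarrow> 'a \<Rightarrow> 'e" and \<Delta> :: "nat \<Rightarrow> nat \<Rightarrow> 'a \<Rightarrow> real" and \<Gamma> :: "nat \<Rightarrow> 'a \<Rightarrow> real"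
  assumes \<kappa>_pos: "\<And>m. 0 < \<kappa> m"
    and loc_lin: "\<And>m i s \<omega>. norm (s - \<theta>) < \<kappa> m \<Longrightarrow> \<omega> \<in> space M \<Longrightarrow>
      \<bar>loc i s \<omega> - \<alpha> i \<omega> \<bullet> (s - \<theta>)\<bar> \<le> \<Delta> m i \<omega> * norm (s - \<theta>)"
    and scl_lin: "\<And>m i s \<omega>. norm (s - \<theta>) < \<kappa> m \<Longrightarrow> \<omega> \<in> space M \<Longrightarrow>
      \<bar>scl i s \<omega> - 1 - \<beta> i \<omega> \<bullet> (s - \<theta>)\<bar> \<le> \<Delta> m i \<omega> * norm (s - \<theta>)"
    and \<alpha>_meas: "\<And>i. \<alpha> i \<in> borel_measurable (G i)" and \<beta>_meas: "\<And>i. \<beta> i \<in> borel_measurable (G i)"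
    and \<Delta>_meas: "\<And>m i. \<Delta> m i \<in> borel_measurable (G i)"
    and \<Delta>_nonneg: "\<And>m i \<omega>. \<omega> \<in> space M \<Longrightarrow> 0 \<le> \<Delta> m i \<omega>"
    and wt_meas: "\<And>i s. norm (s - \<theta>) < \<kappa> 0 \<Longrightarrow> wt i s \<in> borel_measurable (G i)"
    and wt_lip: "\<And>i s s' \<omega>. norm (s - \<theta>) < \<kappa> 0 \<Longrightarrow> norm (s' - \<theta>) < \<kappa> 0 \<Longrightarrow> \<omega> \<in> space M \<Longrightarrow>
      \<bar>wt i s \<omega> - wt i s' \<omega>\<bar> \<le> \<Gamma> i \<omega> * norm (s - s')"
    and \<Gamma>_nonneg: "\<And>i \<omega>. \<omega> \<in> space M \<Longrightarrow> 0 \<le> \<Gamma> i \<omega>"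
    and \<alpha>_null: "null_array M (\<lambda>n i \<omega>. norm (\<alpha> i \<omega>) / sqrt (real n))"
    and \<beta>_null: "null_array M (\<lambda>n i \<omega>. norm (\<beta> i \<omega>) / sqrt (real n))"
    and \<Delta>_null: "\<And>m. null_array M (\<lambda>n i \<omega>. \<Delta> m i \<omega> / sqrt (real n))"
    and wt_null: "null_array M (\<lambda>n i \<omega>. wt i \<theta> \<omega> / sqrt (real n))"
    and \<Gamma>_null: "null_array M (\<lambda>n i \<omega>. sqrt (\<Gamma> i \<omega>) / sqrt (real n))"
    and \<Delta>_small: "\<And>\<zeta> \<tau>. 0 < \<zeta> \<Longrightarrow> 0 < \<tau> \<Longrightarrow> \<exists>m. whp M \<zeta> (\<lambda>n \<omega>. (\<Sum>i<n. (\<Delta> m i \<omega> / sqrt (real n))\<^sup>2) \<le> \<tau>)"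
begin

definition ind :: "nat \<Rightarrow> nat \<Rightarrow> real \<Rightarrow> 'e \<Rightarrow> 'a \<Rightarrow> real" where
  "ind n i x t \<omega> = of_bool (\<eta> i \<omega> \<le> loc i (\<theta> + (1 / sqrt (real n)) *\<^sub>R t) \<omega> + x * scl i (\<theta> + (1 / sqrt (real n)) *\<^sub>R t) \<omega>) - F x"

definition ind0 :: "nat \<Rightarrow> real \<Rightarrow> 'a \<Rightarrow> real" where "ind0 i x \<omega> = of_bool (\<eta> i \<omega> \<le> x) - F x"

definition lin :: "nat \<Rightarrow> nat \<Rightarrow> real \<Rightarrow> 'e \<Rightarrow> 'a \<Rightarrow> real" where
  "lin n i x t \<omega> = (\<alpha> i \<omega> \<bullet> t + x * (\<beta> i \<omega> \<bullet> t)) / sqrt (real n) * f x"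

text \<open>Bounds, up to the factor \<open>1 / \<surd>n\<close>, how far location and scale at any \<open>t\<close> within \<open>\<delta>\<close> of \<open>t0\<close> are from their
  linear parts at \<open>t0\<close>.\<close>

definition err :: "real \<Rightarrow> real \<Rightarrow> nat \<Rightarrow> nat \<Rightarrow> 'a \<Rightarrow> real" where
  "err b \<delta> m i \<omega> = \<delta> * (norm (\<alpha> i \<omega>) + norm (\<beta> i \<omega>)) + b * \<Delta> m i \<omega>"

lemma err_nonneg: "0 \<le> b \<Longrightarrow> 0 \<le> \<delta> \<Longrightarrow> \<omega> \<in> space M \<Longrightarrow> 0 \<le> err b \<delta> m i \<omega>"
  using \<Delta>_nonneg by (simp add: err_def)

lemma ind_abs_le: "\<bar>ind n i x t \<omega>\<bar> \<le> 1" "\<bar>ind0 i x \<omega>\<bar> \<le> 1"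
  using F_nonneg[of x] F_le_1[of x] by (auto simp: ind_def ind0_def)

abbreviation discrepancy :: "(nat \<Rightarrow> nat \<Rightarrow> 'a \<Rightarrow> real) \<Rightarrow> nat \<Rightarrow> real \<Rightarrow> 'e \<Rightarrow> 'a \<Rightarrow> real" where
  "discrepancy w n x t \<omega> \<equiv> \<bar>(\<Sum>i<n. w n i \<omega> * ind n i x t \<omega>) - (\<Sum>i<n. w n i \<omega> * ind0 i x \<omega>) - (\<Sum>i<n. w n i \<omega> * lin n i x t \<omega>)\<bar>"

lemma eventually_local: "\<forall>\<^sub>F n in sequentially. b / sqrt (real n) < \<kappa> m \<and> 0 < n"
proof -
  have "(\<lambda>n. b / sqrt (real n)) \<longlonglongrightarrow> 0"
    by (rule real_tendsto_divide_at_top[where c=b])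
       (auto intro!: filterlim_compose[OF sqrt_at_top] filterlim_real_sequentially)
  then show ?thesis
    using \<kappa>_pos[of m] eventually_gt_at_top[of "0::nat"] by (auto intro: eventually_conj order_tendstoD(2))
qed

text \<open>For all \<open>t\<close> near \<open>t0\<close> the thresholds lie between two predictable perturbations of \<open>x\<close> that do not
  depend on \<open>t\<close>, and by monotonicity the weighted process lies between the two perturbed ones. Both have
  been expanded, and their drifts differ from the linear term by \<open>O(err)\<close> since \<open>(1 + \<bar>x\<bar>) f x\<close>
  is bounded. Weights must be nonnegative here for the sake of monotonicity.\<close>

lemma local_expansion:
  assumes b: "0 \<le> b" and \<delta>: "0 \<le> \<delta>" "\<delta> \<le> 1" and t0: "norm t0 \<le> b"
    and wm: "\<And>n i. i < n \<Longrightarrow> w n i \<in> borel_measurable (G i)"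
    and w0: "\<And>n i \<omega>. i < n \<Longrightarrow> \<omega> \<in> space M \<Longrightarrow> 0 \<le> w n i \<omega>"
    and w: "null_array M w" and e: "0 < e"
  shows "aas M (\<lambda>n \<omega>. \<forall>x t. norm t \<le> b \<longrightarrow> norm (t - t0) \<le> \<delta> \<longrightarrow>
     discrepancy w n x t \<omega>
       \<le> e + 4 * C * (\<Sum>i<n. w n i \<omega> * (err b \<delta> m i \<omega> / sqrt (real n))))"
proof -
  define R where "R n i \<omega> = (2 * b + 2) * (norm (\<alpha> i \<omega>) / sqrt (real n) + norm (\<beta> i \<omega>) / sqrt (real n) + \<Delta> m i \<omega> / sqrt (real n))" for n i \<omega>
  have Rnull: "null_array M R"
    by (rule null_array_mono[OF null_array_plus[OF null_array_plus[OF \<alpha>_null \<beta>_null] \<Delta>_null[of m]], where c="2 * b + 2"])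
       (use b in \<open>auto simp: R_def abs_mult\<close>)
  (* sigma = 1 gives the upper and sigma = -1 the lower bracket. *)
  define u where "u \<sigma> n i \<omega> = (\<alpha> i \<omega> \<bullet> t0 + \<sigma> * err b \<delta> m i \<omega>) / sqrt (real n)" for \<sigma> :: real and n i \<omega>
  define v where "v n i \<omega> = (\<beta> i \<omega> \<bullet> t0) / sqrt (real n)" for n i \<omega>
  define d where "d \<sigma> n i \<omega> = \<sigma> * err b \<delta> m i \<omega> / sqrt (real n)" for \<sigma> :: real and n i \<omega>
  have pert: "perturbation f C M G \<eta> n (w n) (u \<sigma> n) (v n) (d \<sigma> n) (R n)" if \<sigma>: "\<bar>\<sigma>\<bar> = 1" for \<sigma> n
  proof unfold_locales
    fix i assume i: "i < n"
    note [measurable] = \<alpha>_meas[of i] \<beta>_meas[of i] \<Delta>_meas[of m i]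
    show "w n i \<in> borel_measurable (G i)" by (rule wm[OF i])
    show "u \<sigma> n i \<in> borel_measurable (G i)" "v n i \<in> borel_measurable (G i)"
      "d \<sigma> n i \<in> borel_measurable (G i)" "R n i \<in> borel_measurable (G i)"
      unfolding u_def v_def d_def R_def err_def by measurable
    fix \<omega> assume \<omega>: "\<omega> \<in> space M"
    show "0 \<le> w n i \<omega>" by (rule w0[OF i \<omega>])
    define A where "A = norm (\<alpha> i \<omega>)"
    define Bb where "Bb = norm (\<beta> i \<omega>)"
    define D where "D = \<Delta> m i \<omega>"
    have p: "0 \<le> A" "0 \<le> Bb" "0 \<le> D" using \<Delta>_nonneg[OF \<omega>] by (auto simp: A_def Bb_def D_def)
    have 1: "\<bar>\<alpha> i \<omega> \<bullet> t0\<bar> \<le> A * b"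
      using Cauchy_Schwarz_ineq2[of "\<alpha> i \<omega>" t0] t0 p unfolding A_def
      by (meson mult_left_mono norm_ge_zero order_trans)
    have 2: "\<bar>\<beta> i \<omega> \<bullet> t0\<bar> \<le> Bb * b"
      using Cauchy_Schwarz_ineq2[of "\<beta> i \<omega>" t0] t0 p unfolding Bb_def
      by (meson mult_left_mono norm_ge_zero order_trans)
    have 3: "err b \<delta> m i \<omega> \<le> A + Bb + b * D"
      unfolding err_def A_def[symmetric] Bb_def[symmetric] D_def[symmetric]
      using mult_right_mono[OF \<delta>(2), of "A + Bb"] p by simp
    have 4: "0 \<le> err b \<delta> m i \<omega>" by (rule err_nonneg[OF b \<delta>(1) \<omega>])
    have se: "\<bar>\<sigma> * err b \<delta> m i \<omega>\<bar> = err b \<delta> m i \<omega>" using \<sigma> 4 by (simp add: abs_mult)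
    have "\<bar>\<alpha> i \<omega> \<bullet> t0 + \<sigma> * err b \<delta> m i \<omega>\<bar> + \<bar>\<beta> i \<omega> \<bullet> t0\<bar> + \<bar>\<sigma> * err b \<delta> m i \<omega>\<bar>
      \<le> \<bar>\<alpha> i \<omega> \<bullet> t0\<bar> + \<bar>\<beta> i \<omega> \<bullet> t0\<bar> + 2 * err b \<delta> m i \<omega>"
      using se abs_triangle_ineq[of "\<alpha> i \<omega> \<bullet> t0" "\<sigma> * err b \<delta> m i \<omega>"] by simp
    also have "\<bar>\<alpha> i \<omega> \<bullet> t0\<bar> + \<bar>\<beta> i \<omega> \<bullet> t0\<bar> + 2 * err b \<delta> m i \<omega> \<le> A * b + Bb * b + 2 * (A + Bb + b * D)"
      using 1 2 3 by simp
    also have "\<dots> \<le> (2 * b + 2) * (A + Bb + D)"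
      using p b by (simp add: algebra_simps)
    finally have "(\<bar>\<alpha> i \<omega> \<bullet> t0 + \<sigma> * err b \<delta> m i \<omega>\<bar> + \<bar>\<beta> i \<omega> \<bullet> t0\<bar> + \<bar>\<sigma> * err b \<delta> m i \<omega>\<bar>) / sqrt (real n)
      \<le> (2 * b + 2) * (A + Bb + D) / sqrt (real n)" by (intro divide_right_mono) auto
    then show "\<bar>u \<sigma> n i \<omega>\<bar> + \<bar>v n i \<omega>\<bar> + \<bar>d \<sigma> n i \<omega>\<bar> \<le> R n i \<omega>"
      by (simp add: u_def v_def d_def R_def A_def Bb_def D_def abs_divide flip: add_divide_distrib)
  qed
  let ?X = "\<lambda>\<sigma> n \<omega> x. (\<Sum>i<n. w n i \<omega> * (of_bool (\<eta> i \<omega> \<le> thr (u \<sigma> n i \<omega>) (v n i \<omega>) (d \<sigma> n i \<omega>) x) - F x))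
      - (\<Sum>i<n. w n i \<omega> * (of_bool (\<eta> i \<omega> \<le> x) - F x))
      - (\<Sum>i<n. w n i \<omega> * ((u \<sigma> n i \<omega> + v n i \<omega> * x + d \<sigma> n i \<omega> * \<bar>x\<bar>) * f x))"
  have "aas M (\<lambda>n \<omega>. (\<forall>x. \<bar>?X 1 n \<omega> x\<bar> \<le> e) \<and> (\<forall>x. \<bar>?X (-1) n \<omega> x\<bar> \<le> e))"
    by (intro aas_conj perturbed_expansion[OF pert w Rnull e]) auto
  then show ?thesis
  proof (rule aas_mono)
    show "\<forall>\<^sub>F n in sequentially. \<forall>\<omega>\<in>space M. (\<forall>x. \<bar>?X 1 n \<omega> x\<bar> \<le> e) \<and> (\<forall>x. \<bar>?X (-1) n \<omega> x\<bar> \<le> e) \<longrightarrow>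
      (\<forall>x t. norm t \<le> b \<longrightarrow> norm (t - t0) \<le> \<delta> \<longrightarrow>
       discrepancy w n x t \<omega>
       \<le> e + 4 * C * (\<Sum>i<n. w n i \<omega> * (err b \<delta> m i \<omega> / sqrt (real n))))"
      using eventually_local[of b m]
    proof eventually_elim
      case (elim n)
      have sn: "0 < sqrt (real n)" using elim by simp
      show ?case
      proof (intro ballI impI allI, elim conjE)
        fix \<omega> x t
        assume \<omega>: "\<omega> \<in> space M" and t: "norm t \<le> b" "norm (t - t0) \<le> \<delta>"
          and X1: "\<forall>x. \<bar>?X 1 n \<omega> x\<bar> \<le> e" and X2: "\<forall>x. \<bar>?X (-1) n \<omega> x\<bar> \<le> e"
        define s where "s = \<theta> + (1 / sqrt (real n)) *\<^sub>R t"
        have st: "s - \<theta> = (1 / sqrt (real n)) *\<^sub>R t" by (simp add: s_def)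
        have ns: "norm (s - \<theta>) = norm t / sqrt (real n)" using sn by (simp add: st)
        also have "\<dots> \<le> b / sqrt (real n)" using t by (intro divide_right_mono) auto
        finally have sk: "norm (s - \<theta>) < \<kappa> m" using elim by simp
        have pt: "w n i \<omega> * (of_bool (\<eta> i \<omega> \<le> thr (u (-1) n i \<omega>) (v n i \<omega>) (d (-1) n i \<omega>) x) - F x) \<le> w n i \<omega> * ind n i x t \<omega>
            \<and> w n i \<omega> * ind n i x t \<omega> \<le> w n i \<omega> * (of_bool (\<eta> i \<omega> \<le> thr (u 1 n i \<omega>) (v n i \<omega>) (d 1 n i \<omega>) x) - F x)
            \<and> w n i \<omega> * ((u 1 n i \<omega> + v n i \<omega> * x + d 1 n i \<omega> * \<bar>x\<bar>) * f x) \<le> w n i \<omega> * lin n i x t \<omega> + 4 * C * (w n i \<omega> * (err b \<delta> m i \<omega> / sqrt (real n)))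
            \<and> w n i \<omega> * lin n i x t \<omega> - 4 * C * (w n i \<omega> * (err b \<delta> m i \<omega> / sqrt (real n))) \<le> w n i \<omega> * ((u (-1) n i \<omega> + v n i \<omega> * x + d (-1) n i \<omega> * \<bar>x\<bar>) * f x)"
          if i: "i < n" for i
        proof -
          define E where "E = err b \<delta> m i \<omega>"
          define D where "D = \<Delta> m i \<omega>"
          have D0: "0 \<le> D" using \<Delta>_nonneg[OF \<omega>] by (simp add: D_def)
          have E0: "0 \<le> E" unfolding E_def by (rule err_nonneg[OF b \<delta>(1) \<omega>])
          have bD: "D * norm t \<le> b * D" using mult_left_mono[OF t(1) D0] by (simp add: mult.commute)
          have cs: "\<bar>g \<bullet> t - g \<bullet> t0\<bar> \<le> \<delta> * norm g" for g :: 'e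
          proof -
            have "\<bar>g \<bullet> t - g \<bullet> t0\<bar> = \<bar>g \<bullet> (t - t0)\<bar>" by (simp add: inner_diff_right)
            also have "\<dots> \<le> norm g * norm (t - t0)" by (rule Cauchy_Schwarz_ineq2)
            also have "\<dots> \<le> norm g * \<delta>" using t by (intro mult_left_mono) auto
            finally show ?thesis by (simp add: mult.commute)
          qed
          have Eb: "\<delta> * norm (\<alpha> i \<omega>) + b * D \<le> E" "\<delta> * norm (\<beta> i \<omega>) + b * D \<le> E"
            "\<delta> * norm (\<alpha> i \<omega>) \<le> E" "\<delta> * norm (\<beta> i \<omega>) \<le> E"
            using \<delta> b D0 by (auto simp: E_def err_def D_def distrib_left)
          have l: "\<bar>sqrt (real n) * loc i s \<omega> - \<alpha> i \<omega> \<bullet> t\<bar> \<le> D * norm t"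
          proof -
            have "\<bar>loc i s \<omega> - (\<alpha> i \<omega> \<bullet> t) / sqrt (real n)\<bar> \<le> D * (norm t / sqrt (real n))"
              using loc_lin[OF sk \<omega>, of i] ns by (simp add: st D_def)
            then have "sqrt (real n) * \<bar>loc i s \<omega> - (\<alpha> i \<omega> \<bullet> t) / sqrt (real n)\<bar> \<le> sqrt (real n) * (D * (norm t / sqrt (real n)))"
              using sn by (intro mult_left_mono) auto
            then have "\<bar>sqrt (real n) * (loc i s \<omega> - (\<alpha> i \<omega> \<bullet> t) / sqrt (real n))\<bar> \<le> D * norm t"
              using sn by (simp add: abs_mult)
            then show ?thesis using sn by (simp add: right_diff_distrib)
          qed
          have c: "\<bar>sqrt (real n) * (scl i s \<omega> - 1) - \<beta> i \<omega> \<bullet> t\<bar> \<le> D * norm t"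
          proof -
            have "\<bar>scl i s \<omega> - 1 - (\<beta> i \<omega> \<bullet> t) / sqrt (real n)\<bar> \<le> D * (norm t / sqrt (real n))"
              using scl_lin[OF sk \<omega>, of i] ns by (simp add: st D_def)
            then have "sqrt (real n) * \<bar>scl i s \<omega> - 1 - (\<beta> i \<omega> \<bullet> t) / sqrt (real n)\<bar> \<le> sqrt (real n) * (D * (norm t / sqrt (real n)))"
              using sn by (intro mult_left_mono) auto
            then have "\<bar>sqrt (real n) * (scl i s \<omega> - 1 - (\<beta> i \<omega> \<bullet> t) / sqrt (real n))\<bar> \<le> D * norm t"
              using sn by (simp add: abs_mult)
            then show ?thesis using sn by (simp add: right_diff_distrib)
          qed
          have L: "\<bar>sqrt (real n) * loc i s \<omega> - \<alpha> i \<omega> \<bullet> t0\<bar> \<le> E" using l bD cs[of "\<alpha> i \<omega>"] Eb(1) by linarith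
          have S: "\<bar>sqrt (real n) * (scl i s \<omega> - 1) - \<beta> i \<omega> \<bullet> t0\<bar> \<le> E" using c bD cs[of "\<beta> i \<omega>"] Eb(2) by linarith
          have S': "\<bar>x * (sqrt (real n) * (scl i s \<omega> - 1) - \<beta> i \<omega> \<bullet> t0)\<bar> \<le> E * \<bar>x\<bar>"
            unfolding abs_mult using mult_left_mono[OF S, of "\<bar>x\<bar>"] by (simp add: mult.commute)
          have tot: "\<bar>(sqrt (real n) * loc i s \<omega> - \<alpha> i \<omega> \<bullet> t0) + x * (sqrt (real n) * (scl i s \<omega> - 1) - \<beta> i \<omega> \<bullet> t0)\<bar> \<le> E + E * \<bar>x\<bar>"
            using L S' by linarith
          define H where "H = loc i s \<omega> + x * scl i s \<omega>"
          have Hs: "sqrt (real n) * (H - x) = sqrt (real n) * loc i s \<omega> + x * (sqrt (real n) * (scl i s \<omega> - 1))"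
            by (simp add: H_def algebra_simps)
          have thr: "thr (u \<sigma> n i \<omega>) (v n i \<omega>) (d \<sigma> n i \<omega>) x - x = (\<alpha> i \<omega> \<bullet> t0 + x * (\<beta> i \<omega> \<bullet> t0) + \<sigma> * (E + E * \<bar>x\<bar>)) / sqrt (real n)" for \<sigma>
            by (simp add: thr_def u_def v_def d_def E_def add_divide_distrib algebra_simps)
          have up: "H \<le> thr (u 1 n i \<omega>) (v n i \<omega>) (d 1 n i \<omega>) x"
          proof -
            have "sqrt (real n) * (H - x) \<le> \<alpha> i \<omega> \<bullet> t0 + x * (\<beta> i \<omega> \<bullet> t0) + 1 * (E + E * \<bar>x\<bar>)"
              unfolding Hs using tot by (simp add: right_diff_distrib)
            then have "H - x \<le> thr (u 1 n i \<omega>) (v n i \<omega>) (d 1 n i \<omega>) x - x"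
              unfolding thr using sn by (simp add: pos_le_divide_eq mult.commute)
            then show ?thesis by simp
          qed
          have lo: "thr (u (-1) n i \<omega>) (v n i \<omega>) (d (-1) n i \<omega>) x \<le> H"
          proof -
            have "\<alpha> i \<omega> \<bullet> t0 + x * (\<beta> i \<omega> \<bullet> t0) + (-1) * (E + E * \<bar>x\<bar>) \<le> sqrt (real n) * (H - x)"
              unfolding Hs using tot by (simp add: right_diff_distrib)
            then have "thr (u (-1) n i \<omega>) (v n i \<omega>) (d (-1) n i \<omega>) x - x \<le> H - x"
              unfolding thr using sn by (simp add: pos_divide_le_eq mult.commute)
            then show ?thesis by simp
          qed
          have indH: "ind n i x t \<omega> = of_bool (\<eta> i \<omega> \<le> H) - F x"
            by (simp add: ind_def H_def s_def)
          have wi: "0 \<le> w n i \<omega>" by (rule w0[OF i \<omega>])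
          have I: "of_bool (\<eta> i \<omega> \<le> thr (u (-1) n i \<omega>) (v n i \<omega>) (d (-1) n i \<omega>) x) - F x \<le> ind n i x t \<omega>"
            "ind n i x t \<omega> \<le> of_bool (\<eta> i \<omega> \<le> thr (u 1 n i \<omega>) (v n i \<omega>) (d 1 n i \<omega>) x) - F x"
            unfolding indH using up lo by auto
          have fx: "(1 + \<bar>x\<bar>) * f x \<le> 2 * C"
            using f_le[of x] xf_le[of x] by (simp add: distrib_right)
          have D1: "\<bar>(\<alpha> i \<omega> \<bullet> t0 + x * (\<beta> i \<omega> \<bullet> t0)) - (\<alpha> i \<omega> \<bullet> t + x * (\<beta> i \<omega> \<bullet> t))\<bar> \<le> E * (1 + \<bar>x\<bar>)"
          proof -
            have "\<bar>x * (\<beta> i \<omega> \<bullet> t - \<beta> i \<omega> \<bullet> t0)\<bar> \<le> \<bar>x\<bar> * E"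
              unfolding abs_mult using cs[of "\<beta> i \<omega>"] Eb(4) by (intro mult_left_mono) auto
            moreover have "\<bar>\<alpha> i \<omega> \<bullet> t - \<alpha> i \<omega> \<bullet> t0\<bar> \<le> E" using cs[of "\<alpha> i \<omega>"] Eb(3) by linarith
            moreover have "(\<alpha> i \<omega> \<bullet> t0 + x * (\<beta> i \<omega> \<bullet> t0)) - (\<alpha> i \<omega> \<bullet> t + x * (\<beta> i \<omega> \<bullet> t))
               = - (\<alpha> i \<omega> \<bullet> t - \<alpha> i \<omega> \<bullet> t0) - x * (\<beta> i \<omega> \<bullet> t - \<beta> i \<omega> \<bullet> t0)" by (simp add: algebra_simps)
            moreover have "E * (1 + \<bar>x\<bar>) = E + \<bar>x\<bar> * E" by (simp add: algebra_simps)
            ultimately show ?thesis by linarith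
          qed
          have drift: "\<bar>(u \<sigma> n i \<omega> + v n i \<omega> * x + d \<sigma> n i \<omega> * \<bar>x\<bar>) * f x - lin n i x t \<omega>\<bar> \<le> 4 * C * (E / sqrt (real n))"
            if \<sigma>: "\<bar>\<sigma>\<bar> = 1" for \<sigma>
          proof -
            have "(u \<sigma> n i \<omega> + v n i \<omega> * x + d \<sigma> n i \<omega> * \<bar>x\<bar>) * f x - lin n i x t \<omega>
              = ((\<alpha> i \<omega> \<bullet> t0 + x * (\<beta> i \<omega> \<bullet> t0)) - (\<alpha> i \<omega> \<bullet> t + x * (\<beta> i \<omega> \<bullet> t)) + \<sigma> * (E * (1 + \<bar>x\<bar>))) / sqrt (real n) * f x"
              by (simp add: u_def v_def d_def lin_def E_def add_divide_distrib diff_divide_distrib algebra_simps)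
            also have "\<bar>\<dots>\<bar> = \<bar>(\<alpha> i \<omega> \<bullet> t0 + x * (\<beta> i \<omega> \<bullet> t0)) - (\<alpha> i \<omega> \<bullet> t + x * (\<beta> i \<omega> \<bullet> t)) + \<sigma> * (E * (1 + \<bar>x\<bar>))\<bar> / sqrt (real n) * f x"
              using sn f_nonneg[of x] by (simp add: abs_mult abs_divide)
            also have "\<dots> \<le> (2 * (E * (1 + \<bar>x\<bar>))) / sqrt (real n) * f x"
            proof (intro mult_right_mono divide_right_mono f_nonneg)
              have "\<bar>\<sigma> * (E * (1 + \<bar>x\<bar>))\<bar> = E * (1 + \<bar>x\<bar>)" using \<sigma> E0 by (simp add: abs_mult)
              then show "\<bar>(\<alpha> i \<omega> \<bullet> t0 + x * (\<beta> i \<omega> \<bullet> t0)) - (\<alpha> i \<omega> \<bullet> t + x * (\<beta> i \<omega> \<bullet> t)) + \<sigma> * (E * (1 + \<bar>x\<bar>))\<bar> \<le> 2 * (E * (1 + \<bar>x\<bar>))"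
                using D1 by linarith
            qed (use sn in simp)
            also have "\<dots> = 2 * (E / sqrt (real n)) * ((1 + \<bar>x\<bar>) * f x)" by simp
            also have "\<dots> \<le> 2 * (E / sqrt (real n)) * (2 * C)"
              using fx E0 sn by (intro mult_left_mono) auto
            finally show ?thesis by (simp add: mult_ac)
          qed
          have dr1: "(u 1 n i \<omega> + v n i \<omega> * x + d 1 n i \<omega> * \<bar>x\<bar>) * f x \<le> lin n i x t \<omega> + 4 * C * (E / sqrt (real n))"
            using drift[of 1] by (simp add: abs_le_iff)
          have dr2: "lin n i x t \<omega> - 4 * C * (E / sqrt (real n)) \<le> (u (-1) n i \<omega> + v n i \<omega> * x + d (-1) n i \<omega> * \<bar>x\<bar>) * f x"
            using drift[of "-1"] by (simp add: abs_le_iff)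
          have "w n i \<omega> * ((u 1 n i \<omega> + v n i \<omega> * x + d 1 n i \<omega> * \<bar>x\<bar>) * f x) \<le> w n i \<omega> * (lin n i x t \<omega> + 4 * C * (E / sqrt (real n)))"
            "w n i \<omega> * (lin n i x t \<omega> - 4 * C * (E / sqrt (real n))) \<le> w n i \<omega> * ((u (-1) n i \<omega> + v n i \<omega> * x + d (-1) n i \<omega> * \<bar>x\<bar>) * f x)"
            using dr1 dr2 wi by (intro mult_left_mono; simp)+
          moreover have "w n i \<omega> * (lin n i x t \<omega> + 4 * C * (E / sqrt (real n))) = w n i \<omega> * lin n i x t \<omega> + 4 * C * (w n i \<omega> * (E / sqrt (real n)))"
            "w n i \<omega> * (lin n i x t \<omega> - 4 * C * (E / sqrt (real n))) = w n i \<omega> * lin n i x t \<omega> - 4 * C * (w n i \<omega> * (E / sqrt (real n)))"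
            by (simp_all add: algebra_simps)
          ultimately show ?thesis
            using mult_left_mono[OF I(1) wi] mult_left_mono[OF I(2) wi] by (simp add: E_def)
        qed
        define Sm where "Sm g = (\<Sum>i<n. w n i \<omega> * g i)" for g :: "nat \<Rightarrow> real"
        define Er where "Er = 4 * C * Sm (\<lambda>i. err b \<delta> m i \<omega> / sqrt (real n))"
        have q1: "Sm (\<lambda>i. of_bool (\<eta> i \<omega> \<le> thr (u (-1) n i \<omega>) (v n i \<omega>) (d (-1) n i \<omega>) x) - F x) \<le> Sm (\<lambda>i. ind n i x t \<omega>)"
          and q2: "Sm (\<lambda>i. ind n i x t \<omega>) \<le> Sm (\<lambda>i. of_bool (\<eta> i \<omega> \<le> thr (u 1 n i \<omega>) (v n i \<omega>) (d 1 n i \<omega>) x) - F x)"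
          unfolding Sm_def using pt by (intro sum_mono; simp)+
        have q3: "Sm (\<lambda>i. (u 1 n i \<omega> + v n i \<omega> * x + d 1 n i \<omega> * \<bar>x\<bar>) * f x) \<le> Sm (\<lambda>i. lin n i x t \<omega>) + Er"
          unfolding Sm_def Er_def sum_distrib_left sum.distrib[symmetric] using pt by (intro sum_mono) simp
        have q4: "Sm (\<lambda>i. lin n i x t \<omega>) - Er \<le> Sm (\<lambda>i. (u (-1) n i \<omega> + v n i \<omega> * x + d (-1) n i \<omega> * \<bar>x\<bar>) * f x)"
          unfolding Sm_def Er_def sum_distrib_left sum_subtractf[symmetric] using pt by (intro sum_mono) simp
        have Y1: "\<bar>Sm (\<lambda>i. of_bool (\<eta> i \<omega> \<le> thr (u 1 n i \<omega>) (v n i \<omega>) (d 1 n i \<omega>) x) - F x) - Sm (\<lambda>i. ind0 i x \<omega>)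
           - Sm (\<lambda>i. (u 1 n i \<omega> + v n i \<omega> * x + d 1 n i \<omega> * \<bar>x\<bar>) * f x)\<bar> \<le> e"
          using X1[rule_format, of x] by (simp only: Sm_def ind0_def)
        have Y2: "\<bar>Sm (\<lambda>i. of_bool (\<eta> i \<omega> \<le> thr (u (-1) n i \<omega>) (v n i \<omega>) (d (-1) n i \<omega>) x) - F x) - Sm (\<lambda>i. ind0 i x \<omega>)
           - Sm (\<lambda>i. (u (-1) n i \<omega> + v n i \<omega> * x + d (-1) n i \<omega> * \<bar>x\<bar>) * f x)\<bar> \<le> e"
          using X2[rule_format, of x] by (simp only: Sm_def ind0_def)
        have "\<bar>Sm (\<lambda>i. ind n i x t \<omega>) - Sm (\<lambda>i. ind0 i x \<omega>) - Sm (\<lambda>i. lin n i x t \<omega>)\<bar> \<le> e + Er"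
          using q1 q2 q3 q4 Y1 Y2 by linarith
        then show "discrepancy w n x t \<omega>
          \<le> e + 4 * C * (\<Sum>i<n. w n i \<omega> * (err b \<delta> m i \<omega> / sqrt (real n)))"
          by (simp only: Sm_def Er_def)
      qed
    qed
  qed
qed

end

lemma finite_net_cball:
  fixes b \<delta> :: real
  assumes "0 < \<delta>"
  shows "\<exists>T \<subseteq> cball (0::'e::euclidean_space) b. finite T \<and> (\<forall>t. norm t \<le> b \<longrightarrow> (\<exists>t0\<in>T. norm (t - t0) \<le> \<delta>))"
proof -
  have "compact (cball (0::'e) b)" by simp
  then obtain T where T: "T \<subseteq> cball 0 b" "finite T" "cball (0::'e) b \<subseteq> (\<Union>t\<in>T. ball t \<delta>)"
    by (rule compactE_image[where f="\<lambda>t. ball t \<delta>" and C="cball 0 b"]) (use assms in auto)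
  have "\<exists>t0\<in>T. norm (t - t0) \<le> \<delta>" if "norm t \<le> b" for t
  proof -
    have "t \<in> cball 0 b" using that by simp
    then obtain t0 where "t0 \<in> T" "t \<in> ball t0 \<delta>" using T(3) by blast
    then show ?thesis by (intro bexI[of _ t0]) (auto simp: dist_norm norm_minus_commute)
  qed
  with T show ?thesis by blast
qed

lemma null_array_max:
  "null_array M w \<Longrightarrow> null_array M (\<lambda>n i \<omega>. max (w n i \<omega>) 0)"
  "null_array M w \<Longrightarrow> null_array M (\<lambda>n i \<omega>. max (- w n i \<omega>) 0)"
  by (erule null_array_mono[where c=1]; auto)+

context smooth_model
begin

text \<open>A finite net reduces uniformity in \<open>t\<close> to the local expansions. Their error \<open>\<Sum> w err / \<surd>n\<close> is small once the
  mesh \<open>\<delta>\<close> and then the radius \<open>\<kappa> m\<close> are chosen small: Cauchy-Schwarz in the weighted form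
  \<open>ab \<le> \<tau> a\<^sup>2 + b\<^sup>2 / \<tau>\<close> separates the weights from the remainders.\<close>

theorem uniform_expansion_nonneg:
  assumes b: "0 \<le> b"
    and wm: "\<And>n i. i < n \<Longrightarrow> w n i \<in> borel_measurable (G i)"
    and w0: "\<And>n i \<omega>. i < n \<Longrightarrow> \<omega> \<in> space M \<Longrightarrow> 0 \<le> w n i \<omega>"
    and w: "null_array M w" and e: "0 < e"
  shows "aas M (\<lambda>n \<omega>. \<forall>x t. norm t \<le> b \<longrightarrow>
     discrepancy w n x t \<omega> \<le> e)"
  unfolding aas_def
proof (intro allI impI)
  fix \<zeta> :: real assume \<zeta>: "0 < \<zeta>"
  have C0: "C > 0" using C_ge_1 by simp
  define r where "r n i \<omega> = norm (\<alpha> i \<omega>) / sqrt (real n) + norm (\<beta> i \<omega>) / sqrt (real n)" for n i \<omega>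
  have r: "null_array M r" unfolding r_def by (rule null_array_plus[OF \<alpha>_null \<beta>_null])
  obtain B where B: "B > 0" "whp M (\<zeta>/4) (\<lambda>n \<omega>. sq_sum w n \<omega> \<le> B)"
    using null_array_tight[OF w, of "\<zeta>/4"] \<zeta> by auto
  obtain B' where B': "B' > 0" "whp M (\<zeta>/4) (\<lambda>n \<omega>. sq_sum r n \<omega> \<le> B')"
    using null_array_tight[OF r, of "\<zeta>/4"] \<zeta> by auto
  (* Of the total error e, one quarter is for the local expansions and 4 C e1 = e/4 for each of the
     three parts of the error sum: mesh, weights and remainders. *)
  define e1 where "e1 = e / (16 * C)"
  have e1: "0 < e1" using e C0 by (simp add: e1_def)
  define \<delta> where "\<delta> = min 1 (e1 / (B + B'))"
  have \<delta>: "0 < \<delta>" "\<delta> \<le> 1" "\<delta> * (B + B') \<le> e1"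
  proof -
    have "\<delta> * (B + B') \<le> (e1 / (B + B')) * (B + B')" using B B' by (intro mult_right_mono) (auto simp: \<delta>_def)
    then show "\<delta> * (B + B') \<le> e1" using B B' by simp
  qed (use e1 B B' in \<open>auto simp: \<delta>_def\<close>)
  define \<tau> where "\<tau> = e1 / ((b + 1) * B)"
  have \<tau>: "0 < \<tau>" "b * (\<tau> * B) \<le> e1"
  proof -
    show "0 < \<tau>" using e1 b B by (simp add: \<tau>_def)
    have "\<tau> * B = e1 / (b + 1)" using B by (simp add: \<tau>_def)
    moreover have "b * (e1 / (b + 1)) \<le> e1" using e1 b by (simp add: field_simps)
    ultimately show "b * (\<tau> * B) \<le> e1" by simp
  qed
  define \<tau>' where "\<tau>' = \<tau> * e1 / (b + 1)"
  have \<tau>': "0 < \<tau>'" "b * (\<tau>' / \<tau>) \<le> e1"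
  proof -
    show "0 < \<tau>'" using e1 b \<tau> by (simp add: \<tau>'_def)
    have "\<tau>' / \<tau> = e1 / (b + 1)" using \<tau> by (simp add: \<tau>'_def)
    moreover have "b * (e1 / (b + 1)) \<le> e1" using e1 b by (simp add: field_simps)
    ultimately show "b * (\<tau>' / \<tau>) \<le> e1" by simp
  qed
  obtain m where m: "whp M (\<zeta>/4) (\<lambda>n \<omega>. (\<Sum>i<n. (\<Delta> m i \<omega> / sqrt (real n))\<^sup>2) \<le> \<tau>')"
    using \<Delta>_small[of "\<zeta>/4" \<tau>'] \<zeta> \<tau>' by auto
  obtain T where T: "T \<subseteq> cball (0::'e) b" "finite T" "\<And>t. norm t \<le> b \<Longrightarrow> \<exists>t0\<in>T. norm (t - t0) \<le> \<delta>"
    using finite_net_cball[OF \<delta>(1), of b] by metis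
  let ?Z = "\<lambda>n \<omega> x t. discrepancy w n x t \<omega>"
  let ?E = "\<lambda>n \<omega>. \<Sum>i<n. w n i \<omega> * (err b \<delta> m i \<omega> / sqrt (real n))"
  let ?L = "\<lambda>n \<omega>. \<forall>t0\<in>T. \<forall>x t. norm t \<le> b \<longrightarrow> norm (t - t0) \<le> \<delta> \<longrightarrow> ?Z n \<omega> x t \<le> e / 4 + 4 * C * ?E n \<omega>"
  have L: "aas M ?L"
    by (intro aas_finite_ball T(2) local_expansion[OF b _ \<delta>(2) _ wm w0 w]) (use \<delta> T e in auto)
  let ?H = "\<lambda>n \<omega>. (sq_sum w n \<omega> \<le> B \<and> sq_sum r n \<omega> \<le> B') \<and> ((\<Sum>i<n. (\<Delta> m i \<omega> / sqrt (real n))\<^sup>2) \<le> \<tau>' \<and> ?L n \<omega>)"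
  have "whp M ((\<zeta>/4 + \<zeta>/4) + (\<zeta>/4 + \<zeta>/4)) ?H"
    using \<zeta> by (intro whp_conj B B' m aasD[OF L]) auto
  then have "whp M \<zeta> ?H" by simp
  then show "whp M \<zeta> (\<lambda>n \<omega>. \<forall>x t. norm t \<le> b \<longrightarrow> ?Z n \<omega> x t \<le> e)"
  proof (rule whp_impI, intro allI impI)
    fix n \<omega> x and t :: 'e assume \<omega>: "\<omega> \<in> space M" and H: "?H n \<omega>" and t: "norm t \<le> b"
    obtain t0 where t0: "t0 \<in> T" "norm (t - t0) \<le> \<delta>" using T(3)[OF t] by auto
    have Z: "?Z n \<omega> x t \<le> e / 4 + 4 * C * ?E n \<omega>" using H t0 t by blast
    have D0: "0 \<le> \<Delta> m i \<omega>" for i by (rule \<Delta>_nonneg[OF \<omega>])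
    have "?E n \<omega> = (\<Sum>i<n. \<delta> * (\<bar>w n i \<omega>\<bar> * \<bar>r n i \<omega>\<bar>) + b * (\<bar>w n i \<omega>\<bar> * \<bar>\<Delta> m i \<omega> / sqrt (real n)\<bar>))"
    proof (intro sum.cong refl)
      fix i assume "i \<in> {..<n}"
      then have "0 \<le> w n i \<omega>" using w0 \<omega> by simp
      then show "w n i \<omega> * (err b \<delta> m i \<omega> / sqrt (real n)) = \<delta> * (\<bar>w n i \<omega>\<bar> * \<bar>r n i \<omega>\<bar>) + b * (\<bar>w n i \<omega>\<bar> * \<bar>\<Delta> m i \<omega> / sqrt (real n)\<bar>)"
        using D0[of i] by (simp add: err_def r_def add_divide_distrib algebra_simps)
    qed
    also have "\<dots> = \<delta> * (\<Sum>i<n. \<bar>w n i \<omega>\<bar> * \<bar>r n i \<omega>\<bar>) + b * (\<Sum>i<n. \<bar>w n i \<omega>\<bar> * \<bar>\<Delta> m i \<omega> / sqrt (real n)\<bar>)"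
      by (simp only: sum.distrib sum_distrib_left)
    also have "\<dots> \<le> \<delta> * (B + B') + b * (\<tau> * B + \<tau>' / \<tau>)"
    proof (intro add_mono mult_left_mono b)
      show "(\<Sum>i<n. \<bar>w n i \<omega>\<bar> * \<bar>r n i \<omega>\<bar>) \<le> B + B'"
        using sum_prod_le_squares[of "\<lambda>i. w n i \<omega>" "\<lambda>i. r n i \<omega>" n] H by linarith
      have "(\<Sum>i<n. \<bar>w n i \<omega>\<bar> * \<bar>\<Delta> m i \<omega> / sqrt (real n)\<bar>)
        \<le> \<tau> * sq_sum w n \<omega> + (\<Sum>i<n. (\<Delta> m i \<omega> / sqrt (real n))\<^sup>2) / \<tau>"
        by (rule sum_weighted_am_gm[OF \<tau>(1)])
      also have "\<dots> \<le> \<tau> * B + \<tau>' / \<tau>"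
        using H \<tau>(1) by (intro add_mono mult_left_mono divide_right_mono) auto
      finally show "(\<Sum>i<n. \<bar>w n i \<omega>\<bar> * \<bar>\<Delta> m i \<omega> / sqrt (real n)\<bar>) \<le> \<tau> * B + \<tau>' / \<tau>" .
    qed (use \<delta> in simp)
    also have "\<dots> = \<delta> * (B + B') + b * (\<tau> * B) + b * (\<tau>' / \<tau>)" by (simp add: distrib_left)
    also have "\<dots> \<le> 3 * e1" using \<delta>(3) \<tau>(2) \<tau>'(2) by linarith
    finally have "4 * C * ?E n \<omega> \<le> 4 * C * (3 * e1)" using C0 by (intro mult_left_mono) auto
    also have "\<dots> = 3 * e / 4" using C0 by (simp add: e1_def)
    finally show "?Z n \<omega> x t \<le> e" using Z by simp
  qed
qed

theorem uniform_expansion: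
  assumes b: "0 \<le> b"
    and wm: "\<And>n i. i < n \<Longrightarrow> w n i \<in> borel_measurable (G i)"
    and w: "null_array M w" and e: "0 < e"
  shows "aas M (\<lambda>n \<omega>. \<forall>x t. norm t \<le> b \<longrightarrow>
     discrepancy w n x t \<omega> \<le> e)"
proof -
  (* Positive and negative parts of the weights are treated separately. *)
  let ?p = "\<lambda>n i \<omega>. max (w n i \<omega>) 0" and ?m = "\<lambda>n i \<omega>. max (- w n i \<omega>) 0"
  let ?Z = "\<lambda>w n \<omega> x t. discrepancy w n x t \<omega>"
  have "aas M (\<lambda>n \<omega>. (\<forall>x t. norm t \<le> b \<longrightarrow> ?Z ?p n \<omega> x t \<le> e/2) \<and> (\<forall>x t. norm t \<le> b \<longrightarrow> ?Z ?m n \<omega> x t \<le> e/2))"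
  proof (intro aas_conj uniform_expansion_nonneg[OF b _ _ null_array_max(1)[OF w]] uniform_expansion_nonneg[OF b _ _ null_array_max(2)[OF w]])
    fix n i :: nat assume "i < n"
    note [measurable] = wm[OF this]
    show "?p n i \<in> borel_measurable (G i)" "?m n i \<in> borel_measurable (G i)" by measurable
  qed (use e in auto)
  then show ?thesis
  proof (rule aas_impI, intro allI impI, elim conjE)
    fix n \<omega> x and t :: 'e assume t: "norm t \<le> b"
      and h: "\<forall>x t. norm t \<le> b \<longrightarrow> ?Z ?p n \<omega> x t \<le> e/2" "\<forall>x t. norm t \<le> b \<longrightarrow> ?Z ?m n \<omega> x t \<le> e/2"
    have *: "(\<Sum>i<n. w n i \<omega> * g i) = (\<Sum>i<n. max (w n i \<omega>) 0 * g i) - (\<Sum>i<n. max (- w n i \<omega>) 0 * g i)" for g :: "nat \<Rightarrow> real"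
      unfolding sum_subtractf[symmetric] by (intro sum.cong refl) (auto simp: max_def)
    show "?Z w n \<omega> x t \<le> e"
      unfolding *[of "\<lambda>i. ind n i x t \<omega>"] *[of "\<lambda>i. ind0 i x \<omega>"] *[of "\<lambda>i. lin n i x t \<omega>"]
      using h(1)[rule_format, OF t, of x] h(2)[rule_format, OF t, of x] by linarith
  qed
qed

lemma weighted_process_small:
  assumes wm: "\<And>n i. i < n \<Longrightarrow> w n i \<in> borel_measurable (G i)"
    and w: "null_array M w" and sq: "\<And>a. 0 < a \<Longrightarrow> aas M (\<lambda>n \<omega>. sq_sum w n \<omega> \<le> a)" and e: "0 < e"
  shows "aas M (\<lambda>n \<omega>. \<forall>x. \<bar>\<Sum>i<n. w n i \<omega> * ind0 i x \<omega>\<bar> \<le> e)"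
proof -
  let ?p = "\<lambda>n i \<omega>. max (w n i \<omega>) 0" and ?m = "\<lambda>n i \<omega>. max (- w n i \<omega>) 0"
  let ?Z = "\<lambda>w n \<omega> x. \<bar>\<Sum>i<n. w n i \<omega> * dev 0 0 0 x (\<eta> i \<omega>)\<bar>"
  have sq': "aas M (\<lambda>n \<omega>. (\<Sum>i<n. (max (w n i \<omega>) 0)\<^sup>2) \<le> a)" "aas M (\<lambda>n \<omega>. (\<Sum>i<n. (max (- w n i \<omega>) 0)\<^sup>2) \<le> a)"
    if "0 < a" for a
  proof -
    have 1: "(\<Sum>i<n. (max (w n i \<omega>) 0)\<^sup>2) \<le> sq_sum w n \<omega>" and 2: "(\<Sum>i<n. (max (- w n i \<omega>) 0)\<^sup>2) \<le> sq_sum w n \<omega>" for n \<omega>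
      by (intro sum_mono; simp add: max_def)+
    show "aas M (\<lambda>n \<omega>. (\<Sum>i<n. (max (w n i \<omega>) 0)\<^sup>2) \<le> a)" "aas M (\<lambda>n \<omega>. (\<Sum>i<n. (max (- w n i \<omega>) 0)\<^sup>2) \<le> a)"
      by (rule aas_impI[OF sq[OF that]], erule order_trans[rotated], rule 1 2)+
  qed
  have "aas M (\<lambda>n \<omega>. (\<forall>x. ?Z ?p n \<omega> x \<le> e/2) \<and> (\<forall>x. ?Z ?m n \<omega> x \<le> e/2))"
  proof (intro aas_conj process_small[OF _ _ null_array_max(1)[OF w]] process_small[OF _ _ null_array_max(2)[OF w]])
    fix n i :: nat assume "i < n"
    note [measurable] = wm[OF this]
    show "?p n i \<in> borel_measurable (G i)" "?m n i \<in> borel_measurable (G i)" by measurable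
  qed (use e sq' in auto)
  then show ?thesis
  proof (rule aas_impI, intro allI, elim conjE)
    fix n \<omega> x assume h: "\<forall>x. ?Z ?p n \<omega> x \<le> e/2" "\<forall>x. ?Z ?m n \<omega> x \<le> e/2"
    have *: "(\<Sum>i<n. w n i \<omega> * g i) = (\<Sum>i<n. max (w n i \<omega>) 0 * g i) - (\<Sum>i<n. max (- w n i \<omega>) 0 * g i)" for g :: "nat \<Rightarrow> real"
      unfolding sum_subtractf[symmetric] by (intro sum.cong refl) (auto simp: max_def)
    show "\<bar>\<Sum>i<n. w n i \<omega> * ind0 i x \<omega>\<bar> \<le> e"
      unfolding *[of "\<lambda>i. ind0 i x \<omega>"]
      using h(1)[rule_format, of x] h(2)[rule_format, of x] by (simp only: dev_0 ind0_def)
  qed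
qed

lemma \<Gamma>_sum_tight: "0 < \<zeta> \<Longrightarrow> \<exists>B>0. whp M \<zeta> (\<lambda>n \<omega>. (\<Sum>i<n. \<Gamma> i \<omega> / real n) \<le> B)"
proof -
  assume \<zeta>: "0 < \<zeta>"
  obtain B where B: "B > 0" "whp M \<zeta> (\<lambda>n \<omega>. (\<Sum>i<n. (sqrt (\<Gamma> i \<omega>) / sqrt (real n))\<^sup>2) \<le> B)"
    using null_array_tight[OF \<Gamma>_null \<zeta>] by auto
  have "whp M \<zeta> (\<lambda>n \<omega>. (\<Sum>i<n. \<Gamma> i \<omega> / real n) \<le> B)"
    using B(2) by (rule whp_impI) (simp add: power_divide \<Gamma>_nonneg)
  with B(1) show ?thesis by blast
qed

text \<open>Square summing gains the maximal entry of \<open>\<Gamma> / n\<close>, which tends to 0, over the bounded sum of \<open>\<Gamma> / n\<close>.\<close>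

lemma \<Gamma>_small_array:
  assumes le: "\<And>n i \<omega>. i < n \<Longrightarrow> \<omega> \<in> space M \<Longrightarrow> \<bar>w n i \<omega>\<bar> \<le> b * (\<Gamma> i \<omega> / real n)" and b: "0 \<le> b"
  shows "null_array M w" "\<And>a. 0 < a \<Longrightarrow> aas M (\<lambda>n \<omega>. sq_sum w n \<omega> \<le> a)"
proof -
  have sm: "aas M (\<lambda>n \<omega>. \<forall>i<n. \<Gamma> i \<omega> / real n \<le> a)" if a: "0 < a" for a
  proof -
    have "0 < sqrt a" using a by simp
    from null_array_small[OF \<Gamma>_null this] show ?thesis
    proof (rule aas_impI, intro allI impI)
      fix n \<omega> i assume 2: "\<omega> \<in> space M" "\<forall>i<n. \<bar>sqrt (\<Gamma> i \<omega>) / sqrt (real n)\<bar> \<le> sqrt a" and "i < n"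
      then have "\<bar>sqrt (\<Gamma> i \<omega>) / sqrt (real n)\<bar> \<le> sqrt a" using 2 by blast
      then have "sqrt (\<Gamma> i \<omega> / real n) \<le> sqrt a" using \<Gamma>_nonneg[of \<omega> i] 2 by (simp add: real_sqrt_divide)
      then show "\<Gamma> i \<omega> / real n \<le> a" by simp
    qed
  qed
  show sq: "aas M (\<lambda>n \<omega>. sq_sum w n \<omega> \<le> a)" if a: "0 < a" for a
    unfolding aas_def
  proof (intro allI impI)
    fix \<zeta> :: real assume \<zeta>: "0 < \<zeta>"
    obtain B where B: "B > 0" "whp M (\<zeta>/2) (\<lambda>n \<omega>. (\<Sum>i<n. \<Gamma> i \<omega> / real n) \<le> B)"
      using \<Gamma>_sum_tight[of "\<zeta>/2"] \<zeta> by auto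
    define c where "c = a / ((b\<^sup>2 + 1) * B)"
    have c: "0 < c" using a B by (simp add: c_def add_nonneg_pos)
    have "whp M (\<zeta>/2 + \<zeta>/2) (\<lambda>n \<omega>. (\<Sum>i<n. \<Gamma> i \<omega> / real n) \<le> B \<and> (\<forall>i<n. \<Gamma> i \<omega> / real n \<le> c))"
      using \<zeta> by (intro whp_conj B aasD[OF sm[OF c]]) auto
    then have "whp M \<zeta> (\<lambda>n \<omega>. (\<Sum>i<n. \<Gamma> i \<omega> / real n) \<le> B \<and> (\<forall>i<n. \<Gamma> i \<omega> / real n \<le> c))" by simp
    then show "whp M \<zeta> (\<lambda>n \<omega>. sq_sum w n \<omega> \<le> a)"
    proof (rule whp_impI)
      fix n \<omega> assume \<omega>: "\<omega> \<in> space M" and h: "(\<Sum>i<n. \<Gamma> i \<omega> / real n) \<le> B \<and> (\<forall>i<n. \<Gamma> i \<omega> / real n \<le> c)"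
      have "sq_sum w n \<omega> \<le> (\<Sum>i<n. (b\<^sup>2 * c) * (\<Gamma> i \<omega> / real n))"
      proof (rule sum_mono)
        fix i assume "i \<in> {..<n}"
        then have i: "i < n" by simp
        have g: "0 \<le> \<Gamma> i \<omega> / real n" using \<Gamma>_nonneg[OF \<omega>] by simp
        have "\<bar>w n i \<omega>\<bar>\<^sup>2 \<le> (b * (\<Gamma> i \<omega> / real n))\<^sup>2" using le[OF i \<omega>] by (intro power_mono) auto
        also have "\<dots> = b\<^sup>2 * ((\<Gamma> i \<omega> / real n) * (\<Gamma> i \<omega> / real n))" by (simp only: power2_eq_square mult_ac)
        also have "\<dots> \<le> b\<^sup>2 * (c * (\<Gamma> i \<omega> / real n))" using h i g by (intro mult_left_mono mult_right_mono) auto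
        finally show "(w n i \<omega>)\<^sup>2 \<le> (b\<^sup>2 * c) * (\<Gamma> i \<omega> / real n)" by (simp add: mult.assoc)
      qed
      also have "\<dots> = (b\<^sup>2 * c) * (\<Sum>i<n. \<Gamma> i \<omega> / real n)" by (simp only: sum_distrib_left)
      also have "\<dots> \<le> (b\<^sup>2 * c) * B" using h c by (intro mult_left_mono) auto
      also have "\<dots> \<le> ((b\<^sup>2 + 1) * c) * B" using c B by (intro mult_right_mono) auto
      also have "\<dots> = a"
      proof -
        have "b\<^sup>2 + 1 > 0" by (simp add: add_nonneg_pos)
        then show ?thesis using B by (simp add: c_def)
      qed
      finally show "sq_sum w n \<omega> \<le> a" .
    qed
  qed
  show "null_array M w"
    unfolding null_array_def
  proof (intro conjI allI impI)
    fix a :: real assume a: "0 < a"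
    then have "0 < a / (b + 1)" using b by simp
    from sm[OF this] show "aas M (\<lambda>n \<omega>. \<forall>i<n. \<bar>w n i \<omega>\<bar> \<le> a)"
    proof (rule aas_impI, intro allI impI)
      fix n \<omega> i assume h: "\<omega> \<in> space M" "\<forall>i<n. \<Gamma> i \<omega> / real n \<le> a / (b + 1)" "i < n"
      have "\<bar>w n i \<omega>\<bar> \<le> b * (\<Gamma> i \<omega> / real n)" using le h by simp
      also have "\<dots> \<le> b * (a / (b + 1))" using h b by (intro mult_left_mono) auto
      also have "\<dots> \<le> a" using a b by (simp add: field_simps)
      finally show "\<bar>w n i \<omega>\<bar> \<le> a" .
    qed
  next
    show "tight M (\<lambda>n \<omega>. \<Sum>i<n. (w n i \<omega>)\<^sup>2)"
      unfolding tight_def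
    proof (intro allI impI exI[of _ 1] conjI)
      fix \<zeta> :: real assume "0 < \<zeta>"
      then show "whp M \<zeta> (\<lambda>n \<omega>. sq_sum w n \<omega> \<le> 1)" by (intro aasD[OF sq]) auto
    qed simp
  qed
qed

lemma lin_le:
  assumes t: "norm t \<le> b" and \<omega>: "\<omega> \<in> space M"
  shows "\<bar>lin n i x t \<omega>\<bar> \<le> b * C * (norm (\<alpha> i \<omega>) / sqrt (real n) + norm (\<beta> i \<omega>) / sqrt (real n))"
proof -
  have b: "0 \<le> b" using t norm_ge_zero[of t] by linarith
  have cs: "\<bar>g \<bullet> t\<bar> \<le> b * norm g" for g :: 'e
    using order_trans[OF Cauchy_Schwarz_ineq2[of g t] mult_left_mono[OF t, of "norm g"]] by (simp add: mult.commute)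
  have "\<bar>lin n i x t \<omega>\<bar> = \<bar>(\<alpha> i \<omega> \<bullet> t) * f x + (\<beta> i \<omega> \<bullet> t) * (x * f x)\<bar> / sqrt (real n)"
    by (simp add: lin_def abs_divide abs_mult[symmetric] algebra_simps)
  also have "\<dots> \<le> (b * norm (\<alpha> i \<omega>) * C + b * norm (\<beta> i \<omega>) * C) / sqrt (real n)"
  proof (rule divide_right_mono)
    have "\<bar>(\<alpha> i \<omega> \<bullet> t) * f x\<bar> \<le> b * norm (\<alpha> i \<omega>) * C"
      unfolding abs_mult using cs f_le f_nonneg b by (intro mult_mono) auto
    moreover have "\<bar>(\<beta> i \<omega> \<bullet> t) * (x * f x)\<bar> \<le> b * norm (\<beta> i \<omega>) * C"
      unfolding abs_mult[of "\<beta> i \<omega> \<bullet> t"] using cs xf_le[of x] f_nonneg[of x] b by (intro mult_mono) (auto simp: abs_mult)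
    ultimately show "\<bar>(\<alpha> i \<omega> \<bullet> t) * f x + (\<beta> i \<omega> \<bullet> t) * (x * f x)\<bar> \<le> b * norm (\<alpha> i \<omega>) * C + b * norm (\<beta> i \<omega>) * C"
      by linarith
  qed simp
  also have "\<dots> = b * C * (norm (\<alpha> i \<omega>) / sqrt (real n) + norm (\<beta> i \<omega>) / sqrt (real n))"
    by (simp add: add_divide_distrib algebra_simps)
  finally show ?thesis .
qed

text \<open>For \<open>t\<close> in a finite net the weight increments form an array with vanishing square sums, so every part of the
  expansion with these weights vanishes. Between net points the weights change by at most
  \<open>\<delta> \<Gamma> / n\<close>, whose sum is bounded by a multiple of \<open>\<delta>\<close>.\<close>

theorem weight_change_small:
  assumes b: "0 \<le> b" and e: "0 < e"
  shows "aas M (\<lambda>n \<omega>. \<forall>x t. norm t \<le> b \<longrightarrow>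
     \<bar>\<Sum>i<n. (wt i (\<theta> + (1 / sqrt (real n)) *\<^sub>R t) \<omega> - wt i \<theta> \<omega>) / sqrt (real n) * ind n i x t \<omega>\<bar> \<le> e)"
  unfolding aas_def
proof (intro allI impI)
  fix \<zeta> :: real assume \<zeta>: "0 < \<zeta>"
  have C0: "C > 0" using C_ge_1 by simp
  let ?s = "\<lambda>n t. \<theta> + (1 / sqrt (real n)) *\<^sub>R t"
  have close: "norm (?s n t - \<theta>) < \<kappa> 0" if "b / sqrt (real n) < \<kappa> 0" "norm t \<le> b" for n t
    using that divide_right_mono[OF that(2), of "sqrt (real n)"] by simp
  obtain B where B: "B > 0" "whp M (\<zeta>/2) (\<lambda>n \<omega>. (\<Sum>i<n. \<Gamma> i \<omega> / real n) \<le> B)"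
    using \<Gamma>_sum_tight[of "\<zeta>/2"] \<zeta> by auto
  define \<delta> where "\<delta> = e / (4 * B)"
  have \<delta>: "0 < \<delta>" "\<delta> * B \<le> e / 4" using e B by (auto simp: \<delta>_def)
  obtain T where T: "T \<subseteq> cball (0::'e) b" "finite T" "\<And>t. norm t \<le> b \<Longrightarrow> \<exists>t0\<in>T. norm (t - t0) \<le> \<delta>"
    using finite_net_cball[OF \<delta>(1), of b] by metis
  (* For the finitely many n at which the perturbed parameter may leave the ball of radius kappa 0, the
     weights are set to 0 to keep them measurable and bounded. *)
  define w where "w t0 n i \<omega> = (if b / sqrt (real n) < \<kappa> 0 then (wt i (?s n t0) \<omega> - wt i \<theta> \<omega>) / sqrt (real n) else 0)" for t0 n i \<omega>
  have wm: "w t0 n i \<in> borel_measurable (G i)" if "t0 \<in> T" for t0 n i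
  proof (cases "b / sqrt (real n) < \<kappa> 0")
    case True
    have "norm t0 \<le> b" using T(1) that by auto
    note [measurable] = wt_meas[OF close[OF True this], of i] wt_meas[of \<theta> i, simplified, OF \<kappa>_pos]
    show ?thesis unfolding w_def using True by simp
  next
    case False
    then show ?thesis unfolding w_def by simp
  qed
  have wle: "\<bar>w t0 n i \<omega>\<bar> \<le> b * (\<Gamma> i \<omega> / real n)" if t0: "t0 \<in> T" and \<omega>: "\<omega> \<in> space M" for t0 n i \<omega>
  proof (cases "b / sqrt (real n) < \<kappa> 0")
    case True
    have tb: "norm t0 \<le> b" using T(1) t0 by auto
    have "\<bar>wt i (?s n t0) \<omega> - wt i \<theta> \<omega>\<bar> \<le> \<Gamma> i \<omega> * norm (?s n t0 - \<theta>)"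
      using close[OF True tb] \<kappa>_pos by (intro wt_lip \<omega>) auto
    also have "\<dots> \<le> \<Gamma> i \<omega> * (b / sqrt (real n))"
      using tb \<Gamma>_nonneg[OF \<omega>] by (intro mult_left_mono) (auto intro: divide_right_mono)
    finally have "\<bar>wt i (?s n t0) \<omega> - wt i \<theta> \<omega>\<bar> / sqrt (real n) \<le> \<Gamma> i \<omega> * (b / sqrt (real n)) / sqrt (real n)"
      by (intro divide_right_mono) auto
    also have "\<dots> = b * (\<Gamma> i \<omega> / real n)" by (simp add: mult.commute)
    finally show ?thesis using True by (simp add: w_def abs_divide)
  next
    case False
    then show ?thesis using b \<Gamma>_nonneg[OF \<omega>] by (simp add: w_def)
  qed
  note wn = \<Gamma>_small_array[OF wle b]
  let ?r = "\<lambda>n i \<omega>. norm (\<alpha> i \<omega>) / sqrt (real n) + norm (\<beta> i \<omega>) / sqrt (real n)"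
  have r: "null_array M ?r" by (rule null_array_plus[OF \<alpha>_null \<beta>_null])
  let ?A = "\<lambda>t0 n \<omega>. \<forall>x t. norm t \<le> b \<longrightarrow> \<bar>(\<Sum>i<n. w t0 n i \<omega> * ind n i x t \<omega>) - (\<Sum>i<n. w t0 n i \<omega> * ind0 i x \<omega>) - (\<Sum>i<n. w t0 n i \<omega> * lin n i x t \<omega>)\<bar> \<le> e/4"
  let ?B = "\<lambda>t0 n \<omega>. \<forall>x. \<bar>\<Sum>i<n. w t0 n i \<omega> * ind0 i x \<omega>\<bar> \<le> e/4"
  let ?D = "\<lambda>t0 n \<omega>. (\<Sum>i<n. \<bar>w t0 n i \<omega>\<bar> * \<bar>?r n i \<omega>\<bar>) \<le> e / (4 * ((b + 1) * C))"
  let ?Q = "\<lambda>t0 n \<omega>. ?A t0 n \<omega> \<and> ?B t0 n \<omega> \<and> ?D t0 n \<omega>"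
  have Q: "aas M (\<lambda>n \<omega>. \<forall>t0\<in>T. ?Q t0 n \<omega>)"
  proof (intro aas_finite_ball T(2) aas_conj)
    fix t0 assume t0: "t0 \<in> T"
    show "aas M (?A t0)" by (rule uniform_expansion[OF b wm[OF t0] wn(1)[OF t0]]) (use e in auto)
    show "aas M (?B t0)" by (rule weighted_process_small[OF wm[OF t0] wn(1)[OF t0] wn(2)[OF t0]]) (use e in auto)
    show "aas M (?D t0)" by (rule mixed_product_small[OF wn(2)[OF t0] r]) (use e b C0 in auto)
  qed
  have "whp M (\<zeta>/2 + \<zeta>/2) (\<lambda>n \<omega>. (\<Sum>i<n. \<Gamma> i \<omega> / real n) \<le> B \<and> (\<forall>t0\<in>T. ?Q t0 n \<omega>))"
    using \<zeta> by (intro whp_conj B aasD[OF Q]) auto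
  then show "whp M \<zeta> (\<lambda>n \<omega>. \<forall>x t. norm t \<le> b \<longrightarrow>
     \<bar>\<Sum>i<n. (wt i (?s n t) \<omega> - wt i \<theta> \<omega>) / sqrt (real n) * ind n i x t \<omega>\<bar> \<le> e)"
  proof (rule whp_mono)
    show "\<forall>\<^sub>F n in sequentially. \<forall>\<omega>\<in>space M. (\<Sum>i<n. \<Gamma> i \<omega> / real n) \<le> B \<and> (\<forall>t0\<in>T. ?Q t0 n \<omega>) \<longrightarrow>
      (\<forall>x t. norm t \<le> b \<longrightarrow> \<bar>\<Sum>i<n. (wt i (?s n t) \<omega> - wt i \<theta> \<omega>) / sqrt (real n) * ind n i x t \<omega>\<bar> \<le> e)"
      using eventually_local[of b 0]
    proof (eventually_elim, intro ballI impI allI, elim conjE)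
      fix n \<omega> x and t :: 'e assume n: "b / sqrt (real n) < \<kappa> 0" "0 < n" and \<omega>: "\<omega> \<in> space M"
        and GB: "(\<Sum>i<n. \<Gamma> i \<omega> / real n) \<le> B" and Q: "\<forall>t0\<in>T. ?Q t0 n \<omega>" and t: "norm t \<le> b"
      obtain t0 where t0: "t0 \<in> T" "norm (t - t0) \<le> \<delta>" using T(3)[OF t] by auto
      have tb: "norm t0 \<le> b" using T(1) t0 by auto
      have A: "\<bar>(\<Sum>i<n. w t0 n i \<omega> * ind n i x t \<omega>) - (\<Sum>i<n. w t0 n i \<omega> * ind0 i x \<omega>) - (\<Sum>i<n. w t0 n i \<omega> * lin n i x t \<omega>)\<bar> \<le> e/4"
        and B': "\<bar>\<Sum>i<n. w t0 n i \<omega> * ind0 i x \<omega>\<bar> \<le> e/4" and D: "?D t0 n \<omega>"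
        using Q t0(1) t by blast+
      have lw: "\<bar>\<Sum>i<n. w t0 n i \<omega> * lin n i x t \<omega>\<bar> \<le> e/4"
      proof -
        have "\<bar>\<Sum>i<n. w t0 n i \<omega> * lin n i x t \<omega>\<bar> \<le> (\<Sum>i<n. (b * C) * (\<bar>w t0 n i \<omega>\<bar> * \<bar>?r n i \<omega>\<bar>))"
        proof (rule order_trans[OF sum_abs], rule sum_mono)
          fix i
          have "\<bar>w t0 n i \<omega> * lin n i x t \<omega>\<bar> \<le> \<bar>w t0 n i \<omega>\<bar> * (b * C * ?r n i \<omega>)"
            unfolding abs_mult by (intro mult_left_mono lin_le t \<omega>) auto
          also have "\<dots> \<le> (b * C) * (\<bar>w t0 n i \<omega>\<bar> * \<bar>?r n i \<omega>\<bar>)" by (simp add: mult_ac)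
          finally show "\<bar>w t0 n i \<omega> * lin n i x t \<omega>\<bar> \<le> (b * C) * (\<bar>w t0 n i \<omega>\<bar> * \<bar>?r n i \<omega>\<bar>)" .
        qed
        also have "\<dots> = (b * C) * (\<Sum>i<n. \<bar>w t0 n i \<omega>\<bar> * \<bar>?r n i \<omega>\<bar>)" by (simp only: sum_distrib_left)
        also have "\<dots> \<le> ((b + 1) * C) * (e / (4 * ((b + 1) * C)))"
          using D b C0 e by (intro mult_mono) (auto intro: sum_nonneg)
        also have "\<dots> = e / 4" using b C0 by simp
        finally show ?thesis .
      qed
      have main: "\<bar>\<Sum>i<n. w t0 n i \<omega> * ind n i x t \<omega>\<bar> \<le> e/4 + e/4 + e/4" using A B' lw by linarith
      have rest: "\<bar>\<Sum>i<n. ((wt i (?s n t) \<omega> - wt i (?s n t0) \<omega>) / sqrt (real n)) * ind n i x t \<omega>\<bar> \<le> e/4"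
      proof -
        have "\<bar>\<Sum>i<n. ((wt i (?s n t) \<omega> - wt i (?s n t0) \<omega>) / sqrt (real n)) * ind n i x t \<omega>\<bar> \<le> (\<Sum>i<n. \<delta> * (\<Gamma> i \<omega> / real n))"
        proof (rule order_trans[OF sum_abs], rule sum_mono)
          fix i
          have "\<bar>wt i (?s n t) \<omega> - wt i (?s n t0) \<omega>\<bar> \<le> \<Gamma> i \<omega> * norm (?s n t - ?s n t0)"
            by (intro wt_lip close n t tb \<omega>)
          also have "?s n t - ?s n t0 = (1 / sqrt (real n)) *\<^sub>R (t - t0)" by (simp add: scaleR_diff_right)
          also have "\<Gamma> i \<omega> * norm ((1 / sqrt (real n)) *\<^sub>R (t - t0)) \<le> \<Gamma> i \<omega> * (\<delta> / sqrt (real n))"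
            using t0(2) \<Gamma>_nonneg[OF \<omega>] by (intro mult_left_mono) (auto intro: divide_right_mono)
          finally have "\<bar>wt i (?s n t) \<omega> - wt i (?s n t0) \<omega>\<bar> / sqrt (real n) \<le> \<Gamma> i \<omega> * (\<delta> / sqrt (real n)) / sqrt (real n)"
            by (intro divide_right_mono) auto
          also have "\<dots> = \<delta> * (\<Gamma> i \<omega> / real n)" by (simp add: mult.commute)
          finally have 1: "\<bar>(wt i (?s n t) \<omega> - wt i (?s n t0) \<omega>) / sqrt (real n)\<bar> \<le> \<delta> * (\<Gamma> i \<omega> / real n)" by (simp add: abs_divide)
          have "\<bar>(wt i (?s n t) \<omega> - wt i (?s n t0) \<omega>) / sqrt (real n)\<bar> * \<bar>ind n i x t \<omega>\<bar> \<le> \<delta> * (\<Gamma> i \<omega> / real n) * 1"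
            by (intro mult_mono 1 ind_abs_le) (use \<delta> \<Gamma>_nonneg[OF \<omega>] in auto)
          then show "\<bar>((wt i (?s n t) \<omega> - wt i (?s n t0) \<omega>) / sqrt (real n)) * ind n i x t \<omega>\<bar> \<le> \<delta> * (\<Gamma> i \<omega> / real n)"
            by (simp add: abs_mult)
        qed
        also have "\<dots> = \<delta> * (\<Sum>i<n. \<Gamma> i \<omega> / real n)" by (simp only: sum_distrib_left)
        also have "\<dots> \<le> \<delta> * B" using GB \<delta> by (intro mult_left_mono) auto
        finally show ?thesis using \<delta>(2) by linarith
      qed
      have "(\<Sum>i<n. (wt i (?s n t) \<omega> - wt i \<theta> \<omega>) / sqrt (real n) * ind n i x t \<omega>)
        = (\<Sum>i<n. w t0 n i \<omega> * ind n i x t \<omega>) + (\<Sum>i<n. ((wt i (?s n t) \<omega> - wt i (?s n t0) \<omega>) / sqrt (real n)) * ind n i x t \<omega>)"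
        unfolding sum.distrib[symmetric] using n by (intro sum.cong refl) (simp add: w_def diff_divide_distrib algebra_simps)
      then show "\<bar>\<Sum>i<n. (wt i (?s n t) \<omega> - wt i \<theta> \<omega>) / sqrt (real n) * ind n i x t \<omega>\<bar> \<le> e"
        using main rest by linarith
    qed
  qed simp
qed

theorem process_expansion:
  assumes b: "0 \<le> b" and e: "0 < e"
  shows "aas M (\<lambda>n \<omega>. \<forall>x t. norm t \<le> b \<longrightarrow>
     \<bar>(\<Sum>i<n. wt i (\<theta> + (1 / sqrt (real n)) *\<^sub>R t) \<omega> / sqrt (real n) * ind n i x t \<omega>)
       - (\<Sum>i<n. wt i \<theta> \<omega> / sqrt (real n) * ind0 i x \<omega>) - (\<Sum>i<n. wt i \<theta> \<omega> / sqrt (real n) * lin n i x t \<omega>)\<bar> \<le> e)"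
proof -
  let ?s = "\<lambda>n t. \<theta> + (1 / sqrt (real n)) *\<^sub>R t"
  have m: "(\<lambda>\<omega>. wt i \<theta> \<omega> / sqrt (real n)) \<in> borel_measurable (G i)" for i n
    using wt_meas[of \<theta> i] \<kappa>_pos by simp
  have "aas M (\<lambda>n \<omega>. (\<forall>x t. norm t \<le> b \<longrightarrow>
      \<bar>(\<Sum>i<n. wt i \<theta> \<omega> / sqrt (real n) * ind n i x t \<omega>) - (\<Sum>i<n. wt i \<theta> \<omega> / sqrt (real n) * ind0 i x \<omega>) - (\<Sum>i<n. wt i \<theta> \<omega> / sqrt (real n) * lin n i x t \<omega>)\<bar> \<le> e/2)
    \<and> (\<forall>x t. norm t \<le> b \<longrightarrow> \<bar>\<Sum>i<n. (wt i (?s n t) \<omega> - wt i \<theta> \<omega>) / sqrt (real n) * ind n i x t \<omega>\<bar> \<le> e/2))"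
    by (intro aas_conj uniform_expansion[OF b m wt_null] weight_change_small[OF b]) (use e in auto)
  then show ?thesis
  proof (rule aas_impI, intro allI impI, elim conjE)
    fix n \<omega> x and t :: 'e assume t: "norm t \<le> b"
      and 1: "\<forall>x t. norm t \<le> b \<longrightarrow>
      \<bar>(\<Sum>i<n. wt i \<theta> \<omega> / sqrt (real n) * ind n i x t \<omega>) - (\<Sum>i<n. wt i \<theta> \<omega> / sqrt (real n) * ind0 i x \<omega>) - (\<Sum>i<n. wt i \<theta> \<omega> / sqrt (real n) * lin n i x t \<omega>)\<bar> \<le> e/2"
      and 2: "\<forall>x t. norm t \<le> b \<longrightarrow> \<bar>\<Sum>i<n. (wt i (?s n t) \<omega> - wt i \<theta> \<omega>) / sqrt (real n) * ind n i x t \<omega>\<bar> \<le> e/2"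
    have "(\<Sum>i<n. wt i (?s n t) \<omega> / sqrt (real n) * ind n i x t \<omega>)
      = (\<Sum>i<n. wt i \<theta> \<omega> / sqrt (real n) * ind n i x t \<omega>) + (\<Sum>i<n. (wt i (?s n t) \<omega> - wt i \<theta> \<omega>) / sqrt (real n) * ind n i x t \<omega>)"
      unfolding sum.distrib[symmetric] by (intro sum.cong refl) (simp add: diff_divide_distrib algebra_simps)
    then show "\<bar>(\<Sum>i<n. wt i (?s n t) \<omega> / sqrt (real n) * ind n i x t \<omega>)
       - (\<Sum>i<n. wt i \<theta> \<omega> / sqrt (real n) * ind0 i x \<omega>) - (\<Sum>i<n. wt i \<theta> \<omega> / sqrt (real n) * lin n i x t \<omega>)\<bar> \<le> e"
      using 1[rule_format, OF t, of x] 2[rule_format, OF t, of x] by linarith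
  qed
qed

end

section \<open>Identically distributed arrays\<close>

lemma whp_markov:
  fixes X :: "nat \<Rightarrow> 'a \<Rightarrow> real"
  assumes M: "prob_space M" and X: "\<And>n. X n \<in> borel_measurable M"
    and int: "\<And>n. 0 < n \<Longrightarrow> (\<integral>\<^sup>+\<omega>. ennreal (X n \<omega>) \<partial>M) \<le> ennreal c"
    and B: "0 < B" "c \<le> \<zeta> * B"
  shows "whp M \<zeta> (\<lambda>n \<omega>. X n \<omega> \<le> B)"
proof (rule whp_set)
  show "\<forall>\<^sub>F n in sequentially. \<exists>A\<in>sets M. emeasure M A \<le> ennreal \<zeta> \<and> (\<forall>\<omega>\<in>space M - A. X n \<omega> \<le> B)"
    using eventually_gt_at_top[of "0::nat"]
  proof eventually_elim
    case (elim n)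
    note [measurable] = X[of n]
    let ?A = "{\<omega> \<in> space M. 1 \<le> ennreal (1/B) * ennreal (X n \<omega>)}"
    have "emeasure M ?A \<le> ennreal (1/B) * (\<integral>\<^sup>+\<omega>. ennreal (X n \<omega>) * indicator (space M) \<omega> \<partial>M)"
      by (rule nn_integral_Markov_inequality) measurable
    also have "(\<integral>\<^sup>+\<omega>. ennreal (X n \<omega>) * indicator (space M) \<omega> \<partial>M) = (\<integral>\<^sup>+\<omega>. ennreal (X n \<omega>) \<partial>M)"
      by (rule nn_integral_cong) simp
    also have "ennreal (1/B) * \<dots> \<le> ennreal (1/B) * ennreal c" by (intro mult_left_mono int elim) auto
    also have "\<dots> = ennreal (1/B * c)" using B by (intro ennreal_mult'[symmetric]) auto
    also have "\<dots> \<le> ennreal \<zeta>" using B by (intro ennreal_leI) (simp add: field_simps)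
    finally have A: "emeasure M ?A \<le> ennreal \<zeta>" .
    show ?case
    proof (intro bexI[of _ ?A] conjI A ballI)
      fix \<omega> assume \<omega>: "\<omega> \<in> space M - ?A"
      show "X n \<omega> \<le> B"
      proof (rule ccontr)
        assume "\<not> ?thesis"
        then have "1 \<le> 1/B * X n \<omega>" using B by (simp add: field_simps)
        then have "ennreal 1 \<le> ennreal (1/B * X n \<omega>)" by (intro ennreal_leI)
        also have "\<dots> = ennreal (1/B) * ennreal (X n \<omega>)" using B by (intro ennreal_mult') auto
        finally show False using \<omega> by simp
      qed
    qed measurable
  qed
qed

text \<open>Square sums have constant expectation. The largest entry is negligible because
  \<open>n P(\<bar>Y\<bar> > a \<surd>n) \<le> E (Y\<^sup>2; \<bar>Y\<bar> > a \<surd>n) / a\<^sup>2 \<rightarrow> 0\<close> by dominated convergence. Identical distribution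
  is expressed through the expectations of nonnegative functions of one variable.\<close>

lemma null_array_identical:
  fixes Y :: "nat \<Rightarrow> 'a \<Rightarrow> real"
  assumes M: "prob_space M" and Y[measurable]: "\<And>i. Y i \<in> borel_measurable M"
    and id: "\<And>i (\<phi> :: real \<Rightarrow> ennreal). \<phi> \<in> borel_measurable borel \<Longrightarrow> (\<integral>\<^sup>+\<omega>. \<phi> (Y i \<omega>) \<partial>M) = (\<integral>\<^sup>+\<omega>. \<phi> (Y 0 \<omega>) \<partial>M)"
    and fin: "(\<integral>\<^sup>+\<omega>. ennreal ((Y 0 \<omega>)\<^sup>2) \<partial>M) < \<infinity>"
  shows "null_array M (\<lambda>n i \<omega>. Y i \<omega> / sqrt (real n))"
    and "\<And>\<zeta> B. 0 < B \<Longrightarrow> (\<integral>\<^sup>+\<omega>. ennreal ((Y 0 \<omega>)\<^sup>2) \<partial>M) \<le> ennreal (\<zeta> * B) \<Longrightarrow> whp M \<zeta> (\<lambda>n \<omega>. (\<Sum>i<n. (Y i \<omega> / sqrt (real n))\<^sup>2) \<le> B)"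
proof -
  interpret prob_space M by fact
  define c where "c = enn2real (\<integral>\<^sup>+\<omega>. ennreal ((Y 0 \<omega>)\<^sup>2) \<partial>M)"
  have c: "(\<integral>\<^sup>+\<omega>. ennreal ((Y 0 \<omega>)\<^sup>2) \<partial>M) = ennreal c" "0 \<le> c" using fin by (auto simp: c_def)
  have idsq: "(\<integral>\<^sup>+\<omega>. ennreal ((Y i \<omega>)\<^sup>2) \<partial>M) = ennreal c" for i
  proof -
    have "(\<lambda>x::real. ennreal (x\<^sup>2)) \<in> borel_measurable borel" by measurable
    from id[OF this, of i] show ?thesis by (simp only: c(1))
  qed
  have int: "(\<integral>\<^sup>+\<omega>. ennreal (\<Sum>i<n. (Y i \<omega> / sqrt (real n))\<^sup>2) \<partial>M) \<le> ennreal c" if n: "0 < n" for n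
  proof -
    have "(\<integral>\<^sup>+\<omega>. ennreal (\<Sum>i<n. (Y i \<omega> / sqrt (real n))\<^sup>2) \<partial>M) = (\<integral>\<^sup>+\<omega>. (\<Sum>i<n. ennreal (1 / real n) * ennreal ((Y i \<omega>)\<^sup>2)) \<partial>M)"
    proof (rule nn_integral_cong)
      fix \<omega>
      have "ennreal (\<Sum>i<n. (Y i \<omega> / sqrt (real n))\<^sup>2) = (\<Sum>i<n. ennreal ((Y i \<omega> / sqrt (real n))\<^sup>2))"
        by (rule sum_ennreal[symmetric]) simp
      also have "\<dots> = (\<Sum>i<n. ennreal (1 / real n) * ennreal ((Y i \<omega>)\<^sup>2))"
      proof (rule sum.cong[OF refl])
        fix i
        have "(Y i \<omega> / sqrt (real n))\<^sup>2 = 1 / real n * (Y i \<omega>)\<^sup>2" by (simp add: power_divide)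
        then show "ennreal ((Y i \<omega> / sqrt (real n))\<^sup>2) = ennreal (1 / real n) * ennreal ((Y i \<omega>)\<^sup>2)"
          using ennreal_mult'[of "1 / real n" "(Y i \<omega>)\<^sup>2"] by (simp only:) simp
      qed
      finally show "ennreal (\<Sum>i<n. (Y i \<omega> / sqrt (real n))\<^sup>2) = (\<Sum>i<n. ennreal (1 / real n) * ennreal ((Y i \<omega>)\<^sup>2))" .
    qed
    also have "\<dots> = (\<Sum>i<n. ennreal (1 / real n) * (\<integral>\<^sup>+\<omega>. ennreal ((Y i \<omega>)\<^sup>2) \<partial>M))"
      by (subst nn_integral_sum) (auto simp: nn_integral_cmult)
    also have "\<dots> = (\<Sum>i<n. ennreal (1 / real n * c))"
      unfolding idsq by (intro sum.cong refl ennreal_mult'[symmetric]) simp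
    also have "\<dots> = ennreal (\<Sum>i<n. 1 / real n * c)" using c(2) by (intro sum_ennreal) auto
    also have "(\<Sum>i<n. 1 / real n * c) = c" using n by simp
    finally show ?thesis by simp
  qed
  show tm: "whp M \<zeta> (\<lambda>n \<omega>. (\<Sum>i<n. (Y i \<omega> / sqrt (real n))\<^sup>2) \<le> B)"
    if "0 < B" "(\<integral>\<^sup>+\<omega>. ennreal ((Y 0 \<omega>)\<^sup>2) \<partial>M) \<le> ennreal (\<zeta> * B)" for \<zeta> B
  proof (cases "0 \<le> \<zeta> * B")
    case True
    then have "c \<le> \<zeta> * B" using that(2) c by simp
    then show ?thesis by (intro whp_markov[OF M _ int _]) (use that in auto)
  next
    case False
    then have "\<zeta> < 0" using that(1) by (simp add: not_le mult_less_0_iff)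
    moreover have "c = 0" using False that(2) c by (simp add: ennreal_neg)
    ultimately have "whp M 0 (\<lambda>n \<omega>. (\<Sum>i<n. (Y i \<omega> / sqrt (real n))\<^sup>2) \<le> B)"
      by (intro whp_markov[OF M _ int _]) (use that in auto)
    then show ?thesis using \<open>\<zeta> < 0\<close> by (simp add: whp_def ennreal_neg)
  qed
  show "null_array M (\<lambda>n i \<omega>. Y i \<omega> / sqrt (real n))"
    unfolding null_array_def
  proof (intro conjI allI impI)
    show "tight M (\<lambda>n \<omega>. \<Sum>i<n. (Y i \<omega> / sqrt (real n))\<^sup>2)"
      unfolding tight_def
    proof (intro allI impI)
      fix \<zeta> :: real assume \<zeta>: "0 < \<zeta>"
      have "whp M \<zeta> (\<lambda>n \<omega>. (\<Sum>i<n. (Y i \<omega> / sqrt (real n))\<^sup>2) \<le> (c + 1) / \<zeta>)"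
        using \<zeta> c by (intro tm) (auto intro!: ennreal_leI)
      then show "\<exists>B>0. whp M \<zeta> (\<lambda>n \<omega>. (\<Sum>i<n. (Y i \<omega> / sqrt (real n))\<^sup>2) \<le> B)"
        using \<zeta> c by (intro exI[of _ "(c+1)/\<zeta>"]) auto
    qed
  next
    fix a :: real assume a: "0 < a"
    define J where "J n = (\<integral>\<^sup>+\<omega>. ennreal ((Y 0 \<omega>)\<^sup>2) * indicator {\<omega>. a * sqrt (real n) < \<bar>Y 0 \<omega>\<bar>} \<omega> \<partial>M)" for n :: nat
    have lim: "J \<longlonglongrightarrow> (\<integral>\<^sup>+\<omega>. 0 \<partial>M)"
      unfolding J_def
    proof (rule nn_integral_dominated_convergence[where w="\<lambda>\<omega>. ennreal ((Y 0 \<omega>)\<^sup>2)"])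
      show "AE \<omega> in M. (\<lambda>n. ennreal ((Y 0 \<omega>)\<^sup>2) * indicator {\<omega>. a * sqrt (real n) < \<bar>Y 0 \<omega>\<bar>} \<omega>) \<longlonglongrightarrow> 0"
      proof (rule AE_I2)
        fix \<omega>
        have "filterlim (\<lambda>n. a * sqrt (real n)) at_top sequentially"
          using a by (intro filterlim_tendsto_pos_mult_at_top[OF tendsto_const] filterlim_compose[OF sqrt_at_top] filterlim_real_sequentially)
        then have "\<forall>\<^sub>F n in sequentially. \<bar>Y 0 \<omega>\<bar> \<le> a * sqrt (real n)" by (simp add: filterlim_at_top)
        then show "(\<lambda>n. ennreal ((Y 0 \<omega>)\<^sup>2) * indicator {\<omega>. a * sqrt (real n) < \<bar>Y 0 \<omega>\<bar>} \<omega>) \<longlonglongrightarrow> 0"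
          by (intro tendsto_eventually, elim eventually_mono) (simp add: indicator_def)
      qed
    qed (use fin in \<open>auto simp: indicator_def\<close>)
    then have lim0: "J \<longlonglongrightarrow> 0" by simp
    show "aas M (\<lambda>n \<omega>. \<forall>i<n. \<bar>Y i \<omega> / sqrt (real n)\<bar> \<le> a)"
      unfolding aas_def
    proof (intro allI impI whp_set)
      fix \<zeta> :: real assume \<zeta>: "0 < \<zeta>"
      have "\<forall>\<^sub>F n in sequentially. J n < ennreal (\<zeta> * a\<^sup>2)"
        using \<zeta> a by (intro order_tendstoD(2)[OF lim0]) auto
      then show "\<forall>\<^sub>F n in sequentially. \<exists>A\<in>sets M. emeasure M A \<le> ennreal \<zeta> \<and> (\<forall>\<omega>\<in>space M - A. \<forall>i<n. \<bar>Y i \<omega> / sqrt (real n)\<bar> \<le> a)"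
        using eventually_gt_at_top[of "0::nat"]
      proof eventually_elim
        case (elim n)
        have sn: "0 < sqrt (real n)" using elim by simp
        define A where "A i = {\<omega> \<in> space M. a * sqrt (real n) < \<bar>Y i \<omega>\<bar>}" for i
        have Am: "A i \<in> sets M" for i unfolding A_def by measurable
        have Ai: "emeasure M (A i) \<le> ennreal (1 / (a\<^sup>2 * real n)) * J n" for i
        proof -
          have "emeasure M (A i) = (\<integral>\<^sup>+\<omega>. indicator {x. a * sqrt (real n) < \<bar>x\<bar>} (Y i \<omega>) \<partial>M)"
            unfolding nn_integral_indicator[OF Am, symmetric]
            by (intro nn_integral_cong) (auto simp: A_def indicator_def)
          also have "\<dots> = (\<integral>\<^sup>+\<omega>. indicator {x. a * sqrt (real n) < \<bar>x\<bar>} (Y 0 \<omega>) \<partial>M)"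
            by (rule id) measurable
          also have "\<dots> \<le> (\<integral>\<^sup>+\<omega>. ennreal (1 / (a\<^sup>2 * real n)) * (ennreal ((Y 0 \<omega>)\<^sup>2) * indicator {\<omega>. a * sqrt (real n) < \<bar>Y 0 \<omega>\<bar>} \<omega>) \<partial>M)"
          proof (rule nn_integral_mono)
            fix \<omega>
            show "(indicator {x. a * sqrt (real n) < \<bar>x\<bar>} (Y 0 \<omega>) :: ennreal) \<le> ennreal (1 / (a\<^sup>2 * real n)) * (ennreal ((Y 0 \<omega>)\<^sup>2) * indicator {\<omega>. a * sqrt (real n) < \<bar>Y 0 \<omega>\<bar>} \<omega>)"
            proof (cases "a * sqrt (real n) < \<bar>Y 0 \<omega>\<bar>")
              case True
              then have "(a * sqrt (real n))\<^sup>2 \<le> \<bar>Y 0 \<omega>\<bar>\<^sup>2" using a by (intro power_mono) auto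
              then have "a\<^sup>2 * real n \<le> (Y 0 \<omega>)\<^sup>2" by (simp add: power_mult_distrib)
              then have "1 \<le> 1 / (a\<^sup>2 * real n) * (Y 0 \<omega>)\<^sup>2" using a elim by (simp add: field_simps)
              then have "ennreal 1 \<le> ennreal (1 / (a\<^sup>2 * real n) * (Y 0 \<omega>)\<^sup>2)" by (intro ennreal_leI)
              then show ?thesis using True by (simp add: ennreal_mult'[symmetric])
            qed simp
          qed
          also have "\<dots> = ennreal (1 / (a\<^sup>2 * real n)) * J n"
            unfolding J_def by (rule nn_integral_cmult) measurable
          finally show ?thesis .
        qed
        have "emeasure M (\<Union>i\<in>{..<n}. A i) \<le> (\<Sum>i<n. emeasure M (A i))"
          using Am by (intro emeasure_subadditive_finite) auto
        also have "\<dots> \<le> (\<Sum>i<n. ennreal (1 / (a\<^sup>2 * real n)) * J n)" by (intro sum_mono Ai)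
        also have "\<dots> \<le> (\<Sum>i<n. ennreal (1 / (a\<^sup>2 * real n)) * ennreal (\<zeta> * a\<^sup>2))"
          using elim by (intro sum_mono mult_left_mono) auto
        also have "\<dots> = (\<Sum>i<n. ennreal (\<zeta> / real n))"
        proof (rule sum.cong[OF refl])
          have "1 / (a\<^sup>2 * real n) * (\<zeta> * a\<^sup>2) = \<zeta> / real n" using a by simp
          then show "ennreal (1 / (a\<^sup>2 * real n)) * ennreal (\<zeta> * a\<^sup>2) = ennreal (\<zeta> / real n)"
            using ennreal_mult'[of "1 / (a\<^sup>2 * real n)" "\<zeta> * a\<^sup>2"] by simp
        qed
        also have "\<dots> = ennreal (\<Sum>i<n. \<zeta> / real n)" using \<zeta> by (intro sum_ennreal) auto
        also have "(\<Sum>i<n. \<zeta> / real n) = \<zeta>" using elim by simp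
        finally show ?case
          using Am sn by (intro bexI[of _ "\<Union>i\<in>{..<n}. A i"] conjI) (auto simp: A_def field_simps abs_divide not_less)
      qed
    qed
  qed
qed

section \<open>Measurable gradients, remainders and Lipschitz constants\<close>

lemma has_derivative_grad:
  fixes a :: "'e::euclidean_space \<Rightarrow> real"
  assumes "a differentiable (at x)"
  shows "(a has_derivative (\<lambda>h. h \<bullet> grad a x)) (at x)"
proof -
  obtain a' where a': "(a has_derivative a') (at x)" using assms by (auto simp: differentiable_def)
  define D where "D = (\<Sum>b\<in>Basis. a' b *\<^sub>R b)"
  interpret bounded_linear a' using a' by (rule has_derivative_bounded_linear)
  have eq: "a' h = h \<bullet> D" for h
  proof -
    have "a' h = a' (\<Sum>b\<in>Basis. (h \<bullet> b) *\<^sub>R b)" by (simp add: euclidean_representation)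
    also have "\<dots> = (\<Sum>b\<in>Basis. (h \<bullet> b) * a' b)" by (simp add: sum scaleR)
    also have "\<dots> = h \<bullet> D" by (simp add: D_def inner_sum_right mult.commute)
    finally show ?thesis .
  qed
  have "a' = (\<lambda>h. h \<bullet> D)" using eq by (simp add: fun_eq_iff)
  then have gD: "GDERIV a x :> D" using a' by (simp add: gderiv_def)
  have "grad a x = D" unfolding grad_def
  proof (rule the_equality[where P="\<lambda>D. GDERIV a x :> D", OF gD])
    fix D' assume "GDERIV a x :> D'"
    then have "(\<lambda>h. h \<bullet> D') = (\<lambda>h. h \<bullet> D)" using gD unfolding gderiv_def by (rule has_derivative_unique)
    then have "(D' - D) \<bullet> D' = (D' - D) \<bullet> D" by metis
    then have "(D' - D) \<bullet> (D' - D) = 0" by (simp add: inner_diff_right)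
    then show "D' = D" by simp
  qed
  then show ?thesis using gD by (simp add: gderiv_def)
qed

lemma grad_eqI:
  fixes a :: "'e::euclidean_space \<Rightarrow> real"
  assumes "(a has_derivative (\<lambda>h. h \<bullet> D)) (at x)"
  shows "grad a x = D"
proof -
  have "a differentiable (at x)" using assms by (auto simp: differentiable_def)
  from has_derivative_unique[OF has_derivative_grad[OF this] assms]
  have "(grad a x - D) \<bullet> grad a x = (grad a x - D) \<bullet> D" by metis
  then have "(grad a x - D) \<bullet> (grad a x - D) = 0" by (simp add: inner_diff_right)
  then show ?thesis by simp
qed

definition step :: "real \<Rightarrow> nat \<Rightarrow> real" where "step \<kappa> k = \<kappa> / real (k + 2)"

text \<open>The gradient as a limit of difference quotients along the steps \<open>\<kappa> / (k + 2) < \<kappa>\<close>: unlike a gradient defined by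
  a unique choice, it is visibly a measurable function of the values near \<open>x\<close>, at all paths.\<close>

definition qgrad :: "real \<Rightarrow> ('e::euclidean_space \<Rightarrow> real) \<Rightarrow> 'e \<Rightarrow> 'e" where
  "qgrad \<kappa> a x = (\<Sum>b\<in>Basis. lim (\<lambda>k. (a (x + step \<kappa> k *\<^sub>R b) - a x) / step \<kappa> k) *\<^sub>R b)"

lemma step_bounds: "0 < \<kappa> \<Longrightarrow> 0 < step \<kappa> k \<and> step \<kappa> k < \<kappa>"
  by (auto simp: step_def field_simps intro!: add_pos_nonneg)

lemma step_tendsto_0: "step \<kappa> \<longlonglongrightarrow> 0"
  unfolding step_def[abs_def]
  by (rule real_tendsto_divide_at_top[where c=\<kappa>])
     (auto intro!: filterlim_tendsto_add_at_top[OF tendsto_const filterlim_real_sequentially])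

lemma qgrad_eq_grad:
  fixes a :: "'e::euclidean_space \<Rightarrow> real"
  assumes \<kappa>: "0 < \<kappa>" and d: "a differentiable (at x)"
  shows "qgrad \<kappa> a x = grad a x"
proof -
  have "lim (\<lambda>k. (a (x + step \<kappa> k *\<^sub>R b) - a x) / step \<kappa> k) = grad a x \<bullet> b" for b
  proof (rule limI)
    have "((\<lambda>r::real. x + r *\<^sub>R b) has_derivative (\<lambda>r. r *\<^sub>R b)) (at 0)"
      by (auto intro!: derivative_eq_intros)
    moreover have "(a has_derivative (\<lambda>h. h \<bullet> grad a x)) (at (x + 0 *\<^sub>R b))"
      using has_derivative_grad[OF d] by simp
    ultimately have "((\<lambda>r. a (x + r *\<^sub>R b)) has_derivative (\<lambda>r. (r *\<^sub>R b) \<bullet> grad a x)) (at 0)"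
      by (rule has_derivative_compose)
    moreover have "(\<lambda>r. (r *\<^sub>R b) \<bullet> grad a x) = (*) (grad a x \<bullet> b)"
      by (simp add: fun_eq_iff inner_commute)
    ultimately have "((\<lambda>r. a (x + r *\<^sub>R b)) has_real_derivative (grad a x \<bullet> b)) (at 0)"
      by (simp only: has_field_derivative_def)
    then have "((\<lambda>r. (a (x + r *\<^sub>R b) - a x) / r) \<longlongrightarrow> grad a x \<bullet> b) (at 0)"
      by (simp add: has_field_derivative_iff)
    then show "(\<lambda>k. (a (x + step \<kappa> k *\<^sub>R b) - a x) / step \<kappa> k) \<longlonglongrightarrow> grad a x \<bullet> b"
      by (rule filterlim_compose)
         (use step_tendsto_0[of \<kappa>] step_bounds[OF \<kappa>] in \<open>auto simp: filterlim_at intro!: always_eventually less_imp_neq[symmetric]\<close>)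
  qed
  then show ?thesis by (simp add: qgrad_def euclidean_representation)
qed

lemma step_in_ball: "0 < \<kappa> \<Longrightarrow> b \<in> Basis \<Longrightarrow> x + step \<kappa> k *\<^sub>R b \<in> ball x \<kappa>"
  using step_bounds[of \<kappa> k] by (simp add: dist_norm)

lemma qgrad_cong:
  assumes "0 < \<kappa>" "\<And>s. s \<in> ball x \<kappa> \<Longrightarrow> a s = a' s"
  shows "qgrad \<kappa> a x = qgrad \<kappa> a' x"
  unfolding qgrad_def using assms step_in_ball[of \<kappa> _ x]
  by (intro sum.cong refl arg_cong2[where f=scaleR] arg_cong[where f=lim] ext arg_cong2[where f="(/)"] arg_cong2[where f="(-)"]) auto

lemma qgrad_measurable:
  fixes a :: "'w \<Rightarrow> 'e::euclidean_space \<Rightarrow> real"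
  assumes \<kappa>: "0 < \<kappa>" and m: "\<And>s. s \<in> ball x \<kappa> \<Longrightarrow> (\<lambda>\<omega>. a \<omega> s) \<in> borel_measurable N"
  shows "(\<lambda>\<omega>. qgrad \<kappa> (a \<omega>) x) \<in> borel_measurable N"
proof -
  have "(\<lambda>\<omega>. lim (\<lambda>k. (a \<omega> (x + step \<kappa> k *\<^sub>R b) - a \<omega> x) / step \<kappa> k)) \<in> borel_measurable N" if "b \<in> Basis" for b
  proof (rule borel_measurable_lim_metric)
    fix k
    have "(\<lambda>\<omega>. a \<omega> (x + step \<kappa> k *\<^sub>R b)) \<in> borel_measurable N" "(\<lambda>\<omega>. a \<omega> x) \<in> borel_measurable N"
      using step_in_ball[OF \<kappa> that] \<kappa> by (auto intro!: m)
    then show "(\<lambda>\<omega>. (a \<omega> (x + step \<kappa> k *\<^sub>R b) - a \<omega> x) / step \<kappa> k) \<in> borel_measurable N" by measurable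
  qed
  then show ?thesis unfolding qgrad_def by (intro borel_measurable_sum borel_measurable_scaleR) auto
qed

definition cdense :: "'e::euclidean_space set" where
  "cdense = (SOME B. countable B \<and> (\<forall>X. open X \<longrightarrow> X \<noteq> {} \<longrightarrow> (\<exists>d\<in>B. d \<in> X)))"

lemma cdense: "countable (cdense :: 'e::euclidean_space set)" "open X \<Longrightarrow> X \<noteq> {} \<Longrightarrow> \<exists>d\<in>(cdense :: 'e set). d \<in> X"
proof -
  have "\<exists>B::'e set. countable B \<and> (\<forall>X. open X \<longrightarrow> X \<noteq> {} \<longrightarrow> (\<exists>d\<in>B. d \<in> X))"
    by (rule countable_dense_exists)
  from someI_ex[OF this] show "countable (cdense :: 'e set)" "open X \<Longrightarrow> X \<noteq> {} \<Longrightarrow> \<exists>d\<in>(cdense :: 'e set). d \<in> X"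
    unfolding cdense_def by blast+
qed

lemma dense_nonpos:
  fixes \<phi> :: "'e::euclidean_space \<Rightarrow> real"
  assumes "open S" "continuous_on S \<phi>" "\<And>s. s \<in> S \<Longrightarrow> s \<in> cdense \<Longrightarrow> \<phi> s \<le> 0" "s \<in> S"
  shows "\<phi> s \<le> 0"
proof (rule ccontr)
  assume "\<not> ?thesis"
  then have "S \<inter> \<phi> -` {0<..} \<noteq> {}" using assms(4) by auto
  moreover have "open (S \<inter> \<phi> -` {0<..})"
    by (rule continuous_open_preimage[OF assms(2,1)]) simp
  ultimately obtain d where "d \<in> cdense" "d \<in> S \<inter> \<phi> -` {0<..}"
    using cdense(2) by blast
  then show False using assms(3)[of d] by auto
qed

text \<open>The supremum over a countable dense set is measurable, and for continuous \<open>a\<close> it bounds the relative remainder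
  of the linearisation on the whole ball.\<close>

definition Rem :: "real \<Rightarrow> ('e::euclidean_space \<Rightarrow> real) \<Rightarrow> 'e \<Rightarrow> 'e \<Rightarrow> ennreal" where
  "Rem \<kappa> a g x = (SUP s\<in>cdense \<inter> ball x \<kappa> - {x}. ennreal (\<bar>a s - a x - g \<bullet> (s - x)\<bar> / norm (s - x)))"

lemma Rem_mono: "\<kappa> \<le> \<kappa>' \<Longrightarrow> Rem \<kappa> a g x \<le> Rem \<kappa>' a g x"
  unfolding Rem_def by (intro SUP_subset_mono) auto

lemma Rem_cong: "(\<And>s. s \<in> ball x \<kappa> \<Longrightarrow> a s = a' s) \<Longrightarrow> 0 < \<kappa> \<Longrightarrow> Rem \<kappa> a g x = Rem \<kappa> a' g x"
  unfolding Rem_def by (intro SUP_cong refl) auto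

lemma Rem_measurable:
  assumes \<kappa>: "0 < \<kappa>" and m: "\<And>s. s \<in> ball x \<kappa> \<Longrightarrow> (\<lambda>\<omega>. a \<omega> s) \<in> borel_measurable N" and g[measurable]: "g \<in> borel_measurable N"
  shows "(\<lambda>\<omega>. Rem \<kappa> (a \<omega>) (g \<omega>) x) \<in> borel_measurable N"
  unfolding Rem_def
proof (rule borel_measurable_SUP)
  show "countable (cdense \<inter> ball x \<kappa> - {x})" using cdense(1) by (auto intro: countable_subset)
  fix s assume "s \<in> cdense \<inter> ball x \<kappa> - {x}"
  then have [measurable]: "(\<lambda>\<omega>. a \<omega> s) \<in> borel_measurable N" by (intro m) auto
  have [measurable]: "(\<lambda>\<omega>. a \<omega> x) \<in> borel_measurable N" using \<kappa> by (intro m) auto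
  show "(\<lambda>\<omega>. ennreal (\<bar>a \<omega> s - a \<omega> x - g \<omega> \<bullet> (s - x)\<bar> / norm (s - x))) \<in> borel_measurable N" by measurable
qed

lemma Rem_ge:
  assumes cont: "continuous_on (ball x \<kappa>) a" and fin: "Rem \<kappa> a g x < \<infinity>" and s: "s \<in> ball x \<kappa>"
  shows "\<bar>a s - a x - g \<bullet> (s - x)\<bar> \<le> enn2real (Rem \<kappa> a g x) * norm (s - x)"
proof (cases "s = x")
  case False
  let ?R = "enn2real (Rem \<kappa> a g x)"
  have "\<bar>a s - a x - g \<bullet> (s - x)\<bar> - ?R * norm (s - x) \<le> 0"
  proof (rule dense_nonpos[where S="ball x \<kappa> - {x}" and s=s and \<phi>="\<lambda>s. \<bar>a s - a x - g \<bullet> (s - x)\<bar> - ?R * norm (s - x)"])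
    show "open (ball x \<kappa> - {x})" by auto
    have "continuous_on (ball x \<kappa> - {x}) a" using cont by (rule continuous_on_subset) auto
    then show "continuous_on (ball x \<kappa> - {x}) (\<lambda>s. \<bar>a s - a x - g \<bullet> (s - x)\<bar> - ?R * norm (s - x))"
      by (intro continuous_intros)
    show "s \<in> ball x \<kappa> - {x}" using s False by auto
    fix r assume r: "r \<in> ball x \<kappa> - {x}" "r \<in> cdense"
    then have "ennreal (\<bar>a r - a x - g \<bullet> (r - x)\<bar> / norm (r - x)) \<le> Rem \<kappa> a g x"
      unfolding Rem_def by (intro SUP_upper) auto
    then have "\<bar>a r - a x - g \<bullet> (r - x)\<bar> / norm (r - x) \<le> ?R"
      using fin by (metis enn2real_mono enn2real_ennreal abs_ge_zero divide_nonneg_nonneg norm_ge_zero infinity_ennreal_def)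
    then show "\<bar>a r - a x - g \<bullet> (r - x)\<bar> - ?R * norm (r - x) \<le> 0"
      using r by (simp add: pos_divide_le_eq)
  qed
  then show ?thesis by simp
qed simp

text \<open>The increment and the linear term are each at most \<open>B\<close> times the distance.\<close>

lemma Rem_bound:
  assumes d: "\<And>s. s \<in> ball x \<kappa> \<Longrightarrow> (a has_derivative (\<lambda>h. h \<bullet> A s)) (at s)" and \<kappa>: "0 < \<kappa>"
    and B: "\<And>s. s \<in> ball x \<kappa> \<Longrightarrow> norm (A s) \<le> B"
  shows "Rem \<kappa> a (A x) x \<le> ennreal (2 * B)"
  unfolding Rem_def
proof (rule SUP_least, rule ennreal_leI)
  fix s assume s: "s \<in> cdense \<inter> ball x \<kappa> - {x}"
  have "norm (a s - a x) \<le> B * norm (s - x)"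
  proof (rule differentiable_bound[where S="ball x \<kappa>" and f'="\<lambda>s h. h \<bullet> A s"])
    fix r assume r: "r \<in> ball x \<kappa>"
    show "(a has_derivative (\<lambda>h. h \<bullet> A r)) (at r within ball x \<kappa>)" using d[OF r] by (rule has_derivative_at_withinI)
    show "onorm (\<lambda>h. h \<bullet> A r) \<le> B"
    proof (rule onorm_le)
      fix h
      have "norm (h \<bullet> A r) \<le> norm h * norm (A r)" by (simp add: Cauchy_Schwarz_ineq2)
      also have "\<dots> \<le> norm h * B" by (intro mult_left_mono B r) auto
      finally show "norm (h \<bullet> A r) \<le> B * norm h" by (simp add: mult.commute)
    qed
  qed (use s \<kappa> in auto)
  moreover have "\<bar>A x \<bullet> (s - x)\<bar> \<le> B * norm (s - x)"
    using order_trans[OF Cauchy_Schwarz_ineq2 mult_right_mono[OF B[of x]]] \<kappa> by auto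
  ultimately have "\<bar>a s - a x - A x \<bullet> (s - x)\<bar> \<le> 2 * B * norm (s - x)" by (simp add: mult.assoc)
  then show "\<bar>a s - a x - A x \<bullet> (s - x)\<bar> / norm (s - x) \<le> 2 * B"
    using s by (simp add: pos_divide_le_eq)
qed

lemma Rem_tendsto_0:
  assumes d: "(a has_derivative (\<lambda>h. h \<bullet> g)) (at x)" and \<kappa>: "\<kappa> \<longlonglongrightarrow> 0"
  shows "(\<lambda>m. Rem (\<kappa> m) a g x) \<longlonglongrightarrow> 0"
proof (rule order_tendstoI)
  fix e :: ennreal assume "0 < e"
  then obtain y where y: "0 < y" "y < e" using dense by blast
  define r where "r = enn2real y"
  have "y < top" using y(2) by (simp add: order_less_le_trans)
  then have r: "0 < r" "ennreal r < e" using y by (auto simp: r_def enn2real_positive_iff)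
  obtain \<delta> where \<delta>: "\<delta> > 0" "\<And>s. norm (s - x) < \<delta> \<Longrightarrow> norm (a s - a x - (s - x) \<bullet> g) \<le> r * norm (s - x)"
    using d r(1) unfolding has_derivative_at_alt by blast
  have "\<forall>\<^sub>F m in sequentially. \<kappa> m < \<delta>" using \<kappa> \<delta>(1) by (rule order_tendstoD(2))
  then show "\<forall>\<^sub>F m in sequentially. Rem (\<kappa> m) a g x < e"
  proof eventually_elim
    case (elim m)
    have "Rem (\<kappa> m) a g x \<le> ennreal r"
      unfolding Rem_def
    proof (rule SUP_least, rule ennreal_leI)
      fix s assume s: "s \<in> cdense \<inter> ball x (\<kappa> m) - {x}"
      then have "norm (s - x) < \<delta>" using elim by (auto simp: dist_norm norm_minus_commute)
      from \<delta>(2)[OF this] s show "\<bar>a s - a x - g \<bullet> (s - x)\<bar> / norm (s - x) \<le> r"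
        by (simp add: pos_divide_le_eq inner_commute)
    qed
    then show ?case using r by simp
  qed
qed simp

definition Lip :: "real \<Rightarrow> ('e::euclidean_space \<Rightarrow> 'v::real_normed_vector) \<Rightarrow> 'e \<Rightarrow> ennreal" where
  "Lip \<kappa> V x = (SUP p\<in>(cdense \<inter> ball x \<kappa>) \<times> (cdense \<inter> ball x \<kappa>). ennreal (norm (V (fst p) - V (snd p)) / norm (fst p - snd p)))"

lemma Lip_cong: "(\<And>s. s \<in> ball x \<kappa> \<Longrightarrow> V s = V' s) \<Longrightarrow> Lip \<kappa> V x = Lip \<kappa> V' x"
  unfolding Lip_def by (intro SUP_cong refl) auto

lemma Lip_measurable:
  fixes W :: "'w \<Rightarrow> 'e::euclidean_space \<Rightarrow> 'v::euclidean_space"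
  assumes m: "\<And>s. s \<in> ball x \<kappa> \<Longrightarrow> (\<lambda>\<omega>. W \<omega> s) \<in> borel_measurable N"
  shows "(\<lambda>\<omega>. Lip \<kappa> (W \<omega>) x) \<in> borel_measurable N"
  unfolding Lip_def
proof (rule borel_measurable_SUP)
  show "countable ((cdense \<inter> ball x \<kappa>) \<times> (cdense \<inter> ball x \<kappa>))"
    using cdense(1) by (auto intro: countable_subset)
  fix p assume "p \<in> (cdense \<inter> ball x \<kappa>) \<times> (cdense \<inter> ball x \<kappa>)"
  then have [measurable]: "(\<lambda>\<omega>. W \<omega> (fst p)) \<in> borel_measurable N" "(\<lambda>\<omega>. W \<omega> (snd p)) \<in> borel_measurable N"
    by (auto intro!: m)
  show "(\<lambda>\<omega>. ennreal (norm (W \<omega> (fst p) - W \<omega> (snd p)) / norm (fst p - snd p))) \<in> borel_measurable N" by measurable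
qed

lemma Lip_ge:
  fixes W :: "'e::euclidean_space \<Rightarrow> 'v::real_normed_vector"
  assumes cont: "continuous_on (ball x \<kappa>) W" and fin: "Lip \<kappa> W x < \<infinity>" and s: "s \<in> ball x \<kappa>" "s' \<in> ball x \<kappa>"
  shows "norm (W s - W s') \<le> enn2real (Lip \<kappa> W x) * norm (s - s')"
proof -
  let ?L = "enn2real (Lip \<kappa> W x)"
  have 1: "norm (W r - W r') \<le> ?L * norm (r - r')" if r: "r \<in> ball x \<kappa>" "r' \<in> ball x \<kappa>" "r \<in> cdense" "r' \<in> cdense" for r r'
  proof (cases "r = r'")
    case False
    have "ennreal (norm (W (fst (r,r')) - W (snd (r,r'))) / norm (fst (r,r') - snd (r,r'))) \<le> Lip \<kappa> W x"
      unfolding Lip_def using r by (intro SUP_upper) auto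
    then have "ennreal (norm (W r - W r') / norm (r - r')) \<le> Lip \<kappa> W x" by simp
    then have "norm (W r - W r') / norm (r - r') \<le> ?L"
      using fin by (metis enn2real_mono enn2real_ennreal divide_nonneg_nonneg norm_ge_zero infinity_ennreal_def)
    then show ?thesis using False by (simp add: pos_divide_le_eq)
  qed simp
  have 2: "norm (W r - W r') - ?L * norm (r - r') \<le> 0" if r: "r \<in> ball x \<kappa>" "r' \<in> ball x \<kappa>" "r' \<in> cdense" for r r'
  proof (rule dense_nonpos[where S="ball x \<kappa>" and s=r and \<phi>="\<lambda>r. norm (W r - W r') - ?L * norm (r - r')"])
    show "continuous_on (ball x \<kappa>) (\<lambda>r. norm (W r - W r') - ?L * norm (r - r'))"
      using cont by (intro continuous_intros)
  qed (use 1 r in auto)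
  have "norm (W s - W s') - ?L * norm (s - s') \<le> 0"
  proof (rule dense_nonpos[where S="ball x \<kappa>" and s=s' and \<phi>="\<lambda>r. norm (W s - W r) - ?L * norm (s - r)"])
    show "continuous_on (ball x \<kappa>) (\<lambda>r. norm (W s - W r) - ?L * norm (s - r))"
      using cont by (intro continuous_intros)
  qed (use 2 s in auto)
  then show ?thesis by simp
qed

lemma Lip_bound:
  fixes W :: "'e::euclidean_space \<Rightarrow> 'v::real_normed_vector"
  assumes d: "\<And>s. s \<in> ball x \<kappa> \<Longrightarrow> (W has_derivative W' s) (at s)"
    and B: "\<And>s h. s \<in> ball x \<kappa> \<Longrightarrow> norm (W' s h) \<le> B * norm h"
  shows "Lip \<kappa> W x \<le> ennreal B"
  unfolding Lip_def
proof (rule SUP_least, rule ennreal_leI)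
  fix p assume "p \<in> (cdense \<inter> ball x \<kappa>) \<times> (cdense \<inter> ball x \<kappa>)"
  then have s: "fst p \<in> ball x \<kappa>" "snd p \<in> ball x \<kappa>" by auto
  have "norm (W (fst p) - W (snd p)) \<le> B * norm (fst p - snd p)"
  proof (rule differentiable_bound[where S="ball x \<kappa>" and f'=W'])
    show "(W has_derivative W' r) (at r within ball x \<kappa>)" if "r \<in> ball x \<kappa>" for r
      using d[OF that] by (rule has_derivative_at_withinI)
    show "onorm (W' r) \<le> B" if "r \<in> ball x \<kappa>" for r
      using B[OF that] by (rule onorm_le)
  qed (use s in auto)
  moreover have "0 \<le> B"
  proof -
    obtain b :: 'e where "b \<in> Basis" using nonempty_Basis by blast
    then show ?thesis using order_trans[OF norm_ge_zero B[OF s(1), of b]] by simp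
  qed
  ultimately show "norm (W (fst p) - W (snd p)) / norm (fst p - snd p) \<le> B"
    by (cases "fst p = snd p") (simp_all add: pos_divide_le_eq)
qed

section \<open>Functionals of the trajectories of mean and variance\<close>

text \<open>All quantities of the expansion are functionals of the pair \<open>(m, g)\<close> of the functions \<open>\<mu>\<^sub>i\<close> and \<open>h\<^sub>i\<close> for
  a fixed \<open>i\<close> and a fixed outcome: location and scale of the perturbed threshold, the
  weight \<open>W\<^sub>2\<^sub>2\<close>, gradients at \<open>\<theta>\<close>, remainders and the Lipschitz constant of the weight. In this form
  predictability and identical distribution are inherited from \<open>(\<mu>\<^sub>i, h\<^sub>i)\<close>.\<close>

definition floc :: "('q, 'r) param \<Rightarrow> (real^'q \<Rightarrow> real) \<Rightarrow> (('q::finite, 'r::finite) param \<Rightarrow> real) \<Rightarrow> ('q, 'r) param \<Rightarrow> real" where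
  "floc \<theta> m g s = (m (fst s) - m (fst \<theta>)) / sqrt (g \<theta>)"
definition fscl :: "('q, 'r) param \<Rightarrow> (('q::finite, 'r::finite) param \<Rightarrow> real) \<Rightarrow> ('q, 'r) param \<Rightarrow> real" where
  "fscl \<theta> g s = sqrt (g s / g \<theta>)"
definition fwt :: "real \<Rightarrow> (('q::finite, 'r::finite) param \<Rightarrow> real) \<Rightarrow> ('q, 'r) param \<Rightarrow> real^'r" where
  "fwt k0 g s = (1 / g s) *\<^sub>R snd (qgrad k0 g s)"
definition floc_grad where "floc_grad k0 \<theta> m g = qgrad k0 (floc \<theta> m g) \<theta>"
definition fscl_grad where "fscl_grad k0 \<theta> g = qgrad k0 (fscl \<theta> g) \<theta>"
definition floc_rem where "floc_rem k k0 \<theta> m g = Rem k (floc \<theta> m g) (floc_grad k0 \<theta> m g) \<theta>"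
definition fscl_rem where "fscl_rem k k0 \<theta> g = Rem k (fscl \<theta> g) (fscl_grad k0 \<theta> g) \<theta>"
definition fwt_lip where "fwt_lip k0 \<theta> g = Lip k0 (fwt k0 g) \<theta>"

lemma functionals_measurable:
  fixes mm :: "'w \<Rightarrow> real^'q::finite \<Rightarrow> real" and gg :: "'w \<Rightarrow> ('q, 'r::finite) param \<Rightarrow> real"
  assumes k0: "0 < k0"
    and m: "\<And>s. s \<in> ball \<theta> (2 * k0) \<Longrightarrow> (\<lambda>\<omega>. mm \<omega> (fst s)) \<in> borel_measurable N"
    and g: "\<And>s. s \<in> ball \<theta> (2 * k0) \<Longrightarrow> (\<lambda>\<omega>. gg \<omega> s) \<in> borel_measurable N"
  shows "(\<lambda>\<omega>. floc_grad k0 \<theta> (mm \<omega>) (gg \<omega>)) \<in> borel_measurable N" (is ?A)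
    and "(\<lambda>\<omega>. fscl_grad k0 \<theta> (gg \<omega>)) \<in> borel_measurable N" (is ?B)
    and "\<And>k. 0 < k \<Longrightarrow> k \<le> k0 \<Longrightarrow> (\<lambda>\<omega>. floc_rem k k0 \<theta> (mm \<omega>) (gg \<omega>)) \<in> borel_measurable N"
    and "\<And>k. 0 < k \<Longrightarrow> k \<le> k0 \<Longrightarrow> (\<lambda>\<omega>. fscl_rem k k0 \<theta> (gg \<omega>)) \<in> borel_measurable N"
    and "\<And>s. s \<in> ball \<theta> k0 \<Longrightarrow> (\<lambda>\<omega>. qgrad k0 (gg \<omega>) s) \<in> borel_measurable N"
    and "\<And>s. s \<in> ball \<theta> k0 \<Longrightarrow> (\<lambda>\<omega>. fwt k0 (gg \<omega>) s) \<in> borel_measurable N"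
    and "(\<lambda>\<omega>. fwt_lip k0 \<theta> (gg \<omega>)) \<in> borel_measurable N"
proof -
  have in2: "s \<in> ball \<theta> (2 * k0)" if "s \<in> ball \<theta> k0" for s using that k0 by auto
  have [measurable]: "(\<lambda>\<omega>. gg \<omega> \<theta>) \<in> borel_measurable N" "(\<lambda>\<omega>. mm \<omega> (fst \<theta>)) \<in> borel_measurable N"
    using g m k0 by auto
  have l: "(\<lambda>\<omega>. floc \<theta> (mm \<omega>) (gg \<omega>) s) \<in> borel_measurable N" if "s \<in> ball \<theta> k0" for s
  proof -
    note [measurable] = m[OF in2[OF that]]
    show ?thesis unfolding floc_def by measurable
  qed
  have c: "(\<lambda>\<omega>. fscl \<theta> (gg \<omega>) s) \<in> borel_measurable N" if "s \<in> ball \<theta> k0" for s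
  proof -
    note [measurable] = g[OF in2[OF that]]
    show ?thesis unfolding fscl_def by measurable
  qed
  show A: ?A unfolding floc_grad_def by (rule qgrad_measurable[OF k0 l])
  show B: ?B unfolding fscl_grad_def by (rule qgrad_measurable[OF k0 c])
  show "(\<lambda>\<omega>. floc_rem k k0 \<theta> (mm \<omega>) (gg \<omega>)) \<in> borel_measurable N" if "0 < k" "k \<le> k0" for k
    unfolding floc_rem_def by (rule Rem_measurable[OF that(1) l A]) (use that in auto)
  show "(\<lambda>\<omega>. fscl_rem k k0 \<theta> (gg \<omega>)) \<in> borel_measurable N" if "0 < k" "k \<le> k0" for k
    unfolding fscl_rem_def by (rule Rem_measurable[OF that(1) c B]) (use that in auto)
  show qg: "(\<lambda>\<omega>. qgrad k0 (gg \<omega>) s) \<in> borel_measurable N" if s: "s \<in> ball \<theta> k0" for s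
  proof (rule qgrad_measurable[OF k0 g])
    fix r assume "r \<in> ball s k0"
    then have "dist s r < k0" by simp
    moreover have "dist \<theta> s < k0" using s by simp
    ultimately show "r \<in> ball \<theta> (2 * k0)" using dist_triangle[of \<theta> r s] by simp
  qed
  show W: "(\<lambda>\<omega>. fwt k0 (gg \<omega>) s) \<in> borel_measurable N" if s: "s \<in> ball \<theta> k0" for s
  proof -
    note [measurable] = qg[OF s] g[OF in2[OF s]]
    have "(\<lambda>\<omega>. snd (qgrad k0 (gg \<omega>) s)) \<in> borel_measurable N"
      by (rule measurable_compose[OF qg[OF s] borel_measurable_continuous_onI]) (intro continuous_intros)
    then show ?thesis unfolding fwt_def by measurable
  qed
  show "(\<lambda>\<omega>. fwt_lip k0 \<theta> (gg \<omega>)) \<in> borel_measurable N"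
    unfolding fwt_lip_def by (rule Lip_measurable[OF W])
qed

lemma functionals_cong:
  fixes m m' :: "real^'q::finite \<Rightarrow> real" and g g' :: "('q, 'r::finite) param \<Rightarrow> real"
  assumes k0: "0 < k0"
    and m: "\<And>s. s \<in> ball \<theta> (2 * k0) \<Longrightarrow> m (fst s) = m' (fst s)"
    and g: "\<And>s. s \<in> ball \<theta> (2 * k0) \<Longrightarrow> g s = g' s"
  shows "floc_grad k0 \<theta> m g = floc_grad k0 \<theta> m' g'"
    and "fscl_grad k0 \<theta> g = fscl_grad k0 \<theta> g'"
    and "\<And>k. 0 < k \<Longrightarrow> k \<le> k0 \<Longrightarrow> floc_rem k k0 \<theta> m g = floc_rem k k0 \<theta> m' g'"
    and "\<And>k. 0 < k \<Longrightarrow> k \<le> k0 \<Longrightarrow> fscl_rem k k0 \<theta> g = fscl_rem k k0 \<theta> g'"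
    and "\<And>s. s \<in> ball \<theta> k0 \<Longrightarrow> fwt k0 g s = fwt k0 g' s"
    and "fwt_lip k0 \<theta> g = fwt_lip k0 \<theta> g'"
proof -
  have in2: "s \<in> ball \<theta> (2 * k0)" if "s \<in> ball \<theta> k0" for s using that k0 by auto
  have th: "\<theta> \<in> ball \<theta> (2 * k0)" using k0 by simp
  have l: "floc \<theta> m g s = floc \<theta> m' g' s" if "s \<in> ball \<theta> k0" for s
    using m[OF in2[OF that]] m[OF th] g[OF th] by (simp add: floc_def)
  have c: "fscl \<theta> g s = fscl \<theta> g' s" if "s \<in> ball \<theta> k0" for s
    using g[OF in2[OF that]] g[OF th] by (simp add: fscl_def)
  show A: "floc_grad k0 \<theta> m g = floc_grad k0 \<theta> m' g'" unfolding floc_grad_def by (rule qgrad_cong[OF k0 l])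
  show B: "fscl_grad k0 \<theta> g = fscl_grad k0 \<theta> g'" unfolding fscl_grad_def by (rule qgrad_cong[OF k0 c])
  show "floc_rem k k0 \<theta> m g = floc_rem k k0 \<theta> m' g'" if "0 < k" "k \<le> k0" for k
    unfolding floc_rem_def A by (rule Rem_cong[OF l]) (use that in auto)
  show "fscl_rem k k0 \<theta> g = fscl_rem k k0 \<theta> g'" if "0 < k" "k \<le> k0" for k
    unfolding fscl_rem_def B by (rule Rem_cong[OF c]) (use that in auto)
  show W: "fwt k0 g s = fwt k0 g' s" if s: "s \<in> ball \<theta> k0" for s
  proof -
    have "qgrad k0 g s = qgrad k0 g' s"
    proof (rule qgrad_cong[OF k0 g])
      fix r assume "r \<in> ball s k0"
      then have "dist s r < k0" by simp
      moreover have "dist \<theta> s < k0" using s by simp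
      ultimately show "r \<in> ball \<theta> (2 * k0)" using dist_triangle[of \<theta> r s] by simp
    qed
    then show ?thesis using g[OF in2[OF s]] by (simp add: fwt_def)
  qed
  show "fwt_lip k0 \<theta> g = fwt_lip k0 \<theta> g'" unfolding fwt_lip_def by (rule Lip_cong[OF W])
qed

text \<open>Cauchy-Schwarz, applied to the coordinates of \<open>D h\<close> one by one.\<close>

lemma hessian_norm_bound:
  fixes g :: "'e::euclidean_space \<Rightarrow> real"
  assumes D: "(grad g has_derivative D) (at s)"
  shows "norm (D h) \<le> hessian_norm g s * norm h"
proof -
  interpret bounded_linear D using D by (rule has_derivative_bounded_linear)
  have hs: "hessian g s a b = D a \<bullet> b" for a b
  proof -
    have "((\<lambda>u. grad g u \<bullet> b) has_derivative (\<lambda>h. D h \<bullet> b)) (at s)"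
      using D by (rule has_derivative_inner_left)
    then show ?thesis unfolding hessian_def by (metis frechet_derivative_at)
  qed
  have nsq: "(norm x)\<^sup>2 = (\<Sum>b\<in>Basis. (x \<bullet> b)\<^sup>2)" for x :: 'e
    unfolding power2_norm_eq_inner euclidean_inner[of x x] by (simp only: power2_eq_square)
  have "(norm (D h))\<^sup>2 = (\<Sum>b\<in>Basis. (D h \<bullet> b)\<^sup>2)" by (rule nsq)
  also have "\<dots> \<le> (\<Sum>b\<in>Basis. (norm h)\<^sup>2 * (\<Sum>a\<in>Basis. (hessian g s a b)\<^sup>2))"
  proof (rule sum_mono)
    fix b :: 'e assume "b \<in> Basis"
    have "D h = D (\<Sum>a\<in>Basis. (h \<bullet> a) *\<^sub>R a)" by (simp add: euclidean_representation)
    also have "\<dots> = (\<Sum>a\<in>Basis. (h \<bullet> a) *\<^sub>R D a)" by (simp add: sum scaleR)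
    finally have "D h \<bullet> b = (\<Sum>a\<in>Basis. (h \<bullet> a) * hessian g s a b)" by (simp add: inner_sum_left hs)
    then have "(D h \<bullet> b)\<^sup>2 \<le> (\<Sum>a\<in>Basis. (h \<bullet> a)\<^sup>2) * (\<Sum>a\<in>Basis. (hessian g s a b)\<^sup>2)"
      using Cauchy_Schwarz_ineq_sum[of "\<lambda>a. h \<bullet> a" "\<lambda>a. hessian g s a b" Basis] by simp
    also have "(\<Sum>a\<in>Basis. (h \<bullet> a)\<^sup>2) = (norm h)\<^sup>2"
      by (rule nsq[symmetric])
    finally show "(D h \<bullet> b)\<^sup>2 \<le> (norm h)\<^sup>2 * (\<Sum>a\<in>Basis. (hessian g s a b)\<^sup>2)" .
  qed
  also have "\<dots> = (norm h)\<^sup>2 * (\<Sum>a\<in>Basis. \<Sum>b\<in>Basis. (hessian g s a b)\<^sup>2)"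
    unfolding sum_distrib_left[symmetric] by (subst sum.swap) (rule refl)
  also have "\<dots> = (hessian_norm g s * norm h)\<^sup>2"
    unfolding hessian_norm_def power_mult_distrib by (subst real_sqrt_pow2) (auto intro!: sum_nonneg)
  finally show ?thesis
    by (rule power2_le_imp_le)
       (simp add: hessian_norm_def mult_nonneg_nonneg sum_nonneg)
qed

lemma has_derivative_imp_continuous_on:
  assumes "\<And>s. s \<in> T \<Longrightarrow> (\<phi> has_derivative \<phi>' s) (at s)"
  shows "continuous_on T \<phi>"
  using assms by (intro continuous_at_imp_continuous_on ballI has_derivative_continuous)

text \<open>One trajectory that is twice differentiable near \<open>\<theta>\<close>. The radius \<open>2 * k0\<close> leaves room for the difference
  quotients at points of the ball of radius \<open>k0\<close> and makes the closed ball of radius \<open>k0\<close> compact inside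
  the region of smoothness, so that all functionals are finite.\<close>

locale smooth_point =
  fixes \<theta> :: "('q::finite, 'r::finite) param" and k0 :: real
    and m :: "real^'q \<Rightarrow> real" and g :: "('q, 'r) param \<Rightarrow> real"
    and S1 :: "(real^'q) set" and S :: "(('q, 'r) param) set"
  assumes k0: "0 < k0"
    and m_C2: "C2_on S1 m" and g_C2: "C2_on S g"
    and near: "\<And>s. s \<in> ball \<theta> (2 * k0) \<Longrightarrow> fst s \<in> S1 \<and> s \<in> S \<and> 0 < g s"
begin

lemma in_ball2: "s \<in> cball \<theta> k0 \<Longrightarrow> s \<in> ball \<theta> (2 * k0)"
  using k0 by auto

lemma g_pos: "s \<in> ball \<theta> (2 * k0) \<Longrightarrow> 0 < g s" using near by blast

lemma th: "\<theta> \<in> ball \<theta> (2 * k0)" "0 < g \<theta>"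
  using k0 g_pos[of \<theta>] by auto

lemma g_deriv: "s \<in> ball \<theta> (2 * k0) \<Longrightarrow> (g has_derivative (\<lambda>h. h \<bullet> grad g s)) (at s)"
  using near g_C2 by (intro has_derivative_grad) (auto simp: C2_on_def)

lemma m_deriv: "s \<in> ball \<theta> (2 * k0) \<Longrightarrow> (m has_derivative (\<lambda>h. h \<bullet> grad m (fst s))) (at (fst s))"
  using near m_C2 by (intro has_derivative_grad) (auto simp: C2_on_def)

lemma gradg_deriv: "s \<in> ball \<theta> (2 * k0) \<Longrightarrow> (grad g has_derivative frechet_derivative (grad g) (at s)) (at s)"
  using near g_C2 by (simp add: C2_on_def frechet_derivative_works[symmetric])

definition lA :: "('q, 'r) param \<Rightarrow> ('q, 'r) param" where
  "lA s = (1 / sqrt (g \<theta>)) *\<^sub>R (grad m (fst s), 0)"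
definition sA :: "('q, 'r) param \<Rightarrow> ('q, 'r) param" where
  "sA s = (1 / (2 * sqrt (g s * g \<theta>))) *\<^sub>R grad g s"

lemma loc_deriv: 
  assumes s: "s \<in> ball \<theta> (2 * k0)"
  shows "(floc \<theta> m g has_derivative (\<lambda>h. h \<bullet> lA s)) (at s)"
proof -
  have "((\<lambda>s. m (fst s)) has_derivative (\<lambda>h. fst h \<bullet> grad m (fst s))) (at s)"
    using has_derivative_compose[OF has_derivative_fst[OF has_derivative_ident] m_deriv[OF s]] .
  then have "((\<lambda>s. (m (fst s) - m (fst \<theta>)) / sqrt (g \<theta>)) has_derivative (\<lambda>h. (fst h \<bullet> grad m (fst s) - 0) / sqrt (g \<theta>))) (at s)"
    by (intro bounded_linear.has_derivative[OF bounded_linear_divide] has_derivative_diff has_derivative_const)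
  moreover have "(\<lambda>h. (fst h \<bullet> grad m (fst s) - 0) / sqrt (g \<theta>)) = (\<lambda>h. h \<bullet> lA s)"
    by (simp add: fun_eq_iff lA_def inner_prod_def)
  ultimately show ?thesis unfolding floc_def[abs_def] by simp
qed

lemma scl_deriv:
  assumes s: "s \<in> ball \<theta> (2 * k0)"
  shows "(fscl \<theta> g has_derivative (\<lambda>h. h \<bullet> sA s)) (at s)"
proof -
  have p: "0 < g s" "0 < g \<theta>" using g_pos[OF s] th by auto
  have "((\<lambda>s. g s / g \<theta>) has_derivative (\<lambda>h. (h \<bullet> grad g s) / g \<theta>)) (at s)"
    using g_deriv[OF s] by (rule bounded_linear.has_derivative[OF bounded_linear_divide])
  moreover have "(sqrt has_derivative (\<lambda>x. x * (inverse (sqrt (g s / g \<theta>)) / 2))) (at (g s / g \<theta>))"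
  proof -
    have "(\<lambda>x. x * (inverse (sqrt (g s / g \<theta>)) / 2)) = (*) (inverse (sqrt (g s / g \<theta>)) / 2)"
      by (simp add: fun_eq_iff)
    then show ?thesis using DERIV_real_sqrt[of "g s / g \<theta>"] p by (simp only: has_field_derivative_def) simp
  qed
  ultimately have "((\<lambda>s. sqrt (g s / g \<theta>)) has_derivative (\<lambda>h. (h \<bullet> grad g s) / g \<theta> * (inverse (sqrt (g s / g \<theta>)) / 2))) (at s)"
    by (rule has_derivative_compose)
  moreover have "(\<lambda>h. (h \<bullet> grad g s) / g \<theta> * (inverse (sqrt (g s / g \<theta>)) / 2)) = (\<lambda>h. h \<bullet> sA s)"
  proof
    fix h
    have aux: "I / (B * B) * (inverse (A / B) / 2) = 1 / (2 * (A * B)) * I" if "0 < A" "0 < B" for A B I :: real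
      using that by (simp add: field_simps)
    define A where "A = sqrt (g s)"
    define B where "B = sqrt (g \<theta>)"
    have AB: "0 < A" "0 < B" using p by (auto simp: A_def B_def)
    have e: "sqrt (g s / g \<theta>) = A / B" "sqrt (g s * g \<theta>) = A * B" "B * B = g \<theta>"
      using p by (simp_all add: A_def B_def real_sqrt_divide real_sqrt_mult)
    have "(h \<bullet> grad g s) / g \<theta> * (inverse (sqrt (g s / g \<theta>)) / 2) = 1 / (2 * (A * B)) * (h \<bullet> grad g s)"
      unfolding e(1) using aux[OF AB, of "h \<bullet> grad g s"] by (simp only: e(3))
    then show "(h \<bullet> grad g s) / g \<theta> * (inverse (sqrt (g s / g \<theta>)) / 2) = h \<bullet> sA s"
      by (simp only: sA_def e(2) inner_scaleR_right)
  qed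
  ultimately show ?thesis unfolding fscl_def[abs_def] by simp
qed

lemma alpha_eq: "floc_grad k0 \<theta> m g = lA \<theta>" and beta_eq: "fscl_grad k0 \<theta> g = sA \<theta>"
proof -
  have "floc \<theta> m g differentiable (at \<theta>)" "fscl \<theta> g differentiable (at \<theta>)"
    using loc_deriv[OF th(1)] scl_deriv[OF th(1)] by (auto simp: differentiable_def)
  then show "floc_grad k0 \<theta> m g = lA \<theta>" "fscl_grad k0 \<theta> g = sA \<theta>"
    unfolding floc_grad_def fscl_grad_def using qgrad_eq_grad[OF k0] grad_eqI[OF loc_deriv[OF th(1)]] grad_eqI[OF scl_deriv[OF th(1)]]
    by metis+
qed

lemma sA_theta: "sA \<theta> = (1 / (2 * g \<theta>)) *\<^sub>R grad g \<theta>"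
  using th by (simp add: sA_def)

lemma fwt_eq: "s \<in> ball \<theta> (2 * k0) \<Longrightarrow> fwt k0 g s = (1 / g s) *\<^sub>R snd (grad g s)"
proof -
  assume s: "s \<in> ball \<theta> (2 * k0)"
  have "g differentiable (at s)" using g_deriv[OF s] by (auto simp: differentiable_def)
  then show ?thesis by (simp add: fwt_def qgrad_eq_grad[OF k0])
qed

definition fwt' :: "('q, 'r) param \<Rightarrow> ('q, 'r) param \<Rightarrow> real^'r" where
  "fwt' s h = (1 / g s) *\<^sub>R snd (frechet_derivative (grad g) (at s) h) + (- (h \<bullet> grad g s) / (g s)\<^sup>2) *\<^sub>R snd (grad g s)"

lemma fwt_deriv:
  assumes s: "s \<in> ball \<theta> (2 * k0)"
  shows "(fwt k0 g has_derivative fwt' s) (at s)"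
proof -
  have p: "g s \<noteq> 0" using g_pos[OF s] by simp
  have "((\<lambda>s. inverse (g s)) has_derivative (\<lambda>h. - (inverse (g s) * (h \<bullet> grad g s) * inverse (g s)))) (at s)"
    using p g_deriv[OF s] by (rule Deriv.has_derivative_inverse)
  moreover have "((\<lambda>s. snd (grad g s)) has_derivative (\<lambda>h. snd (frechet_derivative (grad g) (at s) h))) (at s)"
    using gradg_deriv[OF s] by (rule has_derivative_snd)
  ultimately have "((\<lambda>s. inverse (g s) *\<^sub>R snd (grad g s)) has_derivative
     (\<lambda>h. inverse (g s) *\<^sub>R snd (frechet_derivative (grad g) (at s) h) + (- (inverse (g s) * (h \<bullet> grad g s) * inverse (g s))) *\<^sub>R snd (grad g s))) (at s)"
    by (rule has_derivative_scaleR)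
  moreover have "(\<lambda>h. inverse (g s) *\<^sub>R snd (frechet_derivative (grad g) (at s) h) + (- (inverse (g s) * (h \<bullet> grad g s) * inverse (g s))) *\<^sub>R snd (grad g s)) = fwt' s"
    by (simp add: fun_eq_iff fwt'_def divide_inverse power2_eq_square mult_ac)
  ultimately have "((\<lambda>s. inverse (g s) *\<^sub>R snd (grad g s)) has_derivative fwt' s) (at s)" by simp
  then show ?thesis
    by (rule has_derivative_transform_within_open[OF _ open_ball s]) (simp add: fwt_eq divide_inverse)
qed

text \<open>The quotient rule produces exactly the two ratios whose suprema near \<open>\<theta>\<close> are assumed integrable.\<close>

lemma fwt'_bound:
  assumes s: "s \<in> ball \<theta> (2 * k0)"
  shows "norm (fwt' s h) \<le> (hessian_norm g s / g s + (norm (grad g s))\<^sup>2 / (g s)\<^sup>2) * norm h"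
proof -
  have p: "0 < g s" using g_pos[OF s] .
  have sn: "norm (snd v) \<le> norm v" for v :: "('q, 'r) param"
    by (metis norm_snd_le prod.collapse)
  have "norm (fwt' s h) \<le> norm ((1 / g s) *\<^sub>R snd (frechet_derivative (grad g) (at s) h)) + norm ((- (h \<bullet> grad g s) / (g s)\<^sup>2) *\<^sub>R snd (grad g s))"
    unfolding fwt'_def by (rule norm_triangle_ineq)
  also have "\<dots> \<le> (1 / g s) * (hessian_norm g s * norm h) + (norm h * norm (grad g s) / (g s)\<^sup>2) * norm (grad g s)"
  proof (rule add_mono)
    have "norm (snd (frechet_derivative (grad g) (at s) h)) \<le> hessian_norm g s * norm h"
      using order_trans[OF sn hessian_norm_bound[OF gradg_deriv[OF s]]] .
    then show "norm ((1 / g s) *\<^sub>R snd (frechet_derivative (grad g) (at s) h)) \<le> (1 / g s) * (hessian_norm g s * norm h)"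
      using p by (simp add: divide_right_mono)
    have "\<bar>h \<bullet> grad g s\<bar> / (g s)\<^sup>2 \<le> norm h * norm (grad g s) / (g s)\<^sup>2"
      by (intro divide_right_mono Cauchy_Schwarz_ineq2) auto
    then have "\<bar>h \<bullet> grad g s\<bar> / (g s)\<^sup>2 * norm (snd (grad g s)) \<le> (norm h * norm (grad g s) / (g s)\<^sup>2) * norm (grad g s)"
      by (intro mult_mono sn) auto
    then show "norm ((- (h \<bullet> grad g s) / (g s)\<^sup>2) *\<^sub>R snd (grad g s)) \<le> (norm h * norm (grad g s) / (g s)\<^sup>2) * norm (grad g s)"
      by (simp add: abs_divide)
  qed
  also have "\<dots> = (hessian_norm g s / g s + (norm (grad g s))\<^sup>2 / (g s)\<^sup>2) * norm h"
    by (simp add: power2_eq_square distrib_right distrib_left mult_ac)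
  finally show ?thesis .
qed

lemma cont_grad_g: "continuous_on (ball \<theta> (2 * k0)) (grad g)"
  by (rule has_derivative_imp_continuous_on[OF gradg_deriv])

lemma cont_g: "continuous_on (ball \<theta> (2 * k0)) g"
  by (rule has_derivative_imp_continuous_on[OF g_deriv])

lemma cont_lA: "continuous_on (ball \<theta> (2 * k0)) lA"
proof -
  have "continuous_on S1 (grad m)"
    using m_C2 by (intro continuous_at_imp_continuous_on ballI differentiable_imp_continuous_within) (simp add: C2_on_def)
  then have "continuous_on (ball \<theta> (2 * k0)) (\<lambda>s. grad m (fst s))"
    by (rule continuous_on_compose2) (use near in \<open>auto intro!: continuous_intros\<close>)
  then show ?thesis unfolding lA_def[abs_def] by (intro continuous_intros)
qed

lemma cont_sA: "continuous_on (ball \<theta> (2 * k0)) sA"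
proof -
  have "2 * sqrt (g s * g \<theta>) \<noteq> 0" if "s \<in> ball \<theta> (2 * k0)" for s
    using g_pos[OF that] th(2) by simp
  then have nz: "\<forall>s\<in>ball \<theta> (2 * k0). 2 * sqrt (g s * g \<theta>) \<noteq> 0" ..
  have "continuous_on (ball \<theta> (2 * k0)) (\<lambda>s. g s * g \<theta>)"
    by (rule continuous_on_mult[OF cont_g continuous_on_const])
  then have "continuous_on (ball \<theta> (2 * k0)) (\<lambda>s. 2 * sqrt (g s * g \<theta>))"
    by (rule continuous_on_mult_left[OF continuous_on_real_sqrt])
  from continuous_on_divide[OF continuous_on_const this nz]
  have "continuous_on (ball \<theta> (2 * k0)) (\<lambda>s. 1 / (2 * sqrt (g s * g \<theta>)))" .
  from continuous_on_scaleR[OF this cont_grad_g] show ?thesis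
    unfolding sA_def[abs_def] .
qed

lemma cont_hess: "continuous_on (ball \<theta> (2 * k0)) (\<lambda>s. hessian_norm g s / g s)"
proof -
  have "continuous_on (ball \<theta> (2 * k0)) (\<lambda>s. hessian g s a b)" if "a \<in> Basis" "b \<in> Basis" for a b
  proof (rule continuous_on_subset)
    show "continuous_on S (\<lambda>s. hessian g s a b)" using g_C2 that unfolding C2_on_def by blast
    show "ball \<theta> (2 * k0) \<subseteq> S" using near by blast
  qed
  then have c: "continuous_on (ball \<theta> (2 * k0)) (hessian_norm g)"
    unfolding hessian_norm_def[abs_def]
    by (intro continuous_on_real_sqrt continuous_on_sum continuous_on_power)
  have "g s \<noteq> 0" if "s \<in> ball \<theta> (2 * k0)" for s using g_pos[OF that] by simp
  then have nz: "\<forall>s\<in>ball \<theta> (2 * k0). g s \<noteq> 0" ..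
  show ?thesis by (rule continuous_on_divide[OF c cont_g nz])
qed

lemma cont_sq: "continuous_on (ball \<theta> (2 * k0)) (\<lambda>s. (norm (grad g s))\<^sup>2 / (g s)\<^sup>2)"
proof -
  have "(g s)\<^sup>2 \<noteq> 0" if "s \<in> ball \<theta> (2 * k0)" for s using g_pos[OF that] by simp
  then have nz: "\<forall>s\<in>ball \<theta> (2 * k0). (g s)\<^sup>2 \<noteq> 0" ..
  show ?thesis
    by (rule continuous_on_divide[OF continuous_on_power[OF continuous_on_norm[OF cont_grad_g]] continuous_on_power[OF cont_g] nz])
qed

lemma bounded_near:
  assumes "continuous_on (ball \<theta> (2 * k0)) \<phi>"
  shows "\<exists>B. \<forall>s\<in>ball \<theta> k0. norm (\<phi> s :: 'b::real_normed_vector) \<le> B"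
proof -
  have "compact (\<phi> ` cball \<theta> k0)"
    using assms in_ball2 by (intro compact_continuous_image) (auto intro: continuous_on_subset)
  then obtain B where "\<forall>z\<in>\<phi> ` cball \<theta> k0. norm z \<le> B" using compact_imp_bounded bounded_iff by metis
  then show ?thesis by (intro exI[of _ B]) auto
qed

lemma in_ball2': "s \<in> ball \<theta> k \<Longrightarrow> k \<le> k0 \<Longrightarrow> s \<in> ball \<theta> (2 * k0)"
  using k0 by auto

lemma rem1_le:
  assumes "0 < k" "k \<le> k0" "\<And>s. s \<in> ball \<theta> k0 \<Longrightarrow> norm (lA s) \<le> B"
  shows "floc_rem k k0 \<theta> m g \<le> ennreal (2 * B)"
  unfolding floc_rem_def alpha_eq
  by (rule Rem_bound) (use assms loc_deriv in_ball2'[OF _ assms(2)] in auto)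

lemma rem2_le:
  assumes "0 < k" "k \<le> k0" "\<And>s. s \<in> ball \<theta> k0 \<Longrightarrow> norm (sA s) \<le> B"
  shows "fscl_rem k k0 \<theta> g \<le> ennreal (2 * B)"
  unfolding fscl_rem_def beta_eq
  by (rule Rem_bound) (use assms scl_deriv in_ball2'[OF _ assms(2)] in auto)

lemma fwt_lip_le:
  assumes "\<And>s. s \<in> ball \<theta> k0 \<Longrightarrow> hessian_norm g s / g s + (norm (grad g s))\<^sup>2 / (g s)\<^sup>2 \<le> B"
  shows "fwt_lip k0 \<theta> g \<le> ennreal B"
  unfolding fwt_lip_def
proof (rule Lip_bound)
  fix s assume s: "s \<in> ball \<theta> k0"
  then have s2: "s \<in> ball \<theta> (2 * k0)" by (rule in_ball2'[OF _ order_refl])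
  show "(fwt k0 g has_derivative fwt' s) (at s)" by (rule fwt_deriv[OF s2])
  show "norm (fwt' s h) \<le> B * norm h" for h
    using fwt'_bound[OF s2, of h] mult_right_mono[OF assms[OF s], of "norm h"] by simp
qed

lemma finite_functionals:
  assumes "0 < k" "k \<le> k0"
  shows "floc_rem k k0 \<theta> m g < \<infinity>" "fscl_rem k k0 \<theta> g < \<infinity>" "fwt_lip k0 \<theta> g < \<infinity>"
proof -
  obtain B1 where "\<forall>s\<in>ball \<theta> k0. norm (lA s) \<le> B1" using bounded_near[OF cont_lA] by blast
  then show "floc_rem k k0 \<theta> m g < \<infinity>" using rem1_le[OF assms, of B1] by (auto intro: le_less_trans)
  obtain B2 where "\<forall>s\<in>ball \<theta> k0. norm (sA s) \<le> B2" using bounded_near[OF cont_sA] by blast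
  then show "fscl_rem k k0 \<theta> g < \<infinity>" using rem2_le[OF assms, of B2] by (auto intro: le_less_trans)
  obtain B3 where B3: "\<forall>s\<in>ball \<theta> k0. norm (hessian_norm g s / g s + (norm (grad g s))\<^sup>2 / (g s)\<^sup>2) \<le> B3"
    using bounded_near[OF continuous_on_add[OF cont_hess cont_sq]] by blast
  have "fwt_lip k0 \<theta> g \<le> ennreal B3"
  proof (rule fwt_lip_le)
    fix s assume "s \<in> ball \<theta> k0"
    with B3 have "norm (hessian_norm g s / g s + (norm (grad g s))\<^sup>2 / (g s)\<^sup>2) \<le> B3" by blast
    then show "hessian_norm g s / g s + (norm (grad g s))\<^sup>2 / (g s)\<^sup>2 \<le> B3" by (simp add: abs_le_iff)
  qed
  then show "fwt_lip k0 \<theta> g < \<infinity>" by (auto intro: le_less_trans)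
qed

lemma loc_expansion:
  assumes "0 < k" "k \<le> k0" "s \<in> ball \<theta> k"
  shows "\<bar>floc \<theta> m g s - floc_grad k0 \<theta> m g \<bullet> (s - \<theta>)\<bar> \<le> enn2real (floc_rem k k0 \<theta> m g) * norm (s - \<theta>)"
proof -
  have "continuous_on (ball \<theta> k) (floc \<theta> m g)"
    by (rule has_derivative_imp_continuous_on[OF loc_deriv[OF in_ball2'[OF _ assms(2)]]])
  from Rem_ge[OF this finite_functionals(1)[OF assms(1,2), unfolded floc_rem_def] assms(3)]
  show ?thesis by (simp add: floc_rem_def floc_def)
qed

lemma scl_expansion:
  assumes "0 < k" "k \<le> k0" "s \<in> ball \<theta> k"
  shows "\<bar>fscl \<theta> g s - 1 - fscl_grad k0 \<theta> g \<bullet> (s - \<theta>)\<bar> \<le> enn2real (fscl_rem k k0 \<theta> g) * norm (s - \<theta>)"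
proof -
  have "continuous_on (ball \<theta> k) (fscl \<theta> g)"
    by (rule has_derivative_imp_continuous_on[OF scl_deriv[OF in_ball2'[OF _ assms(2)]]])
  moreover have "fscl \<theta> g \<theta> = 1" using th by (simp add: fscl_def)
  ultimately show ?thesis
    using Rem_ge[OF _ finite_functionals(2)[OF assms(1,2), unfolded fscl_rem_def] assms(3)] by (simp add: fscl_rem_def)
qed

lemma fwt_lipschitz:
  assumes "s \<in> ball \<theta> k0" "s' \<in> ball \<theta> k0"
  shows "norm (fwt k0 g s - fwt k0 g s') \<le> enn2real (fwt_lip k0 \<theta> g) * norm (s - s')"
proof -
  have "continuous_on (ball \<theta> k0) (fwt k0 g)"
    by (rule has_derivative_imp_continuous_on[OF fwt_deriv[OF in_ball2'[OF _ order_refl]]])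
  from Lip_ge[OF this finite_functionals(3)[OF k0 order_refl, unfolded fwt_lip_def] assms]
  show ?thesis by (simp add: fwt_lip_def)
qed

lemma rem_tendsto_0:
  assumes "\<kappa> \<longlonglongrightarrow> 0"
  shows "(\<lambda>j. floc_rem (\<kappa> j) k0 \<theta> m g) \<longlonglongrightarrow> 0" "(\<lambda>j. fscl_rem (\<kappa> j) k0 \<theta> g) \<longlonglongrightarrow> 0"
  unfolding floc_rem_def fscl_rem_def alpha_eq beta_eq
  using Rem_tendsto_0[OF loc_deriv[OF th(1)] assms] Rem_tendsto_0[OF scl_deriv[OF th(1)] assms] by auto

end

section \<open>The density and the filtration of the model\<close>

text \<open>\<open>f' = \<psi> f\<close> with \<open>\<psi> = f' / f\<close>, and \<open>(x f)' = \<phi> f\<close> with \<open>\<phi> = 1 + x f' / f\<close>; the informations are the second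
  moments of \<open>\<psi>\<close> and \<open>\<phi>\<close>.\<close>

lemma hoelder_density_exists:
  fixes f\<^sub>0 f\<^sub>0' :: "real \<Rightarrow> real"
  assumes f0_nonneg: "\<And>x. 0 \<le> f\<^sub>0 x"
    and f0_meas[measurable]: "f\<^sub>0 \<in> borel_measurable borel"
    and f0_prob: "prob_space (density lborel f\<^sub>0)"
    and ac: "\<And>a b. absolutely_cont_on {a..b} f\<^sub>0"
    and f0'_meas[measurable]: "f\<^sub>0' \<in> borel_measurable borel"
    and deriv: "AE x in lborel. (f\<^sub>0 has_real_derivative f\<^sub>0' x) (at x)"
    and i1: "integrable (density lborel f\<^sub>0) (\<lambda>x. (f\<^sub>0' x / f\<^sub>0 x)\<^sup>2)"
    and i2: "integrable (density lborel f\<^sub>0) (\<lambda>x. (1 + x * f\<^sub>0' x / f\<^sub>0 x)\<^sup>2)"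
  shows "\<exists>C. hoelder_density f\<^sub>0 C"
proof -
  let ?P = "density lborel f\<^sub>0"
  define \<psi> where "\<psi> x = f\<^sub>0' x / f\<^sub>0 x" for x
  define \<phi> where "\<phi> x = 1 + x * f\<^sub>0' x / f\<^sub>0 x" for x
  define c1 where "c1 = sqrt (LINT x|?P. (\<psi> x)\<^sup>2)"
  define c2 where "c2 = sqrt (LINT x|?P. (\<phi> x)\<^sup>2)"
  define C where "C = max 1 (max c1 c2)"
  have m: "\<psi> \<in> borel_measurable borel" "\<phi> \<in> borel_measurable borel" unfolding \<psi>_def \<phi>_def by measurable
  (* Where f vanishes it has a minimum, so the quotients with value 0 by convention do no harm. *)
  have zero: "f\<^sub>0' x = 0" if "(f\<^sub>0 has_real_derivative f\<^sub>0' x) (at x)" "f\<^sub>0 x = 0" for x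
    using DERIV_local_min[OF that(1), of 1] f0_nonneg that(2) by simp
  have d1: "AE x in lborel. (f\<^sub>0 has_real_derivative \<psi> x * f\<^sub>0 x) (at x)"
    using deriv
  proof eventually_elim
    case (elim x)
    then show ?case using zero[OF elim] by (cases "f\<^sub>0 x = 0") (auto simp: \<psi>_def)
  qed
  have d2: "AE x in lborel. ((\<lambda>x. x * f\<^sub>0 x) has_real_derivative \<phi> x * f\<^sub>0 x) (at x)"
    using deriv
  proof eventually_elim
    case (elim x)
    have "((\<lambda>x. x * f\<^sub>0 x) has_real_derivative 1 * f\<^sub>0 x + f\<^sub>0' x * x) (at x)"
      by (rule DERIV_mult[OF DERIV_ident elim])
    moreover have "1 * f\<^sub>0 x + f\<^sub>0' x * x = \<phi> x * f\<^sub>0 x"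
      using zero[OF elim] by (cases "f\<^sub>0 x = 0") (auto simp: \<phi>_def distrib_right)
    ultimately show ?case by simp
  qed
  have ac2: "absolutely_cont_on {a..b} (\<lambda>x. x * f\<^sub>0 x)" for a b
    by (rule absolutely_cont_on_times_ident[OF ac absolutely_cont_on_imp_continuous[OF ac]])
  have h1: "\<bar>f\<^sub>0 x - f\<^sub>0 y\<bar> \<le> c1 * sqrt \<bar>cdf ?P x - cdf ?P y\<bar>" for x y
    unfolding c1_def using i1 by (intro hoelder_of_weighted_derivative[OF f0_prob f0_nonneg f0_meas m(1) ac d1]) (simp add: \<psi>_def)
  have h2: "\<bar>x * f\<^sub>0 x - y * f\<^sub>0 y\<bar> \<le> c2 * sqrt \<bar>cdf ?P x - cdf ?P y\<bar>" for x y
    unfolding c2_def using i2 by (intro hoelder_of_weighted_derivative[OF f0_prob f0_nonneg f0_meas m(2) ac2 d2]) (simp add: \<phi>_def)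
  have "hoelder_density f\<^sub>0 C"
  proof (rule hoelder_density.intro)
    show "0 \<le> f\<^sub>0 x" for x by (rule f0_nonneg)
    show "f\<^sub>0 \<in> borel_measurable borel" by (rule f0_meas)
    show "prob_space ?P" by (rule f0_prob)
    show "1 \<le> C" by (simp add: C_def)
    have C: "c1 \<le> C" "c2 \<le> C" by (auto simp: C_def)
    show "\<bar>f\<^sub>0 x - f\<^sub>0 y\<bar> \<le> C * sqrt \<bar>cdf ?P x - cdf ?P y\<bar>" for x y
      by (rule order_trans[OF h1 mult_right_mono[OF C(1)]]) simp
    show "\<bar>x * f\<^sub>0 x - y * f\<^sub>0 y\<bar> \<le> C * sqrt \<bar>cdf ?P x - cdf ?P y\<bar>" for x y
      by (rule order_trans[OF h2 mult_right_mono[OF C(2)]]) simp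
  qed
  then show ?thesis ..
qed

text \<open>On events that are determined separately by the initial vector and by \<open>\<eta>\<^sub>1, \<dots>, \<eta>\<^sub>i\<close> the product
  formula follows from the two independence assumptions; these events generate the past and
  are closed under intersection.\<close>

lemma past_field_indep:
  fixes M :: "'a measure" and \<eta> y :: "int \<Rightarrow> 'a \<Rightarrow> real" and L :: "int set" and i :: nat
  assumes M: "prob_space M" and ym: "\<And>j. y j \<in> borel_measurable M"
    and ind: "prob_space.indep_vars M (\<lambda>_. borel) \<eta> UNIV"
    and init: "prob_space.indep_var M
         (Pi\<^sub>M L (\<lambda>_. borel)) (\<lambda>\<omega>. restrict (\<lambda>j. y j \<omega>) L)
         (Pi\<^sub>M {1..} (\<lambda>_. borel)) (\<lambda>\<omega>. restrict (\<lambda>i. \<eta> i \<omega>) {1..})"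
    and A: "A \<in> sets (past_field M y \<eta> L (int i))" and B: "B \<in> sets borel"
  shows "measure M (A \<inter> \<eta> (int i + 1) -` B) = measure M A * measure M (\<eta> (int i + 1) -` B \<inter> space M)"
proof -
  interpret prob_space M by fact
  have em[measurable]: "\<eta> k \<in> borel_measurable M" for k using ind by (auto simp: indep_vars_def)
  note [measurable] = ym
  define R0 where "R0 \<omega> = restrict (\<lambda>j. y j \<omega>) L" for \<omega>
  define R1 where "R1 \<omega> = restrict (\<lambda>k. \<eta> k \<omega>) {1..int i}" for \<omega>
  define R where "R \<omega> = restrict (\<lambda>k. \<eta> k \<omega>) {1..}" for \<omega>
  have R0m: "R0 \<in> measurable M (Pi\<^sub>M L (\<lambda>_. borel))" unfolding R0_def by measurable
  have R1m: "R1 \<in> measurable M (Pi\<^sub>M {1..int i} (\<lambda>_. borel))" unfolding R1_def by measurable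
  define PS where "PS = {R0 -` S0 \<inter> R1 -` S1 \<inter> space M | S0 S1. S0 \<in> sets (Pi\<^sub>M L (\<lambda>_. borel :: real measure)) \<and> S1 \<in> sets (Pi\<^sub>M {1..int i} (\<lambda>_. borel :: real measure))}"
  define SG where "SG = {\<eta> (int i + 1) -` B \<inter> space M | B. B \<in> sets (borel :: real measure)}"
  have key: "prob (R0 -` S0 \<inter> R1 -` S1 \<inter> space M \<inter> \<eta> (int i + 1) -` B) =
      prob (R0 -` S0 \<inter> space M) * (prob (R1 -` S1 \<inter> space M) * prob (\<eta> (int i + 1) -` B \<inter> space M))"
    if S0: "S0 \<in> sets (Pi\<^sub>M L (\<lambda>_. borel))" and S1: "S1 \<in> sets (Pi\<^sub>M {1..int i} (\<lambda>_. borel))" and B: "B \<in> sets borel" for S0 S1 B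
  proof -
    define T where "T = {x \<in> space (Pi\<^sub>M {1..} (\<lambda>_. borel :: real measure)). restrict x {1..int i} \<in> S1 \<and> x (int i + 1) \<in> B}"
    have T: "T \<in> sets (Pi\<^sub>M {1..} (\<lambda>_. borel))"
    proof -
      have [measurable]: "(\<lambda>x. restrict x {1..int i}) \<in> measurable (Pi\<^sub>M {1..} (\<lambda>_. borel :: real measure)) (Pi\<^sub>M {1..int i} (\<lambda>_. borel))"
        by (rule measurable_restrict_subset) auto
      have [measurable]: "(\<lambda>x. x (int i + 1)) \<in> measurable (Pi\<^sub>M {1..} (\<lambda>_. borel :: real measure)) borel"
        by (rule measurable_component_singleton) simp
      note [measurable] = S1 B
      show ?thesis unfolding T_def by measurable
    qed
    have "prob (R0 -` S0 \<inter> R1 -` S1 \<inter> space M \<inter> \<eta> (int i + 1) -` B) = prob ((\<lambda>\<omega>. (R0 \<omega>, R \<omega>)) -` (S0 \<times> T) \<inter> space M)"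
    proof (rule arg_cong[where f=prob], intro set_eqI iffI)
      fix \<omega> assume "\<omega> \<in> R0 -` S0 \<inter> R1 -` S1 \<inter> space M \<inter> \<eta> (int i + 1) -` B"
      moreover have "restrict (R \<omega>) {1..int i} = R1 \<omega>" by (auto simp: R_def R1_def fun_eq_iff)
      ultimately show "\<omega> \<in> (\<lambda>\<omega>. (R0 \<omega>, R \<omega>)) -` (S0 \<times> T) \<inter> space M"
        by (auto simp: T_def space_PiM R_def)
    next
      fix \<omega> assume "\<omega> \<in> (\<lambda>\<omega>. (R0 \<omega>, R \<omega>)) -` (S0 \<times> T) \<inter> space M"
      moreover have "restrict (R \<omega>) {1..int i} = R1 \<omega>" by (auto simp: R_def R1_def fun_eq_iff)
      ultimately show "\<omega> \<in> R0 -` S0 \<inter> R1 -` S1 \<inter> space M \<inter> \<eta> (int i + 1) -` B"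
        by (auto simp: T_def R_def)
    qed
    also have "\<dots> = prob (R0 -` S0 \<inter> space M) * prob (R -` T \<inter> space M)"
      using indep_varD[OF init S0 T] by (simp add: R0_def[abs_def] R_def[abs_def])
    also have "R -` T \<inter> space M = (\<lambda>\<omega>. (R1 \<omega>, restrict (\<lambda>k. \<eta> k \<omega>) {int i + 1})) -` (S1 \<times> {x \<in> space (Pi\<^sub>M {int i + 1} (\<lambda>_. borel :: real measure)). x (int i + 1) \<in> B}) \<inter> space M"
    proof (intro set_eqI iffI)
      fix \<omega> assume "\<omega> \<in> R -` T \<inter> space M"
      moreover have "restrict (R \<omega>) {1..int i} = R1 \<omega>" by (auto simp: R_def R1_def fun_eq_iff)
      ultimately show "\<omega> \<in> (\<lambda>\<omega>. (R1 \<omega>, restrict (\<lambda>k. \<eta> k \<omega>) {int i + 1})) -` (S1 \<times> {x \<in> space (Pi\<^sub>M {int i + 1} (\<lambda>_. borel :: real measure)). x (int i + 1) \<in> B}) \<inter> space M"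
        by (auto simp: T_def R_def space_PiM)
    next
      fix \<omega> assume "\<omega> \<in> (\<lambda>\<omega>. (R1 \<omega>, restrict (\<lambda>k. \<eta> k \<omega>) {int i + 1})) -` (S1 \<times> {x \<in> space (Pi\<^sub>M {int i + 1} (\<lambda>_. borel :: real measure)). x (int i + 1) \<in> B}) \<inter> space M"
      moreover have "restrict (R \<omega>) {1..int i} = R1 \<omega>" by (auto simp: R_def R1_def fun_eq_iff)
      ultimately show "\<omega> \<in> R -` T \<inter> space M"
        by (auto simp: T_def R_def space_PiM)
    qed
    also have "prob \<dots> = prob (R1 -` S1 \<inter> space M) * prob ((\<lambda>\<omega>. restrict (\<lambda>k. \<eta> k \<omega>) {int i + 1}) -` {x \<in> space (Pi\<^sub>M {int i + 1} (\<lambda>_. borel :: real measure)). x (int i + 1) \<in> B} \<inter> space M)"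
    proof -
      have iv: "indep_var (Pi\<^sub>M {1..int i} (\<lambda>_. borel)) (\<lambda>\<omega>. restrict (\<lambda>k. \<eta> k \<omega>) {1..int i})
         (Pi\<^sub>M {int i + 1} (\<lambda>_. borel)) (\<lambda>\<omega>. restrict (\<lambda>k. \<eta> k \<omega>) {int i + 1})"
        by (rule indep_var_restrict[OF ind]) auto
      have "{x \<in> space (Pi\<^sub>M {int i + 1} (\<lambda>_. borel :: real measure)). x (int i + 1) \<in> B} \<in> sets (Pi\<^sub>M {int i + 1} (\<lambda>_. borel))"
        using B by measurable
      from indep_varD[OF iv S1 this] show ?thesis by (simp add: R1_def[abs_def])
    qed
    also have "(\<lambda>\<omega>. restrict (\<lambda>k. \<eta> k \<omega>) {int i + 1}) -` {x \<in> space (Pi\<^sub>M {int i + 1} (\<lambda>_. borel :: real measure)). x (int i + 1) \<in> B} \<inter> space M = \<eta> (int i + 1) -` B \<inter> space M"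
      by (auto simp: space_PiM)
    finally show ?thesis .
  qed
  have key2: "prob (R0 -` S0 \<inter> R1 -` S1 \<inter> space M) = prob (R0 -` S0 \<inter> space M) * prob (R1 -` S1 \<inter> space M)"
    if "S0 \<in> sets (Pi\<^sub>M L (\<lambda>_. borel))" "S1 \<in> sets (Pi\<^sub>M {1..int i} (\<lambda>_. borel))" for S0 S1
    using key[OF that, of UNIV] by (simp add: prob_space)
  have PSev: "PS \<subseteq> events"
  proof
    fix a assume "a \<in> PS"
    then obtain S0 S1 where a: "a = R0 -` S0 \<inter> R1 -` S1 \<inter> space M" "S0 \<in> sets (Pi\<^sub>M L (\<lambda>_. borel))" "S1 \<in> sets (Pi\<^sub>M {1..int i} (\<lambda>_. borel))"
      by (auto simp: PS_def)
    have "a = (R0 -` S0 \<inter> space M) \<inter> (R1 -` S1 \<inter> space M)" using a(1) by auto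
    then show "a \<in> events" using measurable_sets[OF R0m a(2)] measurable_sets[OF R1m a(3)] by simp
  qed
  have ips: "indep_set PS SG"
  proof (rule indep_setI[OF PSev])
    show "SG \<subseteq> events" by (auto simp: SG_def)
    fix a b assume "a \<in> PS" "b \<in> SG"
    then obtain S0 S1 B where a: "a = R0 -` S0 \<inter> R1 -` S1 \<inter> space M" "b = \<eta> (int i + 1) -` B \<inter> space M"
      and S: "S0 \<in> sets (Pi\<^sub>M L (\<lambda>_. borel))" "S1 \<in> sets (Pi\<^sub>M {1..int i} (\<lambda>_. borel))" "B \<in> sets borel"
      by (auto simp: PS_def SG_def)
    have "a \<inter> b = R0 -` S0 \<inter> R1 -` S1 \<inter> space M \<inter> \<eta> (int i + 1) -` B" using a by auto
    then show "prob (a \<inter> b) = prob a * prob b"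
      using key[OF S] key2[OF S(1,2)] a by simp
  qed
  have I1: "Int_stable PS"
  proof (rule Int_stableI)
    fix a b assume "a \<in> PS" "b \<in> PS"
    then obtain S0 S1 S0' S1' where ab: "a = R0 -` S0 \<inter> R1 -` S1 \<inter> space M" "b = R0 -` S0' \<inter> R1 -` S1' \<inter> space M"
      and S: "S0 \<in> sets (Pi\<^sub>M L (\<lambda>_. borel))" "S1 \<in> sets (Pi\<^sub>M {1..int i} (\<lambda>_. borel))"
        "S0' \<in> sets (Pi\<^sub>M L (\<lambda>_. borel))" "S1' \<in> sets (Pi\<^sub>M {1..int i} (\<lambda>_. borel))"
      by (auto simp: PS_def)
    have "a \<inter> b = R0 -` (S0 \<inter> S0') \<inter> R1 -` (S1 \<inter> S1') \<inter> space M" using ab by auto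
    then show "a \<inter> b \<in> PS" unfolding PS_def using S by blast
  qed
  have I2: "Int_stable SG"
  proof (rule Int_stableI)
    fix a b assume "a \<in> SG" "b \<in> SG"
    then obtain B B' where "a = \<eta> (int i + 1) -` B \<inter> space M" "b = \<eta> (int i + 1) -` B' \<inter> space M" "B \<in> sets borel" "B' \<in> sets borel"
      by (auto simp: SG_def)
    then show "a \<inter> b \<in> SG" unfolding SG_def by (intro CollectI exI[of _ "B \<inter> B'"]) auto
  qed
  have ix: "indep_set (sigma_sets (space M) PS) (sigma_sets (space M) SG)"
    by (rule indep_set_sigma_sets[OF ips I1 I2])
  let ?gen = "{\<eta> k -` B \<inter> space M | k B. 1 \<le> k \<and> k \<le> int i \<and> B \<in> sets borel} \<union>
      {y j -` B \<inter> space M | j B. j \<in> L \<and> B \<in> sets borel}"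
  have gen: "?gen \<subseteq> PS"
  proof
    fix a assume "a \<in> ?gen"
    then consider k B where "a = \<eta> k -` B \<inter> space M" "1 \<le> k" "k \<le> int i" "B \<in> sets borel"
      | j B where "a = y j -` B \<inter> space M" "j \<in> L" "B \<in> sets borel" by blast
    then show "a \<in> PS"
    proof cases
      case 1
      let ?S = "{x \<in> space (Pi\<^sub>M {1..int i} (\<lambda>_. borel :: real measure)). x k \<in> B}"
      have "?S \<in> sets (Pi\<^sub>M {1..int i} (\<lambda>_. borel))"
      proof -
        have [measurable]: "(\<lambda>x. x k) \<in> measurable (Pi\<^sub>M {1..int i} (\<lambda>_. borel :: real measure)) borel"
          using 1 by (intro measurable_component_singleton) auto
        note [measurable] = 1(4)
        show ?thesis by measurable
      qed
      moreover have "a = R0 -` space (Pi\<^sub>M L (\<lambda>_. borel)) \<inter> R1 -` ?S \<inter> space M"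
        using 1 by (auto simp: R0_def R1_def space_PiM)
      ultimately show ?thesis unfolding PS_def by blast
    next
      case 2
      let ?S = "{x \<in> space (Pi\<^sub>M L (\<lambda>_. borel :: real measure)). x j \<in> B}"
      have "?S \<in> sets (Pi\<^sub>M L (\<lambda>_. borel))"
      proof -
        have [measurable]: "(\<lambda>x. x j) \<in> measurable (Pi\<^sub>M L (\<lambda>_. borel :: real measure)) borel"
          using 2 by (intro measurable_component_singleton) auto
        note [measurable] = 2(3)
        show ?thesis by measurable
      qed
      moreover have "a = R0 -` ?S \<inter> R1 -` space (Pi\<^sub>M {1..int i} (\<lambda>_. borel)) \<inter> space M"
        using 2 by (auto simp: R0_def R1_def space_PiM)
      ultimately show ?thesis unfolding PS_def by blast
    qed
  qed
  have gp: "?gen \<subseteq> Pow (space M)" by auto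
  have "sets (past_field M y \<eta> L (int i)) = sigma_sets (space M) ?gen"
    unfolding past_field_def by (rule sets_measure_of[OF gp])
  then have A': "A \<in> sigma_sets (space M) PS" using A sigma_sets_mono'[OF gen] by blast
  have "PS \<subseteq> Pow (space M)" by (auto simp: PS_def)
  then have As: "A \<subseteq> space M" using A' sigma_sets_into_sp by metis
  have "\<eta> (int i + 1) -` B \<inter> space M \<in> sigma_sets (space M) SG"
    using B by (auto simp: SG_def)
  from indep_setD[OF ix A' this]
  have "prob (A \<inter> (\<eta> (int i + 1) -` B \<inter> space M)) = prob A * prob (\<eta> (int i + 1) -` B \<inter> space M)" .
  moreover have "A \<inter> (\<eta> (int i + 1) -` B \<inter> space M) = A \<inter> \<eta> (int i + 1) -` B" using As by auto
  ultimately show ?thesis by simp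
qed

lemma past_field_props:
  assumes "\<And>k. \<eta> k \<in> borel_measurable M" "\<And>j. y j \<in> borel_measurable M"
  shows "space (past_field M y \<eta> L i) = space M" "sets (past_field M y \<eta> L i) \<subseteq> sets M"
    "sets (past_field M y \<eta> L i) \<subseteq> sets (past_field M y \<eta> L (i + 1))"
    "1 \<le> i \<Longrightarrow> \<eta> i \<in> borel_measurable (past_field M y \<eta> L i)"
proof -
  let ?gen = "\<lambda>i. {\<eta> k -` B \<inter> space M | k B. 1 \<le> k \<and> k \<le> i \<and> B \<in> sets borel} \<union>
      {y j -` B \<inter> space M | j B. j \<in> L \<and> B \<in> sets borel}"
  have gp: "?gen i \<subseteq> Pow (space M)" for i by auto
  have st: "sets (past_field M y \<eta> L i) = sigma_sets (space M) (?gen i)" for i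
    unfolding past_field_def by (rule sets_measure_of[OF gp])
  show sp: "space (past_field M y \<eta> L i) = space M" for i
    unfolding past_field_def by (rule space_measure_of[OF gp])
  have "?gen i \<subseteq> sets M" using assms measurable_sets by blast
  then show "sets (past_field M y \<eta> L i) \<subseteq> sets M" unfolding st by (rule sets.sigma_sets_subset)
  have "?gen i \<subseteq> ?gen (i + 1)"
  proof (rule Un_mono[OF subsetI order_refl])
    fix a assume "a \<in> {\<eta> k -` B \<inter> space M | k B. 1 \<le> k \<and> k \<le> i \<and> B \<in> sets borel}"
    then obtain k B where a: "a = \<eta> k -` B \<inter> space M" "1 \<le> k" "k \<le> i" "B \<in> sets borel" by blast
    then have "k \<le> i + 1" by simp
    with a show "a \<in> {\<eta> k -` B \<inter> space M | k B. 1 \<le> k \<and> k \<le> i + 1 \<and> B \<in> sets borel}" by blast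
  qed
  then show "sets (past_field M y \<eta> L i) \<subseteq> sets (past_field M y \<eta> L (i + 1))"
    unfolding st by (rule sigma_sets_mono')
  show "\<eta> i \<in> borel_measurable (past_field M y \<eta> L i)" if "1 \<le> i"
  proof (rule measurableI)
    fix B :: "real set" assume "B \<in> sets borel"
    then have "\<eta> i -` B \<inter> space M \<in> ?gen i" using that by blast
    then show "\<eta> i -` B \<inter> space (past_field M y \<eta> L i) \<in> sets (past_field M y \<eta> L i)"
      unfolding st sp by (rule sigma_sets.Basic)
  qed simp
qed

lemma past_innovations:
  fixes f :: "real \<Rightarrow> real" and M :: "'a measure" and \<eta> y :: "int \<Rightarrow> 'a \<Rightarrow> real" and L :: "int set"
  assumes hd: "hoelder_density f C"
    and M: "prob_space M" and ym: "\<And>j. y j \<in> borel_measurable M"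
    and ind: "prob_space.indep_vars M (\<lambda>_. borel) \<eta> UNIV"
    and distr: "\<And>i. cdf (distr M borel (\<eta> i)) = cdf (density lborel f)"
    and init: "prob_space.indep_var M
         (Pi\<^sub>M L (\<lambda>_. borel)) (\<lambda>\<omega>. restrict (\<lambda>j. y j \<omega>) L)
         (Pi\<^sub>M {1..} (\<lambda>_. borel)) (\<lambda>\<omega>. restrict (\<lambda>i. \<eta> i \<omega>) {1..})"
  shows "innovations f C M (\<lambda>i. past_field M y \<eta> L (int i)) (\<lambda>i. \<eta> (int i + 1))"
proof -
  interpret M: prob_space M by fact
  interpret hoelder_density f C by fact
  have em: "\<eta> k \<in> borel_measurable M" for k using ind by (auto simp: M.indep_vars_def)
  note pp = past_field_props[of \<eta> M y, OF em ym]
  have eqd: "distr M borel (\<eta> k) = density lborel f" for k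
    by (rule cdf_unique[OF M.real_distribution_distr[OF em] _ distr])
       (use P.real_distribution_axioms in \<open>simp add: P_def\<close>)
  show ?thesis
  proof (unfold_locales, goal_cases)
    case (1 i) then show ?case by (rule pp(1))
  next
    case (2 i) then show ?case by (rule pp(2))
  next
    case (3 i) then show ?case using pp(3)[of L "int i"] by (simp add: add.commute)
  next
    case (4 i) then show ?case using pp(4)[of "int i + 1" L] by (simp add: add.commute)
  next
    case (5 i A B)
    have "measure M (\<eta> (int i + 1) -` B \<inter> space M) = measure (density lborel f) B"
      using measure_distr[OF em, of B "int i + 1"] 5 by (simp add: eqd)
    then show ?case using past_field_indep[OF M ym ind init 5] by simp
  qed
qed

lemma aas_imp_tendsto:
  assumes "aas M Q"
  shows "(\<lambda>n. outer_measure_of M {\<omega> \<in> space M. \<not> Q n \<omega>}) \<longlonglongrightarrow> 0"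
proof (rule order_tendstoI)
  fix e :: ennreal assume "0 < e"
  then obtain z where z: "0 < z" "z < e" using dense by blast
  define r where "r = enn2real z"
  have "z < top" using z(2) by (simp add: order_less_le_trans)
  then have r: "0 < r" "ennreal r < e" using z by (auto simp: r_def enn2real_positive_iff)
  have "whp M r Q" by (rule aasD[OF assms r(1)])
  then show "\<forall>\<^sub>F n in sequentially. outer_measure_of M {\<omega> \<in> space M. \<not> Q n \<omega>} < e"
    unfolding whp_def by eventually_elim (use r(2) in auto)
qed simp

section \<open>Moments and stationarity\<close>

locale garch_model = M: prob_space M for M :: "'a measure" +
  fixes y :: "int \<Rightarrow> 'a \<Rightarrow> real"
    and \<mu> :: "int \<Rightarrow> real^'q::finite \<Rightarrow> 'a \<Rightarrow> real"
    and h :: "int \<Rightarrow> ('q, 'r::finite) param \<Rightarrow> 'a \<Rightarrow> real"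
    and \<Theta>1 :: "(real^'q) set" and \<Theta>2 :: "(real^'r) set"
    and \<theta> :: "('q, 'r) param" and U :: "(('q, 'r) param) set" and k0 :: real
  assumes h_pos: "\<And>i s \<omega>. s \<in> \<Theta>1 \<times> \<Theta>2 \<Longrightarrow> \<omega> \<in> space M \<Longrightarrow> 0 < h i s \<omega>"
    and stationary: "strictly_stationary M (model_space \<Theta>1 \<Theta>2) (model_process \<Theta>1 \<Theta>2 y \<mu> h)"
    and mu_C2: "\<And>i \<omega>. \<omega> \<in> space M \<Longrightarrow> C2_on (interior \<Theta>1) (\<lambda>s\<^sub>1. \<mu> i s\<^sub>1 \<omega>)"
    and h_C2: "\<And>i \<omega>. \<omega> \<in> space M \<Longrightarrow> C2_on (interior (\<Theta>1 \<times> \<Theta>2)) (\<lambda>s. h i s \<omega>)"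
    and U: "open U" "U \<subseteq> \<Theta>1 \<times> \<Theta>2" and k0: "0 < k0" "ball \<theta> (2 * k0) \<subseteq> U"
    and v1: "(\<integral>\<^sup>+ \<omega>. (SUP s\<in>U. ennreal ((norm (mu_dot_ext \<mu> 1 s \<omega>))\<^sup>2 / h 1 \<theta> \<omega>)) \<partial>M) < \<infinity>"
    and v2: "(\<integral>\<^sup>+ \<omega>. (SUP s\<in>U. ennreal ((norm (h_dot h 1 s \<omega>))\<^sup>2 / (h 1 s \<omega> * h 1 \<theta> \<omega>))) \<partial>M) < \<infinity>"
    and v3: "(\<integral>\<^sup>+ \<omega>. (SUP s\<in>U. ennreal (hessian_norm (\<lambda>u. h 1 u \<omega>) s / h 1 s \<omega>)) \<partial>M) < \<infinity>"
    and v4: "(\<integral>\<^sup>+ \<omega>. (SUP s\<in>U. ennreal ((norm (h_dot h 1 s \<omega>))\<^sup>2 / (h 1 s \<omega>)\<^sup>2)) \<partial>M) < \<infinity>"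
begin

abbreviation mp :: "int \<Rightarrow> 'a \<Rightarrow> real^'q \<Rightarrow> real" where "mp i \<omega> \<equiv> (\<lambda>s. \<mu> i s \<omega>)"
abbreviation hp :: "int \<Rightarrow> 'a \<Rightarrow> ('q, 'r) param \<Rightarrow> real" where "hp i \<omega> \<equiv> (\<lambda>s. h i s \<omega>)"

abbreviation mn :: "nat \<Rightarrow> 'a \<Rightarrow> real^'q \<Rightarrow> real" where "mn i \<equiv> mp (int i + 1)"
abbreviation hn :: "nat \<Rightarrow> 'a \<Rightarrow> ('q, 'r) param \<Rightarrow> real" where "hn i \<equiv> hp (int i + 1)"

abbreviation V1 where "V1 \<omega> \<equiv> SUP s\<in>U. ennreal ((norm (mu_dot_ext \<mu> 1 s \<omega>))\<^sup>2 / h 1 \<theta> \<omega>)"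
abbreviation V2 where "V2 \<omega> \<equiv> SUP s\<in>U. ennreal ((norm (h_dot h 1 s \<omega>))\<^sup>2 / (h 1 s \<omega> * h 1 \<theta> \<omega>))"
abbreviation V4 where "V4 \<omega> \<equiv> SUP s\<in>U. ennreal ((norm (h_dot h 1 s \<omega>))\<^sup>2 / (h 1 s \<omega>)\<^sup>2)"

lemma ball_param: "s \<in> ball \<theta> (2 * k0) \<Longrightarrow> fst s \<in> \<Theta>1 \<and> s \<in> \<Theta>1 \<times> \<Theta>2"
proof -
  assume "s \<in> ball \<theta> (2 * k0)"
  then have "s \<in> \<Theta>1 \<times> \<Theta>2" using U(2) k0(2) by blast
  then show ?thesis by auto
qed

lemma ball_U: "s \<in> ball \<theta> k0 \<Longrightarrow> s \<in> U"
proof -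
  assume "s \<in> ball \<theta> k0"
  then have "s \<in> ball \<theta> (2 * k0)" using k0(1) by simp
  then show ?thesis using k0(2) by blast
qed

lemma smooth:
  assumes \<omega>: "\<omega> \<in> space M"
  shows "smooth_point \<theta> k0 (mp i \<omega>) (hp i \<omega>) (interior \<Theta>1) (interior (\<Theta>1 \<times> \<Theta>2))"
proof
  show "0 < k0" by (rule k0(1))
  show "C2_on (interior \<Theta>1) (mp i \<omega>)" "C2_on (interior (\<Theta>1 \<times> \<Theta>2)) (hp i \<omega>)"
    using mu_C2[OF \<omega>] h_C2[OF \<omega>] by auto
  fix s assume s: "s \<in> ball \<theta> (2 * k0)"
  then have sU: "s \<in> U" using k0(2) by blast
  have "open (fst ` U)" using U(1) by (rule open_image_fst)
  moreover have "fst ` U \<subseteq> \<Theta>1" using U(2) by auto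
  ultimately have "fst ` U \<subseteq> interior \<Theta>1" by (rule interior_maximal[rotated])
  moreover have "U \<subseteq> interior (\<Theta>1 \<times> \<Theta>2)" using U by (rule interior_maximal[rotated])
  ultimately show "fst s \<in> interior \<Theta>1 \<and> s \<in> interior (\<Theta>1 \<times> \<Theta>2) \<and> 0 < h i s \<omega>"
    using sU h_pos[of s \<omega> i] U(2) \<omega> by blast
qed

lemma X_measurable: "model_process \<Theta>1 \<Theta>2 y \<mu> h i \<in> measurable M (model_space \<Theta>1 \<Theta>2)"
  using stationary by (simp add: strictly_stationary_def)

lemma X_identical: "distr M (model_space \<Theta>1 \<Theta>2) (model_process \<Theta>1 \<Theta>2 y \<mu> h i)
    = distr M (model_space \<Theta>1 \<Theta>2) (model_process \<Theta>1 \<Theta>2 y \<mu> h 1)"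
proof -
  let ?N = "model_space \<Theta>1 \<Theta>2" and ?X = "model_process \<Theta>1 \<Theta>2 y \<mu> h"
  let ?P = "Pi\<^sub>M UNIV (\<lambda>_::int. ?N)"
  have c: "(\<lambda>x. x 1) \<in> measurable ?P ?N" by (rule measurable_component_singleton) simp
  have m: "(\<lambda>\<omega> j. ?X (j + k) \<omega>) \<in> measurable M ?P" for k
    using X_measurable by (intro measurable_PiM_single') (auto simp: space_PiM dest: measurable_space)
  have "distr M ?N (\<lambda>\<omega>. ?X (1 + k) \<omega>) = distr (distr M ?P (\<lambda>\<omega> j. ?X (j + k) \<omega>)) ?N (\<lambda>x. x 1)" for k
    by (subst distr_distr[OF c m]) (simp add: comp_def)
  moreover have "distr M ?P (\<lambda>\<omega> j. ?X (j + (i - 1)) \<omega>) = distr M ?P (\<lambda>\<omega> j. ?X (j + 0) \<omega>)"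
    using stationary by (simp add: strictly_stationary_def)
  ultimately have "distr M ?N (\<lambda>\<omega>. ?X (1 + (i - 1)) \<omega>) = distr M ?N (\<lambda>\<omega>. ?X (1 + 0) \<omega>)"
    by metis
  then show ?thesis by simp
qed

lemma comp_measurable:
  assumes "s \<in> ball \<theta> (2 * k0)"
  shows "(\<lambda>x. fst (snd x) (fst s)) \<in> borel_measurable (model_space \<Theta>1 \<Theta>2)"
    "(\<lambda>x. snd (snd x) s) \<in> borel_measurable (model_space \<Theta>1 \<Theta>2)"
proof -
  have 1: "(\<lambda>x. fst (snd x)) \<in> measurable (model_space \<Theta>1 \<Theta>2) (Pi\<^sub>M \<Theta>1 (\<lambda>_. borel :: real measure))"
    unfolding model_space_def by (rule measurable_compose[OF measurable_snd measurable_fst])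
  have 2: "(\<lambda>x. snd (snd x)) \<in> measurable (model_space \<Theta>1 \<Theta>2) (Pi\<^sub>M (\<Theta>1 \<times> \<Theta>2) (\<lambda>_. borel :: real measure))"
    unfolding model_space_def by (rule measurable_compose[OF measurable_snd measurable_snd])
  show "(\<lambda>x. fst (snd x) (fst s)) \<in> borel_measurable (model_space \<Theta>1 \<Theta>2)"
    by (rule measurable_compose[OF 1 measurable_component_singleton]) (use ball_param[OF assms] in simp)
  show "(\<lambda>x. snd (snd x) s) \<in> borel_measurable (model_space \<Theta>1 \<Theta>2)"
    by (rule measurable_compose[OF 2 measurable_component_singleton]) (use ball_param[OF assms] in simp)
qed

lemma model_coord:
  assumes "s \<in> ball \<theta> (2 * k0)"
  shows "fst (snd (model_process \<Theta>1 \<Theta>2 y \<mu> h i \<omega>)) (fst s) = \<mu> i (fst s) \<omega>"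
    "snd (snd (model_process \<Theta>1 \<Theta>2 y \<mu> h i \<omega>)) s = h i s \<omega>"
  using ball_param[OF assms] by (auto simp: model_process_def)

lemma y_measurable: "y i \<in> borel_measurable M"
proof -
  have "fst \<in> borel_measurable (model_space \<Theta>1 \<Theta>2)" unfolding model_space_def by (rule measurable_fst)
  from measurable_compose[OF X_measurable[of i] this] show ?thesis by (simp add: model_process_def)
qed

lemma mh_measurable:
  assumes "s \<in> ball \<theta> (2 * k0)"
  shows "\<mu> i (fst s) \<in> borel_measurable M" "h i s \<in> borel_measurable M"
  using measurable_compose[OF X_measurable[of i] comp_measurable(1)[OF assms]]
    measurable_compose[OF X_measurable[of i] comp_measurable(2)[OF assms]]
  by (simp_all add: model_coord[OF assms])

text \<open>A measurable functional that depends on the trajectories only near \<open>\<theta>\<close> is a function of the stationary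
  process \<open>(y\<^sub>i, \<mu>\<^sub>i, h\<^sub>i)\<close>, hence has the same distribution at every time. The restriction to a
  neighbourhood matters because the model process carries \<open>\<mu>\<^sub>i\<close> and \<open>h\<^sub>i\<close> only on the parameter sets.\<close>

definition local_functional :: "((real^'q \<Rightarrow> real) \<Rightarrow> (('q, 'r) param \<Rightarrow> real) \<Rightarrow> 'b::topological_space) \<Rightarrow> bool" where
  "local_functional \<Phi> \<longleftrightarrow> (\<lambda>x. \<Phi> (fst (snd x)) (snd (snd x))) \<in> borel_measurable (model_space \<Theta>1 \<Theta>2) \<and>
     (\<forall>m m' g g'. (\<forall>s\<in>ball \<theta> (2 * k0). m (fst s) = m' (fst s)) \<longrightarrow> (\<forall>s\<in>ball \<theta> (2 * k0). g s = g' s) \<longrightarrow> \<Phi> m g = \<Phi> m' g')"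

lemma local_functional_eq:
  assumes "local_functional \<Phi>"
  shows "\<Phi> (mp i \<omega>) (hp i \<omega>) = \<Phi> (fst (snd (model_process \<Theta>1 \<Theta>2 y \<mu> h i \<omega>))) (snd (snd (model_process \<Theta>1 \<Theta>2 y \<mu> h i \<omega>)))"
  using assms unfolding local_functional_def by (auto simp: model_coord)

lemma local_functional_measurable:
  assumes "local_functional \<Phi>"
  shows "(\<lambda>\<omega>. \<Phi> (mp i \<omega>) (hp i \<omega>)) \<in> borel_measurable M"
  unfolding local_functional_eq[OF assms]
  by (rule measurable_compose[OF X_measurable]) (use assms in \<open>simp add: local_functional_def\<close>)

lemma local_functional_identical:
  fixes \<Phi> :: "(real^'q \<Rightarrow> real) \<Rightarrow> (('q, 'r) param \<Rightarrow> real) \<Rightarrow> real" and \<phi> :: "real \<Rightarrow> ennreal"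
  assumes \<Phi>: "local_functional \<Phi>" and \<phi>: "\<phi> \<in> borel_measurable borel"
  shows "(\<integral>\<^sup>+\<omega>. \<phi> (\<Phi> (mp i \<omega>) (hp i \<omega>)) \<partial>M) = (\<integral>\<^sup>+\<omega>. \<phi> (\<Phi> (mp 1 \<omega>) (hp 1 \<omega>)) \<partial>M)"
proof -
  let ?g = "\<lambda>x. \<phi> (\<Phi> (fst (snd x)) (snd (snd x)))"
  have gm: "?g \<in> borel_measurable (model_space \<Theta>1 \<Theta>2)"
    using \<Phi> \<phi> unfolding local_functional_def by (auto intro: measurable_compose)
  have "(\<integral>\<^sup>+\<omega>. \<phi> (\<Phi> (mp i \<omega>) (hp i \<omega>)) \<partial>M) = (\<integral>\<^sup>+x. ?g x \<partial>distr M (model_space \<Theta>1 \<Theta>2) (model_process \<Theta>1 \<Theta>2 y \<mu> h i))" for i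
    unfolding local_functional_eq[OF \<Phi>] by (rule nn_integral_distr[symmetric, OF X_measurable]) (use gm in simp)
  then show ?thesis by (simp only: X_identical[of i])
qed

lemma local_functional_null:
  fixes \<Phi> :: "(real^'q \<Rightarrow> real) \<Rightarrow> (('q, 'r) param \<Rightarrow> real) \<Rightarrow> real"
  assumes \<Phi>: "local_functional \<Phi>" and fin: "(\<integral>\<^sup>+\<omega>. ennreal ((\<Phi> (mp 1 \<omega>) (hp 1 \<omega>))\<^sup>2) \<partial>M) < \<infinity>"
  shows "null_array M (\<lambda>n i \<omega>. \<Phi> (mn i \<omega>) (hn i \<omega>) / sqrt (real n))"
    and "\<And>\<zeta> B. 0 < B \<Longrightarrow> (\<integral>\<^sup>+\<omega>. ennreal ((\<Phi> (mp 1 \<omega>) (hp 1 \<omega>))\<^sup>2) \<partial>M) \<le> ennreal (\<zeta> * B) \<Longrightarrow>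
      whp M \<zeta> (\<lambda>n \<omega>. (\<Sum>i<n. (\<Phi> (mn i \<omega>) (hn i \<omega>) / sqrt (real n))\<^sup>2) \<le> B)"
proof -
  let ?Y = "\<lambda>i::nat. \<lambda>\<omega>. \<Phi> (mn i \<omega>) (hn i \<omega>)"
  have id: "(\<integral>\<^sup>+\<omega>. \<phi> (?Y i \<omega>) \<partial>M) = (\<integral>\<^sup>+\<omega>. \<phi> (?Y 0 \<omega>) \<partial>M)" if "\<phi> \<in> borel_measurable borel" for i and \<phi> :: "real \<Rightarrow> ennreal"
    using local_functional_identical[OF \<Phi> that, of "int i + 1"] by simp
  have m: "?Y i \<in> borel_measurable M" for i by (rule local_functional_measurable[OF \<Phi>])
  have fin': "(\<integral>\<^sup>+\<omega>. ennreal ((?Y 0 \<omega>)\<^sup>2) \<partial>M) < \<infinity>" using fin by simp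
  note na = null_array_identical[of M ?Y, OF M.prob_space_axioms m id fin']
  show "null_array M (\<lambda>n i \<omega>. \<Phi> (mn i \<omega>) (hn i \<omega>) / sqrt (real n))" by (rule na(1))
  show "whp M \<zeta> (\<lambda>n \<omega>. (\<Sum>i<n. (\<Phi> (mn i \<omega>) (hn i \<omega>) / sqrt (real n))\<^sup>2) \<le> B)"
    if "0 < B" "(\<integral>\<^sup>+\<omega>. ennreal ((\<Phi> (mp 1 \<omega>) (hp 1 \<omega>))\<^sup>2) \<partial>M) \<le> ennreal (\<zeta> * B)" for \<zeta> B
    by (rule na(2)) (use that in auto)
qed

definition \<kappa> :: "nat \<Rightarrow> real" where "\<kappa> j = k0 / real (j + 1)"

lemma \<kappa>: "0 < \<kappa> j" "\<kappa> j \<le> k0" "\<kappa> 0 = k0"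
  using k0(1) by (auto simp: \<kappa>_def field_simps)

lemma \<kappa>_tendsto_0: "\<kappa> \<longlonglongrightarrow> 0"
  unfolding \<kappa>_def[abs_def]
  by (rule real_tendsto_divide_at_top[where c=k0])
     (auto intro!: filterlim_tendsto_add_at_top[OF tendsto_const filterlim_real_sequentially])

definition frem :: "nat \<Rightarrow> (real^'q \<Rightarrow> real) \<Rightarrow> (('q, 'r) param \<Rightarrow> real) \<Rightarrow> real" where
  "frem j m g = enn2real (floc_rem (\<kappa> j) k0 \<theta> m g) + enn2real (fscl_rem (\<kappa> j) k0 \<theta> g)"

lemma local_functionalI:
  assumes "(\<lambda>x. \<Phi> (fst (snd x)) (snd (snd x))) \<in> borel_measurable (model_space \<Theta>1 \<Theta>2)"
    and "\<And>m m' g g'. (\<And>s. s \<in> ball \<theta> (2 * k0) \<Longrightarrow> m (fst s) = m' (fst s)) \<Longrightarrow>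
      (\<And>s. s \<in> ball \<theta> (2 * k0) \<Longrightarrow> g s = g' s) \<Longrightarrow> \<Phi> m g = \<Phi> m' g'"
  shows "local_functional \<Phi>"
  unfolding local_functional_def
proof (intro conjI allI impI)
  fix m m' :: "real^'q \<Rightarrow> real" and g g' :: "('q, 'r) param \<Rightarrow> real"
  assume "\<forall>s\<in>ball \<theta> (2 * k0). m (fst s) = m' (fst s)" "\<forall>s\<in>ball \<theta> (2 * k0). g s = g' s"
  then show "\<Phi> m g = \<Phi> m' g'" by (intro assms(2)) auto
qed (rule assms(1))

lemma local_functionals:
  "local_functional (\<lambda>m g. norm (floc_grad k0 \<theta> m g))"
  "local_functional (\<lambda>m g. norm (fscl_grad k0 \<theta> g))"
  "local_functional (\<lambda>m g. enn2real (floc_rem (\<kappa> j) k0 \<theta> m g))"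
  "local_functional (\<lambda>m g. enn2real (fscl_rem (\<kappa> j) k0 \<theta> g))"
  "local_functional (\<lambda>m g. fwt k0 g \<theta> $ c)"
  "local_functional (\<lambda>m g. sqrt (enn2real (fwt_lip k0 \<theta> g)))"
  "local_functional (\<lambda>m g. fwt_lip k0 \<theta> g)"
proof -
  let ?N = "model_space \<Theta>1 \<Theta>2"
  have th: "\<theta> \<in> ball \<theta> k0" using k0 by simp
  note fm = functionals_measurable[where \<theta>=\<theta> and mm="\<lambda>x. fst (snd x)" and gg="\<lambda>x. snd (snd x)" and N="?N", OF k0(1) comp_measurable]
  note fc = functionals_cong[OF k0(1), of \<theta>]
  have [measurable]: "(\<lambda>x. floc_grad k0 \<theta> (fst (snd x)) (snd (snd x))) \<in> borel_measurable ?N" by (rule fm(1))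
  have [measurable]: "(\<lambda>x. fscl_grad k0 \<theta> (snd (snd x))) \<in> borel_measurable ?N" by (rule fm(2))
  have [measurable]: "(\<lambda>x. floc_rem (\<kappa> j) k0 \<theta> (fst (snd x)) (snd (snd x))) \<in> borel_measurable ?N"
    by (rule fm(3)) (use \<kappa>(1,2)[of j] in auto)
  have [measurable]: "(\<lambda>x. fscl_rem (\<kappa> j) k0 \<theta> (snd (snd x))) \<in> borel_measurable ?N"
    by (rule fm(4)) (use \<kappa>(1,2)[of j] in auto)
  have fw1: "(\<lambda>x. fwt k0 (snd (snd x)) \<theta>) \<in> borel_measurable ?N"
    by (rule fm(6)) (use th in auto)
  have [measurable]: "(\<lambda>x. fwt k0 (snd (snd x)) \<theta> $ c) \<in> borel_measurable ?N"
    by (rule measurable_compose[OF fw1]) simp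
  have [measurable]: "(\<lambda>x. fwt_lip k0 \<theta> (snd (snd x))) \<in> borel_measurable ?N" by (rule fm(7))
  show "local_functional (\<lambda>m g. norm (floc_grad k0 \<theta> m g))"
    by (rule local_functionalI, measurable) (rule arg_cong[where f="norm"], rule fc(1))
  show "local_functional (\<lambda>m g. norm (fscl_grad k0 \<theta> g))"
    by (rule local_functionalI, measurable) (rule arg_cong[where f="norm"], rule fc(2))
  show "local_functional (\<lambda>m g. enn2real (floc_rem (\<kappa> j) k0 \<theta> m g))"
    by (rule local_functionalI, measurable) (rule arg_cong[where f="enn2real"], rule fc(3)[OF _ _ \<kappa>(1,2)])
  show "local_functional (\<lambda>m g. enn2real (fscl_rem (\<kappa> j) k0 \<theta> g))"
    by (rule local_functionalI, measurable) (rule arg_cong[where f="enn2real"], rule fc(4)[OF _ _ \<kappa>(1,2)])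
  show "local_functional (\<lambda>m g. fwt k0 g \<theta> $ c)"
    by (rule local_functionalI, measurable) (rule arg_cong[where f="\<lambda>z. z $ c"], rule fc(5)[OF _ _ th])
  show "local_functional (\<lambda>m g. fwt_lip k0 \<theta> g)"
    by (rule local_functionalI, measurable) (rule fc(6))
  show "local_functional (\<lambda>m g. sqrt (enn2real (fwt_lip k0 \<theta> g)))"
    by (rule local_functionalI, measurable) (rule arg_cong[where f="\<lambda>z. sqrt (enn2real z)"], rule fc(6))
qed

lemma local_functional_frem: "local_functional (frem j)"
proof (rule local_functionalI)
  note l = local_functionals(3,4)[of j, unfolded local_functional_def]
  show "(\<lambda>x. frem j (fst (snd x)) (snd (snd x))) \<in> borel_measurable (model_space \<Theta>1 \<Theta>2)"
    unfolding frem_def by (rule borel_measurable_add[OF conjunct1[OF l(1)] conjunct1[OF l(2)]])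
  fix m m' :: "real^'q \<Rightarrow> real" and g g' :: "('q, 'r) param \<Rightarrow> real"
  assume e: "\<And>s. s \<in> ball \<theta> (2 * k0) \<Longrightarrow> m (fst s) = m' (fst s)" "\<And>s. s \<in> ball \<theta> (2 * k0) \<Longrightarrow> g s = g' s"
  show "frem j m g = frem j m' g'"
    unfolding frem_def
    by (rule arg_cong2[where f="(+)"])
      (rule l(1)[THEN conjunct2, rule_format, of m m' g g'] l(2)[THEN conjunct2, rule_format, of m m' g g'];
       use e in blast)+
qed

text \<open>The suprema in the moment conditions may be infinite or not measurable; a bound for \<open>R\<close> in terms of a
  finite value of the supremum yields an inequality between extended numbers in either case.\<close>

lemma sup_bound:
  fixes S R :: ennreal
  assumes "\<And>B. 0 \<le> B \<Longrightarrow> S = ennreal (B\<^sup>2) \<Longrightarrow> R \<le> ennreal (2 * B)"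
  shows "ennreal ((enn2real R)\<^sup>2 / 4) \<le> S"
proof (cases "S = top")
  case False
  define B where "B = sqrt (enn2real S)"
  have SB: "S = ennreal (B\<^sup>2)" using False by (simp add: B_def less_top)
  have B0: "0 \<le> B" by (simp add: B_def)
  have "enn2real R \<le> 2 * B" using enn2real_mono[OF assms[OF B0 SB]] B0 by simp
  then have "(enn2real R)\<^sup>2 \<le> (2 * B)\<^sup>2" by (intro power_mono) auto
  then show ?thesis unfolding SB by (intro ennreal_leI) (simp add: power_mult_distrib)
qed simp

lemma sup_real_bound:
  assumes "(SUP s\<in>U. ennreal (\<phi> s)) = ennreal B" "0 \<le> B" "s \<in> U"
  shows "\<phi> s \<le> B"
proof -
  have "ennreal (\<phi> s) \<le> ennreal B" using assms(1,3) by (metis SUP_upper)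
  then show ?thesis using assms(2) by (simp add: ennreal_le_iff)
qed

lemma rem_moments:
  assumes \<omega>: "\<omega> \<in> space M"
  shows "ennreal ((enn2real (floc_rem (\<kappa> j) k0 \<theta> (mp 1 \<omega>) (hp 1 \<omega>)))\<^sup>2 / 4) \<le> V1 \<omega>"
    and "ennreal ((enn2real (fscl_rem (\<kappa> j) k0 \<theta> (hp 1 \<omega>)))\<^sup>2 / 4) \<le> V2 \<omega>"
    and "ennreal ((norm (floc_grad k0 \<theta> (mp 1 \<omega>) (hp 1 \<omega>)))\<^sup>2) \<le> V1 \<omega>"
    and "ennreal ((norm (fscl_grad k0 \<theta> (hp 1 \<omega>)))\<^sup>2) \<le> V2 \<omega>"
    and "ennreal ((fwt k0 (hp 1 \<omega>) \<theta> $ c)\<^sup>2) \<le> V4 \<omega>"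
proof -
  interpret smooth_point \<theta> k0 "mp 1 \<omega>" "hp 1 \<omega>" "interior \<Theta>1" "interior (\<Theta>1 \<times> \<Theta>2)" by (rule smooth[OF \<omega>])
  have thk: "\<theta> \<in> ball \<theta> k0" using k0 by simp
  have tU: "\<theta> \<in> U" by (rule ball_U[OF thk])
  have lA2: "(norm (lA s))\<^sup>2 = (norm (mu_dot_ext \<mu> 1 s \<omega>))\<^sup>2 / h 1 \<theta> \<omega>" for s
    using th(2) by (simp add: lA_def mu_dot_ext_def mu_dot_def power_divide)
  have sA2: "(norm (sA s))\<^sup>2 \<le> (norm (h_dot h 1 s \<omega>))\<^sup>2 / (h 1 s \<omega> * h 1 \<theta> \<omega>)" if "s \<in> ball \<theta> k0" for s
  proof -
    have p: "0 < h 1 s \<omega>" using that by (intro g_pos in_ball2'[OF _ order_refl])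
    have "(norm (sA s))\<^sup>2 = (norm (h_dot h 1 s \<omega>))\<^sup>2 / (4 * (h 1 s \<omega> * h 1 \<theta> \<omega>))"
      using p th(2) by (simp add: sA_def h_dot_def power_divide power_mult_distrib)
    also have "\<dots> \<le> (norm (h_dot h 1 s \<omega>))\<^sup>2 / (h 1 s \<omega> * h 1 \<theta> \<omega>)"
      using p th(2) by (intro divide_left_mono) auto
    finally show ?thesis .
  qed
  show "ennreal ((enn2real (floc_rem (\<kappa> j) k0 \<theta> (mp 1 \<omega>) (hp 1 \<omega>)))\<^sup>2 / 4) \<le> V1 \<omega>"
  proof (rule sup_bound, rule rem1_le[OF \<kappa>(1,2)])
    fix B s assume B: "0 \<le> B" "V1 \<omega> = ennreal (B\<^sup>2)" and s: "s \<in> ball \<theta> k0"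
    have "(norm (lA s))\<^sup>2 \<le> B\<^sup>2" unfolding lA2 by (rule sup_real_bound[OF B(2) _ ball_U[OF s]]) simp
    then show "norm (lA s) \<le> B" using B(1) by (rule power2_le_imp_le)
  qed
  show "ennreal ((enn2real (fscl_rem (\<kappa> j) k0 \<theta> (hp 1 \<omega>)))\<^sup>2 / 4) \<le> V2 \<omega>"
  proof (rule sup_bound, rule rem2_le[OF \<kappa>(1,2)])
    fix B s assume B: "0 \<le> B" "V2 \<omega> = ennreal (B\<^sup>2)" and s: "s \<in> ball \<theta> k0"
    have "(norm (h_dot h 1 s \<omega>))\<^sup>2 / (h 1 s \<omega> * h 1 \<theta> \<omega>) \<le> B\<^sup>2" by (rule sup_real_bound[OF B(2) _ ball_U[OF s]]) simp
    then have "(norm (sA s))\<^sup>2 \<le> B\<^sup>2" using sA2[OF s] by linarith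
    then show "norm (sA s) \<le> B" using B(1) by (rule power2_le_imp_le)
  qed
  show "ennreal ((norm (floc_grad k0 \<theta> (mp 1 \<omega>) (hp 1 \<omega>)))\<^sup>2) \<le> V1 \<omega>"
    unfolding alpha_eq lA2 by (rule SUP_upper[OF tU])
  have "ennreal ((norm (fscl_grad k0 \<theta> (hp 1 \<omega>)))\<^sup>2) \<le> ennreal ((norm (h_dot h 1 \<theta> \<omega>))\<^sup>2 / (h 1 \<theta> \<omega> * h 1 \<theta> \<omega>))"
    unfolding beta_eq by (rule ennreal_leI[OF sA2[OF thk]])
  also have "\<dots> \<le> V2 \<omega>" by (rule SUP_upper[OF tU])
  finally show "ennreal ((norm (fscl_grad k0 \<theta> (hp 1 \<omega>)))\<^sup>2) \<le> V2 \<omega>" .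
  have sn: "norm (snd v) \<le> norm v" for v :: "('q, 'r) param"
    by (metis norm_snd_le prod.collapse)
  have "\<bar>fwt k0 (hp 1 \<omega>) \<theta> $ c\<bar> \<le> norm (fwt k0 (hp 1 \<omega>) \<theta>)" by (rule component_le_norm_cart)
  also have "\<dots> \<le> norm (h_dot h 1 \<theta> \<omega>) / h 1 \<theta> \<omega>"
    unfolding fwt_eq[OF th(1)] h_dot_def using th(2) sn by (simp add: divide_right_mono)
  finally have "\<bar>fwt k0 (hp 1 \<omega>) \<theta> $ c\<bar>\<^sup>2 \<le> (norm (h_dot h 1 \<theta> \<omega>) / h 1 \<theta> \<omega>)\<^sup>2" by (rule power_mono) simp
  then have "ennreal ((fwt k0 (hp 1 \<omega>) \<theta> $ c)\<^sup>2) \<le> ennreal ((norm (h_dot h 1 \<theta> \<omega>))\<^sup>2 / (h 1 \<theta> \<omega>)\<^sup>2)"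
    by (intro ennreal_leI) (simp add: power_divide)
  also have "\<dots> \<le> V4 \<omega>" by (rule SUP_upper[OF tU])
  finally show "ennreal ((fwt k0 (hp 1 \<omega>) \<theta> $ c)\<^sup>2) \<le> V4 \<omega>" .
qed

lemma finite_moments:
  "(\<integral>\<^sup>+\<omega>. ennreal ((norm (floc_grad k0 \<theta> (mp 1 \<omega>) (hp 1 \<omega>)))\<^sup>2) \<partial>M) < \<infinity>"
  "(\<integral>\<^sup>+\<omega>. ennreal ((norm (fscl_grad k0 \<theta> (hp 1 \<omega>)))\<^sup>2) \<partial>M) < \<infinity>"
  "(\<integral>\<^sup>+\<omega>. ennreal ((fwt k0 (hp 1 \<omega>) \<theta> $ c)\<^sup>2) \<partial>M) < \<infinity>"
  by (rule le_less_trans[OF nn_integral_mono[OF rem_moments(3)] v1], assumption)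
    (rule le_less_trans[OF nn_integral_mono[OF rem_moments(4)] v2], assumption,
     rule le_less_trans[OF nn_integral_mono[OF rem_moments(5)] v4], assumption)

lemma frem_nonneg: "0 \<le> frem j m g" by (simp add: frem_def)

lemma frem_mono:
  assumes "\<omega> \<in> space M"
  shows "frem j (mp i \<omega>) (hp i \<omega>) \<le> frem 0 (mp i \<omega>) (hp i \<omega>)"
proof -
  interpret smooth_point \<theta> k0 "mp i \<omega>" "hp i \<omega>" "interior \<Theta>1" "interior (\<Theta>1 \<times> \<Theta>2)" by (rule smooth[OF assms])
  have "floc_rem (\<kappa> j) k0 \<theta> (mp i \<omega>) (hp i \<omega>) \<le> floc_rem (\<kappa> 0) k0 \<theta> (mp i \<omega>) (hp i \<omega>)"
    "fscl_rem (\<kappa> j) k0 \<theta> (hp i \<omega>) \<le> fscl_rem (\<kappa> 0) k0 \<theta> (hp i \<omega>)"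
    unfolding floc_rem_def fscl_rem_def by (rule Rem_mono; simp add: \<kappa>)+
  then show ?thesis unfolding frem_def
    using finite_functionals(1,2)[OF \<kappa>(1,2)[of 0]] by (intro add_mono enn2real_mono) auto
qed

lemma frem_moment: "(\<integral>\<^sup>+\<omega>. ennreal ((frem j (mp 1 \<omega>) (hp 1 \<omega>))\<^sup>2) \<partial>M) < \<infinity>"
proof -
  let ?R1 = "\<lambda>\<omega>. enn2real (floc_rem (\<kappa> j) k0 \<theta> (mp 1 \<omega>) (hp 1 \<omega>))"
  let ?R2 = "\<lambda>\<omega>. enn2real (fscl_rem (\<kappa> j) k0 \<theta> (hp 1 \<omega>))"
  note [measurable] = local_functional_measurable[OF local_functionals(3)[of j], of 1] local_functional_measurable[OF local_functionals(4)[of j], of 1]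
  have 1: "(\<integral>\<^sup>+\<omega>. ennreal ((?R1 \<omega>)\<^sup>2 / 4) \<partial>M) < \<infinity>"
    by (rule le_less_trans[OF nn_integral_mono[OF rem_moments(1)] v1])
  have 2: "(\<integral>\<^sup>+\<omega>. ennreal ((?R2 \<omega>)\<^sup>2 / 4) \<partial>M) < \<infinity>"
    by (rule le_less_trans[OF nn_integral_mono[OF rem_moments(2)] v2])
  have "(\<integral>\<^sup>+\<omega>. ennreal ((frem j (mp 1 \<omega>) (hp 1 \<omega>))\<^sup>2) \<partial>M) \<le> (\<integral>\<^sup>+\<omega>. 8 * (ennreal ((?R1 \<omega>)\<^sup>2 / 4) + ennreal ((?R2 \<omega>)\<^sup>2 / 4)) \<partial>M)"
  proof (rule nn_integral_mono)
    fix \<omega>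
    have "0 \<le> (?R1 \<omega> - ?R2 \<omega>)\<^sup>2" by simp
    then have "(frem j (mp 1 \<omega>) (hp 1 \<omega>))\<^sup>2 \<le> 8 * ((?R1 \<omega>)\<^sup>2 / 4 + (?R2 \<omega>)\<^sup>2 / 4)"
      by (simp add: frem_def power2_diff power2_sum)
    then have "ennreal ((frem j (mp 1 \<omega>) (hp 1 \<omega>))\<^sup>2) \<le> ennreal (8 * ((?R1 \<omega>)\<^sup>2 / 4 + (?R2 \<omega>)\<^sup>2 / 4))" by (rule ennreal_leI)
    also have "\<dots> = 8 * (ennreal ((?R1 \<omega>)\<^sup>2 / 4) + ennreal ((?R2 \<omega>)\<^sup>2 / 4))"
      by (subst ennreal_mult) (simp_all add: ennreal_plus)
    finally show "ennreal ((frem j (mp 1 \<omega>) (hp 1 \<omega>))\<^sup>2) \<le> 8 * (ennreal ((?R1 \<omega>)\<^sup>2 / 4) + ennreal ((?R2 \<omega>)\<^sup>2 / 4))" .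
  qed
  also have "\<dots> = 8 * ((\<integral>\<^sup>+\<omega>. ennreal ((?R1 \<omega>)\<^sup>2 / 4) \<partial>M) + (\<integral>\<^sup>+\<omega>. ennreal ((?R2 \<omega>)\<^sup>2 / 4) \<partial>M))"
    by (subst nn_integral_cmult, measurable, subst nn_integral_add) auto
  also have "\<dots> < \<infinity>" using 1 2 by (simp add: ennreal_mult_less_top)
  finally show ?thesis .
qed

text \<open>At every outcome the remainder tends to 0 by differentiability at \<open>\<theta>\<close>, and it decreases with the radius.\<close>

lemma frem_moment_tendsto_0: "(\<lambda>j. \<integral>\<^sup>+\<omega>. ennreal ((frem j (mp 1 \<omega>) (hp 1 \<omega>))\<^sup>2) \<partial>M) \<longlonglongrightarrow> 0"
proof -
  note [measurable] = local_functional_measurable[OF local_functional_frem, of _ 1]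
  have "(\<lambda>j. \<integral>\<^sup>+\<omega>. ennreal ((frem j (mp 1 \<omega>) (hp 1 \<omega>))\<^sup>2) \<partial>M) \<longlonglongrightarrow> (\<integral>\<^sup>+\<omega>. 0 \<partial>M)"
  proof (rule nn_integral_dominated_convergence[where w="\<lambda>\<omega>. ennreal ((frem 0 (mp 1 \<omega>) (hp 1 \<omega>))\<^sup>2)"])
    show "AE \<omega> in M. ennreal ((frem j (mp 1 \<omega>) (hp 1 \<omega>))\<^sup>2) \<le> ennreal ((frem 0 (mp 1 \<omega>) (hp 1 \<omega>))\<^sup>2)" for j
      by (rule AE_I2) (intro ennreal_leI power_mono frem_mono frem_nonneg)
    show "AE \<omega> in M. (\<lambda>j. ennreal ((frem j (mp 1 \<omega>) (hp 1 \<omega>))\<^sup>2)) \<longlonglongrightarrow> 0"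
    proof (rule AE_I2)
      fix \<omega> assume "\<omega> \<in> space M"
      then interpret smooth_point \<theta> k0 "mp 1 \<omega>" "hp 1 \<omega>" "interior \<Theta>1" "interior (\<Theta>1 \<times> \<Theta>2)" by (rule smooth)
      have "(\<lambda>j. enn2real (floc_rem (\<kappa> j) k0 \<theta> (mp 1 \<omega>) (hp 1 \<omega>))) \<longlonglongrightarrow> 0"
        "(\<lambda>j. enn2real (fscl_rem (\<kappa> j) k0 \<theta> (hp 1 \<omega>))) \<longlonglongrightarrow> 0"
        using rem_tendsto_0[OF \<kappa>_tendsto_0] by (auto intro!: tendsto_enn2real)
      then have "(\<lambda>j. frem j (mp 1 \<omega>) (hp 1 \<omega>)) \<longlonglongrightarrow> 0 + 0"
        unfolding frem_def by (rule tendsto_add)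
      then have "(\<lambda>j. ennreal ((frem j (mp 1 \<omega>) (hp 1 \<omega>))\<^sup>2)) \<longlonglongrightarrow> ennreal ((0 + 0)\<^sup>2)"
        by (intro tendsto_ennrealI tendsto_power)
      then show "(\<lambda>j. ennreal ((frem j (mp 1 \<omega>) (hp 1 \<omega>))\<^sup>2)) \<longlonglongrightarrow> 0" by simp
    qed
  qed (use frem_moment in auto)
  then show ?thesis by simp
qed

text \<open>The Lipschitz constant is at most the sum of the two suprema. Integrating a sum requires measurability of one
  summand, which the supremum \<open>S4\<close> has once it is taken over the dense set; so the Lipschitz constant is split
  into the part below \<open>S4\<close> and the excess, which is at most \<open>S3\<close>.\<close>

lemma fwt_lip_moment: "(\<integral>\<^sup>+\<omega>. ennreal ((sqrt (enn2real (fwt_lip k0 \<theta> (hp 1 \<omega>))))\<^sup>2) \<partial>M) < \<infinity>"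
proof -
  define S3 where "S3 \<omega> = (SUP s\<in>U. ennreal (hessian_norm (\<lambda>u. h 1 u \<omega>) s / h 1 s \<omega>))" for \<omega>
  define S4 where "S4 \<omega> = (SUP s\<in>cdense \<inter> ball \<theta> k0. ennreal ((norm (qgrad k0 (hp 1 \<omega>) s))\<^sup>2 / (h 1 s \<omega>)\<^sup>2))" for \<omega>
  have hm: "s \<in> ball \<theta> (2 * k0) \<Longrightarrow> (\<lambda>\<omega>. h 1 s \<omega>) \<in> borel_measurable M" for s by (rule mh_measurable)
  have mm: "s \<in> ball \<theta> (2 * k0) \<Longrightarrow> (\<lambda>\<omega>. \<mu> 1 (fst s) \<omega>) \<in> borel_measurable M" for s by (rule mh_measurable)
  have [measurable]: "S4 \<in> borel_measurable M"
    unfolding S4_def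
  proof (rule borel_measurable_SUP)
    show "countable (cdense \<inter> ball \<theta> k0)" using cdense(1) by (auto intro: countable_subset)
    fix s assume "s \<in> cdense \<inter> ball \<theta> k0"
    then have s: "s \<in> ball \<theta> k0" by auto
    have [measurable]: "(\<lambda>\<omega>. qgrad k0 (hp 1 \<omega>) s) \<in> borel_measurable M"
      by (rule functionals_measurable(5)[where mm="\<lambda>\<omega>. mp 1 \<omega>" and \<theta>=\<theta>, OF k0(1) mm hm s])
    have [measurable]: "(\<lambda>\<omega>. h 1 s \<omega>) \<in> borel_measurable M" using s k0 by (intro hm) auto
    show "(\<lambda>\<omega>. ennreal ((norm (qgrad k0 (hp 1 \<omega>) s))\<^sup>2 / (h 1 s \<omega>)\<^sup>2)) \<in> borel_measurable M" by measurable
  qed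
  have [measurable]: "(\<lambda>\<omega>. fwt_lip k0 \<theta> (hp 1 \<omega>)) \<in> borel_measurable M"
    using local_functional_measurable[OF local_functionals(7), of 1] .
  have S4V: "S4 \<omega> \<le> V4 \<omega>"
    and fl: "fwt_lip k0 \<theta> (hp 1 \<omega>) \<le> S3 \<omega> + S4 \<omega>" and fin: "fwt_lip k0 \<theta> (hp 1 \<omega>) < \<infinity>" if \<omega>: "\<omega> \<in> space M" for \<omega>
  proof -
    interpret smooth_point \<theta> k0 "mp 1 \<omega>" "hp 1 \<omega>" "interior \<Theta>1" "interior (\<Theta>1 \<times> \<Theta>2)" by (rule smooth[OF \<omega>])
    have qg: "qgrad k0 (hp 1 \<omega>) s = grad (hp 1 \<omega>) s" if "s \<in> ball \<theta> k0" for s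
      using g_deriv[OF in_ball2'[OF that order_refl]] by (intro qgrad_eq_grad[OF k0]) (auto simp: differentiable_def)
    show "S4 \<omega> \<le> V4 \<omega>"
      unfolding S4_def
    proof (rule SUP_mono)
      fix s assume s: "s \<in> cdense \<inter> ball \<theta> k0"
      then show "\<exists>s'\<in>U. ennreal ((norm (qgrad k0 (hp 1 \<omega>) s))\<^sup>2 / (h 1 s \<omega>)\<^sup>2) \<le> ennreal ((norm (h_dot h 1 s' \<omega>))\<^sup>2 / (h 1 s' \<omega>)\<^sup>2)"
        using ball_U[of s] qg[of s] by (intro bexI[of _ s]) (auto simp: h_dot_def)
    qed
    show "fwt_lip k0 \<theta> (hp 1 \<omega>) < \<infinity>" by (rule finite_functionals(3)[OF k0 order_refl])
    show "fwt_lip k0 \<theta> (hp 1 \<omega>) \<le> S3 \<omega> + S4 \<omega>"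
    proof (cases "S3 \<omega> = top \<or> S4 \<omega> = top")
      case True
      then show ?thesis by auto
    next
      case False
      define a where "a = enn2real (S3 \<omega>)"
      define b where "b = enn2real (S4 \<omega>)"
      have ab: "S3 \<omega> = ennreal a" "S4 \<omega> = ennreal b" "0 \<le> a" "0 \<le> b"
        using False by (auto simp: a_def b_def less_top)
      have "fwt_lip k0 \<theta> (hp 1 \<omega>) \<le> ennreal (a + b)"
      proof (rule fwt_lip_le, rule add_mono)
        fix s assume s: "s \<in> ball \<theta> k0"
        show "hessian_norm (hp 1 \<omega>) s / h 1 s \<omega> \<le> a"
          by (rule sup_real_bound[OF _ ab(3) ball_U[OF s]]) (use ab(1) in \<open>simp add: S3_def\<close>)
        have "(norm (grad (hp 1 \<omega>) s))\<^sup>2 / (h 1 s \<omega>)\<^sup>2 - b \<le> 0"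
        proof (rule dense_nonpos[where S="ball \<theta> k0" and s=s and \<phi>="\<lambda>s. (norm (grad (hp 1 \<omega>) s))\<^sup>2 / (h 1 s \<omega>)\<^sup>2 - b"])
          have "continuous_on (ball \<theta> k0) (\<lambda>s. (norm (grad (hp 1 \<omega>) s))\<^sup>2 / (h 1 s \<omega>)\<^sup>2)"
            by (rule continuous_on_subset[OF cont_sq]) (use in_ball2' in auto)
          then show "continuous_on (ball \<theta> k0) (\<lambda>s. (norm (grad (hp 1 \<omega>) s))\<^sup>2 / (h 1 s \<omega>)\<^sup>2 - b)"
            by (intro continuous_on_diff continuous_on_const)
          fix r assume r: "r \<in> ball \<theta> k0" "r \<in> cdense"
          have "ennreal ((norm (qgrad k0 (hp 1 \<omega>) r))\<^sup>2 / (h 1 r \<omega>)\<^sup>2) \<le> S4 \<omega>"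
            unfolding S4_def using r by (intro SUP_upper) auto
          then show "(norm (grad (hp 1 \<omega>) r))\<^sup>2 / (h 1 r \<omega>)\<^sup>2 - b \<le> 0"
            using ab(2,4) qg[OF r(1)] by (simp add: ennreal_le_iff)
        qed (use s in auto)
        then show "(norm (grad (hp 1 \<omega>) s))\<^sup>2 / (h 1 s \<omega>)\<^sup>2 \<le> b" by simp
      qed
      then show ?thesis using ab by (simp add: ennreal_plus)
    qed
  qed
  have "(\<integral>\<^sup>+\<omega>. ennreal ((sqrt (enn2real (fwt_lip k0 \<theta> (hp 1 \<omega>))))\<^sup>2) \<partial>M) \<le> (\<integral>\<^sup>+\<omega>. (fwt_lip k0 \<theta> (hp 1 \<omega>) - S4 \<omega>) + S4 \<omega> \<partial>M)"
  proof (rule nn_integral_mono)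
    fix \<omega> assume \<omega>: "\<omega> \<in> space M"
    have "ennreal ((sqrt (enn2real (fwt_lip k0 \<theta> (hp 1 \<omega>))))\<^sup>2) = fwt_lip k0 \<theta> (hp 1 \<omega>)"
      using fin[OF \<omega>] by simp
    also have "\<dots> \<le> (fwt_lip k0 \<theta> (hp 1 \<omega>) - S4 \<omega>) + S4 \<omega>"
      by (cases "S4 \<omega> \<le> fwt_lip k0 \<theta> (hp 1 \<omega>)") (auto simp: diff_add_cancel_ennreal intro: order_trans add_increasing)
    finally show "ennreal ((sqrt (enn2real (fwt_lip k0 \<theta> (hp 1 \<omega>))))\<^sup>2) \<le> (fwt_lip k0 \<theta> (hp 1 \<omega>) - S4 \<omega>) + S4 \<omega>" .
  qed
  also have "\<dots> = (\<integral>\<^sup>+\<omega>. (fwt_lip k0 \<theta> (hp 1 \<omega>) - S4 \<omega>) \<partial>M) + (\<integral>\<^sup>+\<omega>. S4 \<omega> \<partial>M)"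
    by (rule nn_integral_add) measurable
  also have "\<dots> < \<infinity>"
  proof -
    have "(\<integral>\<^sup>+\<omega>. (fwt_lip k0 \<theta> (hp 1 \<omega>) - S4 \<omega>) \<partial>M) \<le> (\<integral>\<^sup>+\<omega>. S3 \<omega> \<partial>M)"
    proof (rule nn_integral_mono)
      fix \<omega> assume \<omega>: "\<omega> \<in> space M"
      show "fwt_lip k0 \<theta> (hp 1 \<omega>) - S4 \<omega> \<le> S3 \<omega>"
        using fl[OF \<omega>] fin[OF \<omega>] by (subst ennreal_minus_le_iff) (auto simp: add.commute)
    qed
    also have "\<dots> < \<infinity>" unfolding S3_def by (rule v3)
    finally have 1: "(\<integral>\<^sup>+\<omega>. (fwt_lip k0 \<theta> (hp 1 \<omega>) - S4 \<omega>) \<partial>M) < \<infinity>" .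
    have "(\<integral>\<^sup>+\<omega>. S4 \<omega> \<partial>M) < \<infinity>" by (rule le_less_trans[OF nn_integral_mono[OF S4V] v4])
    with 1 show ?thesis by simp
  qed
  finally show ?thesis .
qed

end

section \<open>The expansion of the residual process\<close>

context garch_model
begin

text \<open>Time \<open>i \<ge> 1\<close> of the model is index \<open>i - 1\<close> of the array, so that \<open>G i\<close> is the past of \<open>\<eta>\<^bsub>i+1\<^esub>\<close>.\<close>

lemma smooth_model:
  fixes \<eta> :: "int \<Rightarrow> 'a \<Rightarrow> real" and L :: "int set" and c :: 'r
  assumes inn: "innovations f C M (\<lambda>i. past_field M y \<eta> L (int i)) (\<lambda>i. \<eta> (int i + 1))"
    and past_mu: "\<And>i s\<^sub>1. 1 \<le> i \<Longrightarrow> s\<^sub>1 \<in> \<Theta>1 \<Longrightarrow> \<mu> i s\<^sub>1 \<in> borel_measurable (past_field M y \<eta> L (i - 1))"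
    and past_h: "\<And>i s. 1 \<le> i \<Longrightarrow> s \<in> \<Theta>1 \<times> \<Theta>2 \<Longrightarrow> h i s \<in> borel_measurable (past_field M y \<eta> L (i - 1))"
  shows "smooth_model f C M (\<lambda>i. past_field M y \<eta> L (int i)) (\<lambda>i. \<eta> (int i + 1)) \<theta> \<kappa>
      (\<lambda>i s \<omega>. floc \<theta> (mn i \<omega>) (hn i \<omega>) s) (\<lambda>i s \<omega>. fscl \<theta> (hn i \<omega>) s)
      (\<lambda>i s \<omega>. fwt k0 (hn i \<omega>) s $ c)
      (\<lambda>i \<omega>. floc_grad k0 \<theta> (mn i \<omega>) (hn i \<omega>)) (\<lambda>i \<omega>. fscl_grad k0 \<theta> (hn i \<omega>))
      (\<lambda>j i \<omega>. frem j (mn i \<omega>) (hn i \<omega>)) (\<lambda>i \<omega>. enn2real (fwt_lip k0 \<theta> (hn i \<omega>)))"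
proof -
  let ?G = "\<lambda>i. past_field M y \<eta> L (int i)"
  have gm: "(\<lambda>\<omega>. mn i \<omega> (fst s)) \<in> borel_measurable (?G i)"
    and gh: "(\<lambda>\<omega>. hn i \<omega> s) \<in> borel_measurable (?G i)" if "s \<in> ball \<theta> (2 * k0)" for s and i :: nat
    using past_mu[of "int i + 1" "fst s"] past_h[of "int i + 1" s] ball_param[OF that] by simp_all
  note fm = functionals_measurable[where \<theta>=\<theta> and mm="\<lambda>\<omega>. mn i \<omega>" and gg="\<lambda>\<omega>. hn i \<omega>" and N="?G i" for i :: nat,
      OF k0(1) gm gh]
  have sb: "s \<in> ball \<theta> k \<longleftrightarrow> norm (s - \<theta>) < k" for s k by (simp add: dist_norm norm_minus_commute)
  interpret innovations f C M ?G "\<lambda>i. \<eta> (int i + 1)" by (rule inn)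
  show ?thesis
  proof
    show "0 < \<kappa> m" for m by (rule \<kappa>(1))
    fix m i s and \<omega> :: 'a assume s: "norm (s - \<theta>) < \<kappa> m" and \<omega>: "\<omega> \<in> space M"
    interpret smooth_point \<theta> k0 "mn i \<omega>" "hn i \<omega>" "interior \<Theta>1" "interior (\<Theta>1 \<times> \<Theta>2)" by (rule smooth[OF \<omega>])
    have le: "enn2real (floc_rem (\<kappa> m) k0 \<theta> (mn i \<omega>) (hn i \<omega>)) * norm (s - \<theta>) \<le> frem m (mn i \<omega>) (hn i \<omega>) * norm (s - \<theta>)"
      "enn2real (fscl_rem (\<kappa> m) k0 \<theta> (hn i \<omega>)) * norm (s - \<theta>) \<le> frem m (mn i \<omega>) (hn i \<omega>) * norm (s - \<theta>)"
      by (simp_all add: frem_def mult_right_mono)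
    show "\<bar>floc \<theta> (mn i \<omega>) (hn i \<omega>) s - floc_grad k0 \<theta> (mn i \<omega>) (hn i \<omega>) \<bullet> (s - \<theta>)\<bar>
        \<le> frem m (mn i \<omega>) (hn i \<omega>) * norm (s - \<theta>)"
      by (rule order_trans[OF loc_expansion[OF \<kappa>(1,2)] le(1)]) (use s sb in blast)
    show "\<bar>fscl \<theta> (hn i \<omega>) s - 1 - fscl_grad k0 \<theta> (hn i \<omega>) \<bullet> (s - \<theta>)\<bar>
        \<le> frem m (mn i \<omega>) (hn i \<omega>) * norm (s - \<theta>)"
      by (rule order_trans[OF scl_expansion[OF \<kappa>(1,2)] le(2)]) (use s sb in blast)
  next
    fix i
    show "(\<lambda>\<omega>. floc_grad k0 \<theta> (mn i \<omega>) (hn i \<omega>)) \<in> borel_measurable (?G i)" by (rule fm(1))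
    show "(\<lambda>\<omega>. fscl_grad k0 \<theta> (hn i \<omega>)) \<in> borel_measurable (?G i)" by (rule fm(2))
    fix m
    have [measurable]: "(\<lambda>\<omega>. floc_rem (\<kappa> m) k0 \<theta> (mn i \<omega>) (hn i \<omega>)) \<in> borel_measurable (?G i)"
      by (rule fm(3)) (use \<kappa>(1,2)[of m] in auto)
    have [measurable]: "(\<lambda>\<omega>. fscl_rem (\<kappa> m) k0 \<theta> (hn i \<omega>)) \<in> borel_measurable (?G i)"
      by (rule fm(4)) (use \<kappa>(1,2)[of m] in auto)
    show "(\<lambda>\<omega>. frem m (mn i \<omega>) (hn i \<omega>)) \<in> borel_measurable (?G i)"
      unfolding frem_def by measurable
  next
    show "0 \<le> frem m (mn i \<omega>) (hn i \<omega>)" for m i \<omega> by (rule frem_nonneg)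
  next
    fix i s assume "norm (s - \<theta>) < \<kappa> 0"
    then have s: "s \<in> ball \<theta> k0" by (simp only: sb \<kappa>(3))
    have "(\<lambda>\<omega>. fwt k0 (hn i \<omega>) s) \<in> borel_measurable (?G i)" by (rule fm(6)) (use s in auto)
    then show "(\<lambda>\<omega>. fwt k0 (hn i \<omega>) s $ c) \<in> borel_measurable (?G i)"
      by (rule measurable_compose) simp
  next
    fix i s s' and \<omega> :: 'a assume s: "norm (s - \<theta>) < \<kappa> 0" "norm (s' - \<theta>) < \<kappa> 0" and \<omega>: "\<omega> \<in> space M"
    interpret smooth_point \<theta> k0 "mn i \<omega>" "hn i \<omega>" "interior \<Theta>1" "interior (\<Theta>1 \<times> \<Theta>2)" by (rule smooth[OF \<omega>])
    have "\<bar>(fwt k0 (hn i \<omega>) s - fwt k0 (hn i \<omega>) s') $ c\<bar> \<le> norm (fwt k0 (hn i \<omega>) s - fwt k0 (hn i \<omega>) s')"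
      by (rule component_le_norm_cart)
    also have "\<dots> \<le> enn2real (fwt_lip k0 \<theta> (hn i \<omega>)) * norm (s - s')"
      by (rule fwt_lipschitz) (use s in \<open>simp_all only: sb \<kappa>(3)\<close>)
    finally show "\<bar>fwt k0 (hn i \<omega>) s $ c - fwt k0 (hn i \<omega>) s' $ c\<bar> \<le> enn2real (fwt_lip k0 \<theta> (hn i \<omega>)) * norm (s - s')"
      by simp
  next
    show "0 \<le> enn2real (fwt_lip k0 \<theta> (hn i \<omega>))" for i \<omega> by simp
    show "null_array M (\<lambda>n i \<omega>. norm (floc_grad k0 \<theta> (mn i \<omega>) (hn i \<omega>)) / sqrt (real n))"
      by (rule local_functional_null(1)[OF local_functionals(1) finite_moments(1)])
    show "null_array M (\<lambda>n i \<omega>. norm (fscl_grad k0 \<theta> (hn i \<omega>)) / sqrt (real n))"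
      by (rule local_functional_null(1)[OF local_functionals(2) finite_moments(2)])
    show "null_array M (\<lambda>n i \<omega>. frem m (mn i \<omega>) (hn i \<omega>) / sqrt (real n))" for m
      by (rule local_functional_null(1)[OF local_functional_frem frem_moment])
    show "null_array M (\<lambda>n i \<omega>. fwt k0 (hn i \<omega>) \<theta> $ c / sqrt (real n))"
      by (rule local_functional_null(1)[OF local_functionals(5) finite_moments(3)])
    show "null_array M (\<lambda>n i \<omega>. sqrt (enn2real (fwt_lip k0 \<theta> (hn i \<omega>))) / sqrt (real n))"
      by (rule local_functional_null(1)[OF local_functionals(6) fwt_lip_moment])
  next
    fix \<zeta> \<tau> :: real assume z: "0 < \<zeta>" "0 < \<tau>"
    have "\<forall>\<^sub>F j in sequentially. (\<integral>\<^sup>+\<omega>. ennreal ((frem j (mp 1 \<omega>) (hp 1 \<omega>))\<^sup>2) \<partial>M) < ennreal (\<zeta> * \<tau>)"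
      using order_tendstoD(2)[OF frem_moment_tendsto_0, of "ennreal (\<zeta> * \<tau>)"] z by simp
    then obtain m where m: "(\<integral>\<^sup>+\<omega>. ennreal ((frem m (mp 1 \<omega>) (hp 1 \<omega>))\<^sup>2) \<partial>M) < ennreal (\<zeta> * \<tau>)"
      unfolding eventually_sequentially by blast
    show "\<exists>m. whp M \<zeta> (\<lambda>n \<omega>. (\<Sum>i<n. (frem m (mn i \<omega>) (hn i \<omega>) / sqrt (real n))\<^sup>2) \<le> \<tau>)"
      by (rule exI, rule local_functional_null(2)[OF local_functional_frem frem_moment z(2) less_imp_le[OF m]])
  qed
qed

text \<open>Insert \<open>y\<^sub>i = \<mu>\<^sub>i(\<theta>) + \<eta>\<^sub>i \<surd>h\<^sub>i(\<theta>)\<close> and divide by \<open>\<surd>h\<^sub>i(\<theta>)\<close>.\<close>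

lemma resid_le_iff:
  assumes \<omega>: "\<omega> \<in> space M" and s: "s \<in> \<Theta>1 \<times> \<Theta>2" "\<theta> \<in> \<Theta>1 \<times> \<Theta>2"
  shows "resid y \<mu> h i s \<omega> \<le> x \<longleftrightarrow> resid y \<mu> h i \<theta> \<omega> \<le> floc \<theta> (mp i \<omega>) (hp i \<omega>) s + x * fscl \<theta> (hp i \<omega>) s"
proof -
  have p: "0 < sqrt (h i s \<omega>)" "0 < sqrt (h i \<theta> \<omega>)" using h_pos[OF s(1) \<omega>] h_pos[OF s(2) \<omega>] by auto
  have "floc \<theta> (mp i \<omega>) (hp i \<omega>) s + x * fscl \<theta> (hp i \<omega>) s
      = (\<mu> i (fst s) \<omega> - \<mu> i (fst \<theta>) \<omega> + x * sqrt (h i s \<omega>)) / sqrt (h i \<theta> \<omega>)"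
    by (simp add: floc_def fscl_def real_sqrt_divide add_divide_distrib)
  moreover have "resid y \<mu> h i s \<omega> \<le> x \<longleftrightarrow> y i \<omega> - \<mu> i (fst s) \<omega> \<le> x * sqrt (h i s \<omega>)"
    using p(1) by (simp add: resid_def pos_divide_le_eq)
  ultimately show ?thesis using p(2) by (simp add: resid_def divide_le_cancel) linarith
qed

lemma sum_nat_index: "(\<Sum>i\<in>{1..int n}. g i) = (\<Sum>i<n. g (int i + 1))"
  by (rule sum.reindex_bij_witness[where i="\<lambda>i. int i + 1" and j="\<lambda>i. nat (i - 1)"]) auto

lemma K_process_component:
  fixes t :: "('q, 'r) param" and c :: 'r
  assumes \<omega>: "\<omega> \<in> space M" and s: "s \<in> ball \<theta> k0"
  shows "K_process y \<mu> h F\<^sub>0 n x s \<omega> $ c = (1/2) * (\<Sum>i<n. fwt k0 (hn i \<omega>) s $ c / sqrt (real n) *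
     (of_bool (resid y \<mu> h (int i + 1) \<theta> \<omega> \<le> floc \<theta> (mn i \<omega>) (hn i \<omega>) s + x * fscl \<theta> (hn i \<omega>) s) - F\<^sub>0 x))"
proof -
  have sT: "s \<in> \<Theta>1 \<times> \<Theta>2" "\<theta> \<in> \<Theta>1 \<times> \<Theta>2" using ball_U[OF s] ball_U[of \<theta>] U(2) k0(1) by auto
  have w: "W22 h i s \<omega> = fwt k0 (hp i \<omega>) s" for i
  proof -
    interpret smooth_point \<theta> k0 "mp i \<omega>" "hp i \<omega>" "interior \<Theta>1" "interior (\<Theta>1 \<times> \<Theta>2)" by (rule smooth[OF \<omega>])
    show ?thesis by (simp add: W22_def h_dot_def fwt_eq[OF in_ball2'[OF s order_refl]])
  qed
  show ?thesis
    unfolding K_process_def sum_nat_index w resid_le_iff[OF \<omega> sT]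
    by (simp add: sum_distrib_left mult_ac)
qed

lemma drift_component:
  fixes t :: "('q, 'r) param" and c :: 'r
  assumes \<omega>: "\<omega> \<in> space M"
  shows "((1 / 2) *\<^sub>R (1 / real n) *\<^sub>R
          (\<Sum>i\<in>{1..int n}.
             (((1 / sqrt (h i \<theta> \<omega>)) *\<^sub>R (a *\<^sub>R mu_dot_ext \<mu> i \<theta> \<omega>) +
               (x * a * (1 / 2) / h i \<theta> \<omega>) *\<^sub>R h_dot h i \<theta> \<omega>) \<bullet> t) *\<^sub>R W22 h i \<theta> \<omega>)) $ c
    = (1/2) * (\<Sum>i<n. fwt k0 (hn i \<omega>) \<theta> $ c / sqrt (real n) *
       ((floc_grad k0 \<theta> (mn i \<omega>) (hn i \<omega>) \<bullet> t + x * (fscl_grad k0 \<theta> (hn i \<omega>) \<bullet> t)) / sqrt (real n) * a))"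
proof -
  have e: "W22 h i \<theta> \<omega> = fwt k0 (hp i \<omega>) \<theta>" "floc_grad k0 \<theta> (mp i \<omega>) (hp i \<omega>) = (1 / sqrt (h i \<theta> \<omega>)) *\<^sub>R mu_dot_ext \<mu> i \<theta> \<omega>"
    "fscl_grad k0 \<theta> (hp i \<omega>) = (1 / (2 * h i \<theta> \<omega>)) *\<^sub>R h_dot h i \<theta> \<omega>" for i
  proof -
    interpret smooth_point \<theta> k0 "mp i \<omega>" "hp i \<omega>" "interior \<Theta>1" "interior (\<Theta>1 \<times> \<Theta>2)" by (rule smooth[OF \<omega>])
    show "W22 h i \<theta> \<omega> = fwt k0 (hp i \<omega>) \<theta>" by (simp add: W22_def h_dot_def fwt_eq[OF th(1)])
    show "floc_grad k0 \<theta> (mp i \<omega>) (hp i \<omega>) = (1 / sqrt (h i \<theta> \<omega>)) *\<^sub>R mu_dot_ext \<mu> i \<theta> \<omega>"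
      by (simp add: alpha_eq lA_def mu_dot_ext_def mu_dot_def)
    show "fscl_grad k0 \<theta> (hp i \<omega>) = (1 / (2 * h i \<theta> \<omega>)) *\<^sub>R h_dot h i \<theta> \<omega>"
      by (simp add: beta_eq sA_theta h_dot_def)
  qed
  have key: "(1 / (r * r)) * ((((1 / sqrt H) *\<^sub>R (a *\<^sub>R A) + (x * a * (1 / 2) / H) *\<^sub>R B) \<bullet> t) * w)
     = w / r * ((((1 / sqrt H) *\<^sub>R A) \<bullet> t + x * (((1 / (2 * H)) *\<^sub>R B) \<bullet> t)) / r * a)"
    for H w r :: real and A B :: "('q, 'r) param"
    by (simp add: inner_add_left add_divide_distrib algebra_simps)
  have scaled: "(1 / real n) * ((((1 / sqrt H) *\<^sub>R (a *\<^sub>R A) + (x * a * (1 / 2) / H) *\<^sub>R B) \<bullet> t) * w)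
     = w / sqrt (real n) * ((((1 / sqrt H) *\<^sub>R A) \<bullet> t + x * (((1 / (2 * H)) *\<^sub>R B) \<bullet> t)) / sqrt (real n) * a)"
    for H w :: real and A B :: "('q, 'r) param"
    using key[of "sqrt (real n)" H A B w] by (simp only: real_sqrt_mult_self abs_of_nat)
  show ?thesis
    unfolding sum_nat_index e sum_component vector_scaleR_component real_scaleR_def sum_distrib_left
    by (rule sum.cong[OF refl]) (simp only: scaled)
qed

end

theorem theorem2p1:
  fixes M :: "'a measure"
    and y :: "int \<Rightarrow> 'a \<Rightarrow> real"
    and \<mu> :: "int \<Rightarrow> real^'q::finite \<Rightarrow> 'a \<Rightarrow> real"
    and h :: "int \<Rightarrow> (real^'q) \<times> (real^'r::finite) \<Rightarrow> 'a \<Rightarrow> real"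
    and \<Theta>1 :: "(real^'q) set" and \<Theta>2 :: "(real^'r) set"
    and \<theta> :: "(real^'q) \<times> (real^'r)"
    and U :: "((real^'q) \<times> (real^'r)) set"
    and L :: "int set"
    and F F\<^sub>0 f\<^sub>0 f\<^sub>0' :: "real \<Rightarrow> real"
    and \<theta>_hat :: "nat \<Rightarrow> 'a \<Rightarrow> (real^'q) \<times> (real^'r)"
    and \<eta> :: "int \<Rightarrow> 'a \<Rightarrow> real"
  assumes prob: "prob_space M"
    \<comment> \<open>the model\<close>
    and true_param: "\<theta> \<in> \<Theta>1 \<times> \<Theta>2"
    and h_pos: "\<And>i s \<omega>. s \<in> \<Theta>1 \<times> \<Theta>2 \<Longrightarrow> \<omega> \<in> space M \<Longrightarrow> 0 < h i s \<omega>"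
    and eta: "\<And>i. \<eta> i = resid y \<mu> h i \<theta>"
    \<comment> \<open>\<open>y\<close> is strictly stationary and ergodic, jointly with \<open>\<mu>\<close> and \<open>h\<close>\<close>
    and stationary: "strictly_stationary M (model_space \<Theta>1 \<Theta>2) (model_process \<Theta>1 \<Theta>2 y \<mu> h)"
    and ergodic: "ergodic_process M (model_space \<Theta>1 \<Theta>2) (model_process \<Theta>1 \<Theta>2 y \<mu> h)"
    and eta_indep: "prob_space.indep_vars M (\<lambda>_. borel) \<eta> UNIV"
    and eta_distr: "\<And>i. cdf (distr M borel (\<eta> i)) = F"
    and eta_mean: "\<And>i. integrable M (\<eta> i)" "\<And>i. (LINT \<omega>|M. \<eta> i \<omega>) = 0"
    and eta_var: "\<And>i. integrable M (\<lambda>\<omega>. (\<eta> i \<omega>)\<^sup>2)" "\<And>i. (LINT \<omega>|M. (\<eta> i \<omega>)\<^sup>2) = 1"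
    and initial: "initial_index_set L"
    and initial_indep:
      "prob_space.indep_var M
         (Pi\<^sub>M L (\<lambda>_. borel)) (\<lambda>\<omega>. restrict (\<lambda>j. y j \<omega>) L)
         (Pi\<^sub>M {1..} (\<lambda>_. borel)) (\<lambda>\<omega>. restrict (\<lambda>i. \<eta> i \<omega>) {1..})"
    and past_mu: "\<And>i s\<^sub>1. 1 \<le> i \<Longrightarrow> s\<^sub>1 \<in> \<Theta>1 \<Longrightarrow>
        \<mu> i s\<^sub>1 \<in> borel_measurable (past_field M y \<eta> L (i - 1))"
    and past_h: "\<And>i s. 1 \<le> i \<Longrightarrow> s \<in> \<Theta>1 \<times> \<Theta>2 \<Longrightarrow>
        h i s \<in> borel_measurable (past_field M y \<eta> L (i - 1))"
    \<comment> \<open>the null hypothesis\<close>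
    and null_hyp: "F = F\<^sub>0"
    \<comment> \<open>(i)\<close>
    and mu_C2: "\<And>i \<omega>. \<omega> \<in> space M \<Longrightarrow> C2_on (interior \<Theta>1) (\<lambda>s\<^sub>1. \<mu> i s\<^sub>1 \<omega>)"
    and h_C2: "\<And>i \<omega>. \<omega> \<in> space M \<Longrightarrow> C2_on (interior (\<Theta>1 \<times> \<Theta>2)) (\<lambda>s. h i s \<omega>)"
    \<comment> \<open>(ii)\<close>
    and f0_nonneg: "\<And>x. 0 \<le> f\<^sub>0 x"
    and f0_meas: "f\<^sub>0 \<in> borel_measurable borel"
    and f0_prob: "prob_space (density lborel f\<^sub>0)"
    and F0: "F\<^sub>0 = cdf (density lborel f\<^sub>0)"
    and f0_abs_cont: "\<And>a b. absolutely_cont_on {a..b} f\<^sub>0"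
    and f0'_meas: "f\<^sub>0' \<in> borel_measurable borel"
    and f0_deriv: "AE x in lborel. (f\<^sub>0 has_real_derivative f\<^sub>0' x) (at x)"
    and f0_sup: "bdd_above (range (\<lambda>x. \<bar>x\<bar> * f\<^sub>0 x))"
    and fisher_loc: "integrable (density lborel f\<^sub>0) (\<lambda>x. (f\<^sub>0' x / f\<^sub>0 x)\<^sup>2)"
      "0 < (LINT x|density lborel f\<^sub>0. (f\<^sub>0' x / f\<^sub>0 x)\<^sup>2)"
    and fisher_scale: "integrable (density lborel f\<^sub>0) (\<lambda>x. (1 + x * f\<^sub>0' x / f\<^sub>0 x)\<^sup>2)"
      "0 < (LINT x|density lborel f\<^sub>0. (1 + x * f\<^sub>0' x / f\<^sub>0 x)\<^sup>2)"
    and info_pd: "positive_definite (info_matrix M y \<mu> h f\<^sub>0 f\<^sub>0' \<theta>)"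
    \<comment> \<open>(iii)\<close>
    and orth: "(LINT \<omega>|M. psi0 f\<^sub>0 f\<^sub>0' (\<eta> 1 \<omega>) * phi0 f\<^sub>0 f\<^sub>0' (\<eta> 1 \<omega>)) = 0"
    \<comment> \<open>(iv)\<close>
    and est_meas: "\<And>n. \<theta>_hat n \<in> borel_measurable (data_field M y L n)"
    and est: "small_in_prob M (\<lambda>n \<omega>.
        stack (sqrt (real n) *\<^sub>R (\<theta>_hat n \<omega> - \<theta>)) -
        - (matrix_inv (info_matrix M y \<mu> h f\<^sub>0 f\<^sub>0' \<theta>) *v
           ((1 / sqrt (real n)) *\<^sub>R
            (\<Sum>i\<in>{1..int n}. W \<mu> h i \<theta> \<omega> *v
               vector [psi0 f\<^sub>0 f\<^sub>0' (\<eta> i \<omega>), phi0 f\<^sub>0 f\<^sub>0' (\<eta> i \<omega>)]))))"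
    \<comment> \<open>(v)\<close>
    and U: "open U" "\<theta> \<in> U" "U \<subseteq> \<Theta>1 \<times> \<Theta>2"
    and v1: "(\<integral>\<^sup>+ \<omega>. (SUP s\<in>U. ennreal ((norm (mu_dot_ext \<mu> 1 s \<omega>))\<^sup>2 / h 1 \<theta> \<omega>)) \<partial>M) < \<infinity>"
    and v2: "(\<integral>\<^sup>+ \<omega>. (SUP s\<in>U. ennreal ((norm (h_dot h 1 s \<omega>))\<^sup>2 / (h 1 s \<omega> * h 1 \<theta> \<omega>))) \<partial>M) < \<infinity>"
    and v3: "(\<integral>\<^sup>+ \<omega>. (SUP s\<in>U. ennreal (hessian_norm (\<lambda>u. h 1 u \<omega>) s / h 1 s \<omega>)) \<partial>M) < \<infinity>"
    and v4: "(\<integral>\<^sup>+ \<omega>. (SUP s\<in>U. ennreal ((norm (h_dot h 1 s \<omega>))\<^sup>2 / (h 1 s \<omega>)\<^sup>2)) \<partial>M) < \<infinity>"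
  shows "\<forall>b>0. unif_small_in_prob M
      {(x :: real, t :: (real^'q) \<times> (real^'r)). norm t \<le> b}
      (\<lambda>n (x, t) \<omega>.
         K_process y \<mu> h F\<^sub>0 n x (\<theta> + (1 / sqrt (real n)) *\<^sub>R t) \<omega> -
         (K_process y \<mu> h F\<^sub>0 n x \<theta> \<omega> +
          (1 / 2) *\<^sub>R (1 / real n) *\<^sub>R
          (\<Sum>i\<in>{1..int n}.
             (((1 / sqrt (h i \<theta> \<omega>)) *\<^sub>R (f\<^sub>0 x *\<^sub>R mu_dot_ext \<mu> i \<theta> \<omega>) +
               (x * f\<^sub>0 x * (1 / 2) / h i \<theta> \<omega>) *\<^sub>R h_dot h i \<theta> \<omega>) \<bullet> t) *\<^sub>R
             W22 h i \<theta> \<omega>)))"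
proof (intro allI impI)
  fix b :: real assume b: "0 < b"
  obtain e where e: "0 < e" "ball \<theta> e \<subseteq> U" using U(1,2) openE by blast
  interpret garch_model M y \<mu> h \<Theta>1 \<Theta>2 \<theta> U "e / 2"
  proof (intro garch_model.intro garch_model_axioms.intro)
    show "0 < e / 2" "ball \<theta> (2 * (e / 2)) \<subseteq> U" using e by simp_all
  qed fact+
  obtain C where C: "hoelder_density f\<^sub>0 C"
    using hoelder_density_exists[OF f0_nonneg f0_meas f0_prob f0_abs_cont f0'_meas f0_deriv fisher_loc(1) fisher_scale(1)] by blast
  have inn: "innovations f\<^sub>0 C M (\<lambda>i. past_field M y \<eta> L (int i)) (\<lambda>i. \<eta> (int i + 1))"
    by (rule past_innovations[OF C prob y_measurable eta_indep _ initial_indep]) (simp add: eta_distr null_hyp F0)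
  let ?s = "\<lambda>n t. \<theta> + (1 / sqrt (real n)) *\<^sub>R t"
  let ?D = "\<lambda>n x t \<omega>. (1 / 2) *\<^sub>R (1 / real n) *\<^sub>R
          (\<Sum>i\<in>{1..int n}.
             (((1 / sqrt (h i \<theta> \<omega>)) *\<^sub>R (f\<^sub>0 x *\<^sub>R mu_dot_ext \<mu> i \<theta> \<omega>) +
               (x * f\<^sub>0 x * (1 / 2) / h i \<theta> \<omega>) *\<^sub>R h_dot h i \<theta> \<omega>) \<bullet> t) *\<^sub>R W22 h i \<theta> \<omega>)"
  let ?R = "\<lambda>n x t \<omega>. K_process y \<mu> h F\<^sub>0 n x (?s n t) \<omega> - (K_process y \<mu> h F\<^sub>0 n x \<theta> \<omega> + ?D n x t \<omega>)"
  have local: "\<forall>\<^sub>F n in sequentially. \<forall>t. norm t \<le> b \<longrightarrow> ?s n t \<in> ball \<theta> (e / 2)"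
  proof -
    have "(\<lambda>n. b / sqrt (real n)) \<longlonglongrightarrow> 0"
      by (rule real_tendsto_divide_at_top[OF tendsto_const filterlim_compose[OF sqrt_at_top filterlim_real_sequentially]])
    then have "\<forall>\<^sub>F n in sequentially. b / sqrt (real n) < e / 2" using e(1) by (intro order_tendstoD(2)) auto
    then show ?thesis
    proof eventually_elim
      case (elim n)
      show ?case
      proof (intro allI impI)
        fix t :: "(real^'q) \<times> (real^'r)" assume "norm t \<le> b"
        then have "norm t / sqrt (real n) \<le> b / sqrt (real n)" by (intro divide_right_mono) auto
        also note elim
        also have "norm t / sqrt (real n) = dist \<theta> (?s n t)" by (simp add: dist_norm)
        finally show "?s n t \<in> ball \<theta> (e / 2)" by (simp only: mem_ball)
      qed
    qed
  qed
  have component: "aas M (\<lambda>n \<omega>. \<forall>x t. norm t \<le> b \<longrightarrow> \<bar>?R n x t \<omega> $ c\<bar> \<le> \<delta>)" if \<delta>: "0 < \<delta>" for \<delta> :: real and c :: 'r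
  proof -
    interpret sm: smooth_model f\<^sub>0 C M "\<lambda>i. past_field M y \<eta> L (int i)" "\<lambda>i. \<eta> (int i + 1)" \<theta> \<kappa>
      "\<lambda>i s \<omega>. floc \<theta> (mn i \<omega>) (hn i \<omega>) s" "\<lambda>i s \<omega>. fscl \<theta> (hn i \<omega>) s"
      "\<lambda>i s \<omega>. fwt (e / 2) (hn i \<omega>) s $ c"
      "\<lambda>i \<omega>. floc_grad (e / 2) \<theta> (mn i \<omega>) (hn i \<omega>)" "\<lambda>i \<omega>. fscl_grad (e / 2) \<theta> (hn i \<omega>)"
      "\<lambda>j i \<omega>. frem j (mn i \<omega>) (hn i \<omega>)" "\<lambda>i \<omega>. enn2real (fwt_lip (e / 2) \<theta> (hn i \<omega>))"
      by (rule smooth_model[OF inn past_mu past_h])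
    have F: "sm.F = F\<^sub>0" by (simp add: sm.F_def sm.P_def F0)
    show ?thesis
    proof (rule aas_mono[OF sm.process_expansion[OF less_imp_le[OF b] \<delta>]])
      show "\<forall>\<^sub>F n in sequentially. \<forall>\<omega>\<in>space M.
        (\<forall>x t. norm t \<le> b \<longrightarrow>
           \<bar>(\<Sum>i<n. fwt (e / 2) (hn i \<omega>) (?s n t) $ c / sqrt (real n) * sm.ind n i x t \<omega>)
             - (\<Sum>i<n. fwt (e / 2) (hn i \<omega>) \<theta> $ c / sqrt (real n) * sm.ind0 i x \<omega>)
             - (\<Sum>i<n. fwt (e / 2) (hn i \<omega>) \<theta> $ c / sqrt (real n) * sm.lin n i x t \<omega>)\<bar> \<le> \<delta>) \<longrightarrow>
        (\<forall>x t. norm t \<le> b \<longrightarrow> \<bar>?R n x t \<omega> $ c\<bar> \<le> \<delta>)"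
        using local
      proof (eventually_elim, intro ballI impI allI)
        fix n \<omega> x and t :: "(real^'q) \<times> (real^'r)"
        assume loc: "\<forall>t. norm t \<le> b \<longrightarrow> ?s n t \<in> ball \<theta> (e / 2)" and \<omega>: "\<omega> \<in> space M" and t: "norm t \<le> b"
        assume exp: "\<forall>x t. norm t \<le> b \<longrightarrow>
           \<bar>(\<Sum>i<n. fwt (e / 2) (hn i \<omega>) (?s n t) $ c / sqrt (real n) * sm.ind n i x t \<omega>)
             - (\<Sum>i<n. fwt (e / 2) (hn i \<omega>) \<theta> $ c / sqrt (real n) * sm.ind0 i x \<omega>)
             - (\<Sum>i<n. fwt (e / 2) (hn i \<omega>) \<theta> $ c / sqrt (real n) * sm.lin n i x t \<omega>)\<bar> \<le> \<delta>"
        have th: "\<theta> \<in> ball \<theta> (e / 2)" using e(1) by simp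
        have st: "?s n t \<in> ball \<theta> (e / 2)" using loc t by blast
        define S1 where "S1 = (\<Sum>i<n. fwt (e / 2) (hn i \<omega>) (?s n t) $ c / sqrt (real n) * sm.ind n i x t \<omega>)"
        define S2 where "S2 = (\<Sum>i<n. fwt (e / 2) (hn i \<omega>) \<theta> $ c / sqrt (real n) * sm.ind0 i x \<omega>)"
        define S3 where "S3 = (\<Sum>i<n. fwt (e / 2) (hn i \<omega>) \<theta> $ c / sqrt (real n) * sm.lin n i x t \<omega>)"
        have 1: "K_process y \<mu> h F\<^sub>0 n x (?s n t) \<omega> $ c = (1/2) * S1"
          unfolding K_process_component[OF \<omega> st] S1_def sm.ind_def F unfolding eta ..
        have 0: "floc \<theta> (mp i \<omega>) (hp i \<omega>) \<theta> + x * fscl \<theta> (hp i \<omega>) \<theta> = x" for i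
          using h_pos[OF true_param \<omega>, of i] by (simp add: floc_def fscl_def)
        have 2: "K_process y \<mu> h F\<^sub>0 n x \<theta> \<omega> $ c = (1/2) * S2"
          unfolding K_process_component[OF \<omega> th] S2_def sm.ind0_def F unfolding eta 0 ..
        have 3: "?D n x t \<omega> $ c = (1/2) * S3"
          unfolding drift_component[OF \<omega>] S3_def sm.lin_def ..
        have "?R n x t \<omega> $ c = (1/2) * (S1 - S2 - S3)"
          unfolding vector_minus_component vector_add_component 1 2 3 by (simp add: algebra_simps)
        moreover have "\<bar>S1 - S2 - S3\<bar> \<le> \<delta>" using exp t unfolding S1_def S2_def S3_def by blast
        ultimately show "\<bar>?R n x t \<omega> $ c\<bar> \<le> \<delta>" using \<delta> by (simp add: abs_mult)
      qed
    qed
  qed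
  show "unif_small_in_prob M {(x :: real, t :: (real^'q) \<times> (real^'r)). norm t \<le> b} (\<lambda>n (x, t) \<omega>. ?R n x t \<omega>)"
    unfolding unif_small_in_prob_def
  proof (intro allI impI)
    fix \<epsilon> :: real assume \<epsilon>: "0 < \<epsilon>"
    define \<delta> where "\<delta> = \<epsilon> / real CARD('r)"
    have \<delta>: "0 < \<delta>" using \<epsilon> by (simp add: \<delta>_def)
    have all: "aas M (\<lambda>n \<omega>. \<forall>c\<in>UNIV. \<forall>x t. norm t \<le> b \<longrightarrow> \<bar>?R n x t \<omega> $ c\<bar> \<le> \<delta>)"
      by (rule aas_finite_ball[OF finite_class.finite_UNIV component[OF \<delta>]])
    have "aas M (\<lambda>n \<omega>. \<not> (\<exists>z\<in>{(x, t). norm t \<le> b}. \<epsilon> < norm (case z of (x, t) \<Rightarrow> ?R n x t \<omega>)))"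
    proof (rule aas_impI[OF all])
      fix n \<omega>
      assume small: "\<forall>c\<in>UNIV. \<forall>x t. norm t \<le> b \<longrightarrow> \<bar>?R n x t \<omega> $ c\<bar> \<le> \<delta>"
      have "norm (?R n x t \<omega>) \<le> \<epsilon>" if t: "norm t \<le> b" for x t
      proof -
        have "norm (?R n x t \<omega>) \<le> (\<Sum>c\<in>UNIV. \<bar>?R n x t \<omega> $ c\<bar>)" by (rule norm_le_l1_cart)
        also have "\<dots> \<le> real CARD('r) * \<delta>" by (rule sum_bounded_above) (use small t in blast)
        also have "\<dots> = \<epsilon>" by (simp add: \<delta>_def)
        finally show ?thesis .
      qed
      then show "\<not> (\<exists>z\<in>{(x, t). norm t \<le> b}. \<epsilon> < norm (case z of (x, t) \<Rightarrow> ?R n x t \<omega>))"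
        by (auto simp: not_less)
    qed
    from aas_imp_tendsto[OF this]
    show "(\<lambda>n. outer_measure_of M {\<omega> \<in> space M. \<exists>z\<in>{(x, t). norm t \<le> b}. \<epsilon> < norm ((case z of (x, t) \<Rightarrow> \<lambda>\<omega>. ?R n x t \<omega>) \<omega>)}) \<longlonglongrightarrow> 0"
      by (simp add: case_prod_beta)
  qed
qed

end
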